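(* Let $P$ be a $3$-dimensional lattice polytope. Then $P$ is thin if and only if $P$ is a lattice pyramid over a lattice polygon or $\deg(P)\le 1$. Equivalently, $P$ is thin if and only if $P$ is a lattice pyramid over a lattice polygon or $P$ is a Lawrence prism.
   Context: Lattice polytopes are taken with respect to a lattice $M\cong\mathbb{Z}^d$; a lattice polytope that is not full-dimensional (in particular a face) is considered with respect to the lattice of lattice points in its affine hull. Two lattice polytopes are isomorphic if an affine automorphism of the ambient space mapping the lattice bijectively onto itself maps one onto the other. The $h^*$-polynomial $h^*_P(t)$ is defined by $1+\sum_{n\ge1}|nP\cap M|t^n=h^*_P(t)/(1-t)^{\dim P+1}$, and $\deg(P)$ is the degree of $h^*_P$. Conventions: $h^*_\emptyset=1$, $\dim\emptyset=-1$. For a finite lower Eulerian poset $\mathcal P$ (ranked, with minimal element $\hat0$ of rank $0$, every interval $[x,y]$ with $x\ne y$ having equally many elements of even and odd rank) of rank $d$ with rank function $\rho$, Stanley's $g$-polynomial is defined recursively: $g_\emptyset(t)=1$, and for $\mathcal P\ne\emptyset$ put $f_{\mathcal P}(t)=\sum_{x\in\mathcal P}(t-1)^{d-\rho(x)}g_{[\hat0,x)}(t)=\sum_i f_it^i$ and $g_{\mathcal P}(t)=\sum_{i=0}^{\lfloor d/2\rfloor}(f_i-f_{i-1})t^i$ ($f_{-1}=0$). For a face $F$ of $P$ (faces include $\emptyset$ and $P$), $(F,P]^*$ is the poset of faces $G$ with $F\subsetneq G\subseteq P$ ordered by reverse inclusion. The local $h^*$-polynomial is $l^*_P(t)=\sum_{\emptyset\le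 F\le P}(-1)^{\dim P-\dim F}h^*_F(t)\,g_{(F,P]^*}(t)$, the sum over all faces of $P$ including $\emptyset$ and $P$. $P$ is thin if $l^*_P=0$. A lattice polytope is a lattice pyramid over a lattice polytope $Q\subset\mathbb R^{k}$ if it is isomorphic to $\mathrm{conv}(Q\times\{0\},\{0\}\times\{1\})\subset\mathbb R^{k}\times\mathbb R$; a lattice polygon is a $2$-dimensional lattice polytope. A Lawrence prism is a $d$-dimensional lattice polytope in $\mathbb R^d$ isomorphic to $\mathrm{conv}(0,e_1,\dots,e_{d-1},k_0e_d,e_1+k_1e_d,\dots,e_{d-1}+k_{d-1}e_d)$ with $k_0,\dots,k_{d-1}\in\mathbb Z_{\ge1}$. *)

theory Defs
  imports
    "HOL-Analysis.Analysis"
    "HOL-Computational_Algebra.Computational_Algebra"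
begin

text \<open>
  The ambient lattice is the standard lattice of a Euclidean space. Working over the class
  \<^class>\<open>euclidean_space\<close> covers \<open>real ^ 'n\<close> and products such as \<open>(real ^ 'k) \<times> real\<close> alike.
\<close>

definition int_lattice :: "'a::euclidean_space set" where
  "int_lattice = {x. \<forall>b\<in>Basis. x \<bullet> b \<in> \<int>}"

definition lattice_polytope :: "'a::euclidean_space set \<Rightarrow> bool" where
  "lattice_polytope P \<longleftrightarrow> (\<exists>V. finite V \<and> V \<subseteq> int_lattice \<and> P = convex hull V)"

text \<open>
  Each polytope is regarded as full-dimensional in its affine hull, equipped with the lattice points
  of that affine hull. If \<open>P\<close> and \<open>Q\<close> are full-dimensional in the same space, both affine hulls are
  the whole space and the map below is an affine automorphism preserving the lattice.
\<close>

definition lattice_isomorphic ::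
  "'a::euclidean_space set \<Rightarrow> 'b::euclidean_space set \<Rightarrow> bool" where
  "lattice_isomorphic P Q \<longleftrightarrow>
     (\<exists>f c. linear f \<and>
        bij_betw (\<lambda>x. f x + c) (affine hull P) (affine hull Q) \<and>
        bij_betw (\<lambda>x. f x + c) (affine hull P \<inter> int_lattice) (affine hull Q \<inter> int_lattice) \<and>
        (\<lambda>x. f x + c) ` P = Q)"

definition ehrhart_series :: "'a::euclidean_space set \<Rightarrow> int fps" where
  "ehrhart_series P =
     Abs_fps (\<lambda>n. if n = 0 then 1 else int (card ((\<lambda>x. real n *\<^sub>R x) ` P \<inter> int_lattice)))"

text \<open>
  For \<open>P = {}\<close> we have \<open>aff_dim P = -1\<close>, the series is \<open>1\<close> and the exponent is \<open>0\<close>,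
  which gives the convention that the polynomial of the empty polytope is \<open>1\<close>.
\<close>

definition hstar :: "'a::euclidean_space set \<Rightarrow> int poly" where
  "hstar P =
     (THE h. fps_of_poly h = ehrhart_series P * (1 - fps_X) ^ nat (aff_dim P + 1))"

definition lattice_degree :: "'a::euclidean_space set \<Rightarrow> nat" where
  "lattice_degree P = degree (hstar P)"

text \<open>
  A poset is given by its carrier \<open>A\<close> and order \<open>le\<close>. The rank of \<open>x\<close> is the length of a longest
  chain ending in \<open>x\<close>, and the rank of a nonempty finite poset is the largest rank of an element.
\<close>

definition poset_rank :: "('a \<Rightarrow> 'a \<Rightarrow> bool) \<Rightarrow> 'a set \<Rightarrow> 'a \<Rightarrow> nat" where
  "poset_rank le A x =
     Max {card C - 1 | C. C \<subseteq> A \<and> x \<in> C \<and> (\<forall>y\<in>C. le y x) \<and> Complete_Partial_Order.chain le C}"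

text \<open>
  Stanley's \<open>g\<close>-polynomial. In a poset with least element, the half-open interval from the least
  element up to (excluding) \<open>x\<close> consists of all elements strictly below \<open>x\<close>. The polynomial
  \<open>t - 1\<close> is \<open>[:-1, 1:]\<close>. The value at infinite carriers is irrelevant.
\<close>

function g_polynomial :: "('a \<Rightarrow> 'a \<Rightarrow> bool) \<Rightarrow> 'a set \<Rightarrow> int poly" where
  "g_polynomial le A =
     (if A = {} \<or> infinite A then 1
      else let d = Max (poset_rank le A ` A);
               f = (\<Sum>x\<in>A. [:-1, 1:] ^ (d - poset_rank le A x)
                             * g_polynomial le {y \<in> A. le y x \<and> y \<noteq> x})
           in (\<Sum>i\<le>d div 2. monom (coeff f i - (if i = 0 then 0 else coeff f (i - 1))) i))"
  by pat_completeness auto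
termination
  by (relation "Wellfounded.measure (\<lambda>(le, A). card A)") (auto intro!: psubset_card_mono)

declare g_polynomial.simps [simp del]

text \<open>
  The poset attached to a face \<open>F\<close> consists of the faces of \<open>P\<close> strictly containing \<open>F\<close>, ordered by
  reverse inclusion, so \<open>P\<close> is its least element. Both \<open>{}\<close> and \<open>P\<close> are faces
  in the sense of \<^const>\<open>face_of\<close>.
\<close>

definition local_hstar :: "'a::euclidean_space set \<Rightarrow> int poly" where
  "local_hstar P =
     (\<Sum>F | F face_of P.
        (-1) ^ nat (aff_dim P - aff_dim F) * hstar F *
        g_polynomial (\<lambda>G H. H \<subseteq> G) {G. G face_of P \<and> F \<subset> G})"

definition thin :: "'a::euclidean_space set \<Rightarrow> bool" where
  "thin P \<longleftrightarrow> local_hstar P = 0"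

definition lattice_pyramid_over ::
  "'a::euclidean_space set \<Rightarrow> (real ^ 'k) set \<Rightarrow> bool" where
  "lattice_pyramid_over P Q \<longleftrightarrow> lattice_isomorphic P (convex hull (Q \<times> {0::real} \<union> {0} \<times> {1}))"

definition lattice_polygon :: "'a::euclidean_space set \<Rightarrow> bool" where
  "lattice_polygon Q \<longleftrightarrow> lattice_polytope Q \<and> aff_dim Q = 2"

text \<open>
  The standard Lawrence prism of dimension \<open>d = CARD('m) + 1\<close>, with the space of dimension \<open>d\<close>
  written as \<open>(real ^ 'm) \<times> real\<close>: here \<open>e\<^sub>d = (0, 1)\<close>, and \<open>e\<^sub>1, \<dots>, e\<^sub>d\<^sub>-\<^sub>1\<close> are the
  vectors \<open>(axis i 1, 0)\<close>.
\<close>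

definition std_lawrence_prism :: "nat \<Rightarrow> ('m::finite \<Rightarrow> nat) \<Rightarrow> ((real ^ 'm) \<times> real) set" where
  "std_lawrence_prism k\<^sub>0 k =
     convex hull ({(0, 0), (0, real k\<^sub>0)} \<union>
                  (\<Union>i. {(axis i 1, 0), (axis i 1, real (k i))}))"

definition lawrence_prism_3 :: "'a::euclidean_space set \<Rightarrow> bool" where
  "lawrence_prism_3 P \<longleftrightarrow>
     (\<exists>k\<^sub>0 (k :: 2 \<Rightarrow> nat). k\<^sub>0 \<ge> 1 \<and> (\<forall>i. k i \<ge> 1) \<and>
        lattice_isomorphic P (std_lawrence_prism k\<^sub>0 k))"

end

theory Submission
  imports Defs
begin

text \<open>
  A half-open decomposition of a lattice triangulation gives Ehrhart reciprocity, hence the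
  coefficients of \<open>h\<^sup>*\<close> in terms of (interior) lattice points, and Euler's relation. In dimension
  three the local polynomial \<open>l\<^sup>*\<close> then has the coefficients \<open>|int P|\<close> in degrees one and three and
  \<open>|int 2P| - 4 |int P| - \<Sum>|int F|\<close> (over the facets \<open>F\<close>) in degree two, where \<open>|S|\<close> counts lattice
  points. So \<open>P\<close> is thin iff \<open>int P\<close> contains no lattice point and \<open>int 2P\<close> contains exactly as many
  as all the \<open>int F\<close> together.

  Adding an interior lattice point of a facet to a lattice point of \<open>P\<close> off that facet gives an
  interior lattice point of \<open>2P\<close>. Counting such sums shows that a thin \<open>P\<close> has at most one facet
  with interior lattice points. If there is one, exactly one lattice point of \<open>P\<close> lies off it, and this
  apex has lattice height one, since otherwise \<open>int 2P\<close> would contain a further point; thus \<open>P\<close> is a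
  lattice pyramid. If there is none, \<open>int 2P\<close> has no lattice points, which means that the degree is at
  most one. Then every empty lattice tetrahedron spanning the same space is unimodular, and
  in the coordinates of such a tetrahedron few lattice points remain possible, which leaves only lattice
  pyramids and Lawrence prisms.
\<close>

section \<open>Lattice points in half-open cones\<close>

text \<open>Two obstacles shape the argument. A sumset of finite nonempty sets \<open>A\<close> and
  \<open>B\<close> has at least \<open>card A + card B - 1\<close> elements, which falls two short
  of contradicting thinness when two facets have interior lattice points. The missing points are
  found among further sums, kept apart from the rest by facet functionals; if two of three such
  facets carry a single point each, element sums of two translates are compared instead. In degree
  at most one, the split is by whether three lattice points of \<open>P\<close> are collinear. If
  so, a segment of lattice length two gives room to round a coordinate to an integer. If not,
  distinct lattice points differ modulo two, so there are at most eight, and their parity classes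
  decide which configurations survive. Moreover \<open>P\<close> may lie in a space of higher
  dimension, where the double of \<open>P\<close> need not meet the affine hull of \<open>P\<close>.
  Hence coordinates are taken relative to a lattice basis of the affine hull
  (\<open>lattice_frame\<close>), and doubled points are moved back by subtracting a lattice point
  of \<open>P\<close>.\<close>

lemma int_lattice_0 [simp]: "0 \<in> int_lattice"
  by (simp add: int_lattice_def)

lemma int_lattice_add: "x \<in> int_lattice \<Longrightarrow> y \<in> int_lattice \<Longrightarrow> x + y \<in> int_lattice"
  by (simp add: int_lattice_def inner_add_left)

lemma int_lattice_diff: "x \<in> int_lattice \<Longrightarrow> y \<in> int_lattice \<Longrightarrow> x - y \<in> int_lattice"
  by (simp add: int_lattice_def inner_diff_left)

lemma int_lattice_scaleR: "x \<in> int_lattice \<Longrightarrow> r \<in> \<int> \<Longrightarrow> r *\<^sub>R x \<in> int_lattice"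
  by (simp add: int_lattice_def)

lemma int_lattice_sum: "(\<And>i. i \<in> A \<Longrightarrow> f i \<in> int_lattice) \<Longrightarrow> sum f A \<in> int_lattice"
  by (induction A rule: infinite_finite_induct) (auto intro: int_lattice_add)

lemma int_lattice_add_cancel: "y \<in> int_lattice \<Longrightarrow> x + y \<in> int_lattice \<longleftrightarrow> x \<in> int_lattice"
  using int_lattice_add int_lattice_diff by (metis add_diff_cancel_right')

lemma finite_bounded_int_lattice:
  fixes S :: "'a::euclidean_space set"
  assumes "bounded S"
  shows "finite (S \<inter> int_lattice)"
proof -
  obtain c where c: "\<And>x. x \<in> S \<Longrightarrow> norm x \<le> c"
    using assms by (auto simp: bounded_iff)
  define f where "f = (\<lambda>x::'a. restrict (\<lambda>b. x \<bullet> b) Basis)"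
  have "inj_on f (S \<inter> int_lattice)"
    by (rule inj_onI) (metis (mono_tags, lifting) euclidean_eqI f_def restrict_apply')
  moreover have "f ` (S \<inter> int_lattice) \<subseteq> Pi\<^sub>E Basis (\<lambda>_. {x \<in> \<int>. \<bar>x\<bar> \<le> c})"
  proof (clarsimp simp: f_def)
    fix x b :: 'a assume "x \<in> S" "x \<in> int_lattice" "b \<in> Basis"
    then show "x \<bullet> b \<in> \<int> \<and> \<bar>x \<bullet> b\<bar> \<le> c"
      using c[of x] Basis_le_norm[of b x] by (auto simp: int_lattice_def)
  qed
  moreover have "finite (Pi\<^sub>E (Basis::'a set) (\<lambda>_. {x::real \<in> \<int>. \<bar>x\<bar> \<le> c}))"
    by (intro finite_PiE finite_Basis finite_abs_int_segment)
  ultimately show ?thesis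
    using finite_imageD finite_subset by blast
qed

lemma affine_independent_weights_unique:
  assumes "\<not> affine_dependent A" "sum u A = sum w A"
    "(\<Sum>v\<in>A. u v *\<^sub>R v) = (\<Sum>v\<in>A. w v *\<^sub>R v)" "a \<in> A"
  shows "u a = w (a::'a::euclidean_space)"
proof -
  have "finite A" using assms(1) aff_independent_finite by blast
  moreover have "sum (\<lambda>v. u v - w v) A = 0" "(\<Sum>v\<in>A. (u v - w v) *\<^sub>R v) = 0"
    using assms by (auto simp: sum_subtractf scaleR_diff_left)
  ultimately show ?thesis
    using assms(1,4) by (auto simp: affine_dependent_explicit_finite)
qed

text \<open>
  Coefficient vectors of lattice points at height \<open>n\<close> in the cone over a simplex with vertex set
  \<open>A\<close>: coefficients in \<open>J\<close> are strictly positive (a half-open cone), and coefficients in \<open>K\<close> are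
  reduced modulo \<open>1\<close> to the half-open unit interval.
\<close>
definition cone_weights :: "'a::euclidean_space set \<Rightarrow> 'a set \<Rightarrow> 'a set \<Rightarrow> nat \<Rightarrow> ('a \<Rightarrow> real) set" where
  "cone_weights A J K n = {u. (\<forall>a. a \<notin> A \<longrightarrow> u a = 0) \<and>
     (\<forall>a\<in>A. if a \<in> J then 0 < u a \<and> (a \<in> K \<longrightarrow> u a \<le> 1) else 0 \<le> u a \<and> (a \<in> K \<longrightarrow> u a < 1)) \<and>
     sum u A = real n \<and> (\<Sum>a\<in>A. u a *\<^sub>R a) \<in> int_lattice}"

lemma inj_on_cone_weights:
  assumes "\<not> affine_dependent A"
  shows "inj_on (\<lambda>u. \<Sum>a\<in>A. u a *\<^sub>R a) (cone_weights A J K n)"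
proof (rule inj_onI)
  fix u w assume *: "u \<in> cone_weights A J K n" "w \<in> cone_weights A J K n"
    "(\<Sum>a\<in>A. u a *\<^sub>R a) = (\<Sum>a\<in>A. w a *\<^sub>R a)"
  show "u = w"
  proof
    fix a show "u a = w a"
      using * affine_independent_weights_unique[OF assms, of u w a]
      by (cases "a \<in> A") (auto simp: cone_weights_def)
  qed
qed

lemma finite_cone_weights:
  assumes "\<not> affine_dependent A"
  shows "finite (cone_weights A J K n)"
proof (rule finite_imageD[OF _ inj_on_cone_weights[OF assms]])
  have fin: "finite A" using assms aff_independent_finite by blast
  define c where "c = real n * (\<Sum>a\<in>A. norm a)"
  have "norm (\<Sum>a\<in>A. u a *\<^sub>R a) \<le> c" if u: "u \<in> cone_weights A J K n" for u
  proof -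
    have nn: "0 \<le> u a" if "a \<in> A" for a
      using u that by (auto simp: cone_weights_def split: if_splits)
    have "u a \<le> n" if "a \<in> A" for a
      using member_le_sum[of a A u] nn fin that u by (auto simp: cone_weights_def)
    then have "(\<Sum>a\<in>A. norm (u a *\<^sub>R a)) \<le> (\<Sum>a\<in>A. real n * norm a)"
      by (intro sum_mono) (use nn in \<open>auto intro!: mult_right_mono\<close>)
    then show ?thesis
      unfolding c_def sum_distrib_left using norm_sum[of "\<lambda>a. u a *\<^sub>R a" A] by linarith
  qed
  then have "(\<lambda>u. \<Sum>a\<in>A. u a *\<^sub>R a) ` cone_weights A J K n \<subseteq> cball 0 c \<inter> int_lattice"
    by (auto simp: cone_weights_def)
  then show "finite ((\<lambda>u. \<Sum>a\<in>A. u a *\<^sub>R a) ` cone_weights A J K n)"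
    using finite_bounded_int_lattice[OF bounded_cball] finite_subset by blast
qed

text \<open>The coefficient of \<open>a\<close> is either already reduced, or it can be lowered by
  one; the latter removes one copy of the lattice point \<open>a\<close> and drops the height by
  one. In generating functions this is multiplication by \<open>1 - X\<close>.\<close>

lemma card_cone_weights_insert:
  assumes ind: "\<not> affine_dependent A" and A: "A \<subseteq> int_lattice" and a: "a \<in> A" "a \<notin> K"
  shows "card (cone_weights A J K n) = card (cone_weights A J (insert a K) n)
           + (if n = 0 then 0 else card (cone_weights A J K (n - 1)))"
proof -
  have fin: "finite A" using ind aff_independent_finite by blast
  \<comment> \<open>The threshold matches the reduced range, which is \<open>(0, 1]\<close> for
    \<open>a\<close> in \<open>J\<close> and \<open>[0, 1)\<close> otherwise: the complement begins
    strictly above \<open>1\<close> or at \<open>1\<close>.\<close>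
  define big where "big = {u \<in> cone_weights A J K n. if a \<in> J then 1 < u a else 1 \<le> u a}"
  define f where "f = (\<lambda>u::'a\<Rightarrow>real. u(a := u a + 1))"
  have un: "cone_weights A J K n = cone_weights A J (insert a K) n \<union> big"
    using a by (auto simp: cone_weights_def big_def split: if_splits)
  have dis: "cone_weights A J (insert a K) n \<inter> big = {}"
    using a by (auto simp: cone_weights_def big_def split: if_splits)
  have "card (cone_weights A J K n) = card (cone_weights A J (insert a K) n) + card big"
    unfolding un using finite_cone_weights[OF ind] by (intro card_Un_disjoint dis) (auto simp: big_def)
  moreover have "card big = (if n = 0 then 0 else card (cone_weights A J K (n - 1)))"
  proof (cases "n = 0")
    case True
    have "big = {}"
    proof (rule ccontr)
      assume "big \<noteq> {}"
      then obtain u where u: "u \<in> big" by auto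
      then have "\<forall>b\<in>A. 0 \<le> u b" "sum u A = 0"
        using True by (auto simp: big_def cone_weights_def split: if_splits)
      then have "u a = 0" using fin a sum_nonneg_eq_0_iff[of A u] by auto
      then show False using u by (auto simp: big_def split: if_splits)
    qed
    then show ?thesis using True by simp
  next
    case False
    have s1: "sum (f u) A = sum u A + 1" for u
      using fin a by (simp add: f_def sum.remove[OF fin a(1)])
    have s2: "(\<Sum>b\<in>A. f u b *\<^sub>R b) = (\<Sum>b\<in>A. u b *\<^sub>R b) + a" for u
      using fin a by (simp add: f_def sum.remove[OF fin a(1)] scaleR_add_left)
    have lat: "(\<Sum>b\<in>A. f u b *\<^sub>R b) \<in> int_lattice \<longleftrightarrow> (\<Sum>b\<in>A. u b *\<^sub>R b) \<in> int_lattice" for u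
      unfolding s2 using A a by (intro int_lattice_add_cancel) auto
    have "bij_betw f (cone_weights A J K (n - 1)) big"
    proof (rule bij_betw_byWitness[where f' = "\<lambda>u. u(a := u a - 1)"])
      show "f ` cone_weights A J K (n - 1) \<subseteq> big"
      proof
        fix w assume "w \<in> f ` cone_weights A J K (n - 1)"
        then obtain u where u: "u \<in> cone_weights A J K (n - 1)" "w = f u" by auto
        then show "w \<in> big"
          using a False s1[of u] lat[of u]
          unfolding big_def cone_weights_def by (auto simp: f_def split: if_splits)
      qed
      show "(\<lambda>u. u(a := u a - 1)) ` big \<subseteq> cone_weights A J K (n - 1)"
      proof
        fix w assume "w \<in> (\<lambda>u. u(a := u a - 1)) ` big"
        then obtain u where u: "u \<in> big" "w = u(a := u a - 1)" by auto
        then have fw: "f w = u" by (auto simp: f_def)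
        have "sum w A = real (n - 1)" "(\<Sum>b\<in>A. w b *\<^sub>R b) \<in> int_lattice"
          using s1[of w] lat[of w] u False unfolding fw by (auto simp: big_def cone_weights_def)
        moreover have "\<forall>b. b \<notin> A \<longrightarrow> w b = 0"
          using u a by (auto simp: big_def cone_weights_def)
        moreover have "if b \<in> J then 0 < w b \<and> (b \<in> K \<longrightarrow> w b \<le> 1) else 0 \<le> w b \<and> (b \<in> K \<longrightarrow> w b < 1)"
          if "b \<in> A" for b
          using u a that by (cases "b = a") (auto simp: big_def cone_weights_def split: if_splits)
        ultimately show "w \<in> cone_weights A J K (n - 1)"
          unfolding cone_weights_def by blast
      qed
    qed (auto simp: f_def)
    then show ?thesis
      using False bij_betw_same_card by fastforce
  qed
  ultimately show ?thesis by simp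
qed

definition cone_series :: "'a::euclidean_space set \<Rightarrow> 'a set \<Rightarrow> 'a set \<Rightarrow> int fps" where
  "cone_series A J K = Abs_fps (\<lambda>n. int (card (cone_weights A J K n)))"

lemma fps_mult_one_minus_X_nth:
  "fps_nth ((f :: 'a::comm_ring_1 fps) * (1 - fps_X)) n = fps_nth f n - (if n = 0 then 0 else fps_nth f (n - 1))"
  by (simp add: right_diff_distrib)

text \<open>Reducing the coefficients one vertex at a time turns the series of the cone into the
  finite count of lattice points in the half-open fundamental parallelepiped, sorted by
  height.\<close>

lemma cone_series_mult:
  assumes ind: "\<not> affine_dependent A" and A: "A \<subseteq> int_lattice"
  shows "cone_series A J {} * (1 - fps_X) ^ card A = cone_series A J A"
proof -
  have fin: "finite A" using ind aff_independent_finite by blast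
  have "cone_series A J {} * (1 - fps_X) ^ card K = cone_series A J K" if "K \<subseteq> A" "finite K" for K
    using that(2,1)
  proof (induction K rule: finite_induct)
    case empty then show ?case by simp
  next
    case (insert a K)
    have "cone_series A J {} * (1 - fps_X) ^ card (insert a K) = cone_series A J K * (1 - fps_X)"
      using insert by (simp add: power_Suc2 mult.assoc[symmetric] del: power_Suc)
    also have "\<dots> = cone_series A J (insert a K)"
    proof (rule fps_ext)
      fix n
      show "fps_nth (cone_series A J K * (1 - fps_X)) n = fps_nth (cone_series A J (insert a K)) n"
        using card_cone_weights_insert[OF ind A, of a K J n] insert
        by (simp only: fps_mult_one_minus_X_nth) (auto simp: cone_series_def)
    qed
    finally show ?case .
  qed
  then show ?thesis using fin by blast
qed

lemma sum_cone_weights_box_le: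
  assumes "finite A" "u \<in> cone_weights A J A n"
  shows "n \<le> card A"
proof -
  have "sum u A \<le> (\<Sum>a\<in>A. 1)"
    using assms by (intro sum_mono) (auto simp: cone_weights_def split: if_splits)
  then show ?thesis using assms by (simp add: cone_weights_def)
qed

text \<open>A vertex outside \<open>J\<close> has a coefficient strictly below \<open>1\<close>.
  This is what keeps the degree of \<open>h\<^sup>*\<close> below \<open>card A\<close>.\<close>

lemma sum_cone_weights_box_less:
  assumes "finite A" "u \<in> cone_weights A J A n" "\<not> A \<subseteq> J"
  shows "n < card A"
proof -
  have "sum u A < (\<Sum>a\<in>A. 1)"
    using assms by (intro sum_strict_mono_ex1) (auto simp: cone_weights_def split: if_splits)
  then show ?thesis using assms by (simp add: cone_weights_def)
qed

text \<open>Reflecting every coefficient \<open>u\<close> to \<open>1 - u\<close> exchanges the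
  ranges \<open>[0, 1)\<close> and \<open>(0, 1]\<close>, hence \<open>J\<close> and its complement,
  and turns height \<open>n\<close> into \<open>card A - n\<close>. This involution is the source of
  Ehrhart reciprocity.\<close>

lemma card_cone_weights_reflect:
  assumes ind: "\<not> affine_dependent A" and A: "A \<subseteq> int_lattice" and n: "n \<le> card A" and J: "J \<subseteq> A"
  shows "card (cone_weights A (A - J) A n) = card (cone_weights A J A (card A - n))"
proof -
  have fin: "finite A" using ind aff_independent_finite by blast
  define f where "f = (\<lambda>(u::'a\<Rightarrow>real) a. if a \<in> A then 1 - u a else 0)"
  have s1: "sum (f u) A = real (card A) - sum u A" for u
    by (simp add: f_def sum_subtractf)
  have s2: "(\<Sum>b\<in>A. f u b *\<^sub>R b) = (\<Sum>b\<in>A. b) - (\<Sum>b\<in>A. u b *\<^sub>R b)" for u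
    by (simp add: f_def scaleR_diff_left sum_subtractf)
  have SA: "(\<Sum>b\<in>A. b) \<in> int_lattice" using A by (intro int_lattice_sum) auto
  have lat: "(\<Sum>b\<in>A. u b *\<^sub>R b) \<in> int_lattice \<Longrightarrow> (\<Sum>b\<in>A. f u b *\<^sub>R b) \<in> int_lattice" for u
    unfolding s2 by (intro int_lattice_diff SA)
  have sub: "f ` cone_weights A J A m \<subseteq> cone_weights A (A - J) A (card A - m)"
    if "m \<le> card A" "J \<subseteq> A" for m J
  proof
    fix w assume "w \<in> f ` cone_weights A J A m"
    then obtain u where u: "u \<in> cone_weights A J A m" "w = f u" by auto
    have "sum w A = real (card A - m)"
      using u that by (simp add: s1 cone_weights_def of_nat_diff)
    moreover have "(\<Sum>b\<in>A. w b *\<^sub>R b) \<in> int_lattice"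
      using u lat by (simp add: cone_weights_def)
    ultimately show "w \<in> cone_weights A (A - J) A (card A - m)"
      using u by (auto simp: cone_weights_def f_def split: if_splits)
  qed
  have inv: "f (f u) = u" if "u \<in> cone_weights A J A m" for u J m
    using that by (auto simp: f_def cone_weights_def)
  have "bij_betw f (cone_weights A (A - J) A n) (cone_weights A J A (card A - n))"
  proof (rule bij_betw_byWitness[where f' = f])
    show "f ` cone_weights A (A - J) A n \<subseteq> cone_weights A J A (card A - n)"
      using sub[OF n, of "A - J"] J by (simp add: double_diff)
    show "f ` cone_weights A J A (card A - n) \<subseteq> cone_weights A (A - J) A n"
      using sub[of "card A - n" J] n J by simp
  qed (use inv in auto)
  then show ?thesis by (rule bij_betw_same_card)
qed

section \<open>Half-open lattice triangulations\<close>

text \<open>A point outside the relative interior lies in some facet, whose dimension is smaller, so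
  descending through facets ends at the right face.\<close>

lemma polytope_rel_interior_face:
  fixes P :: "'a::euclidean_space set"
  assumes "polytope P" "x \<in> P"
  obtains F where "F face_of P" "x \<in> rel_interior F"
proof -
  have "\<exists>F. F face_of P \<and> x \<in> rel_interior F"
    using assms
  proof (induction "nat (aff_dim P)" arbitrary: P rule: less_induct)
    case less
    show ?case
    proof (cases "x \<in> rel_interior P")
      case True
      then show ?thesis using less.prems polytope_imp_convex face_of_refl by blast
    next
      case False
      then have "x \<in> rel_frontier P"
        using less.prems by (simp add: rel_frontier_def polytope_imp_closed)
      then obtain F where F: "F facet_of P" "x \<in> F"
        using rel_frontier_of_polyhedron[OF polytope_imp_polyhedron[OF less.prems(1)]] by auto
      then have "polytope F" "F face_of P"
        using less.prems face_of_polytope_polytope facet_of_imp_face_of by blast+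
      moreover have "nat (aff_dim F) < nat (aff_dim P)"
        using F aff_dim_negative_iff[of F] unfolding facet_of_def by auto
      ultimately show ?thesis
        using less.hyps[of F] F(2) face_of_trans by blast
    qed
  qed
  then show thesis using that by blast
qed

text \<open>A finite union of affine sets is closed, so a small step from a point that avoids the
  earlier sets still avoids them; stepping towards a point of \<open>S\<close> off the new set
  leaves that set at once.\<close>

lemma exists_rel_interior_avoiding_affine:
  fixes S :: "'a::euclidean_space set"
  assumes "convex S" "S \<noteq> {}" "finite \<H>" "\<And>H. H \<in> \<H> \<Longrightarrow> affine H \<and> \<not> S \<subseteq> H"
  shows "\<exists>y\<in>rel_interior S. \<forall>H\<in>\<H>. y \<notin> H"
  using assms(3,4)
proof (induction \<H> rule: finite_induct)
  case empty
  then show ?case using rel_interior_eq_empty assms by blast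
next
  case (insert H \<H>)
  then obtain y where y: "y \<in> rel_interior S" "\<forall>H\<in>\<H>. y \<notin> H" by auto
  show ?case
  proof (cases "y \<in> H")
    case False then show ?thesis using y by auto
  next
    case True
    obtain z where z: "z \<in> S" "z \<notin> H" using insert.prems by blast
    define f where "f = (\<lambda>t::real. y - t *\<^sub>R (y - z))"
    have "closed (\<Union>\<H>)" using insert affine_closed by (intro closed_Union) auto
    moreover have "(f \<longlongrightarrow> f 0) (at_right 0)"
      unfolding f_def by (intro tendsto_intros)
    moreover have "f 0 \<in> - \<Union>\<H>" using y by (auto simp: f_def)
    ultimately have "eventually (\<lambda>t. f t \<in> - \<Union>\<H>) (at_right 0)"
      by (intro topological_tendstoD) auto
    moreover have "eventually (\<lambda>t::real. t \<in> {0<..<1}) (at_right 0)"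
      by (rule eventually_at_right_real) simp
    ultimately have "eventually (\<lambda>t. f t \<in> - \<Union>\<H> \<and> t \<in> {0<..<1}) (at_right 0)"
      by (rule eventually_conj)
    then have "\<exists>t. f t \<in> - \<Union>\<H> \<and> t \<in> {0<..<1}"
      by (intro eventually_happens'[of "at_right 0"] trivial_limit_at_right_real)
    then obtain t where t: "f t \<in> - \<Union>\<H>" "0 < t" "t < 1" by auto
    have "f t \<in> rel_interior S"
    proof -
      have "f t = z - (1 - t) *\<^sub>R (z - y)" by (simp add: f_def algebra_simps)
      then show ?thesis using rel_interior_convex_shrink[OF assms(1) y(1) z(1), of "1 - t"] t by simp
    qed
    moreover have "f t \<notin> H"
    proof
      assume "f t \<in> H"
      \<comment> \<open>The line through \<open>y\<close> and \<open>f t\<close> contains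
        \<open>z\<close>, so an affine set containing the first two contains the third.\<close>
      then have "(1 - 1/t) *\<^sub>R y + (1/t) *\<^sub>R f t \<in> H"
        using True insert.prems mem_affine[of H y "f t" "1 - 1/t" "1/t"] by auto
      moreover have "(1 - 1/t) *\<^sub>R y + (1/t) *\<^sub>R f t = z"
        using t by (simp add: f_def algebra_simps)
      ultimately show False using z by simp
    qed
    ultimately show ?thesis using t by auto
  qed
qed

lemma lattice_polytope_imp_polytope: "lattice_polytope P \<Longrightarrow> polytope P"
  by (auto simp: lattice_polytope_def polytope_def)

lemma lattice_polytope_face:
  assumes "lattice_polytope P" "F face_of P"
  shows "lattice_polytope F"
proof -
  obtain V where V: "finite V" "V \<subseteq> int_lattice" "P = convex hull V"
    using assms by (auto simp: lattice_polytope_def)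
  then obtain V' where "V' \<subseteq> V" "F = convex hull V'"
    using face_of_convex_hull_subset[OF finite_imp_compact, of V F] assms by auto
  then show ?thesis
    using V finite_subset[of V' V] unfolding lattice_polytope_def by (intro exI[of _ V']) auto
qed

lemma extreme_point_lattice_polytope:
  "lattice_polytope P \<Longrightarrow> v extreme_point_of P \<Longrightarrow> v \<in> int_lattice"
  by (auto simp: lattice_polytope_def dest!: extreme_point_of_convex_hull)

section \<open>Barycentric coordinates and triangulations by pulling a vertex\<close>

definition bary :: "'a::euclidean_space set \<Rightarrow> 'a \<Rightarrow> 'a \<Rightarrow> real" where
  "bary A x = (SOME u. sum u A = 1 \<and> (\<Sum>a\<in>A. u a *\<^sub>R a) = x)"

lemma bary:
  assumes "\<not> affine_dependent A" "x \<in> affine hull A"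
  shows "sum (bary A x) A = 1" "(\<Sum>a\<in>A. bary A x a *\<^sub>R a) = x"
proof -
  have "\<exists>u. sum u A = 1 \<and> (\<Sum>a\<in>A. u a *\<^sub>R a) = x"
    using assms affine_hull_finite[OF aff_independent_finite] by blast
  from someI_ex[OF this] show "sum (bary A x) A = 1" "(\<Sum>a\<in>A. bary A x a *\<^sub>R a) = x"
    unfolding bary_def by blast+
qed

lemma bary_unique:
  assumes "\<not> affine_dependent A" "sum u A = 1" "(\<Sum>a\<in>A. u a *\<^sub>R a) = x" "a \<in> A"
  shows "bary A x a = u a"
proof -
  have "x \<in> affine hull A"
    using assms affine_hull_finite[OF aff_independent_finite] by blast
  then show ?thesis
    using affine_independent_weights_unique[OF assms(1), of "bary A x" u] bary[OF assms(1)] assms by metis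
qed

lemma bary_affine:
  assumes "\<not> affine_dependent A" "x \<in> affine hull A" "y \<in> affine hull A" "a \<in> A"
  shows "bary A (x + t *\<^sub>R (y - x)) a = bary A x a + t * (bary A y a - bary A x a)"
proof (rule bary_unique[OF assms(1) _ _ assms(4)])
  show "(\<Sum>a\<in>A. bary A x a + t * (bary A y a - bary A x a)) = 1"
    using bary[OF assms(1)] assms(2,3) by (simp add: sum.distrib sum_subtractf flip: sum_distrib_left)
  have "(\<Sum>a\<in>A. (bary A x a + t * (bary A y a - bary A x a)) *\<^sub>R a)
      = (\<Sum>a\<in>A. bary A x a *\<^sub>R a) + t *\<^sub>R ((\<Sum>a\<in>A. bary A y a *\<^sub>R a) - (\<Sum>a\<in>A. bary A x a *\<^sub>R a))"
    by (simp add: scaleR_left_distrib scaleR_left_diff_distrib sum.distrib sum_subtractf right_diff_distrib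
        scaleR_right_diff_distrib scaleR_sum_right)
  also have "\<dots> = x + t *\<^sub>R (y - x)" using bary[OF assms(1)] assms(2,3) by simp
  finally show "(\<Sum>a\<in>A. (bary A x a + t * (bary A y a - bary A x a)) *\<^sub>R a) = x + t *\<^sub>R (y - x)" .
qed

lemma convex_hull_eq_bary:
  assumes "\<not> affine_dependent A"
  shows "x \<in> convex hull A \<longleftrightarrow> x \<in> affine hull A \<and> (\<forall>a\<in>A. 0 \<le> bary A x a)"
proof
  assume x: "x \<in> convex hull A"
  then obtain u where "\<forall>a\<in>A. 0 \<le> u a" "sum u A = 1" "(\<Sum>a\<in>A. u a *\<^sub>R a) = x"
    using convex_hull_finite[OF aff_independent_finite[OF assms]] by auto
  then show "x \<in> affine hull A \<and> (\<forall>a\<in>A. 0 \<le> bary A x a)"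
    using bary_unique[OF assms] x convex_hull_subset_affine_hull by fastforce
next
  assume "x \<in> affine hull A \<and> (\<forall>a\<in>A. 0 \<le> bary A x a)"
  then show "x \<in> convex hull A"
    using bary[OF assms] convex_hull_finite[OF aff_independent_finite[OF assms]] by blast
qed

lemma rel_interior_convex_hull_eq_bary:
  assumes "\<not> affine_dependent A"
  shows "x \<in> rel_interior (convex hull A) \<longleftrightarrow> x \<in> affine hull A \<and> (\<forall>a\<in>A. 0 < bary A x a)"
proof
  assume x: "x \<in> rel_interior (convex hull A)"
  then obtain u where "\<forall>a\<in>A. 0 < u a" "sum u A = 1" "(\<Sum>a\<in>A. u a *\<^sub>R a) = x"
    using rel_interior_convex_hull_explicit[OF assms] by auto
  then show "x \<in> affine hull A \<and> (\<forall>a\<in>A. 0 < bary A x a)"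
    using bary_unique[OF assms] x convex_hull_subset_affine_hull rel_interior_subset by (metis subsetD)
next
  assume "x \<in> affine hull A \<and> (\<forall>a\<in>A. 0 < bary A x a)"
  then show "x \<in> rel_interior (convex hull A)"
    using bary[OF assms] rel_interior_convex_hull_explicit[OF assms] by blast
qed

text \<open>Simplices are not asked to meet in common faces: for the half-open decomposition it is
  enough that their relative interiors are disjoint. Full dimension is expressed by the affine
  hull.\<close>

definition lattice_triangulation :: "'a::euclidean_space set \<Rightarrow> 'a set set \<Rightarrow> bool" where
  "lattice_triangulation P \<T> \<longleftrightarrow> finite \<T> \<and>
     (\<forall>A\<in>\<T>. A \<subseteq> int_lattice \<and> \<not> affine_dependent A \<and> affine hull A = affine hull P) \<and>
     (\<Union>A\<in>\<T>. convex hull A) = P \<and>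
     (\<forall>A\<in>\<T>. \<forall>B\<in>\<T>. rel_interior (convex hull A) \<inter> rel_interior (convex hull B) \<noteq> {} \<longrightarrow> A = B)"

text \<open>Follow the ray from \<open>v\<close> through \<open>x\<close> to its last point
  \<open>z\<close> in \<open>P\<close>. The face with \<open>z\<close> in its relative interior
  cannot contain \<open>v\<close>, since otherwise the ray could be prolonged beyond
  \<open>z\<close>; being an intersection of facets, it lies in one that misses
  \<open>v\<close>.\<close>

lemma ray_exit_facet:
  fixes v :: "'a::euclidean_space"
  assumes P: "polytope P" and v: "v \<in> P" and x: "x \<in> P" "x \<noteq> v"
  obtains F z where "F facet_of P" "v \<notin> F" "z \<in> F" "x \<in> closed_segment v z"
proof -
  define T where "T = {t. v + t *\<^sub>R (x - v) \<in> P}"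
  have "closed T"
  proof -
    have "closed ((\<lambda>t. v + t *\<^sub>R (x - v)) -` P)"
      by (intro continuous_closed_vimage polytope_imp_closed P continuous_intros)
    then show ?thesis by (simp add: T_def vimage_def)
  qed
  moreover have "bounded T"
  proof -
    obtain c where c: "\<And>y. y \<in> P \<Longrightarrow> norm y \<le> c"
      using polytope_imp_bounded[OF P] by (auto simp: bounded_iff)
    have "\<bar>t\<bar> \<le> (c + norm v) / norm (x - v)" if "t \<in> T" for t
    proof -
      have "norm (t *\<^sub>R (x - v)) \<le> norm (v + t *\<^sub>R (x - v)) + norm v"
        by (metis add_diff_cancel_left' norm_triangle_ineq4)
      also have "\<dots> \<le> c + norm v" using c that by (simp add: T_def)
      finally show ?thesis using x by (simp add: pos_le_divide_eq)
    qed
    then show ?thesis by (auto simp: bounded_iff)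
  qed
  moreover have "1 \<in> T" using x by (simp add: T_def)
  ultimately obtain t where t: "t \<in> T" "\<And>s. s \<in> T \<Longrightarrow> s \<le> t"
    using compact_attains_sup[of T] compact_eq_bounded_closed by blast
  have t1: "1 \<le> t" using t \<open>1 \<in> T\<close> by blast
  define z where "z = v + t *\<^sub>R (x - v)"
  have "z \<in> P" using t by (simp add: z_def T_def)
  then obtain G where G: "G face_of P" "z \<in> rel_interior G"
    using polytope_rel_interior_face[OF P] by metis
  have vG: "v \<notin> G"
  proof
    assume "v \<in> G"
    moreover have "convex G" "G \<noteq> {}" using G face_of_imp_convex rel_interior_empty by auto
    ultimately obtain e where e: "e > 1" "(1 - e) *\<^sub>R v + e *\<^sub>R z \<in> G"
      using convex_rel_interior_iff[of G z] G by blast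
    moreover have "(1 - e) *\<^sub>R v + e *\<^sub>R z = v + (e * t) *\<^sub>R (x - v)"
      by (simp add: z_def algebra_simps)
    ultimately have "e * t \<in> T" using G face_of_imp_subset by (auto simp: T_def)
    then have "e * t \<le> t" using t by blast
    moreover have "t < e * t" using e t1 by simp
    ultimately show False by linarith
  qed
  have "G \<noteq> {}" "G \<noteq> P" using G vG v rel_interior_empty by auto
  then have "G = \<Inter>{F. F facet_of P \<and> G \<subseteq> F}"
    using face_of_polyhedron[OF polytope_imp_polyhedron[OF P] G(1)] by blast
  then obtain F where F: "F facet_of P" "G \<subseteq> F" "v \<notin> F" using vG by blast
  have "z \<in> F" using F G rel_interior_subset by blast
  moreover have "x \<in> closed_segment v z"
    unfolding closed_segment_def using t1
    by (intro CollectI exI[of _ "1/t"]) (simp add: z_def algebra_simps)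
  ultimately show thesis using that F by blast
qed

lemma rel_interior_convex_hull_insert:
  fixes v :: "'a::euclidean_space"
  assumes "\<not> affine_dependent (insert v A)" "v \<notin> A" "A \<noteq> {}" "x \<in> rel_interior (convex hull (insert v A))"
  obtains z s where "z \<in> rel_interior (convex hull A)" "0 < s" "x = v + s *\<^sub>R (z - v)"
proof -
  have ind: "\<not> affine_dependent A" by (rule affine_independent_subset[OF assms(1)]) auto
  have fin: "finite A" by (rule aff_independent_finite[OF ind])
  obtain u where u: "\<forall>a\<in>insert v A. 0 < u a" "sum u (insert v A) = 1" "(\<Sum>a\<in>insert v A. u a *\<^sub>R a) = x"
    using assms(4) rel_interior_convex_hull_explicit[OF assms(1)] by auto
  define s where "s = sum u A"
  have s: "0 < s" "u v = 1 - s"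
    using u fin assms by (auto simp: s_def intro!: sum_pos)
  define z where "z = (\<Sum>a\<in>A. (u a / s) *\<^sub>R a)"
  have "z \<in> rel_interior (convex hull A)"
    unfolding rel_interior_convex_hull_explicit[OF ind]
    by (intro CollectI exI[of _ "\<lambda>a. u a / s"])
      (use u s in \<open>auto simp: z_def s_def simp flip: sum_divide_distrib\<close>)
  moreover have "x = v + s *\<^sub>R (z - v)"
    using u s fin assms by (auto simp: z_def scaleR_sum_right algebra_simps)
  ultimately show thesis using that s by blast
qed

text \<open>If the two points on the ray differed, the nearer one would lie strictly between
  \<open>v\<close> and the other, and the face containing it would also contain
  \<open>v\<close>.\<close>

lemma ray_face_point_unique:
  fixes v :: "'a::euclidean_space"
  assumes "F face_of P" "G face_of P" "v \<in> P" "v \<notin> F" "v \<notin> G" "z \<in> F" "z' \<in> G"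
    "v + s *\<^sub>R (z - v) = v + s' *\<^sub>R (z' - v)" "0 < s" "0 < s'"
  shows "z = z'"
proof -
  have *: False if "F face_of P" "G face_of P" "v \<notin> G" "z \<in> F" "z' \<in> G" "v \<notin> F"
    "s *\<^sub>R (z - v) = s' *\<^sub>R (z' - v)" "0 < s" "s < s'" for F G z z' s s'
  proof -
    have ss: "0 < s'" "0 < s / s'" "s / s' < 1" using that by auto
    have "z' - v = (s / s') *\<^sub>R (z - v)"
    proof -
      have "(s / s') *\<^sub>R (z - v) = (1/s') *\<^sub>R (s *\<^sub>R (z - v))" by simp
      also have "\<dots> = z' - v" unfolding that(7) using that by simp
      finally show ?thesis by simp
    qed
    then have "z' = (1 - s/s') *\<^sub>R v + (s/s') *\<^sub>R z" by (simp add: algebra_simps)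
    moreover have "v \<noteq> z" using that by auto
    ultimately have "z' \<in> open_segment v z"
      using ss unfolding in_segment by blast
    then show False
      using face_ofD[OF that(2), of z' v z] that assms(3) face_of_imp_subset by blast
  qed
  have "s = s'"
    using *[of F G z z' s s'] *[of G F z' z s' s] assms by (metis add_left_cancel linorder_neqE_linordered_idom)
  then show ?thesis using assms by simp
qed

text \<open>Pulling a vertex: cone from an extreme point \<open>v\<close> over triangulations of the
  facets that miss \<open>v\<close>. Rays from \<open>v\<close> leave \<open>P\<close> through these
  facets, which gives the covering, and they do so in a unique point, which gives
  disjointness.\<close>

theorem lattice_triangulation_exists:
  fixes P :: "'a::euclidean_space set"
  assumes "lattice_polytope P" "P \<noteq> {}"
  shows "\<exists>\<T>. lattice_triangulation P \<T>"
  using assms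
proof (induction "nat (aff_dim P)" arbitrary: P rule: less_induct)
  case less
  have P: "polytope P" "convex P" "compact P"
    using less.prems lattice_polytope_imp_polytope polytope_imp_convex polytope_imp_compact by blast+
  obtain v where v: "v extreme_point_of P"
    using extreme_point_exists_convex[OF P(3,2) less.prems(2)] by blast
  then have vP: "v \<in> P" by (simp add: extreme_point_of_def)
  have vM: "v \<in> int_lattice" using extreme_point_lattice_polytope less.prems(1) v by blast
  show ?case
  proof (cases "P = {v}")
    case True
    then have "lattice_triangulation P {{v}}"
      using vM by (simp add: lattice_triangulation_def)
    then show ?thesis by blast
  next
    case False
    define \<Phi> where "\<Phi> = {F. F facet_of P \<and> v \<notin> F}"
    have fin: "finite \<Phi>" using finite_polytope_facets[OF P(1)] by (simp add: \<Phi>_def)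
    have \<Phi>: "F face_of P" "F facet_of P" "v \<notin> F" "F \<noteq> {}" "aff_dim F = aff_dim P - 1" "lattice_polytope F" "F \<subseteq> P"
      if "F \<in> \<Phi>" for F
      using that lattice_polytope_face[OF less.prems(1)] face_of_imp_subset[of F P]
      by (auto simp: \<Phi>_def facet_of_def)
    have "\<exists>\<T>. lattice_triangulation F \<T>" if "F \<in> \<Phi>" for F
      using less.hyps[of F] \<Phi>[OF that] aff_dim_negative_iff[of F] by simp
    then obtain \<T> where \<T>: "\<And>F. F \<in> \<Phi> \<Longrightarrow> lattice_triangulation F (\<T> F)" by metis
    have tri: "finite (\<T> F)" "(\<Union>A\<in>\<T> F. convex hull A) = F" if "F \<in> \<Phi>" for F
      using \<T>[OF that] by (auto simp: lattice_triangulation_def)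
    have simp: "A \<subseteq> int_lattice" "\<not> affine_dependent A" "affine hull A = affine hull F"
      "v \<notin> affine hull A" "v \<notin> A" "A \<noteq> {}" "convex hull A \<subseteq> F" "\<not> affine_dependent (insert v A)"
      "affine hull (insert v A) = affine hull P" "convex hull (insert v A) \<subseteq> P"
      if "F \<in> \<Phi>" "A \<in> \<T> F" for F A
    proof -
      show 1: "A \<subseteq> int_lattice" "\<not> affine_dependent A" "affine hull A = affine hull F"
        using \<T>[OF that(1)] that(2) by (auto simp: lattice_triangulation_def)
      show 2: "convex hull A \<subseteq> F" using tri[OF that(1)] that(2) by blast
      show 3: "v \<notin> affine hull A"
        using face_of_imp_eq_affine_Int[OF P(2) \<Phi>(1)[OF that(1)]] \<Phi>(3)[OF that(1)] vP 1 by auto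
      then show 4: "v \<notin> A" by (meson hull_inc)
      show "A \<noteq> {}" using 1 \<Phi>(4)[OF that(1)] by auto
      show 5: "\<not> affine_dependent (insert v A)" by (rule affine_independent_insert[OF 1(2) 3])
      show 6: "convex hull (insert v A) \<subseteq> P"
        using 2 \<Phi>(7)[OF that(1)] vP P(2) hull_subset[of A convex] by (intro hull_minimal) auto
      have "aff_dim (insert v A) = aff_dim P"
        using aff_dim_insert[of v A] 3 1(3) \<Phi>(5)[OF that(1)] aff_dim_affine_hull by (metis diff_add_cancel)
      moreover have "insert v A \<subseteq> P" using 6 hull_subset[of "insert v A" convex] by blast
      ultimately show "affine hull (insert v A) = affine hull P"
        by (intro affine_dim_equal) (auto simp: hull_mono aff_dim_affine_hull)
    qed
    define \<S> where "\<S> = (\<Union>F\<in>\<Phi>. insert v ` \<T> F)"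
    have cover: "\<exists>A\<in>\<S>. x \<in> convex hull A" if x: "x \<in> P" for x
    proof -
      obtain w where "w \<in> P" "w \<noteq> v" using False vP by blast
      then obtain x' where x': "x' \<in> P" "x' \<noteq> v" "x \<noteq> v \<Longrightarrow> x' = x" using x by (cases "x = v") auto
      obtain F z where F: "F \<in> \<Phi>" "z \<in> F" "x' \<in> closed_segment v z"
        by (rule ray_exit_facet[OF P(1) vP x'(1,2)]) (simp add: \<Phi>_def)
      then have xs: "x \<in> closed_segment v z" using x' by (cases "x = v") auto
      obtain A where A: "A \<in> \<T> F" "z \<in> convex hull A" using tri F by blast
      have "closed_segment v z \<subseteq> convex hull (insert v A)"
        using A hull_mono[of A "insert v A" convex] hull_inc[of v "insert v A" convex]
        by (intro closed_segment_subset) auto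
      then show ?thesis using xs A F by (auto simp: \<S>_def)
    qed
    have uniq: "B = B'"
      if B: "B \<in> \<S>" "B' \<in> \<S>" and x: "x \<in> rel_interior (convex hull B)" "x \<in> rel_interior (convex hull B')" for B B' x
    proof -
      obtain F A where A: "F \<in> \<Phi>" "A \<in> \<T> F" "B = insert v A" using B by (auto simp: \<S>_def)
      obtain F' A' where A': "F' \<in> \<Phi>" "A' \<in> \<T> F'" "B' = insert v A'" using B by (auto simp: \<S>_def)
      obtain z s where z: "z \<in> rel_interior (convex hull A)" "0 < s" "x = v + s *\<^sub>R (z - v)"
        using rel_interior_convex_hull_insert[OF simp(8,5,6)[OF A(1,2)]] x A by blast
      obtain z' s' where z': "z' \<in> rel_interior (convex hull A')" "0 < s'" "x = v + s' *\<^sub>R (z' - v)"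
        using rel_interior_convex_hull_insert[OF simp(8,5,6)[OF A'(1,2)]] x A' by blast
      have zF: "z \<in> rel_interior F"
        using subset_rel_interior[OF simp(7)[OF A(1,2)]] simp(3)[OF A(1,2)] z by auto
      have zF': "z' \<in> rel_interior F'"
        using subset_rel_interior[OF simp(7)[OF A'(1,2)]] simp(3)[OF A'(1,2)] z' by auto
      have "z = z'"
        using ray_face_point_unique[OF \<Phi>(1)[OF A(1)] \<Phi>(1)[OF A'(1)] vP \<Phi>(3)[OF A(1)] \<Phi>(3)[OF A'(1)], of z z' s s']
          zF zF' z z' rel_interior_subset by blast
      then have "F = F'" using face_of_eq[OF \<Phi>(1)[OF A(1)] \<Phi>(1)[OF A'(1)]] zF zF' by blast
      then show ?thesis
        using \<T>[OF A(1)] A A' z z' \<open>z = z'\<close> unfolding lattice_triangulation_def by blast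
    qed
    have "lattice_triangulation P \<S>"
      unfolding lattice_triangulation_def
    proof (intro conjI)
      show "finite \<S>" using fin tri by (auto simp: \<S>_def)
      show "\<forall>A\<in>\<S>. A \<subseteq> int_lattice \<and> \<not> affine_dependent A \<and> affine hull A = affine hull P"
        using simp vM by (auto simp: \<S>_def)
      have "convex hull A \<subseteq> P" if "A \<in> \<S>" for A
        using that simp(10) unfolding \<S>_def by blast
      then show "(\<Union>A\<in>\<S>. convex hull A) = P" using cover by blast
      show "\<forall>A\<in>\<S>. \<forall>B\<in>\<S>. rel_interior (convex hull A) \<inter> rel_interior (convex hull B) \<noteq> {} \<longrightarrow> A = B"
        using uniq by blast
    qed
    then show ?thesis by blast
  qed
qed

section \<open>Half-open simplices seen from a generic point\<close>

definition half_open :: "'a::euclidean_space set \<Rightarrow> 'a set \<Rightarrow> 'a set" where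
  "half_open A J = {x \<in> affine hull A. \<forall>a\<in>A. 0 \<le> bary A x a \<and> (a \<in> J \<longrightarrow> 0 < bary A x a)}"

lemma bary_eq_0_imp:
  assumes "\<not> affine_dependent A" "x \<in> affine hull A" "a \<in> A" "bary A x a = 0"
  shows "x \<in> affine hull (A - {a})"
proof -
  have fin: "finite A" by (rule aff_independent_finite[OF assms(1)])
  have "sum (bary A x) (A - {a}) = 1" "(\<Sum>b\<in>A - {a}. bary A x b *\<^sub>R b) = x"
    using bary[OF assms(1,2)] assms(3,4) fin by (simp_all add: sum.remove[of A a])
  then show ?thesis
    using affine_hull_finite[of "A - {a}"] fin by blast
qed

text \<open>
  The half-open decomposition seen from a generic interior point \<open>y\<close>: a point \<open>x\<close> goes to the
  simplex that contains the points of the segment from \<open>x\<close> to \<open>y\<close> close to \<open>x\<close>. Moving away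
  from \<open>y\<close> instead gives the complementary half-open simplices, which partition the interior.
\<close>
lemma half_open_decomposition:
  fixes P :: "'a::euclidean_space set"
  assumes tri: "lattice_triangulation P \<T>" and P: "convex P" "P \<noteq> {}"
  obtains J where "\<And>A. A \<in> \<T> \<Longrightarrow> J A \<subseteq> A" "\<And>A. A \<in> \<T> \<Longrightarrow> J A \<noteq> A"
    "\<And>x. x \<in> P \<longleftrightarrow> (\<exists>A\<in>\<T>. x \<in> half_open A (J A))"
    "\<And>x A B. A \<in> \<T> \<Longrightarrow> B \<in> \<T> \<Longrightarrow> x \<in> half_open A (J A) \<Longrightarrow> x \<in> half_open B (J B) \<Longrightarrow> A = B"
    "\<And>x. x \<in> rel_interior P \<longleftrightarrow> (\<exists>A\<in>\<T>. x \<in> half_open A (A - J A))"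
    "\<And>x A B. A \<in> \<T> \<Longrightarrow> B \<in> \<T> \<Longrightarrow> x \<in> half_open A (A - J A) \<Longrightarrow> x \<in> half_open B (B - J B) \<Longrightarrow> A = B"
    "card {A \<in> \<T>. J A = {}} = 1"
proof -
  have fin: "finite \<T>" and un: "(\<Union>A\<in>\<T>. convex hull A) = P"
    and ind: "\<And>A. A \<in> \<T> \<Longrightarrow> \<not> affine_dependent A" and aff: "\<And>A. A \<in> \<T> \<Longrightarrow> affine hull A = affine hull P"
    and dis: "\<And>A B x. A \<in> \<T> \<Longrightarrow> B \<in> \<T> \<Longrightarrow> x \<in> rel_interior (convex hull A) \<Longrightarrow>
        x \<in> rel_interior (convex hull B) \<Longrightarrow> A = B"
    using tri unfolding lattice_triangulation_def by blast+
  have finA: "finite A" if "A \<in> \<T>" for A by (rule aff_independent_finite[OF ind[OF that]])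
  define \<H> where "\<H> = (\<Union>A\<in>\<T>. (\<lambda>a. affine hull (A - {a})) ` A)"
  have "\<exists>y\<in>rel_interior P. \<forall>H\<in>\<H>. y \<notin> H"
  proof (rule exists_rel_interior_avoiding_affine[OF P])
    show "finite \<H>" using fin finA by (auto simp: \<H>_def)
    fix H assume "H \<in> \<H>"
    then obtain A a where A: "A \<in> \<T>" "a \<in> A" "H = affine hull (A - {a})" by (auto simp: \<H>_def)
    have "\<not> P \<subseteq> H"
    proof
      assume "P \<subseteq> H"
      then have "affine hull P \<subseteq> H" unfolding A by (intro hull_minimal) auto
      then have "a \<in> H" using aff[OF A(1)] A(2) hull_inc[of a A affine] by auto
      then show False using ind[OF A(1)] A by (auto simp: affine_dependent_def)
    qed
    then show "affine H \<and> \<not> P \<subseteq> H" using A by simp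
  qed
  then obtain y where y: "y \<in> rel_interior P" "\<And>H. H \<in> \<H> \<Longrightarrow> y \<notin> H" by blast
  have yP: "y \<in> P" using y rel_interior_subset by blast
  have yA: "y \<in> affine hull A" if "A \<in> \<T>" for A using aff[OF that] yP hull_inc by fastforce
  have nz: "bary A y a \<noteq> 0" if "A \<in> \<T>" "a \<in> A" for A a
    using bary_eq_0_imp[OF ind[OF that(1)] yA[OF that(1)] that(2)] y(2) that by (auto simp: \<H>_def)
  \<comment> \<open>\<open>Q \<sigma> A x\<close> says that the points
    \<open>x + \<sigma> t (y - x)\<close> lie in the relative interior of the simplex on
    \<open>A\<close> for all small \<open>t > 0\<close>; \<open>\<sigma>\<close> is \<open>1\<close>
    for moving towards \<open>y\<close> and \<open>-1\<close> for moving away. Where a coordinate of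
    \<open>x\<close> vanishes, the sign of that coordinate of \<open>y\<close> decides, and it is
    nonzero by genericity.\<close>
  define Q where "Q = (\<lambda>\<sigma> A x. \<forall>a\<in>A. 0 \<le> bary A x a \<and> (bary A x a = 0 \<longrightarrow> 0 < \<sigma> * bary A y a))"
  define z where "z = (\<lambda>\<sigma> x t. x + (\<sigma> * t) *\<^sub>R (y - x))"
  have zA: "z \<sigma> x t \<in> affine hull A" if "A \<in> \<T>" "x \<in> affine hull P" for \<sigma> x t A
  proof -
    have "z \<sigma> x t = (1 - \<sigma> * t) *\<^sub>R x + (\<sigma> * t) *\<^sub>R y" by (simp add: z_def algebra_simps)
    then show ?thesis
      using mem_affine[OF affine_affine_hull, of x A y "1 - \<sigma> * t" "\<sigma> * t"] that aff yA by simp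
  qed
  have bz: "bary A (z \<sigma> x t) a = bary A x a + (\<sigma> * t) * (bary A y a - bary A x a)"
    if "A \<in> \<T>" "x \<in> affine hull P" "a \<in> A" for A \<sigma> x t a
    unfolding z_def using bary_affine[OF ind] yA aff that by blast
  have lim: "((\<lambda>t. bary A (z \<sigma> x t) a) \<longlongrightarrow> bary A x a) (at_right 0)"
    if "A \<in> \<T>" "x \<in> affine hull P" "a \<in> A" for A \<sigma> x a
    unfolding bz[OF that] by (auto intro!: tendsto_eq_intros)
  have pos: "eventually (\<lambda>t::real. t > 0) (at_right 0)"
    by (simp add: eventually_at_right_less)
  have into: "eventually (\<lambda>t. z \<sigma> x t \<in> rel_interior (convex hull A)) (at_right 0)"
    if A: "A \<in> \<T>" "x \<in> affine hull P" and Q: "Q \<sigma> A x" for A \<sigma> x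
  proof -
    have "eventually (\<lambda>t. 0 < bary A (z \<sigma> x t) a) (at_right 0)" if a: "a \<in> A" for a
    proof (cases "bary A x a = 0")
      case True
      then have "0 < \<sigma> * bary A y a" using Q a by (auto simp: Q_def)
      then show ?thesis
        by (intro eventually_mono[OF pos]) (auto simp: bz[OF A a] True zero_less_mult_iff mult_less_0_iff)
    next
      case False
      then have "0 < bary A x a" using Q a by (force simp: Q_def)
      then show ?thesis using lim[OF A a] order_tendstoD(1) by blast
    qed
    then have "eventually (\<lambda>t. \<forall>a\<in>A. 0 < bary A (z \<sigma> x t) a) (at_right 0)"
      using finA[OF A(1)] by (simp add: eventually_ball_finite)
    then show ?thesis
      by (rule eventually_mono) (use rel_interior_convex_hull_eq_bary[OF ind[OF A(1)]] zA[OF A] in blast)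
  qed
  have outof: "eventually (\<lambda>t. z \<sigma> x t \<notin> convex hull A) (at_right 0)"
    if A: "A \<in> \<T>" "x \<in> affine hull P" and Q: "\<not> Q \<sigma> A x" and \<sigma>: "\<sigma> \<noteq> 0" for A \<sigma> x
  proof -
    obtain a where a: "a \<in> A" "bary A x a < 0 \<or> bary A x a = 0 \<and> \<not> 0 < \<sigma> * bary A y a"
      using Q by (force simp: Q_def)
    have "eventually (\<lambda>t. bary A (z \<sigma> x t) a < 0) (at_right 0)"
      using a(2)
    proof
      assume "bary A x a < 0"
      then show ?thesis using lim[OF A a(1)] order_tendstoD(2) by blast
    next
      assume *: "bary A x a = 0 \<and> \<not> 0 < \<sigma> * bary A y a"
      then have "\<sigma> * bary A y a < 0" using nz[OF A(1) a(1)] \<sigma> by (simp add: less_le)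
      then show ?thesis
        by (intro eventually_mono[OF pos])
          (auto simp: bz[OF A a(1)] * zero_less_mult_iff mult_less_0_iff)
    qed
    then show ?thesis
      by (rule eventually_mono) (use convex_hull_eq_bary[OF ind[OF A(1)]] a in force)
  qed
  have small: "eventually (\<lambda>t::real. t \<in> {0<..<e}) (at_right 0)" if "0 < e" for e
    by (rule eventually_at_right_real) (rule that)
  have nontriv: "at_right (0::real) \<noteq> bot" by (rule trivial_limit_at_right_real)
  have affP: "x \<in> affine hull P" if "x \<in> P" for x using that by (rule hull_inc)
  have uniq: "A = B" if "A \<in> \<T>" "B \<in> \<T>" "x \<in> affine hull P" "Q \<sigma> A x" "Q \<sigma> B x" for A B x \<sigma>
  proof -
    have "\<exists>t. z \<sigma> x t \<in> rel_interior (convex hull A) \<and> z \<sigma> x t \<in> rel_interior (convex hull B)"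
      by (rule eventually_happens'[OF nontriv eventually_conj[OF into into]]) (use that in auto)
    then show ?thesis using dis that by blast
  qed
  have ex: "\<exists>A\<in>\<T>. Q \<sigma> A x"
    if "x \<in> affine hull P" "\<sigma> \<noteq> 0" "eventually (\<lambda>t. z \<sigma> x t \<in> P) (at_right 0)" for x \<sigma>
  proof (rule ccontr)
    assume "\<not> ?thesis"
    then have "eventually (\<lambda>t. \<forall>A\<in>\<T>. z \<sigma> x t \<notin> convex hull A) (at_right 0)"
      using fin outof that by (simp add: eventually_ball_finite)
    then have "\<exists>t. z \<sigma> x t \<in> P \<and> (\<forall>A\<in>\<T>. z \<sigma> x t \<notin> convex hull A)"
      using eventually_happens'[OF nontriv eventually_conj[OF that(3)]] by blast
    then show False using un by blast
  qed
  \<comment> \<open>The hyperplane opposite such a vertex separates the simplex from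
    \<open>y\<close>; the facet in it is removed when looking towards \<open>y\<close>.\<close>
  define J where "J = (\<lambda>A. {a \<in> A. bary A y a < 0})"
  have J1: "x \<in> half_open A (J A) \<longleftrightarrow> x \<in> affine hull P \<and> Q 1 A x" if "A \<in> \<T>" for A x
    using nz[OF that] aff[OF that] unfolding half_open_def Q_def J_def by force
  have J2: "x \<in> half_open A (A - J A) \<longleftrightarrow> x \<in> affine hull P \<and> Q (-1) A x" if "A \<in> \<T>" for A x
    using nz[OF that] aff[OF that] unfolding half_open_def Q_def J_def by force
  have hoP: "x \<in> P" if "A \<in> \<T>" "x \<in> half_open A K" for A x K
    using that un convex_hull_eq_bary[OF ind[OF that(1)]] by (auto simp: half_open_def)
  have P1: "x \<in> P \<longleftrightarrow> (\<exists>A\<in>\<T>. x \<in> half_open A (J A))" for x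
  proof
    assume x: "x \<in> P"
    have "eventually (\<lambda>t. z 1 x t \<in> P) (at_right 0)"
    proof (rule eventually_mono[OF small[OF zero_less_one]])
      fix t :: real assume t: "t \<in> {0<..<1}"
      have "z 1 x t = (1 - t) *\<^sub>R x + t *\<^sub>R y" by (simp add: z_def algebra_simps)
      then show "z 1 x t \<in> P" using convexD_alt[OF P(1) x yP, of t] t by simp
    qed
    then show "\<exists>A\<in>\<T>. x \<in> half_open A (J A)" using ex[of x 1] x affP J1 by auto
  qed (use hoP in blast)
  have P2: "x \<in> rel_interior P \<longleftrightarrow> (\<exists>A\<in>\<T>. x \<in> half_open A (A - J A))" for x
  proof
    assume x: "x \<in> rel_interior P"
    then obtain e where e: "e > 1" "(1 - e) *\<^sub>R y + e *\<^sub>R x \<in> P"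
      using convex_rel_interior_iff[OF P] yP by blast
    have xP: "x \<in> P" using x rel_interior_subset by blast
    have "eventually (\<lambda>t. z (-1) x t \<in> P) (at_right 0)"
    proof (rule eventually_mono[OF small[of "e - 1"]])
      show "0 < e - 1" using e by simp
      fix t :: real assume t: "t \<in> {0<..<e - 1}"
      define r where "r = t / (e - 1)"
      have r: "0 \<le> r" "r \<le> 1" "t = r * (e - 1)" using t e by (auto simp: r_def)
      have "z (-1) x t = (1 - r) *\<^sub>R x + r *\<^sub>R ((1 - e) *\<^sub>R y + e *\<^sub>R x)"
        by (simp add: z_def r(3) algebra_simps)
      then show "z (-1) x t \<in> P" using convexD_alt[OF P(1) xP e(2) r(1,2)] by simp
    qed
    then show "\<exists>A\<in>\<T>. x \<in> half_open A (A - J A)" using ex[of x "-1"] xP affP J2 by auto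
  next
    assume "\<exists>A\<in>\<T>. x \<in> half_open A (A - J A)"
    then obtain A where A: "A \<in> \<T>" "x \<in> affine hull P" "Q (-1) A x" using J2 by blast
    have "\<exists>t. z (-1) x t \<in> rel_interior (convex hull A) \<and> 0 < t"
      by (rule eventually_happens'[OF nontriv eventually_conj[OF into[OF A] pos]])
    then obtain t where t: "z (-1) x t \<in> P" "0 < t"
      using A(1) un rel_interior_subset[of "convex hull A"] by auto
    \<comment> \<open>Solving \<open>z = x - t (y - x)\<close> for \<open>x\<close> writes it as a
      convex combination of \<open>z\<close> and the relative interior point \<open>y\<close>, with
      weight \<open>s\<close> on \<open>y\<close>.\<close>
    define s where "s = t / (1 + t)"
    have "s * (1 + t) = t" using t by (simp add: s_def)
    have "x = z (-1) x t - s *\<^sub>R (z (-1) x t - y)"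
    proof -
      have "s *\<^sub>R (z (-1) x t - y) = (s * (1 + t)) *\<^sub>R (x - y)" by (simp add: z_def algebra_simps)
      then show ?thesis unfolding \<open>s * (1 + t) = t\<close> by (simp add: z_def algebra_simps)
    qed
    moreover have "0 < s" "s \<le> 1" using t by (auto simp: s_def)
    ultimately show "x \<in> rel_interior P" using rel_interior_convex_shrink[OF P(1) y(1) t(1), of s] by simp
  qed
  \<comment> \<open>No strict condition is imposed exactly when \<open>y\<close> itself lies in the
    simplex, which by genericity happens for one simplex only. This makes the constant coefficient
    of \<open>h\<^sup>*\<close> equal to \<open>1\<close>.\<close>
  have "J A = {} \<longleftrightarrow> y \<in> half_open A (J A)" if "A \<in> \<T>" for A
    using yA[OF that] nz[OF that] by (auto simp: J_def half_open_def not_less)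
  note J0 = this
  obtain A0 where A0: "A0 \<in> \<T>" "y \<in> half_open A0 (J A0)" using P1 yP by blast
  have "B = A0" if "B \<in> \<T>" "y \<in> half_open B (J B)" for B
    using uniq[of B A0 y 1] J1[OF that(1), of y] J1[OF A0(1), of y] that A0 by simp
  then have "{A \<in> \<T>. J A = {}} = {A0}" using J0 A0 by blast
  then have card1: "card {A \<in> \<T>. J A = {}} = 1" by simp
  have J_ne: "J A \<noteq> A" if A: "A \<in> \<T>" for A
  proof
    assume "J A = A"
    then have "\<forall>a\<in>A. bary A y a < 0" by (auto simp: J_def)
    then have "sum (bary A y) A \<le> 0" by (intro sum_nonpos) auto
    then show False using bary(1)[OF ind[OF A] yA[OF A]] by simp
  qed
  show thesis
  proof (rule that[of J])
    show "J A \<subseteq> A" for A by (auto simp: J_def)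
    show "A = B" if "A \<in> \<T>" "B \<in> \<T>" "x \<in> half_open A (J A)" "x \<in> half_open B (J B)" for x A B
      using uniq[of A B x 1] J1[of A x] J1[of B x] that by blast
    show "A = B" if "A \<in> \<T>" "B \<in> \<T>" "x \<in> half_open A (A - J A)" "x \<in> half_open B (B - J B)" for x A B
      using uniq[of A B x "-1"] J2[of A x] J2[of B x] that by blast
  qed (fact J_ne P1 P2 card1)+
qed

text \<open>Dividing weights of height \<open>n\<close> by \<open>n\<close> gives barycentric
  coordinates, so the half-open cone at height \<open>n\<close> is the dilated half-open
  simplex.\<close>

lemma card_half_open_dilation:
  fixes A :: "'a::euclidean_space set"
  assumes ind: "\<not> affine_dependent A" and J: "J \<subseteq> A" and n: "n \<ge> 1"
  shows "card ((\<lambda>x. real n *\<^sub>R x) ` half_open A J \<inter> int_lattice) = card (cone_weights A J {} n)"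
proof -
  have "(\<lambda>u. \<Sum>a\<in>A. u a *\<^sub>R a) ` cone_weights A J {} n = (\<lambda>x. real n *\<^sub>R x) ` half_open A J \<inter> int_lattice"
  proof (intro equalityI subsetI)
    fix x assume "x \<in> (\<lambda>u. \<Sum>a\<in>A. u a *\<^sub>R a) ` cone_weights A J {} n"
    then obtain u where u: "u \<in> cone_weights A J {} n" "x = (\<Sum>a\<in>A. u a *\<^sub>R a)" by blast
    define z where "z = (\<Sum>a\<in>A. (u a / n) *\<^sub>R a)"
    have x: "x = real n *\<^sub>R z" using n u by (simp add: z_def scaleR_sum_right)
    have s: "(\<Sum>a\<in>A. u a / n) = 1" using u n by (simp add: cone_weights_def flip: sum_divide_distrib)
    then have "z \<in> affine hull A"
      unfolding affine_hull_finite[OF aff_independent_finite[OF ind]] z_def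
      by (intro CollectI exI[of _ "\<lambda>a. u a / n"]) simp
    moreover have "bary A z a = u a / n" if "a \<in> A" for a
      using bary_unique[OF ind s _ that, of z] by (simp add: z_def)
    ultimately have "z \<in> half_open A J"
      using u n by (auto simp: half_open_def cone_weights_def split: if_splits)
    then show "x \<in> (\<lambda>x. real n *\<^sub>R x) ` half_open A J \<inter> int_lattice"
      using x u by (auto simp: cone_weights_def)
  next
    fix x assume "x \<in> (\<lambda>x. real n *\<^sub>R x) ` half_open A J \<inter> int_lattice"
    then obtain z where z: "z \<in> half_open A J" "x = real n *\<^sub>R z" "x \<in> int_lattice" by blast
    define u where "u = (\<lambda>a. if a \<in> A then real n * bary A z a else 0)"
    have zA: "z \<in> affine hull A" using z by (simp add: half_open_def)
    have "sum u A = real n * sum (bary A z) A" by (simp add: u_def sum_distrib_left)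
    then have su: "sum u A = n" using bary(1)[OF ind zA] by simp
    have "(\<Sum>a\<in>A. u a *\<^sub>R a) = real n *\<^sub>R (\<Sum>a\<in>A. bary A z a *\<^sub>R a)"
      by (simp add: u_def scaleR_sum_right)
    then have ux: "(\<Sum>a\<in>A. u a *\<^sub>R a) = x" using bary(2)[OF ind zA] z by simp
    have "\<forall>a\<in>A. 0 \<le> u a \<and> (a \<in> J \<longrightarrow> 0 < u a)" using z n by (auto simp: u_def half_open_def)
    then have "u \<in> cone_weights A J {} n"
      using z su ux by (auto simp: cone_weights_def u_def)
    then show "x \<in> (\<lambda>u. \<Sum>a\<in>A. u a *\<^sub>R a) ` cone_weights A J {} n" using ux by blast
  qed
  then show ?thesis using card_image[OF inj_on_cone_weights[OF ind], of J "{}" n] by simp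
qed

lemma card_cone_weights_0:
  assumes "finite A"
  shows "card (cone_weights A J K 0) = (if A \<inter> J = {} then 1 else 0)"
proof -
  have "u = (\<lambda>_. 0)" if "u \<in> cone_weights A J K 0" for u
  proof
    fix a
    have "\<forall>b\<in>A. 0 \<le> u b" "sum u A = 0" "\<forall>b. b \<notin> A \<longrightarrow> u b = 0"
      using that by (auto simp: cone_weights_def split: if_splits)
    then show "u a = 0" using sum_nonneg_eq_0_iff[OF assms, of u] by auto
  qed
  moreover have "(\<lambda>_. 0) \<in> cone_weights A J K 0 \<longleftrightarrow> A \<inter> J = {}"
    by (auto simp: cone_weights_def)
  ultimately have "cone_weights A J K 0 = (if A \<inter> J = {} then {\<lambda>_. 0} else {})" by auto
  then show ?thesis by auto
qed

section \<open>Ehrhart reciprocity\<close>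

definition interior_count :: "nat \<Rightarrow> 'a::euclidean_space set \<Rightarrow> nat" where
  "interior_count n P = card ((\<lambda>x. real n *\<^sub>R x) ` rel_interior P \<inter> int_lattice)"

definition interior_series :: "'a::euclidean_space set \<Rightarrow> int fps" where
  "interior_series P = Abs_fps (\<lambda>n. if n = 0 then 0 else int (interior_count n P))"

text \<open>Summed over a half-open triangulation, the Ehrhart series has as numerator the box
  points of the pieces with conditions \<open>J A\<close>, and the interior series those with the
  complementary conditions; reflecting the boxes reverses one numerator into the other. The
  polynomial is obtained first and identified with \<open>hstar\<close> afterwards, because the
  latter is a definite description.\<close>

theorem ehrhart_reciprocity:
  fixes P :: "'a::euclidean_space set"
  assumes "lattice_polytope P" "P \<noteq> {}"
  defines "k \<equiv> nat (aff_dim P)"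
  obtains h where "degree h \<le> k" "coeff h 0 = 1"
    "fps_of_poly h = ehrhart_series P * (1 - fps_X) ^ (k + 1)"
    "\<And>j. fps_nth (interior_series P * (1 - fps_X) ^ (k + 1)) j = (if j \<le> k + 1 then coeff h (k + 1 - j) else 0)"
proof -
  have P: "convex P" "bounded P"
    using assms lattice_polytope_imp_polytope polytope_imp_convex polytope_imp_bounded by blast+
  obtain \<T> where \<T>: "lattice_triangulation P \<T>" using lattice_triangulation_exists assms by blast
  have fin: "finite \<T>" and ind: "\<And>A. A \<in> \<T> \<Longrightarrow> \<not> affine_dependent A"
    and lat: "\<And>A. A \<in> \<T> \<Longrightarrow> A \<subseteq> int_lattice" and aff: "\<And>A. A \<in> \<T> \<Longrightarrow> affine hull A = affine hull P"
    using \<T> unfolding lattice_triangulation_def by blast+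
  have finA: "finite A" if "A \<in> \<T>" for A by (rule aff_independent_finite[OF ind[OF that]])
  have cardA: "card A = k + 1" if "A \<in> \<T>" for A
  proof -
    have "int (card A) = aff_dim P + 1"
      using aff_dim_unique[of A P] ind[OF that] aff[OF that] by simp
    moreover have "aff_dim P \<ge> 0" using assms(2) aff_dim_negative_iff[of P] by linarith
    ultimately show ?thesis by (simp add: k_def)
  qed
  obtain J where J: "\<And>A. A \<in> \<T> \<Longrightarrow> J A \<subseteq> A" "\<And>A. A \<in> \<T> \<Longrightarrow> J A \<noteq> A"
    "\<And>x. x \<in> P \<longleftrightarrow> (\<exists>A\<in>\<T>. x \<in> half_open A (J A))"
    "\<And>x A B. A \<in> \<T> \<Longrightarrow> B \<in> \<T> \<Longrightarrow> x \<in> half_open A (J A) \<Longrightarrow> x \<in> half_open B (J B) \<Longrightarrow> A = B"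
    "\<And>x. x \<in> rel_interior P \<longleftrightarrow> (\<exists>A\<in>\<T>. x \<in> half_open A (A - J A))"
    "\<And>x A B. A \<in> \<T> \<Longrightarrow> B \<in> \<T> \<Longrightarrow> x \<in> half_open A (A - J A) \<Longrightarrow> x \<in> half_open B (B - J B) \<Longrightarrow> A = B"
    "card {A \<in> \<T>. J A = {}} = 1"
    by (rule half_open_decomposition[OF \<T> P(1) assms(2)]) (rule that)
  have count: "card ((\<lambda>x. real n *\<^sub>R x) ` S \<inter> int_lattice) = (\<Sum>A\<in>\<T>. card (cone_weights A (I A) {} n))"
    if n: "n \<ge> 1" and I: "\<And>A. A \<in> \<T> \<Longrightarrow> I A \<subseteq> A" and S: "\<And>x. x \<in> S \<longleftrightarrow> (\<exists>A\<in>\<T>. x \<in> half_open A (I A))"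
      and dis: "\<And>x A B. A \<in> \<T> \<Longrightarrow> B \<in> \<T> \<Longrightarrow> x \<in> half_open A (I A) \<Longrightarrow> x \<in> half_open B (I B) \<Longrightarrow> A = B"
    for n I S
  proof -
    define H where "H = (\<lambda>A. (\<lambda>x. real n *\<^sub>R x) ` half_open A (I A) \<inter> int_lattice)"
    have "finite (cone_weights A (I A) {} n)" if "A \<in> \<T>" for A using finite_cone_weights ind that by blast
    have cH: "card (H A) = card (cone_weights A (I A) {} n)" if "A \<in> \<T>" for A
      unfolding H_def by (rule card_half_open_dilation[OF ind[OF that] I[OF that] n])
    have "half_open A (I A) \<subseteq> convex hull A" if "A \<in> \<T>" for A
      using convex_hull_eq_bary[OF ind[OF that]] by (auto simp: half_open_def)
    then have "bounded (half_open A (I A))" if "A \<in> \<T>" for A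
      using that finite_imp_bounded_convex_hull[OF finA[OF that]] bounded_subset by metis
    then have "finite (H A)" if "A \<in> \<T>" for A
      unfolding H_def using that by (intro finite_bounded_int_lattice bounded_scaling) auto
    moreover have "H A \<inter> H B = {}" if "A \<in> \<T>" "B \<in> \<T>" "A \<noteq> B" for A B
      using dis[OF that(1,2)] that n by (auto simp: H_def)
    ultimately have "card (\<Union>A\<in>\<T>. H A) = (\<Sum>A\<in>\<T>. card (H A))"
      using fin by (intro card_UN_disjoint) auto
    moreover have "(\<Union>A\<in>\<T>. H A) = (\<lambda>x. real n *\<^sub>R x) ` S \<inter> int_lattice"
    proof -
      have "S = (\<Union>A\<in>\<T>. half_open A (I A))" using S by blast
      then show ?thesis unfolding H_def by blast
    qed
    ultimately show ?thesis using cH by simp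
  qed
  have "ehrhart_series P = (\<Sum>A\<in>\<T>. cone_series A (J A) {})"
  proof (rule fps_ext)
    fix n
    show "fps_nth (ehrhart_series P) n = fps_nth (\<Sum>A\<in>\<T>. cone_series A (J A) {}) n"
    \<comment> \<open>At \<open>n = 0\<close> only the apex of the cone counts, and it belongs to a
      piece only if \<open>J A\<close> is empty. There is one such piece, in agreement with the
      value \<open>1\<close> set by convention.\<close>
    proof (cases "n = 0")
      case True
      have "(\<Sum>A\<in>\<T>. int (card (cone_weights A (J A) {} 0))) = (\<Sum>A\<in>\<T>. if J A = {} then 1 else 0)"
        using J(1) by (intro sum.cong refl) (simp add: card_cone_weights_0 finA Int_absorb1)
      also have "\<dots> = 1" using J(7) fin by (simp add: sum.If_cases Int_def)
      finally show ?thesis using True by (simp add: ehrhart_series_def cone_series_def fps_sum_nth)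
    next
      case False
      then show ?thesis
        using count[of n J P] J by (simp add: ehrhart_series_def cone_series_def fps_sum_nth)
    qed
  qed
  moreover have mult: "(\<Sum>A\<in>\<T>. cone_series A (I A) {}) * (1 - fps_X) ^ (k + 1) = (\<Sum>A\<in>\<T>. cone_series A (I A) A)" for I
    unfolding sum_distrib_right
    by (rule sum.cong[OF refl]) (use cone_series_mult[OF ind lat] cardA in metis)
  ultimately have E: "ehrhart_series P * (1 - fps_X) ^ (k + 1) = (\<Sum>A\<in>\<T>. cone_series A (J A) A)"
    by simp
  have "interior_series P = (\<Sum>A\<in>\<T>. cone_series A (A - J A) {})"
  proof (rule fps_ext)
    fix n
    show "fps_nth (interior_series P) n = fps_nth (\<Sum>A\<in>\<T>. cone_series A (A - J A) {}) n"
    proof (cases "n = 0")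
      case True
      have "A \<inter> (A - J A) \<noteq> {}" if "A \<in> \<T>" for A using J(1,2)[OF that] by blast
      then have "(\<Sum>A\<in>\<T>. int (card (cone_weights A (A - J A) {} 0))) = 0"
        by (intro sum.neutral) (simp add: card_cone_weights_0 finA)
      then show ?thesis using True by (simp add: interior_series_def cone_series_def fps_sum_nth)
    next
      case False
      then show ?thesis
        using count[of n "\<lambda>A. A - J A" "rel_interior P"] J
        by (simp add: interior_series_def interior_count_def cone_series_def fps_sum_nth)
    qed
  qed
  then have I: "interior_series P * (1 - fps_X) ^ (k + 1) = (\<Sum>A\<in>\<T>. cone_series A (A - J A) A)"
    using mult by simp
  define c where "c = (\<lambda>j. \<Sum>A\<in>\<T>. int (card (cone_weights A (J A) A j)))"
  have c0: "c j = 0" if "j > k" for j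
  proof -
    have "cone_weights A (J A) A j = {}" if "A \<in> \<T>" for A
      using sum_cone_weights_box_less[OF finA[OF that], of _ "J A" j] J(1,2)[OF that] cardA[OF that] \<open>j > k\<close> by fastforce
    then show ?thesis by (simp add: c_def)
  qed
  define h where "h = (\<Sum>i\<le>k. monom (c i) i)"
  have h: "coeff h j = c j" for j
    using c0 by (simp add: h_def coeff_sum coeff_monom)
  show thesis
  proof (rule that[of h])
    show "degree h \<le> k" using c0 h by (intro degree_le) auto
    have "c 0 = (\<Sum>A\<in>\<T>. if J A = {} then 1 else 0)"
      unfolding c_def using J(1) by (intro sum.cong refl) (simp add: card_cone_weights_0 finA Int_absorb1)
    also have "\<dots> = 1" using J(7) fin by (simp add: sum.If_cases Int_def)
    finally show "coeff h 0 = 1" using h by simp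
    show "fps_of_poly h = ehrhart_series P * (1 - fps_X) ^ (k + 1)"
      unfolding E by (rule fps_ext) (simp add: h c_def cone_series_def fps_sum_nth)
    fix j
    show "fps_nth (interior_series P * (1 - fps_X) ^ (k + 1)) j = (if j \<le> k + 1 then coeff h (k + 1 - j) else 0)"
    proof (cases "j \<le> k + 1")
      case True
      then have "card (cone_weights A (A - J A) A j) = card (cone_weights A (J A) A (k + 1 - j))" if "A \<in> \<T>" for A
        using card_cone_weights_reflect[OF ind[OF that] lat[OF that] _ J(1)[OF that], of j] cardA[OF that] by simp
      then show ?thesis unfolding I using True by (simp add: h c_def cone_series_def fps_sum_nth)
    next
      case False
      then have "cone_weights A (A - J A) A j = {}" if "A \<in> \<T>" for A
        using sum_cone_weights_box_le[OF finA[OF that], of _ "A - J A" j] cardA[OF that] by fastforce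
      then show ?thesis unfolding I using False by (simp add: cone_series_def fps_sum_nth)
    qed
  qed
qed

lemma one_minus_fps_X_power_nth_0: "fps_nth ((1 - fps_X :: int fps) ^ m) 0 = 1"
  by (induction m) (auto simp: fps_mult_nth_0)

lemma one_minus_fps_X_power_nth_1: "fps_nth ((1 - fps_X :: int fps) ^ m) 1 = - int m"
proof (induction m)
  case (Suc m)
  then show ?case
    unfolding power_Suc2 fps_mult_one_minus_X_nth by (simp add: one_minus_fps_X_power_nth_0)
qed simp

lemma one_minus_fps_X_power_nth_gt: "j > m \<Longrightarrow> fps_nth ((1 - fps_X :: int fps) ^ m) j = 0"
proof (induction m arbitrary: j)
  case (Suc m)
  then show ?case unfolding power_Suc2 fps_mult_one_minus_X_nth by simp
qed simp

lemma one_minus_fps_X_power_nth_same: "fps_nth ((1 - fps_X :: int fps) ^ m) m = (-1) ^ m"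
proof (induction m)
  case (Suc m)
  then show ?case
    unfolding power_Suc2 fps_mult_one_minus_X_nth by (simp add: one_minus_fps_X_power_nth_gt)
qed simp

lemma fps_mult_nth_top:
  fixes f g :: "int fps"
  assumes "\<And>j. j > a \<Longrightarrow> fps_nth f j = 0" "\<And>j. j > b \<Longrightarrow> fps_nth g j = 0"
  shows "fps_nth (f * g) (a + b) = fps_nth f a * fps_nth g b"
proof -
  have "fps_nth (f * g) (a + b) = (\<Sum>i=0..a + b. fps_nth f i * fps_nth g (a + b - i))"
    by (simp add: fps_mult_nth)
  also have "\<dots> = (\<Sum>i\<in>{a}. fps_nth f i * fps_nth g (a + b - i))"
  proof (rule sum.mono_neutral_right)
    show "\<forall>i\<in>{0..a + b} - {a}. fps_nth f i * fps_nth g (a + b - i) = 0"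
    proof
      fix i assume "i \<in> {0..a + b} - {a}"
      then have "i > a \<or> a + b - i > b" by auto
      then show "fps_nth f i * fps_nth g (a + b - i) = 0" using assms by auto
    qed
  qed auto
  finally show ?thesis by simp
qed

lemma aff_dim_nonneg_iff: "0 \<le> aff_dim S \<longleftrightarrow> S \<noteq> {}"
  using aff_dim_negative_iff[of S] by linarith

lemma hstar_reciprocity:
  fixes P :: "'a::euclidean_space set"
  assumes "lattice_polytope P" "P \<noteq> {}"
  defines "k \<equiv> nat (aff_dim P)"
  shows "degree (hstar P) \<le> k" "coeff (hstar P) 0 = 1"
    "fps_of_poly (hstar P) = ehrhart_series P * (1 - fps_X) ^ (k + 1)"
    "fps_nth (interior_series P * (1 - fps_X) ^ (k + 1)) j = (if j \<le> k + 1 then coeff (hstar P) (k + 1 - j) else 0)"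
proof -
  obtain h where h: "degree h \<le> k" "coeff h 0 = 1"
    "fps_of_poly h = ehrhart_series P * (1 - fps_X) ^ (k + 1)"
    "\<And>j. fps_nth (interior_series P * (1 - fps_X) ^ (k + 1)) j = (if j \<le> k + 1 then coeff h (k + 1 - j) else 0)"
    unfolding k_def by (rule ehrhart_reciprocity[OF assms(1,2)]) (rule that; simp only: k_def)
  have "aff_dim P \<ge> 0" using assms(2) by (simp add: aff_dim_nonneg_iff)
  then have "nat (aff_dim P + 1) = k + 1" by (simp add: k_def)
  then have hP: "hstar P = h"
    unfolding hstar_def by (intro the_equality) (simp_all only: h(3)[symmetric] fps_of_poly_eq_iff)
  show "degree (hstar P) \<le> k" "coeff (hstar P) 0 = 1"
    "fps_of_poly (hstar P) = ehrhart_series P * (1 - fps_X) ^ (k + 1)"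
    "fps_nth (interior_series P * (1 - fps_X) ^ (k + 1)) j = (if j \<le> k + 1 then coeff (hstar P) (k + 1 - j) else 0)"
    unfolding hP by (fact h(1) h(2) h(3) h(4))+
qed

lemma hstar_empty: "hstar {} = 1"
proof -
  have "ehrhart_series ({} :: 'a set) = 1"
    by (rule fps_ext) (simp add: ehrhart_series_def)
  then show ?thesis
    unfolding hstar_def by (intro the_equality) (simp_all add: fps_of_poly_eq_iff flip: fps_of_poly_1)
qed

text \<open>The coefficient in degree one is read off the Ehrhart series, the two highest ones off
  the reciprocal interior series. With the constant coefficient \<open>1\<close> this covers all of
  \<open>h\<^sup>*\<close> up to dimension three.\<close>

lemma hstar_coeffs:
  fixes P :: "'a::euclidean_space set"
  assumes P: "lattice_polytope P" "P \<noteq> {}" and k: "aff_dim P = int k"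
  shows "coeff (hstar P) 1 = int (card (P \<inter> int_lattice)) - int k - 1"
    "coeff (hstar P) k = int (interior_count 1 P)"
    "k \<ge> 1 \<Longrightarrow> coeff (hstar P) (k - 1) = int (interior_count 2 P) - int (k + 1) * int (interior_count 1 P)"
    "j > k \<Longrightarrow> coeff (hstar P) j = 0"
proof -
  note h = hstar_reciprocity[OF P, unfolded k nat_int]
  have two: "{0..2::nat} = {0, 1, 2}" by auto
  have "coeff (hstar P) 1 = fps_nth (ehrhart_series P * (1 - fps_X) ^ (k + 1)) 1"
    using h(3) by (metis fps_of_poly_nth)
  also have "\<dots> = int (card (P \<inter> int_lattice)) - int k - 1"
    using one_minus_fps_X_power_nth_0[of "k + 1"] one_minus_fps_X_power_nth_1[of "k + 1"]
    unfolding fps_mult_nth by (simp add: ehrhart_series_def del: power_Suc)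
  finally show "coeff (hstar P) 1 = int (card (P \<inter> int_lattice)) - int k - 1" .
  have "fps_nth (interior_series P * (1 - fps_X) ^ (k + 1)) 1 = int (interior_count 1 P)"
    using one_minus_fps_X_power_nth_0[of "k + 1"]
    unfolding fps_mult_nth by (simp add: interior_series_def del: power_Suc)
  then show "coeff (hstar P) k = int (interior_count 1 P)" using h(4)[of 1] by simp
  define f where "f = (1 - fps_X :: int fps) ^ (k + 1)"
  have f: "fps_nth f 0 = 1" "fps_nth f (Suc 0) = - int (k + 1)"
    unfolding f_def using one_minus_fps_X_power_nth_0[of "k + 1"] one_minus_fps_X_power_nth_1[of "k + 1"] by simp_all
  have "fps_nth (interior_series P * f) 2 = int (interior_count 2 P) - int (k + 1) * int (interior_count 1 P)"
    unfolding fps_mult_nth two using f(1) by (simp add: interior_series_def f(2)[simplified] algebra_simps)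
  then show "k \<ge> 1 \<Longrightarrow> coeff (hstar P) (k - 1) = int (interior_count 2 P) - int (k + 1) * int (interior_count 1 P)"
    using h(4)[of 2, folded f_def] by (simp add: numeral_2_eq_2)
  show "j > k \<Longrightarrow> coeff (hstar P) j = 0" using h(1) by (simp add: coeff_eq_0)
qed

text \<open>A polytope is the disjoint union of the relative interiors of its faces.\<close>

lemma card_dilation_eq_sum_faces:
  fixes P :: "'a::euclidean_space set"
  assumes P: "polytope P" and n: "n \<ge> 1"
  shows "card ((\<lambda>x. real n *\<^sub>R x) ` P \<inter> int_lattice) = (\<Sum>F | F face_of P. interior_count n F)"
proof -
  define H where "H = (\<lambda>F. (\<lambda>x. real n *\<^sub>R x) ` rel_interior F \<inter> (int_lattice :: 'a set))"
  have fin: "finite {F. F face_of P}" by (rule finite_polytope_faces[OF P])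
  have sub: "rel_interior F \<subseteq> P" if "F face_of P" for F
    using that face_of_imp_subset rel_interior_subset by (metis subset_trans)
  have "finite (H F)" if "F face_of P" for F
    unfolding H_def using bounded_subset[OF polytope_imp_bounded[OF P] sub[OF that]]
    by (intro finite_bounded_int_lattice bounded_scaling)
  moreover have "H F \<inter> H G = {}" if "F face_of P" "G face_of P" "F \<noteq> G" for F G
  proof -
    have "rel_interior F \<inter> rel_interior G = {}" using face_of_eq[OF that(1,2)] that(3) by blast
    then show ?thesis using n by (auto simp: H_def)
  qed
  ultimately have "card (\<Union>F\<in>{F. F face_of P}. H F) = (\<Sum>F | F face_of P. card (H F))"
    using fin by (intro card_UN_disjoint) auto
  moreover have "(\<Union>F\<in>{F. F face_of P}. H F) = (\<lambda>x. real n *\<^sub>R x) ` P \<inter> int_lattice"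
  proof -
    have "P = (\<Union>F\<in>{F. F face_of P}. rel_interior F)"
    proof (intro equalityI subsetI)
      fix x assume "x \<in> P"
      then obtain F where "F face_of P" "x \<in> rel_interior F" by (rule polytope_rel_interior_face[OF P])
      then show "x \<in> (\<Union>F\<in>{F. F face_of P}. rel_interior F)" by blast
    qed (use sub in blast)
    then show ?thesis unfolding H_def by blast
  qed
  ultimately show ?thesis by (simp add: H_def interior_count_def)
qed

text \<open>
  Read off from the decomposition of the dilates into relative interiors of faces
  by comparing coefficients of the top power of \<open>t\<close> after clearing denominators.
\<close>
lemma euler_relation:
  fixes P :: "'a::euclidean_space set"
  assumes P: "lattice_polytope P" "P \<noteq> {}"
  shows "(\<Sum>F | F face_of P \<and> F \<noteq> {}. (-1) ^ nat (aff_dim P - aff_dim F)) = ((-1) ^ nat (aff_dim P) :: int)"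
proof -
  define k where "k = nat (aff_dim P)"
  define \<F> where "\<F> = {F. F face_of P \<and> F \<noteq> {}}"
  have poly: "polytope P" by (rule lattice_polytope_imp_polytope[OF P(1)])
  have fin: "finite \<F>" unfolding \<F>_def using finite_polytope_faces[OF poly] by (rule rev_finite_subset) auto
  have kP: "aff_dim P = int k" using P(2) aff_dim_nonneg_iff[of P] by (simp add: k_def)
  have E: "ehrhart_series P - 1 = (\<Sum>F\<in>\<F>. interior_series F)"
  proof (rule fps_ext)
    fix n
    have "(\<Sum>F | F face_of P. interior_count n F) = (\<Sum>F\<in>\<F>. interior_count n F)"
      using finite_polytope_faces[OF poly]
      by (intro sum.mono_neutral_right) (auto simp: \<F>_def interior_count_def)
    then show "fps_nth (ehrhart_series P - 1) n = fps_nth (\<Sum>F\<in>\<F>. interior_series F) n"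
      using card_dilation_eq_sum_faces[OF poly, of n]
      by (auto simp: fps_sum_nth ehrhart_series_def interior_series_def)
  qed
  \<comment> \<open>The numerator of the interior series of \<open>F\<close> has degree
    \<open>m + 1\<close> and leading coefficient \<open>1\<close>, the reflected constant
    coefficient of \<open>h\<^sup>*\<close>. The surplus factor \<open>(1 - X) ^ (k - m)\<close>
    contributes the sign.\<close>
  have F: "fps_nth (interior_series F * (1 - fps_X) ^ (k + 1)) (k + 1) = (-1) ^ nat (aff_dim P - aff_dim F)"
    if "F \<in> \<F>" for F
  proof -
    define m where "m = nat (aff_dim F)"
    have F: "F face_of P" "F \<noteq> {}" using that by (auto simp: \<F>_def)
    have lF: "lattice_polytope F" by (rule lattice_polytope_face[OF P(1) F(1)])
    have mF: "aff_dim F = int m" using F(2) aff_dim_nonneg_iff[of F] by (simp add: m_def)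
    have mk: "m \<le> k" using aff_dim_subset[OF face_of_imp_subset[OF F(1)]] mF kP by simp
    note h = hstar_reciprocity[OF lF F(2), unfolded mF nat_int]
    define f where "f = interior_series F * (1 - fps_X) ^ (m + 1)"
    have "interior_series F * (1 - fps_X) ^ (k + 1) = f * (1 - fps_X) ^ (k - m)"
      unfolding f_def mult.assoc power_add[symmetric] using mk by simp
    moreover have "fps_nth (f * (1 - fps_X) ^ (k - m)) ((m + 1) + (k - m)) = fps_nth f (m + 1) * (-1) ^ (k - m)"
      using h(4) one_minus_fps_X_power_nth_same[of "k - m"]
      by (subst fps_mult_nth_top) (auto simp: f_def one_minus_fps_X_power_nth_gt simp del: power_Suc)
    moreover have "fps_nth f (m + 1) = 1" using h(2) h(4)[of "m + 1"] by (simp add: f_def del: power_Suc)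
    moreover have "nat (aff_dim P - aff_dim F) = k - m" using kP mF mk by simp
    ultimately show ?thesis using mk by (simp del: power_Suc)
  qed
  note h = hstar_reciprocity[OF P, folded k_def]
  have "(\<Sum>F\<in>\<F>. (-1) ^ nat (aff_dim P - aff_dim F))
      = fps_nth ((\<Sum>F\<in>\<F>. interior_series F) * (1 - fps_X) ^ (k + 1)) (k + 1)"
    unfolding sum_distrib_right fps_sum_nth using F by simp
  \<comment> \<open>Since \<open>h\<^sup>*\<close> has degree at most \<open>k\<close>, only the
    contribution of the removed constant \<open>1\<close> survives at degree
    \<open>k + 1\<close>.\<close>
  also have "\<dots> = fps_nth (fps_of_poly (hstar P)) (k + 1) - fps_nth ((1 - fps_X) ^ (k + 1)) (k + 1)"
    unfolding E[symmetric] h(3) left_diff_distrib by (simp del: power_Suc)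
  also have "\<dots> = (-1) ^ k"
    unfolding one_minus_fps_X_power_nth_same using h(1) by (simp add: coeff_eq_0)
  finally show ?thesis by (simp add: k_def \<F>_def)
qed

section \<open>Faces and Stanley's polynomials\<close>

lemma face_functional:
  fixes P :: "'a::euclidean_space set"
  assumes "polytope P" "F face_of P" "F \<noteq> {}" "F \<noteq> P"
  obtains a b where "\<And>x. x \<in> P \<Longrightarrow> b \<le> a \<bullet> x" "F = {x \<in> P. a \<bullet> x = b}"
proof -
  obtain a b where ab: "P \<subseteq> {x. a \<bullet> x \<le> b}" "F = P \<inter> {x. a \<bullet> x = b}"
    using exposed_face_of_polyhedron[OF polytope_imp_polyhedron[OF assms(1)], of F] assms
    unfolding exposed_face_of by blast
  show thesis
    by (rule that[of "- b" "- a"]) (use ab in auto)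
qed

lemma affine_hull_functional_eq:
  fixes a :: "'a::euclidean_space"
  assumes "\<And>x. x \<in> S \<Longrightarrow> a \<bullet> x = b" "y \<in> affine hull S"
  shows "a \<bullet> y = b"
proof -
  have "affine hull S \<subseteq> {x. a \<bullet> x = b}"
    using assms(1) by (intro hull_minimal) (auto simp: affine_hyperplane)
  then show ?thesis using assms(2) by blast
qed

text \<open>Descend through facets that contain \<open>F\<close> until \<open>F\<close> itself is a
  facet of the current polytope; for \<open>F\<close> empty an extreme point serves. This makes the
  face lattice graded.\<close>

lemma face_between:
  fixes P :: "'a::euclidean_space set"
  assumes "polytope P" "F face_of P" "F \<noteq> P"
  shows "\<exists>G. G face_of P \<and> F \<subset> G \<and> aff_dim G = aff_dim F + 1"
  using assms
proof (induction "nat (aff_dim P - aff_dim F)" arbitrary: P rule: less_induct)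
  case less
  have conv: "convex P" by (rule polytope_imp_convex[OF less.prems(1)])
  show ?case
  proof (cases "F = {}")
    case True
    then have "P \<noteq> {}" using less.prems by blast
    then obtain v where "v extreme_point_of P"
      using extreme_point_exists_convex[OF polytope_imp_compact[OF less.prems(1)] conv] by blast
    then show ?thesis using True by (intro exI[of _ "{v}"]) (auto simp: face_of_singleton)
  next
    case False
    then obtain G where G: "G facet_of P" "F \<subseteq> G"
      using face_of_polyhedron_subset_facet[OF polytope_imp_polyhedron[OF less.prems(1)] less.prems(2) _ less.prems(3)]
      by blast
    have Gf: "G face_of P" "aff_dim G = aff_dim P - 1" using G by (auto simp: facet_of_def)
    show ?thesis
    proof (cases "F = G")
      case True
      then show ?thesis
        using Gf less.prems face_of_imp_subset[OF less.prems(2)] conv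
        by (intro exI[of _ P]) (auto simp: face_of_refl_eq)
    next
      case False
      have FG: "F face_of G" using less.prems(2) G face_of_face[OF Gf(1)] by blast
      then have "aff_dim F < aff_dim G" using face_of_aff_dim_lt[OF face_of_imp_convex[OF Gf(1)]] False by blast
      then obtain H where "H face_of G" "F \<subset> H" "aff_dim H = aff_dim F + 1"
        using less.hyps[of G] FG False Gf face_of_polytope_polytope[OF less.prems(1) Gf(1)] by force
      then show ?thesis using face_of_trans Gf by blast
    qed
  qed
qed

lemma face_aff_dim_less:
  fixes P :: "'a::euclidean_space set"
  assumes "F face_of P" "G face_of P" "F \<subset> G"
  shows "aff_dim F < aff_dim G"
  using face_of_aff_dim_lt[of G F] face_of_face[OF assms(2), of F] assms face_of_imp_convex by blast

lemma face_chain_exists: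
  fixes P :: "'a::euclidean_space set"
  assumes "polytope P" "F face_of P"
  shows "\<exists>C. C \<subseteq> {G. G face_of P \<and> F \<subseteq> G} \<and> F \<in> C \<and>
    Complete_Partial_Order.chain (\<lambda>G H. H \<subseteq> G) C \<and> card C = nat (aff_dim P - aff_dim F) + 1"
  using assms(2)
proof (induction "nat (aff_dim P - aff_dim F)" arbitrary: F rule: less_induct)
  case less
  show ?case
  proof (cases "F = P")
    case True
    then show ?thesis using less.prems by (intro exI[of _ "{P}"]) (auto simp: Complete_Partial_Order.chain_def)
  next
    case False
    then obtain G where G: "G face_of P" "F \<subset> G" "aff_dim G = aff_dim F + 1"
      using face_between[OF assms(1) less.prems] by blast
    have le: "aff_dim G \<le> aff_dim P" by (rule aff_dim_subset[OF face_of_imp_subset[OF G(1)]])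
    then obtain C where C: "C \<subseteq> {H. H face_of P \<and> G \<subseteq> H}" "G \<in> C"
      "Complete_Partial_Order.chain (\<lambda>G H. H \<subseteq> G) C" "card C = nat (aff_dim P - aff_dim G) + 1"
      using less.hyps[of G] G by auto
    have "finite C" using C(4) card.infinite by fastforce
    moreover have "F \<notin> C" using C G by blast
    ultimately have "card (insert F C) = nat (aff_dim P - aff_dim F) + 1" using C(4) G(3) le by simp
    moreover have "Complete_Partial_Order.chain (\<lambda>G H. H \<subseteq> G) (insert F C)"
      using C(1,3) G(2) unfolding Complete_Partial_Order.chain_def by blast
    ultimately show ?thesis using C G less.prems by (intro exI[of _ "insert F C"]) blast
  qed
qed

definition faces_above :: "'a::euclidean_space set \<Rightarrow> 'a set \<Rightarrow> 'a set set" where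
  "faces_above P F = {G. G face_of P \<and> F \<subset> G}"

lemma finite_faces_above: "polytope P \<Longrightarrow> finite (faces_above P F)"
  unfolding faces_above_def by (rule finite_subset[OF _ finite_polytope_faces]) auto

text \<open>The dimension is strictly monotone along a chain of faces and takes values between those
  of \<open>G\<close> and \<open>P\<close>, which bounds the rank; a saturated chain attains the
  bound. The order is reversed, so \<open>P\<close> has rank \<open>0\<close>.\<close>

lemma poset_rank_faces_above:
  fixes P :: "'a::euclidean_space set"
  assumes P: "polytope P" and G: "G \<in> faces_above P F"
  shows "poset_rank (\<lambda>G H. H \<subseteq> G) (faces_above P F) G = nat (aff_dim P - aff_dim G)"
  unfolding poset_rank_def
proof (rule Max_eqI)
  let ?S = "{card C - 1 | C. C \<subseteq> faces_above P F \<and> G \<in> C \<and> (\<forall>y\<in>C. G \<subseteq> y) \<and>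
      Complete_Partial_Order.chain (\<lambda>G H. H \<subseteq> G) C}"
  have "?S \<subseteq> (\<lambda>C. card C - 1) ` Pow (faces_above P F)" by auto
  then show "finite ?S" using finite_faces_above[OF P] finite_subset by blast
  show "y \<le> nat (aff_dim P - aff_dim G)" if y: "y \<in> ?S" for y
  proof -
    obtain C where C: "y = card C - 1" "C \<subseteq> faces_above P F" "G \<in> C" "\<forall>y\<in>C. G \<subseteq> y"
      "Complete_Partial_Order.chain (\<lambda>G H. H \<subseteq> G) C" using y by auto
    have "inj_on aff_dim C"
    proof (rule inj_onI)
      fix X Y assume XY: "X \<in> C" "Y \<in> C" "aff_dim X = aff_dim Y"
      then have f: "X face_of P" "Y face_of P" "X \<subseteq> Y \<or> Y \<subseteq> X"
        using C by (auto simp: faces_above_def Complete_Partial_Order.chain_def)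
      then show "X = Y"
        using XY(3) face_aff_dim_less[of X P Y] face_aff_dim_less[of Y P X] by auto
    qed
    moreover have "aff_dim ` C \<subseteq> {aff_dim G..aff_dim P}"
    proof (clarify, unfold atLeastAtMost_iff, intro conjI aff_dim_subset)
      fix X assume "X \<in> C"
      then have "X face_of P" "G \<subseteq> X" using C by (auto simp: faces_above_def)
      then show "G \<subseteq> X" "X \<subseteq> P" using face_of_imp_subset[of X P] by simp_all
    qed
    ultimately have "card C \<le> card {aff_dim G..aff_dim P}"
      using card_inj_on_le by blast
    then show ?thesis using C(1) by simp
  qed
  obtain C where C: "C \<subseteq> {H. H face_of P \<and> G \<subseteq> H}" "G \<in> C"
      "Complete_Partial_Order.chain (\<lambda>G H. H \<subseteq> G) C" "card C = nat (aff_dim P - aff_dim G) + 1"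
    using face_chain_exists[OF P, of G] G by (auto simp: faces_above_def)
  moreover have "C \<subseteq> faces_above P F" using C G by (auto simp: faces_above_def)
  ultimately show "nat (aff_dim P - aff_dim G) \<in> ?S" by (intro CollectI exI[of _ C]) auto
qed

definition g_face :: "'a::euclidean_space set \<Rightarrow> 'a set \<Rightarrow> int poly" where
  "g_face P F = g_polynomial (\<lambda>G H. H \<subseteq> G) (faces_above P F)"

lemma g_face_self: "g_face P P = 1"
proof -
  have "faces_above P P = {}" using face_of_imp_subset by (auto simp: faces_above_def)
  then show ?thesis unfolding g_face_def by (subst g_polynomial.simps) simp
qed

text \<open>The rank of the poset is attained by the faces covering \<open>F\<close>, whence the
  \<open>- 1\<close> in \<open>d\<close>; the exponent is \<open>d\<close> minus the rank of
  \<open>G\<close>. The empty face has dimension \<open>-1\<close> and fits the same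
  formula.\<close>

lemma g_face_rec:
  fixes P :: "'a::euclidean_space set"
  assumes P: "polytope P" and F: "F face_of P" "F \<noteq> P"
  defines "d \<equiv> nat (aff_dim P - aff_dim F - 1)"
  defines "f \<equiv> \<Sum>G\<in>faces_above P F. [:-1, 1:] ^ nat (aff_dim G - aff_dim F - 1) * g_face P G"
  shows "g_face P F = (\<Sum>i\<le>d div 2. monom (coeff f i - (if i = 0 then 0 else coeff f (i - 1))) i)"
proof -
  let ?le = "\<lambda>G H :: 'a set. H \<subseteq> G" and ?A = "faces_above P F"
  have PA: "P \<in> ?A"
    using F face_of_imp_subset[OF F(1)] polytope_imp_convex[OF P] by (auto simp: faces_above_def face_of_refl)
  have less: "aff_dim F < aff_dim G" "aff_dim G \<le> aff_dim P" if "G \<in> ?A" for G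
    using face_aff_dim_less[OF F(1), of G] that
    by (auto simp: faces_above_def intro!: aff_dim_subset face_of_imp_subset)
  have d: "Max (poset_rank ?le ?A ` ?A) = d"
  proof (rule Max_eqI)
    show "finite (poset_rank ?le ?A ` ?A)" using finite_faces_above[OF P] by simp
    show "y \<le> d" if y: "y \<in> poset_rank ?le ?A ` ?A" for y
    proof -
      obtain G where G: "G \<in> ?A" "y = poset_rank ?le ?A G" using y by blast
      then show ?thesis using poset_rank_faces_above[OF P G(1)] less[OF G(1)] by (simp add: d_def)
    qed
    obtain G where G: "G face_of P" "F \<subset> G" "aff_dim G = aff_dim F + 1"
      using face_between[OF P F] by blast
    then have "G \<in> ?A" by (simp add: faces_above_def)
    moreover from this have "poset_rank ?le ?A G = d"
      using poset_rank_faces_above[OF P] G by (simp add: d_def algebra_simps)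
    ultimately show "d \<in> poset_rank ?le ?A ` ?A" by blast
  qed
  have sub: "{y \<in> ?A. G \<subseteq> y \<and> y \<noteq> G} = faces_above P G" if "G \<in> ?A" for G
    using that by (auto simp: faces_above_def)
  have eq: "(\<Sum>x\<in>?A. [:-1, 1:] ^ (d - poset_rank ?le ?A x) * g_polynomial ?le {y \<in> ?A. x \<subseteq> y \<and> y \<noteq> x}) = f"
    unfolding f_def
  proof (rule sum.cong[OF refl])
    fix G assume G: "G \<in> ?A"
    have "d - poset_rank ?le ?A G = nat (aff_dim G - aff_dim F - 1)"
      using poset_rank_faces_above[OF P G] less[OF G] by (simp add: d_def)
    then show "[:-1, 1:] ^ (d - poset_rank ?le ?A G) * g_polynomial ?le {y \<in> ?A. G \<subseteq> y \<and> y \<noteq> G}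
        = [:-1, 1:] ^ nat (aff_dim G - aff_dim F - 1) * g_face P G"
      by (simp add: sub[OF G] g_face_def)
  qed
  have nontriv: "\<not> (?A = {} \<or> infinite ?A)" using PA finite_faces_above[OF P] by auto
  show ?thesis
    unfolding g_face_def[of P F]
    by (subst g_polynomial.simps, subst if_not_P[OF nontriv], unfold Let_def d eq) (rule refl)
qed

text \<open>
  If three facets \<open>F1, F2, F3\<close> contained the same face \<open>G\<close> of codimension two, pick interior points
  \<open>p1, p2, p3\<close>. Writing \<open>p3\<close> as an affine combination of \<open>G, p1, p2\<close>, the functionals of \<open>F1\<close> and
  \<open>F2\<close> make the coefficients of \<open>p1\<close> and \<open>p2\<close> positive, which contradicts that of \<open>F3\<close>.
\<close>
lemma facets_containing_codim2_face:
  fixes P :: "'a::euclidean_space set"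
  assumes P: "polytope P" and G: "G face_of P" "G \<noteq> {}" "aff_dim G = aff_dim P - 2"
  shows "card {F. F facet_of P \<and> G \<subseteq> F} = 2"
proof -
  let ?S = "{F. F facet_of P \<and> G \<subseteq> F}"
  have conv: "convex P" by (rule polytope_imp_convex[OF P])
  have fin: "finite ?S" using finite_polytope_facets[OF P] by (rule rev_finite_subset) auto
  have "G \<noteq> P" using G by auto
  then have Geq: "G = \<Inter>?S" using face_of_polyhedron[OF polytope_imp_polyhedron[OF P] G(1,2)] by blast
  have S0: "?S \<noteq> {}"
    using face_of_polyhedron_subset_facet[OF polytope_imp_polyhedron[OF P] G(1,2) \<open>G \<noteq> P\<close>] by blast
  have S1: "?S \<noteq> {F}" for F
  proof
    assume *: "?S = {F}"
    then have "G = F" using Geq by simp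
    moreover have "aff_dim F = aff_dim P - 1" using * by (auto simp: facet_of_def)
    ultimately show False using G by simp
  qed
  have ge2: "card ?S \<ge> 2"
  proof -
    have "card ?S \<noteq> 0" using S0 fin by (simp add: card_eq_0_iff)
    moreover have "card ?S \<noteq> 1" using S1 by (auto simp: card_1_singleton_iff)
    ultimately show ?thesis by linarith
  qed
  have "card ?S \<le> 2"
  proof (rule ccontr)
    assume "\<not> card ?S \<le> 2"
    then have "3 \<le> card ?S" by linarith
    then obtain T where "T \<subseteq> ?S" "card T = 3" by (rule obtain_subset_with_card_n)
    obtain F1 F2 F3 where "T = {F1, F2, F3}" and ne: "F1 \<noteq> F2" "F1 \<noteq> F3" "F2 \<noteq> F3"
      using \<open>card T = 3\<close> unfolding card_3_iff by blast
    then have F: "F1 \<in> ?S" "F2 \<in> ?S" "F3 \<in> ?S" using \<open>T \<subseteq> ?S\<close> by blast+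
    have props: "\<exists>p a b. p \<in> rel_interior F \<and> (\<forall>x\<in>P. b \<le> a \<bullet> x) \<and> F = {x \<in> P. a \<bullet> x = b}" if "F \<in> ?S" for F
    proof -
      have f: "F face_of P" "F \<noteq> {}" "F \<noteq> P" using that by (auto simp: facet_of_def)
      then have "rel_interior F \<noteq> {}" using rel_interior_eq_empty[OF face_of_imp_convex[OF f(1)]] by simp
      then obtain p where "p \<in> rel_interior F" by blast
      moreover obtain a b where "\<And>x. x \<in> P \<Longrightarrow> b \<le> a \<bullet> x" "F = {x \<in> P. a \<bullet> x = b}"
        by (rule face_functional[OF P f]) (rule that)
      ultimately show ?thesis by blast
    qed
    have face: "F face_of P" "aff_dim F = aff_dim P - 1" "G \<subseteq> F" "F \<subseteq> P" if "F \<in> ?S" for F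
      using that facet_of_imp_subset by (auto simp: facet_of_def)
    have pin: "p \<notin> F'" if "F \<in> ?S" "F' \<in> ?S" "F \<noteq> F'" "p \<in> rel_interior F" for p F F'
    proof
      assume "p \<in> F'"
      then have "F \<subseteq> F'"
        using subset_of_face_of[OF face(1)[OF that(2)] face(4)[OF that(1)]] that(4) by blast
      then show False
        using face_aff_dim_less[OF face(1)[OF that(1)] face(1)[OF that(2)]] face(2)[OF that(1)] face(2)[OF that(2)] that(3) by auto
    qed
    obtain p1 a1 b1 where 1: "p1 \<in> rel_interior F1" "\<forall>x\<in>P. b1 \<le> a1 \<bullet> x" "F1 = {x \<in> P. a1 \<bullet> x = b1}"
      using props[OF F(1)] by blast
    obtain p2 a2 b2 where 2: "p2 \<in> rel_interior F2" "\<forall>x\<in>P. b2 \<le> a2 \<bullet> x" "F2 = {x \<in> P. a2 \<bullet> x = b2}"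
      using props[OF F(2)] by blast
    obtain p3 a3 b3 where 3: "p3 \<in> rel_interior F3" "\<forall>x\<in>P. b3 \<le> a3 \<bullet> x" "F3 = {x \<in> P. a3 \<bullet> x = b3}"
      using props[OF F(3)] by blast
    have mem: "p1 \<in> F1" "p2 \<in> F2" "p3 \<in> F3" using 1(1) 2(1) 3(1) rel_interior_subset by auto
    have inP: "p1 \<in> P" "p2 \<in> P" "p3 \<in> P" using mem face(4) F by auto
    have gt: "b1 < a1 \<bullet> p2" "b1 < a1 \<bullet> p3" "b2 < a2 \<bullet> p1" "b2 < a2 \<bullet> p3" "b3 < a3 \<bullet> p1" "b3 < a3 \<bullet> p2"
      using pin[OF F(2,1) _ 2(1)] pin[OF F(3,1) _ 3(1)] pin[OF F(1,2) _ 1(1)] pin[OF F(3,2) _ 3(1)]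
        pin[OF F(1,3) _ 1(1)] pin[OF F(2,3) _ 2(1)] ne inP 1(2,3) 2(2,3) 3(2,3) by (auto simp: less_le)
    have G0: "a1 \<bullet> x = b1" "a2 \<bullet> x = b2" "a3 \<bullet> x = b3" if "x \<in> G" for x
      using that F 1(3) 2(3) 3(3) by auto
    have p1G: "p1 \<notin> affine hull G" using affine_hull_functional_eq[of G a2 b2 p1] G0 gt by auto
    have p2G: "p2 \<notin> affine hull (insert p1 G)"
      using affine_hull_functional_eq[of "insert p1 G" a1 b1 p2] G0 gt mem 1(3) by auto
    have "aff_dim (insert p2 (insert p1 G)) = aff_dim P"
      using aff_dim_insert[of p2 "insert p1 G"] aff_dim_insert[of p1 G] p1G p2G G(3) by simp
    moreover have "insert p2 (insert p1 G) \<subseteq> P" using inP face_of_imp_subset[OF G(1)] by auto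
    ultimately have "affine hull (insert p2 (insert p1 G)) = affine hull P"
      by (intro affine_dim_equal) (auto simp: hull_mono aff_dim_affine_hull)
    then have "p3 \<in> affine hull (insert p2 (insert p1 G))" using inP by (simp add: hull_inc)
    \<comment> \<open>\<open>\<alpha>\<close> and \<open>\<beta>\<close> are the coefficients of
      \<open>p1\<close> and \<open>p2\<close>. Shifted by its constant, the functional of each facet
      vanishes on \<open>G\<close>; that of \<open>F1\<close> also vanishes at \<open>p1\<close> and
      thus reads off \<open>\<beta>\<close>, and that of \<open>F2\<close> reads off
      \<open>\<alpha>\<close>.\<close>
    moreover have "affine hull (insert p2 (insert p1 G)) \<subseteq>
        {x. \<exists>\<alpha> \<beta>. (a1 \<bullet> x - b1 = \<beta> * (a1 \<bullet> p2 - b1)) \<and> (a2 \<bullet> x - b2 = \<alpha> * (a2 \<bullet> p1 - b2)) \<and>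
          (a3 \<bullet> x - b3 = \<alpha> * (a3 \<bullet> p1 - b3) + \<beta> * (a3 \<bullet> p2 - b3))}" (is "_ \<subseteq> ?H")
    proof (rule hull_minimal)
      show "insert p2 (insert p1 G) \<subseteq> ?H"
      proof (intro insert_subsetI)
        show "p2 \<in> ?H" using mem 2(3) by (intro CollectI exI[of _ 0] exI[of _ 1]) auto
        show "p1 \<in> ?H" using mem 1(3) by (intro CollectI exI[of _ 1] exI[of _ 0]) auto
        show "G \<subseteq> ?H" using G0 by (auto intro!: exI[of _ 0])
      qed
      show "affine ?H"
        unfolding affine_def
      proof (intro ballI allI impI)
        fix x y and u v :: real assume x: "x \<in> ?H" and y: "y \<in> ?H" and uv: "u + v = 1"
        obtain \<alpha> \<beta> where x': "a1 \<bullet> x - b1 = \<beta> * (a1 \<bullet> p2 - b1)" "a2 \<bullet> x - b2 = \<alpha> * (a2 \<bullet> p1 - b2)"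
          "a3 \<bullet> x - b3 = \<alpha> * (a3 \<bullet> p1 - b3) + \<beta> * (a3 \<bullet> p2 - b3)" using x by blast
        obtain \<alpha>' \<beta>' where y': "a1 \<bullet> y - b1 = \<beta>' * (a1 \<bullet> p2 - b1)" "a2 \<bullet> y - b2 = \<alpha>' * (a2 \<bullet> p1 - b2)"
          "a3 \<bullet> y - b3 = \<alpha>' * (a3 \<bullet> p1 - b3) + \<beta>' * (a3 \<bullet> p2 - b3)" using y by blast
        have lin: "a \<bullet> (u *\<^sub>R x + v *\<^sub>R y) - b = u * (a \<bullet> x - b) + v * (a \<bullet> y - b)" for a b
        proof -
          have "b = (u + v) * b" using uv by simp
          then show ?thesis by (simp add: inner_add_right algebra_simps)
        qed
        show "u *\<^sub>R x + v *\<^sub>R y \<in> ?H"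
          unfolding mem_Collect_eq lin x' y'
          by (intro exI[of _ "u * \<alpha> + v * \<alpha>'"] exI[of _ "u * \<beta> + v * \<beta>'"]) (simp add: algebra_simps)
      qed
    qed
    ultimately obtain \<alpha> \<beta> where *: "a1 \<bullet> p3 - b1 = \<beta> * (a1 \<bullet> p2 - b1)" "a2 \<bullet> p3 - b2 = \<alpha> * (a2 \<bullet> p1 - b2)"
          "a3 \<bullet> p3 - b3 = \<alpha> * (a3 \<bullet> p1 - b3) + \<beta> * (a3 \<bullet> p2 - b3)" by blast
    have "0 < \<beta> * (a1 \<bullet> p2 - b1)" "0 < \<alpha> * (a2 \<bullet> p1 - b2)" using * gt by auto
    then have "0 < \<beta>" "0 < \<alpha>" using gt by (auto simp: zero_less_mult_iff)
    then have "0 < \<alpha> * (a3 \<bullet> p1 - b3) + \<beta> * (a3 \<bullet> p2 - b3)" using gt by (intro add_pos_pos mult_pos_pos) auto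
    moreover have "a3 \<bullet> p3 = b3" using mem 3(3) by blast
    ultimately show False using * by simp
  qed
  then show ?thesis using ge2 by linarith
qed

section \<open>Local polynomials in dimension three\<close>

definition faces_dim :: "'a::euclidean_space set \<Rightarrow> int \<Rightarrow> 'a set set" where
  "faces_dim P i = {F. F face_of P \<and> aff_dim F = i}"

lemma finite_faces_dim: "polytope P \<Longrightarrow> finite (faces_dim P i)"
  unfolding faces_dim_def by (rule finite_subset[OF _ finite_polytope_faces]) auto

lemma face_eq_of_aff_dim:
  fixes P :: "'a::euclidean_space set"
  assumes "convex P" "F face_of P" "aff_dim F = aff_dim P"
  shows "F = P"
  using face_of_aff_dim_lt[OF assms(1,2)] assms(3) by auto

lemma interior_count_vertex:
  fixes P :: "'a::euclidean_space set"
  assumes "lattice_polytope P" "v \<in> faces_dim P 0"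
  shows "interior_count 1 v = 1"
proof -
  obtain x where x: "v = {x}" using assms(2) aff_dim_eq_0 by (auto simp: faces_dim_def)
  have "x extreme_point_of P" using assms(2) x by (simp add: faces_dim_def face_of_singleton)
  then have "x \<in> int_lattice" by (rule extreme_point_lattice_polytope[OF assms(1)])
  then show ?thesis by (simp add: interior_count_def x)
qed

lemma hstar_vertex:
  fixes P :: "'a::euclidean_space set"
  assumes "lattice_polytope P" "v \<in> faces_dim P 0"
  shows "hstar v = 1"
proof -
  have v: "lattice_polytope v" "v \<noteq> {}" "aff_dim v = int 0"
    using assms lattice_polytope_face by (auto simp: faces_dim_def)
  have "coeff (hstar v) j = coeff 1 j" for j
    using hstar_coeffs(4)[OF v, of j] hstar_reciprocity(2)[OF v(1,2)] by (cases j) auto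
  then show ?thesis by (rule poly_eqI)
qed

lemma card_vertices_edge:
  fixes P :: "'a::euclidean_space set"
  assumes "polytope P" "e \<in> faces_dim P 1"
  shows "card {v \<in> faces_dim P 0. v \<subseteq> e} = 2"
proof -
  have e: "e face_of P" "aff_dim e = 1" "e \<noteq> {}" using assms by (auto simp: faces_dim_def)
  have pe: "polytope e" by (rule face_of_polytope_polytope[OF assms(1) e(1)])
  have "collinear e" using e by (simp add: collinear_aff_dim)
  then obtain a b where ab: "e = closed_segment a b"
    using compact_convex_collinear_segment[OF e(3) polytope_imp_compact[OF pe] polytope_imp_convex[OF pe]] by blast
  have "a \<noteq> b" using ab e(2) by auto
  have "{v \<in> faces_dim P 0. v \<subseteq> e} = {{a}, {b}}"
  proof -
    have "v \<in> faces_dim P 0 \<and> v \<subseteq> e \<longleftrightarrow> (\<exists>x. v = {x} \<and> x extreme_point_of e)" for v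
      using face_of_face[OF e(1), of v] by (auto simp: faces_dim_def aff_dim_eq_0 face_of_singleton)
    then show ?thesis unfolding ab extreme_point_of_segment by auto
  qed
  then show ?thesis using \<open>a \<noteq> b\<close> by simp
qed

lemma card_facets_ridge:
  fixes P :: "'a::euclidean_space set"
  assumes "polytope P" "aff_dim P = i + 2" "i \<ge> 0" "G \<in> faces_dim P i"
  shows "card {F \<in> faces_dim P (i + 1). G \<subseteq> F} = 2"
proof -
  have "{F \<in> faces_dim P (i + 1). G \<subseteq> F} = {F. F facet_of P \<and> G \<subseteq> F}"
    using assms by (auto simp: faces_dim_def facet_of_def)
  moreover have "G \<noteq> {}" using assms by (auto simp: faces_dim_def)
  ultimately show ?thesis
    using facets_containing_codim2_face[OF assms(1), of G] assms by (simp add: faces_dim_def)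
qed

lemma faces_dim_face:
  assumes "F face_of P"
  shows "faces_dim F i = {G \<in> faces_dim P i. G \<subseteq> F}"
  using face_of_face[OF assms] by (auto simp: faces_dim_def)

lemma card_int_lattice_eq_sum_faces:
  fixes P :: "'a::euclidean_space set"
  assumes P: "polytope P" and n: "aff_dim P = int n"
  shows "card (P \<inter> int_lattice) = (\<Sum>i\<le>n. \<Sum>F\<in>faces_dim P (int i). interior_count 1 F)"
proof -
  have "{F. F face_of P} - {{}} = (\<Union>i\<in>{..n}. faces_dim P (int i))"
  proof (intro equalityI subsetI)
    fix F assume "F \<in> {F. F face_of P} - {{}}"
    then have F: "F face_of P" "0 \<le> aff_dim F" "aff_dim F \<le> int n"
      using aff_dim_subset[OF face_of_imp_subset, of F P] n by (auto simp: aff_dim_nonneg_iff)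
    then show "F \<in> (\<Union>i\<in>{..n}. faces_dim P (int i))"
      by (intro UN_I[of "nat (aff_dim F)"]) (auto simp: faces_dim_def)
  qed (auto simp: faces_dim_def)
  moreover have "card (P \<inter> int_lattice) = (\<Sum>F | F face_of P. interior_count 1 F)"
    using card_dilation_eq_sum_faces[OF P, of 1] by simp
  moreover have "\<dots> = (\<Sum>F\<in>{F. F face_of P} - {{}}. interior_count 1 F)"
    using finite_polytope_faces[OF P] by (intro sum.mono_neutral_right) (auto simp: interior_count_def)
  moreover have "(\<Sum>F\<in>(\<Union>i\<in>{..n}. faces_dim P (int i)). interior_count 1 F)
      = (\<Sum>i\<le>n. \<Sum>F\<in>faces_dim P (int i). interior_count 1 F)"
    using finite_faces_dim[OF P] by (intro sum.UNION_disjoint) (auto simp: faces_dim_def)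
  ultimately show ?thesis by simp
qed

locale lattice_polytope_3 =
  fixes P :: "'a::euclidean_space set"
  assumes lattice: "lattice_polytope P" and dim: "aff_dim P = 3"
begin

abbreviation "vertices \<equiv> faces_dim P 0"
abbreviation "edges \<equiv> faces_dim P 1"
abbreviation "facets \<equiv> faces_dim P 2"

lemma polytope: "polytope P" by (rule lattice_polytope_imp_polytope[OF lattice])
lemma convex: "convex P" by (rule polytope_imp_convex[OF polytope])
lemma nonempty: "P \<noteq> {}" using dim by auto
lemma fin: "finite (faces_dim P i)" by (rule finite_faces_dim[OF polytope])

lemma faces_dim_3: "faces_dim P 3 = {P}"
  using face_eq_of_aff_dim[OF convex] dim convex by (auto simp: faces_dim_def face_of_refl)

lemma face_cases:
  "F face_of P \<longleftrightarrow> F = {} \<or> F \<in> vertices \<or> F \<in> edges \<or> F \<in> facets \<or> F = P"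
proof
  assume F: "F face_of P"
  have "-1 \<le> aff_dim F" "aff_dim F \<le> 3"
    using aff_dim_geq[of F] aff_dim_subset[OF face_of_imp_subset[OF F]] dim by auto
  then have "aff_dim F = -1 \<or> aff_dim F = 0 \<or> aff_dim F = 1 \<or> aff_dim F = 2 \<or> aff_dim F = 3" by presburger
  moreover have "aff_dim F = -1 \<longleftrightarrow> F = {}" by (rule aff_dim_empty[symmetric])
  moreover have "aff_dim F = 3 \<longrightarrow> F = P" using face_eq_of_aff_dim[OF convex F] dim by simp
  ultimately show "F = {} \<or> F \<in> vertices \<or> F \<in> edges \<or> F \<in> facets \<or> F = P"
    using F by (auto simp: faces_dim_def)
next
  assume "F = {} \<or> F \<in> vertices \<or> F \<in> edges \<or> F \<in> facets \<or> F = P"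
  then show "F face_of P" using face_of_refl[OF convex] by (auto simp: faces_dim_def)
qed

lemma faces_dim_disjoint: "i \<noteq> j \<Longrightarrow> faces_dim P i \<inter> faces_dim P j = {}"
  by (auto simp: faces_dim_def)

lemma not_in_faces_dim: "i \<ge> 0 \<Longrightarrow> {} \<notin> faces_dim P i" "i \<noteq> 3 \<Longrightarrow> P \<notin> faces_dim P i"
  using dim by (auto simp: faces_dim_def)

lemma sum_faces:
  fixes f :: "'a set \<Rightarrow> 'b::comm_monoid_add"
  shows "(\<Sum>F | F face_of P. f F) = f {} + (sum f vertices + sum f edges + sum f facets + f P)"
proof -
  have "{F. F face_of P} = insert {} (insert P (vertices \<union> edges \<union> facets))"
    using face_cases by blast
  moreover have "sum f (insert {} (insert P (vertices \<union> edges \<union> facets)))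
      = f {} + (f P + sum f (vertices \<union> edges \<union> facets))"
    using nonempty not_in_faces_dim by (simp add: fin)
  moreover have "sum f (vertices \<union> edges \<union> facets) = sum f (vertices \<union> edges) + sum f facets"
    using faces_dim_disjoint[of 0 2] faces_dim_disjoint[of 1 2] fin by (intro sum.union_disjoint) auto
  moreover have "sum f (vertices \<union> edges) = sum f vertices + sum f edges"
    using faces_dim_disjoint[of 0 1] fin by (intro sum.union_disjoint) auto
  ultimately show ?thesis by (simp add: add.assoc add.commute add.left_commute)
qed

lemma euler: "int (card vertices) - int (card edges) + int (card facets) = 2"
proof -
  define f where "f = (\<lambda>F :: 'a set. if F = {} then 0 else (-1) ^ nat (aff_dim P - aff_dim F) :: int)"
  have "(\<Sum>F | F face_of P. f F) = (\<Sum>F | F face_of P \<and> F \<noteq> {}. (-1) ^ nat (aff_dim P - aff_dim F))"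
    using finite_polytope_faces[OF polytope] by (intro sum.mono_neutral_cong_right) (auto simp: f_def)
  also have "\<dots> = -1" using euler_relation[OF lattice nonempty] by (simp add: dim)
  finally have "f {} + (sum f vertices + sum f edges + sum f facets + f P) = -1" unfolding sum_faces .
  moreover have "sum f vertices = (\<Sum>F\<in>vertices. -1)"
    by (rule sum.cong) (auto simp: f_def faces_dim_def dim)
  moreover have "sum f edges = (\<Sum>F\<in>edges. 1)"
    by (rule sum.cong) (auto simp: f_def faces_dim_def dim)
  moreover have "sum f facets = (\<Sum>F\<in>facets. -1)"
    by (rule sum.cong) (auto simp: f_def faces_dim_def dim)
  moreover have "f {} = 0" "f P = 1" using nonempty by (auto simp: f_def)
  ultimately show ?thesis by simp
qed

lemma faces_above_eq:
  assumes "F \<in> faces_dim P i"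
  shows "faces_above P F = {G. G face_of P \<and> i < aff_dim G \<and> F \<subseteq> G}"
  using assms face_aff_dim_less[of F P] by (auto simp: faces_above_def faces_dim_def)

lemma faces_above_facet: "F \<in> facets \<Longrightarrow> faces_above P F = {P}"
  using face_of_imp_subset[of F P] dim
  by (auto simp: faces_above_eq face_cases) (auto simp: faces_dim_def)

lemma faces_above_edge: "e \<in> edges \<Longrightarrow> faces_above P e = insert P {F \<in> facets. e \<subseteq> F}"
  using face_of_imp_subset[of e P] dim
  by (auto simp: faces_above_eq face_cases) (auto simp: faces_dim_def)

lemma faces_above_vertex:
  "v \<in> vertices \<Longrightarrow> faces_above P v = insert P ({F \<in> facets. v \<subseteq> F} \<union> {e \<in> edges. v \<subseteq> e})"
  using face_of_imp_subset[of v P] dim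
  by (auto simp: faces_above_eq face_cases) (auto simp: faces_dim_def)

lemma faces_above_empty: "faces_above P {} = insert P (facets \<union> edges \<union> vertices)"
  using nonempty by (auto simp: faces_above_def face_cases not_in_faces_dim)

lemma g_face_facet:
  assumes "F \<in> facets"
  shows "g_face P F = 1"
proof -
  have F: "F face_of P" "aff_dim F = 2" "F \<noteq> P" using assms dim by (auto simp: faces_dim_def)
  show ?thesis
    unfolding g_face_rec[OF polytope F(1,3)] faces_above_facet[OF assms]
    by (simp add: F(2) dim g_face_self monom_0)
qed

lemma card_facets_edge: "e \<in> edges \<Longrightarrow> card {F \<in> facets. e \<subseteq> F} = 2"
  using card_facets_ridge[OF polytope, of 1 e] dim by simp

text \<open>The rank is one, so only the constant coefficient of \<open>f\<close> enters; the two
  facets through an edge turn the \<open>-1\<close> of \<open>t - 1\<close> into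
  \<open>1\<close>.\<close>

lemma g_face_edge:
  assumes "e \<in> edges"
  shows "g_face P e = 1"
proof -
  have e: "e face_of P" "aff_dim e = 1" "e \<noteq> P" using assms dim by (auto simp: faces_dim_def)
  define f where "f = (\<Sum>G\<in>faces_above P e. [:-1, 1:] ^ nat (aff_dim G - aff_dim e - 1) * g_face P G)"
  have "f = [:-1, 1:] + (\<Sum>F\<in>{F \<in> facets. e \<subseteq> F}. 1)"
  proof -
    have "P \<notin> {F \<in> facets. e \<subseteq> F}" using not_in_faces_dim by simp
    then have "f = [:-1, 1:] ^ nat (aff_dim P - aff_dim e - 1) * g_face P P
       + (\<Sum>F\<in>{F \<in> facets. e \<subseteq> F}. [:-1, 1:] ^ nat (aff_dim F - aff_dim e - 1) * g_face P F)"
      unfolding f_def faces_above_edge[OF assms] by (simp add: fin)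
    also have "(\<Sum>F\<in>{F \<in> facets. e \<subseteq> F}. [:-1, 1:] ^ nat (aff_dim F - aff_dim e - 1) * g_face P F)
       = (\<Sum>F\<in>{F \<in> facets. e \<subseteq> F}. 1)"
      by (rule sum.cong) (use e(2) in \<open>auto simp: g_face_facet\<close>, auto simp: faces_dim_def)
    finally show ?thesis by (simp add: e dim g_face_self)
  qed
  then have "coeff f 0 = 1" using card_facets_edge[OF assms] by (simp add: numeral_poly)
  then show ?thesis
    unfolding g_face_rec[OF polytope e(1,3), folded f_def] by (simp add: e(2) dim monom_0)
qed

text \<open>Double counting of flags \<open>v \<subset> e \<subset> F\<close>: an edge lies in two
  facets, and a facet at \<open>v\<close> has two edges at \<open>v\<close>.\<close>

lemma card_edges_vertex:
  assumes "v \<in> vertices"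
  shows "card {e \<in> edges. v \<subseteq> e} = card {F \<in> facets. v \<subseteq> F}"
proof -
  have 1: "card {e \<in> {e \<in> edges. v \<subseteq> e}. e \<subseteq> F} = 2" if F: "F \<in> {F \<in> facets. v \<subseteq> F}" for F
  proof -
    have Ff: "F face_of P" "aff_dim F = 2" using F by (auto simp: faces_dim_def)
    have "v \<in> faces_dim F 0" using faces_dim_face[OF Ff(1)] F assms by auto
    then have "card {e \<in> faces_dim F (0 + 1). v \<subseteq> e} = 2"
      using card_facets_ridge[OF face_of_polytope_polytope[OF polytope Ff(1)], of 0 v] Ff by simp
    moreover have "{e \<in> faces_dim F (0 + 1). v \<subseteq> e} = {e \<in> {e \<in> edges. v \<subseteq> e}. e \<subseteq> F}"
      using faces_dim_face[OF Ff(1)] by auto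
    ultimately show ?thesis by simp
  qed
  have 2: "card {F \<in> {F \<in> facets. v \<subseteq> F}. e \<subseteq> F} = 2" if e: "e \<in> {e \<in> edges. v \<subseteq> e}" for e
  proof -
    have "{F \<in> {F \<in> facets. v \<subseteq> F}. e \<subseteq> F} = {F \<in> facets. e \<subseteq> F}" using e by auto
    then show ?thesis using card_facets_edge e by simp
  qed
  have "(\<Sum>e\<in>{e \<in> edges. v \<subseteq> e}. \<Sum>F\<in>{F \<in> {F \<in> facets. v \<subseteq> F}. e \<subseteq> F}. 1)
      = (\<Sum>F\<in>{F \<in> facets. v \<subseteq> F}. \<Sum>e\<in>{e \<in> {e \<in> edges. v \<subseteq> e}. e \<subseteq> F}. 1 :: nat)"
    using fin by (intro sum.swap_restrict) auto
  then show ?thesis using 1 2 by simp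
qed

text \<open>Here \<open>f = (t - 1)^2 + m (t - 1) + m\<close> for \<open>m\<close> facets, and
  equally many edges, at the vertex. The constant coefficient is \<open>1\<close>, the linear one
  \<open>m - 2\<close>, and their difference is \<open>m - 3\<close>.\<close>

lemma g_face_vertex:
  assumes "v \<in> vertices"
  shows "g_face P v = [:1, int (card {F \<in> facets. v \<subseteq> F}) - 3:]"
proof -
  have v: "v face_of P" "aff_dim v = 0" "v \<noteq> P" using assms dim by (auto simp: faces_dim_def)
  define m where "m = card {F \<in> facets. v \<subseteq> F}"
  define f where "f = (\<Sum>G\<in>faces_above P v. [:-1, 1:] ^ nat (aff_dim G - aff_dim v - 1) * g_face P G)"
  let ?F = "{F \<in> facets. v \<subseteq> F}" and ?E = "{e \<in> edges. v \<subseteq> e}"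
  let ?h = "\<lambda>G. [:-1, 1:] ^ nat (aff_dim G - aff_dim v - 1) * g_face P G"
  have "f = ?h P + (sum ?h ?F + sum ?h ?E)"
  proof -
    have "P \<notin> ?F \<union> ?E" using not_in_faces_dim by simp
    moreover have "sum ?h (?F \<union> ?E) = sum ?h ?F + sum ?h ?E"
      using faces_dim_disjoint[of 1 2] fin by (intro sum.union_disjoint) auto
    ultimately show ?thesis
      unfolding f_def faces_above_vertex[OF assms] using fin by simp
  qed
  moreover have "sum ?h ?F = (\<Sum>F\<in>?F. [:-1, 1:])"
    by (rule sum.cong) (use v(2) in \<open>auto simp: g_face_facet\<close>, auto simp: faces_dim_def)
  moreover have "sum ?h ?E = (\<Sum>F\<in>?E. 1)"
    by (rule sum.cong) (use v(2) in \<open>auto simp: g_face_edge\<close>, auto simp: faces_dim_def)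
  ultimately have "f = [:-1, 1:] ^ 2 + of_nat m * [:-1, 1:] + of_nat m"
    using card_edges_vertex[OF assms] by (simp add: m_def v(2) dim g_face_self)
  then have "coeff f 0 = 1" "coeff f 1 = int m - 2"
    by (simp_all add: power2_eq_square of_nat_poly)
  then have "g_face P v = monom 1 0 + monom (int m - 3) 1"
    unfolding g_face_rec[OF polytope v(1,3), folded f_def] by (simp add: v(2) dim)
  also have "\<dots> = [:1, int m - 3:]" by (simp add: monom_0 monom_Suc)
  finally show ?thesis by (simp add: m_def)
qed

text \<open>Euler's relation makes the constant coefficient of \<open>f\<close> equal to
  \<open>1\<close>. The sum over the vertices is left unevaluated, because it cancels against the
  vertex terms of the local polynomial.\<close>

lemma g_face_empty:
  "g_face P {} = [:1, 2 - 2 * int (card facets) + int (card edges)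
      + (\<Sum>v\<in>vertices. int (card {F \<in> facets. v \<subseteq> F}) - 3):]"
proof -
  define m where "m = (\<lambda>v. int (card {F \<in> facets. v \<subseteq> F}) - 3)"
  define f where "f = (\<Sum>G\<in>faces_above P {}. [:-1, 1:] ^ nat (aff_dim G - aff_dim ({} :: 'a set) - 1) * g_face P G)"
  let ?h = "\<lambda>G. [:-1, 1:] ^ nat (aff_dim G - aff_dim ({} :: 'a set) - 1) * g_face P G"
  have "f = ?h P + (sum ?h facets + sum ?h edges + sum ?h vertices)"
  proof -
    have "P \<notin> facets \<union> edges \<union> vertices" using not_in_faces_dim by simp
    moreover have "sum ?h (facets \<union> edges \<union> vertices) = sum ?h (facets \<union> edges) + sum ?h vertices"
      using faces_dim_disjoint[of 2 0] faces_dim_disjoint[of 1 0] fin by (intro sum.union_disjoint) auto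
    moreover have "sum ?h (facets \<union> edges) = sum ?h facets + sum ?h edges"
      using faces_dim_disjoint[of 2 1] fin by (intro sum.union_disjoint) auto
    ultimately show ?thesis
      unfolding f_def faces_above_empty using fin by simp
  qed
  moreover have "sum ?h facets = (\<Sum>F\<in>facets. [:-1, 1:] ^ 2)"
    by (rule sum.cong) (auto simp: g_face_facet, auto simp: faces_dim_def)
  moreover have "sum ?h edges = (\<Sum>F\<in>edges. [:-1, 1:])"
    by (rule sum.cong) (auto simp: g_face_edge, auto simp: faces_dim_def)
  moreover have "sum ?h vertices = (\<Sum>v\<in>vertices. [:1, m v:])"
    by (rule sum.cong) (auto simp: g_face_vertex m_def faces_dim_def one_pCons)
  ultimately have f: "f = [:-1, 1:] ^ 3 + of_nat (card facets) * [:-1, 1:] ^ 2 + of_nat (card edges) * [:-1, 1:]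
      + (\<Sum>v\<in>vertices. [:1, m v:])"
    by (simp add: dim g_face_self)
  have "{} \<noteq> P" using nonempty by simp
  have "coeff f 0 = 1" "coeff f 1 = 3 - 2 * int (card facets) + int (card edges) + (\<Sum>v\<in>vertices. m v)"
    unfolding f using euler by (simp_all add: power2_eq_square power3_eq_cube of_nat_poly coeff_sum)
  then have "g_face P {} = monom 1 0 + monom (2 - 2 * int (card facets) + int (card edges) + (\<Sum>v\<in>vertices. m v)) 1"
    using g_face_rec[OF polytope empty_face_of \<open>{} \<noteq> P\<close>, folded f_def] by (simp add: dim)
  also have "\<dots> = [:1, 2 - 2 * int (card facets) + int (card edges) + (\<Sum>v\<in>vertices. m v):]"
    by (simp add: monom_0 monom_Suc)
  finally show ?thesis by (simp add: m_def)
qed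

end

section \<open>The coefficients of the local polynomial\<close>

lemma interior_count_eq_0_iff:
  fixes P :: "'a::euclidean_space set"
  assumes "bounded P"
  shows "interior_count n P = 0 \<longleftrightarrow> (\<lambda>x. real n *\<^sub>R x) ` rel_interior P \<inter> int_lattice = {}"
proof -
  have "bounded (rel_interior P)" using bounded_subset[OF assms rel_interior_subset] .
  then have "finite ((\<lambda>x. real n *\<^sub>R x) ` rel_interior P \<inter> int_lattice)"
    by (intro finite_bounded_int_lattice bounded_scaling)
  then show ?thesis by (simp add: interior_count_def)
qed

lemma interior_count_1_eq_0_if_2:
  fixes P :: "'a::euclidean_space set"
  assumes "bounded P" "interior_count 2 P = 0"
  shows "interior_count 1 P = 0"
proof -
  have "x \<notin> int_lattice" if "x \<in> rel_interior P" for x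
    using assms(2) int_lattice_scaleR[of x 2] that unfolding interior_count_eq_0_iff[OF assms(1)] by auto
  then show ?thesis unfolding interior_count_eq_0_iff[OF assms(1)] by auto
qed

context lattice_polytope_3
begin

text \<open>The empty face and the vertices have \<open>h\<^sup>* = 1\<close>, while edges, facets
  and \<open>P\<close> have \<open>g = 1\<close>, so each summand keeps a single nontrivial
  factor.\<close>

lemma local_hstar_eq:
  "local_hstar P = g_face P {} - (\<Sum>v\<in>vertices. g_face P v) + (\<Sum>e\<in>edges. hstar e)
     - (\<Sum>F\<in>facets. hstar F) + hstar P"
proof -
  define f where "f = (\<lambda>F. (-1) ^ nat (aff_dim P - aff_dim F) * hstar F * g_face P F)"
  have "local_hstar P = (\<Sum>F | F face_of P. f F)"
    by (simp add: local_hstar_def f_def g_face_def faces_above_def)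
  also have "\<dots> = f {} + (sum f vertices + sum f edges + sum f facets + f P)" by (rule sum_faces)
  also have "f {} = g_face P {}" by (simp add: f_def dim hstar_empty)
  also have "sum f vertices = (\<Sum>v\<in>vertices. - g_face P v)"
    by (rule sum.cong) (auto simp: f_def hstar_vertex[OF lattice], auto simp: faces_dim_def dim)
  also have "sum f edges = (\<Sum>e\<in>edges. hstar e)"
    by (rule sum.cong) (auto simp: f_def g_face_edge, auto simp: faces_dim_def dim)
  also have "sum f facets = (\<Sum>F\<in>facets. - hstar F)"
    by (rule sum.cong) (auto simp: f_def g_face_facet, auto simp: faces_dim_def dim)
  also have "f P = hstar P" by (simp add: f_def g_face_self)
  finally show ?thesis by (simp add: sum_negf)
qed

lemma facet_properties:
  assumes "F \<in> facets"
  shows "F face_of P" "lattice_polytope F" "F \<noteq> {}" "aff_dim F = int 2" "F \<subseteq> P"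
    "polytope F" "convex F" "F \<noteq> P"
  using assms lattice_polytope_face[OF lattice] face_of_imp_subset[of F P] lattice_polytope_imp_polytope[of F]
    polytope_imp_convex[of F] dim
  by (auto simp: faces_dim_def)

lemma edge_properties:
  assumes "e \<in> edges"
  shows "e face_of P" "lattice_polytope e" "e \<noteq> {}" "aff_dim e = int 1"
  using assms lattice_polytope_face[OF lattice] by (auto simp: faces_dim_def)

lemma sum_vertices_incidence:
  "(\<Sum>v\<in>vertices. card {F \<in> facets. v \<subseteq> F}) = 2 * card edges"
proof -
  have "(\<Sum>v\<in>vertices. \<Sum>e\<in>{e \<in> edges. v \<subseteq> e}. 1) = (\<Sum>e\<in>edges. \<Sum>v\<in>{v \<in> vertices. v \<subseteq> e}. 1 :: nat)"
    by (rule sum.swap_restrict) (simp_all add: fin)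
  then show ?thesis using card_vertices_edge[OF polytope] card_edges_vertex by simp
qed

lemma card_edge_points: "e \<in> edges \<Longrightarrow> card (e \<inter> int_lattice) = 2 + interior_count 1 e"
proof -
  assume e: "e \<in> edges"
  note ep = edge_properties[OF e]
  have "card (e \<inter> int_lattice) = (\<Sum>v\<in>faces_dim e 0. interior_count 1 v) + (\<Sum>F\<in>faces_dim e 1. interior_count 1 F)"
    using card_int_lattice_eq_sum_faces[OF lattice_polytope_imp_polytope[OF ep(2)] ep(4)] by simp
  moreover have "faces_dim e 1 = {e}"
    using face_eq_of_aff_dim[OF face_of_imp_convex[OF ep(1)]] face_of_imp_convex[OF ep(1)] ep(4)
    by (auto simp: faces_dim_def face_of_refl)
  moreover have "(\<Sum>v\<in>faces_dim e 0. interior_count 1 v) = card (faces_dim e 0)"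
    using interior_count_vertex[OF ep(2)] by simp
  moreover have "card (faces_dim e 0) = 2"
    using card_vertices_edge[OF polytope e] faces_dim_face[OF ep(1)] by simp
  ultimately show ?thesis by simp
qed

lemma card_facet_points:
  assumes F: "F \<in> facets"
  shows "card (F \<inter> int_lattice) = card {v \<in> vertices. v \<subseteq> F}
     + (\<Sum>e\<in>{e \<in> edges. e \<subseteq> F}. interior_count 1 e) + interior_count 1 F"
proof -
  note Fp = facet_properties[OF F]
  have "{..2::nat} = {0, 1, 2}" by auto
  then have "card (F \<inter> int_lattice) = (\<Sum>v\<in>faces_dim F 0. interior_count 1 v)
      + (\<Sum>e\<in>faces_dim F 1. interior_count 1 e) + (\<Sum>G\<in>faces_dim F 2. interior_count 1 G)"
    using card_int_lattice_eq_sum_faces[OF Fp(6,4)] by simp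
  moreover have "faces_dim F 2 = {F}"
    using face_eq_of_aff_dim[OF Fp(7)] Fp by (auto simp: faces_dim_def face_of_refl)
  moreover have "(\<Sum>v\<in>faces_dim F 0. interior_count 1 v) = card (faces_dim F 0)"
    using interior_count_vertex[OF Fp(2)] by simp
  ultimately show ?thesis using faces_dim_face[OF Fp(1)] by simp
qed

lemma card_points:
  "card (P \<inter> int_lattice) = card vertices + (\<Sum>e\<in>edges. interior_count 1 e)
     + (\<Sum>F\<in>facets. interior_count 1 F) + interior_count 1 P"
proof -
  have "{..3::nat} = {0, 1, 2, 3}" by auto
  then have "card (P \<inter> int_lattice) = (\<Sum>v\<in>vertices. interior_count 1 v)
      + (\<Sum>e\<in>edges. interior_count 1 e) + (\<Sum>F\<in>facets. interior_count 1 F) + (\<Sum>G\<in>faces_dim P 3. interior_count 1 G)"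
    using card_int_lattice_eq_sum_faces[OF polytope, of 3] dim by simp
  then show ?thesis using interior_count_vertex[OF lattice] faces_dim_3 by simp
qed

lemma sum_card_edge_points:
  "(\<Sum>e\<in>edges. card (e \<inter> int_lattice)) = 2 * card edges + (\<Sum>e\<in>edges. interior_count 1 e)"
proof -
  have "(\<Sum>e\<in>edges. card (e \<inter> int_lattice)) = (\<Sum>e\<in>edges. 2 + interior_count 1 e)"
    by (rule sum.cong[OF refl card_edge_points])
  then show ?thesis by (simp only: sum.distrib) simp
qed

text \<open>Each edge is counted by its two facets, and the incidences of vertices with facets
  number twice the edges.\<close>

lemma sum_card_facet_points:
  "(\<Sum>F\<in>facets. card (F \<inter> int_lattice)) = 2 * card edges + 2 * (\<Sum>e\<in>edges. interior_count 1 e)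
     + (\<Sum>F\<in>facets. interior_count 1 F)"
proof -
  have "(\<Sum>F\<in>facets. card {v \<in> vertices. v \<subseteq> F}) = 2 * card edges"
  proof -
    have "(\<Sum>v\<in>vertices. \<Sum>F\<in>{F \<in> facets. v \<subseteq> F}. 1) = (\<Sum>F\<in>facets. \<Sum>v\<in>{v \<in> vertices. v \<subseteq> F}. 1 :: nat)"
      by (rule sum.swap_restrict) (simp_all add: fin)
    then show ?thesis using sum_vertices_incidence by simp
  qed
  moreover have "(\<Sum>F\<in>facets. \<Sum>e\<in>{e \<in> edges. e \<subseteq> F}. interior_count 1 e) = 2 * (\<Sum>e\<in>edges. interior_count 1 e)"
  proof -
    have "(\<Sum>F\<in>facets. \<Sum>e\<in>{e \<in> edges. e \<subseteq> F}. interior_count 1 e)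
        = (\<Sum>e\<in>edges. \<Sum>F\<in>{F \<in> facets. e \<subseteq> F}. interior_count 1 e)"
      by (rule sum.swap_restrict) (simp_all add: fin)
    then show ?thesis by (simp add: card_facets_edge sum_distrib_left)
  qed
  ultimately show ?thesis by (simp add: card_facet_points sum.distrib)
qed

text \<open>In degree one the lattice points on the boundary cancel and Euler's relation removes the
  remaining face numbers, leaving only the interior points. From degree two on the
  \<open>g\<close>-polynomials and the edges no longer contribute, from degree three on neither do
  the facets.\<close>

lemma local_hstar_coeffs:
  "coeff (local_hstar P) 0 = 0"
  "coeff (local_hstar P) 1 = int (interior_count 1 P)"
  "coeff (local_hstar P) 2 = int (interior_count 2 P) - 4 * int (interior_count 1 P)
      - (\<Sum>F\<in>facets. int (interior_count 1 F))"
  "coeff (local_hstar P) 3 = int (interior_count 1 P)"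
  "j > 3 \<Longrightarrow> coeff (local_hstar P) j = 0"
proof -
  have P3: "aff_dim P = int 3" using dim by simp
  note hP = hstar_coeffs[OF lattice nonempty P3] hstar_reciprocity(2)[OF lattice nonempty]
  note hF = hstar_coeffs[OF facet_properties(2-4)] hstar_reciprocity(2)[OF facet_properties(2,3)]
  note he = hstar_coeffs[OF edge_properties(2-4)] hstar_reciprocity(2)[OF edge_properties(2,3)]
  note sums = local_hstar_eq coeff_diff coeff_add coeff_sum
  show "coeff (local_hstar P) 0 = 0"
    using euler by (simp add: sums hP hF he g_face_empty g_face_vertex)
  have sF: "(\<Sum>F\<in>facets. int (card (F \<inter> int_lattice))) = 2 * int (card edges)
      + 2 * (\<Sum>e\<in>edges. int (interior_count 1 e)) + (\<Sum>F\<in>facets. int (interior_count 1 F))"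
    using arg_cong[OF sum_card_facet_points, of int] by (simp add: of_nat_sum)
  have se: "(\<Sum>e\<in>edges. int (card (e \<inter> int_lattice))) = 2 * int (card edges)
      + (\<Sum>e\<in>edges. int (interior_count 1 e))"
    using arg_cong[OF sum_card_edge_points, of int] by (simp add: of_nat_sum)
  have sP: "int (card (P \<inter> int_lattice)) = int (card vertices) + (\<Sum>e\<in>edges. int (interior_count 1 e))
     + (\<Sum>F\<in>facets. int (interior_count 1 F)) + int (interior_count 1 P)"
    using arg_cong[OF card_points, of int] by (simp add: of_nat_sum)
  have 1: "coeff (hstar P) 1 = int (card (P \<inter> int_lattice)) - 4" using hP(1) by simp
  have 2: "(\<Sum>F\<in>facets. coeff (hstar F) 1) = (\<Sum>F\<in>facets. int (card (F \<inter> int_lattice))) - 3 * int (card facets)"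
    using hF(1) by (simp add: sum_subtractf)
  have 3: "(\<Sum>e\<in>edges. coeff (hstar e) 1) = (\<Sum>e\<in>edges. int (card (e \<inter> int_lattice))) - 2 * int (card edges)"
    using he(1) by (simp add: sum_subtractf)
  have 4: "coeff (g_face P {}) 1 - (\<Sum>v\<in>vertices. coeff (g_face P v) 1) = 2 - 2 * int (card facets) + int (card edges)"
    by (simp add: g_face_empty g_face_vertex)
  have "coeff (local_hstar P) 1 = (coeff (g_face P {}) 1 - (\<Sum>v\<in>vertices. coeff (g_face P v) 1))
      + (\<Sum>e\<in>edges. coeff (hstar e) 1) - (\<Sum>F\<in>facets. coeff (hstar F) 1) + coeff (hstar P) 1"
    by (simp only: sums)
  then show "coeff (local_hstar P) 1 = int (interior_count 1 P)"
    unfolding 1 2 3 4 sF se sP using euler by linarith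
  have z: "coeff (g_face P {}) j = 0" "v \<in> vertices \<Longrightarrow> coeff (g_face P v) j = 0"
    "e \<in> edges \<Longrightarrow> coeff (hstar e) j = 0" if "j \<ge> 2" for j v e
    using that he(4)[of e j] by (auto simp: g_face_empty g_face_vertex coeff_pCons split: nat.splits)
  show "coeff (local_hstar P) 2 = int (interior_count 2 P) - 4 * int (interior_count 1 P)
      - (\<Sum>F\<in>facets. int (interior_count 1 F))"
    using z[of 2] hP(3) hF(2) by (simp add: sums numeral_2_eq_2)
  show "coeff (local_hstar P) 3 = int (interior_count 1 P)"
    using z[of 3] hP(2) hF(4)[of _ 3] by (simp add: sums)
  show "j > 3 \<Longrightarrow> coeff (local_hstar P) j = 0"
    using z[of j] hP(4)[of j] hF(4)[of _ j] by (simp add: sums)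
qed

theorem thin_iff:
  "thin P \<longleftrightarrow> interior_count 1 P = 0 \<and> interior_count 2 P = (\<Sum>F\<in>facets. interior_count 1 F)"
proof
  assume "thin P"
  then have "coeff (local_hstar P) j = 0" for j by (simp add: thin_def)
  from this[of 1] this[of 2] have 1: "interior_count 1 P = 0"
    and "int (interior_count 2 P) = int (\<Sum>F\<in>facets. interior_count 1 F)"
    unfolding local_hstar_coeffs of_nat_sum by simp_all
  from this(2) have "interior_count 2 P = (\<Sum>F\<in>facets. interior_count 1 F)" by (rule of_nat_eq_iff[THEN iffD1])
  with 1 show "interior_count 1 P = 0 \<and> interior_count 2 P = (\<Sum>F\<in>facets. interior_count 1 F)" by blast
next
  assume *: "interior_count 1 P = 0 \<and> interior_count 2 P = (\<Sum>F\<in>facets. interior_count 1 F)"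
  have "coeff (local_hstar P) j = 0" for j
  proof -
    have "j = 0 \<or> j = 1 \<or> j = 2 \<or> j = 3 \<or> j > 3" by linarith
    then show ?thesis using * local_hstar_coeffs by auto
  qed
  then show "thin P" by (simp add: thin_def poly_eq_iff)
qed

text \<open>The coefficient in degree three counts the interior points of \<open>P\<close>, which
  must vanish too; this follows because twice an interior point of \<open>P\<close> is an interior
  point of the double.\<close>

theorem lattice_degree_le_1_iff: "lattice_degree P \<le> 1 \<longleftrightarrow> interior_count 2 P = 0"
proof -
  have P3: "aff_dim P = int 3" using dim by simp
  note hP = hstar_coeffs[OF lattice nonempty P3]
  have 2: "coeff (hstar P) 2 = int (interior_count 2 P) - 4 * int (interior_count 1 P)"
    using hP(3) by simp
  show ?thesis
  proof
    assume "lattice_degree P \<le> 1"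
    then have "coeff (hstar P) 2 = 0" "coeff (hstar P) 3 = 0" by (auto simp: lattice_degree_def coeff_eq_0)
    then show "interior_count 2 P = 0" using 2 hP(2) by simp
  next
    assume *: "interior_count 2 P = 0"
    then have "interior_count 1 P = 0"
      using interior_count_1_eq_0_if_2 polytope_imp_bounded[OF polytope] by blast
    then have "coeff (hstar P) j = 0" if "j > 1" for j
    proof -
      have "j = 2 \<or> j = 3 \<or> j > 3" using that by linarith
      then show ?thesis using * \<open>interior_count 1 P = 0\<close> 2 hP(2,4) by auto
    qed
    then show "lattice_degree P \<le> 1" unfolding lattice_degree_def by (intro degree_le) simp
  qed
qed

end

section \<open>Interior lattice points of facets and of the double\<close>

text \<open>From any \<open>x\<close> the segment to \<open>w\<close> can be prolonged inside
  \<open>S\<close>; if the value at \<open>x\<close> were smaller, it would exceed \<open>m\<close>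
  beyond \<open>w\<close>.\<close>

lemma functional_max_rel_interior:
  fixes c :: "'a::euclidean_space"
  assumes "convex S" "\<And>x. x \<in> S \<Longrightarrow> c \<bullet> x \<le> m" "w \<in> rel_interior S" "c \<bullet> w = m" "x \<in> S"
  shows "c \<bullet> x = m"
proof -
  have "S \<noteq> {}" using assms(5) by blast
  then obtain e where e: "e > 1" "(1 - e) *\<^sub>R x + e *\<^sub>R w \<in> S"
    using convex_rel_interior_iff[OF assms(1)] assms(3,5) by blast
  have "c \<bullet> ((1 - e) *\<^sub>R x + e *\<^sub>R w) = m + (e - 1) * (m - c \<bullet> x)"
    using assms(4) by (simp add: inner_add_right algebra_simps)
  then have "(e - 1) * (m - c \<bullet> x) \<le> 0" using assms(2)[OF e(2)] by simp
  then have "m - c \<bullet> x \<le> 0" using e(1) by (simp add: mult_le_0_iff)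
  then show ?thesis using assms(2)[OF assms(5)] by simp
qed

text \<open>A generic \<open>c\<close> avoids the finitely many hyperplanes orthogonal to the
  differences of points of \<open>X\<close>.\<close>

lemma exists_inner_inj_on:
  fixes X :: "'a::euclidean_space set"
  assumes "finite X"
  shows "\<exists>c. inj_on (\<lambda>x. c \<bullet> x) X"
proof -
  define \<H> where "\<H> = (\<lambda>(x, y). {c. (x - y) \<bullet> c = 0}) ` {(x, y) \<in> X \<times> X. x \<noteq> y}"
  have "\<exists>c\<in>rel_interior (UNIV :: 'a set). \<forall>H\<in>\<H>. c \<notin> H"
  proof (rule exists_rel_interior_avoiding_affine)
    have "finite {(x, y) \<in> X \<times> X. x \<noteq> y}" by (rule finite_subset[of _ "X \<times> X"]) (use assms in auto)
    then show "finite \<H>" by (simp add: \<H>_def)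
    fix H assume "H \<in> \<H>"
    then obtain x y where xy: "x \<noteq> y" "H = {c. (x - y) \<bullet> c = 0}" by (auto simp: \<H>_def)
    have "x - y \<notin> H" using xy by simp
    moreover have "affine H" unfolding xy(2) by (rule affine_hyperplane)
    ultimately show "affine H \<and> \<not> UNIV \<subseteq> H" by blast
  qed auto
  then obtain c where c: "\<And>H. H \<in> \<H> \<Longrightarrow> c \<notin> H" by blast
  have "inj_on (\<lambda>x. c \<bullet> x) X"
  proof (rule inj_onI, rule ccontr)
    fix x y assume "x \<in> X" "y \<in> X" "c \<bullet> x = c \<bullet> y" "x \<noteq> y"
    moreover from this have "{c. (x - y) \<bullet> c = 0} \<in> \<H>"
      unfolding \<H>_def by (intro rev_image_eqI[of "(x, y)"]) auto
    moreover have "(x - y) \<bullet> c = 0"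
      using \<open>c \<bullet> x = c \<bullet> y\<close> by (metis inner_commute inner_diff_left right_minus_eq)
    ultimately show False using c by blast
  qed
  then show ?thesis by blast
qed

text \<open>Order the points by a generic functional. The translate of \<open>B\<close> by the
  smallest \<open>a\<close> and the translate of \<open>A\<close> by the largest \<open>b\<close>
  have only \<open>a + b\<close> in common.\<close>

lemma card_sumset_ge:
  fixes A B C :: "'a::euclidean_space set"
  assumes "finite A" "finite B" "A \<noteq> {}" "B \<noteq> {}" "finite C" "\<And>a b. a \<in> A \<Longrightarrow> b \<in> B \<Longrightarrow> a + b \<in> C"
  shows "card A + card B \<le> card C + 1"
proof -
  obtain c where c: "inj_on (\<lambda>x. c \<bullet> x) (A \<union> B)" using exists_inner_inj_on assms by blast
  have "Min ((\<lambda>x. c \<bullet> x) ` A) \<in> (\<lambda>x. c \<bullet> x) ` A" using assms by (intro Min_in) auto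
  then obtain a where "a \<in> A" "Min ((\<lambda>x. c \<bullet> x) ` A) = c \<bullet> a" by blast
  then have a: "a \<in> A" "\<And>x. x \<in> A \<Longrightarrow> c \<bullet> a \<le> c \<bullet> x" using assms(1) by (metis Min_le finite_imageI imageI)+
  have "Max ((\<lambda>x. c \<bullet> x) ` B) \<in> (\<lambda>x. c \<bullet> x) ` B" using assms by (intro Max_in) auto
  then obtain b where "b \<in> B" "Max ((\<lambda>x. c \<bullet> x) ` B) = c \<bullet> b" by blast
  then have b: "b \<in> B" "\<And>x. x \<in> B \<Longrightarrow> c \<bullet> x \<le> c \<bullet> b" using assms(2) by (metis Max_ge finite_imageI imageI)+
  let ?S = "(+) a ` B" and ?T = "(\<lambda>x. x + b) ` A"
  have "?S \<inter> ?T \<subseteq> {a + b}"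
  proof
    fix z assume "z \<in> ?S \<inter> ?T"
    then obtain x y where xy: "y \<in> B" "x \<in> A" "z = a + y" "a + y = x + b" by auto
    have "c \<bullet> a + c \<bullet> y = c \<bullet> x + c \<bullet> b" using arg_cong[OF xy(4), of "\<lambda>t. c \<bullet> t"] by (simp add: inner_add_right)
    then have "c \<bullet> y = c \<bullet> b" using a(2)[OF xy(2)] b(2)[OF xy(1)] by linarith
    then have "y = b" using c xy(1) b(1) by (auto dest: inj_onD)
    then show "z \<in> {a + b}" using xy by simp
  qed
  then have "card (?S \<inter> ?T) \<le> 1" using card_mono[of "{a + b}"] by simp
  moreover have "card (?S \<union> ?T) + card (?S \<inter> ?T) = card ?S + card ?T"
    using card_Un_Int[of ?S ?T] assms by simp
  moreover have "card ?S = card B" "card ?T = card A" by (auto intro!: card_image inj_onI)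
  moreover have "card (?S \<union> ?T) \<le> card C"
    using assms a(1) b(1) by (intro card_mono) auto
  ultimately show ?thesis by linarith
qed

context lattice_polytope_3
begin

definition double_points :: "'a set" where
  "double_points = (\<lambda>x. 2 *\<^sub>R x) ` rel_interior P \<inter> int_lattice"

definition facet_points :: "'a set \<Rightarrow> 'a set" where
  "facet_points F = rel_interior F \<inter> int_lattice"

definition nonhollow_facets :: "'a set set" where
  "nonhollow_facets = {F \<in> facets. facet_points F \<noteq> {}}"

lemma interior_count_facet_points: "interior_count 1 F = card (facet_points F)"
  by (simp add: interior_count_def facet_points_def)

lemma interior_count_double_points: "interior_count 2 P = card double_points"
  by (simp add: interior_count_def double_points_def)

lemma finite_double_points: "finite double_points"
proof -
  have "bounded (rel_interior P)"
    by (rule bounded_subset[OF polytope_imp_bounded[OF polytope] rel_interior_subset])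
  then show ?thesis unfolding double_points_def by (intro finite_bounded_int_lattice bounded_scaling)
qed

lemma finite_points: "finite (P \<inter> int_lattice)"
  by (rule finite_bounded_int_lattice[OF polytope_imp_bounded[OF polytope]])

lemma facet_points_subset: "F \<in> facets \<Longrightarrow> facet_points F \<subseteq> F" "F \<in> facets \<Longrightarrow> facet_points F \<subseteq> P \<inter> int_lattice"
  using facet_properties(5) rel_interior_subset by (force simp: facet_points_def)+

lemma finite_facet_points: "F \<in> facets \<Longrightarrow> finite (facet_points F)"
  using facet_points_subset(2) finite_points finite_subset by blast

lemma facet_not_subset:
  assumes "F \<in> facets" "G \<in> facets" "F \<noteq> G"
  shows "\<not> F \<subseteq> G"
  using face_aff_dim_less[OF facet_properties(1)[OF assms(1)] facet_properties(1)[OF assms(2)]]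
    facet_properties(4)[OF assms(1)] facet_properties(4)[OF assms(2)] assms(3) by auto

lemma facet_point_notin:
  assumes "F \<in> facets" "G \<in> facets" "F \<noteq> G" "w \<in> rel_interior F"
  shows "w \<notin> G"
  using subset_of_face_of[OF facet_properties(1)[OF assms(2)] facet_properties(5)[OF assms(1)]]
    facet_not_subset[OF assms(1-3)] assms(4) by blast

text \<open>The midpoint of \<open>w\<close> and \<open>y\<close> lies in the relative interior of a
  face that contains both. As \<open>w\<close> is interior to \<open>F\<close>, this face contains
  all of \<open>F\<close> and also \<open>y\<close>, so it is \<open>P\<close>.\<close>

lemma facet_plus_point:
  assumes F: "F \<in> facets" and w: "w \<in> facet_points F" and y: "y \<in> P \<inter> int_lattice" "y \<notin> F"
  shows "w + y \<in> double_points"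
proof -
  define m where "m = (1/2) *\<^sub>R (w + y)"
  have wF: "w \<in> rel_interior F" "w \<in> F" "w \<in> P" using w facet_points_subset[OF F] by (auto simp: facet_points_def)
  have "w \<noteq> y" using wF y by auto
  have mseg: "m = (1 - 1/2) *\<^sub>R w + (1/2) *\<^sub>R y" by (simp add: m_def algebra_simps)
  then have "m \<in> open_segment w y"
    using \<open>w \<noteq> y\<close> unfolding in_segment by (intro conjI exI[of _ "1/2"]) auto
  have "m \<in> P" using convexD_alt[OF convex wF(3), of y "1/2"] y mseg by simp
  then obtain G where G: "G face_of P" "m \<in> rel_interior G" by (rule polytope_rel_interior_face[OF polytope])
  have wy: "w \<in> G" "y \<in> G"
    using face_ofD[OF G(1) \<open>m \<in> open_segment w y\<close>] wF y G(2) rel_interior_subset[of G] by blast+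
  have "F \<subseteq> G" using subset_of_face_of[OF G(1) facet_properties(5)[OF F]] wF wy by blast
  then have "F \<subset> G" using wy y by blast
  then have "aff_dim G > 2" using face_aff_dim_less[OF facet_properties(1)[OF F] G(1)] facet_properties(4)[OF F] by simp
  then have "G = P" using face_cases[THEN iffD1, OF G(1)] by (auto simp: faces_dim_def)
  then have "m \<in> rel_interior P" using G by simp
  moreover have "w + y = 2 *\<^sub>R m" by (simp add: m_def)
  moreover have "w + y \<in> int_lattice" using w y by (auto simp: facet_points_def intro: int_lattice_add)
  ultimately show ?thesis by (auto simp: double_points_def)
qed

lemma facet_functional:
  assumes "F \<in> facets"
  obtains a b where "\<And>x. x \<in> P \<Longrightarrow> b \<le> a \<bullet> x" "F = {x \<in> P. a \<bullet> x = b}"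
  by (rule face_functional[OF polytope facet_properties(1,3,8)[OF assms]]) (rule that)

text \<open>\<open>vertices\<close> consists of singleton faces of \<open>P\<close>; the sums below
  need the points themselves, and for any face.\<close>

definition corners :: "'a set \<Rightarrow> 'a set" where
  "corners F = {v. v extreme_point_of F}"

lemma corners:
  assumes F: "F face_of P"
  shows "F = convex hull (corners F)" "corners F \<subseteq> F" "corners F \<subseteq> P \<inter> int_lattice"
proof -
  have "polytope F" by (rule face_of_polytope_polytope[OF polytope F])
  then show "F = convex hull (corners F)"
    unfolding corners_def by (intro Krein_Milman_Minkowski polytope_imp_compact polytope_imp_convex)
  show 1: "corners F \<subseteq> F" by (auto simp: corners_def extreme_point_of_def)
  show "corners F \<subseteq> P \<inter> int_lattice"
    using 1 face_of_imp_subset[OF F] extreme_point_lattice_polytope[OF lattice_polytope_face[OF lattice F]]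
    by (auto simp: corners_def)
qed

lemma corner_notin_facet_points:
  assumes "F \<in> facets" "v \<in> corners F"
  shows "v \<notin> facet_points F"
proof -
  have "F \<noteq> {v}" using facet_properties(4)[OF assms(1)] by auto
  then show ?thesis
    using extreme_point_not_in_REL_INTERIOR[of v F] assms by (auto simp: corners_def facet_points_def)
qed

lemma exists_corner_notin:
  assumes "F face_of P" "G face_of P" "\<not> F \<subseteq> G"
  obtains v where "v \<in> corners F" "v \<notin> G"
proof -
  have "\<not> corners F \<subseteq> G"
    using hull_minimal[of "corners F" G convex] corners(1)[OF assms(1)] face_of_imp_convex[OF assms(2)] assms(3) by auto
  then show thesis using that by blast
qed

lemma corners_facet_not_pair:
  assumes "F \<in> facets"
  shows "\<not> corners F \<subseteq> {v, v'}"
proof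
  assume *: "corners F \<subseteq> {v, v'}"
  have "aff_dim F = aff_dim (corners F)" using corners(1)[OF facet_properties(1)[OF assms]] aff_dim_convex_hull by metis
  also have "\<dots> \<le> aff_dim {v, v'}" by (rule aff_dim_subset[OF *])
  also have "\<dots> \<le> 1" by (simp add: aff_dim_2)
  finally show False using facet_properties(4)[OF assms] by simp
qed

text \<open>All other corners lie where the functional of \<open>G\<close> is minimal, so on
  \<open>F\<close> its maximum is at \<open>v\<close>. A relative interior point attaining it would
  make it constant on \<open>F\<close>, against a second corner.\<close>

lemma facet_functional_corner_max:
  assumes F: "F \<in> facets" and a: "\<And>x. x \<in> P \<Longrightarrow> b \<le> a \<bullet> x" "G = {x \<in> P. a \<bullet> x = b}"
    and v: "v \<in> corners F" "v \<notin> G" and others: "\<And>x. x \<in> corners F \<Longrightarrow> x \<noteq> v \<Longrightarrow> x \<in> G"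
    and w: "w \<in> facet_points F"
  shows "a \<bullet> w < a \<bullet> v"
proof -
  note cF = corners[OF facet_properties(1)[OF F]]
  have vb: "b < a \<bullet> v" using a v cF by (auto simp: less_le)
  have le: "a \<bullet> x \<le> a \<bullet> v" if "x \<in> F" for x
  proof -
    have "corners F \<subseteq> {x. a \<bullet> x \<le> a \<bullet> v}" using others a(2) vb by force
    then have "F \<subseteq> {x. a \<bullet> x \<le> a \<bullet> v}"
      using hull_minimal[of "corners F" "{x. a \<bullet> x \<le> a \<bullet> v}" convex] cF(1) convex_halfspace_le by auto
    then show ?thesis using that by blast
  qed
  have "a \<bullet> w \<noteq> a \<bullet> v"
  proof
    assume *: "a \<bullet> w = a \<bullet> v"
    obtain x where x: "x \<in> corners F" "x \<noteq> v" using corners_facet_not_pair[OF F, of v v] by blast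
    then have "a \<bullet> x = a \<bullet> v"
      using functional_max_rel_interior[OF facet_properties(7)[OF F] le _ *, of x] w cF by (auto simp: facet_points_def)
    then show False using others[OF x] a(2) vb by auto
  qed
  moreover have "w \<in> F" using w facet_points_subset[OF F] by blast
  ultimately show ?thesis using le[of w] by simp
qed

text \<open>If one facet has two corners off the other, these join its interior points as summands
  and the sumset bound gives the required surplus. Otherwise each facet has a single corner off the
  other, and the sums with these two corners, together with one sum of interior points, are told
  apart by the two facet functionals.\<close>

lemma card_double_points_two_facets:
  assumes F: "F1 \<in> facets" "F2 \<in> facets" "F1 \<noteq> F2" and ne: "facet_points F1 \<noteq> {}" "facet_points F2 \<noteq> {}"
  shows "card (facet_points F1) + card (facet_points F2) < card double_points"
proof -
  have *: "card (facet_points F) + card (facet_points G) < card double_points \<or>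
      (\<exists>v\<in>corners G. v \<notin> F \<and> (\<forall>x\<in>corners G. x \<noteq> v \<longrightarrow> x \<in> F))"
    if F: "F \<in> facets" "G \<in> facets" "F \<noteq> G" "facet_points F \<noteq> {}" for F G
  proof -
    let ?B = "(G - F) \<inter> int_lattice"
    obtain v where v: "v \<in> corners G" "v \<notin> F"
      using exists_corner_notin[OF facet_properties(1)[OF F(2)] facet_properties(1)[OF F(1)] facet_not_subset[OF F(2,1)]] F(3) by metis
    note cG = corners[OF facet_properties(1)[OF F(2)]]
    have GP: "G \<subseteq> P" by (rule facet_properties(5)[OF F(2)])
    have finB: "finite ?B" using finite_points GP by (rule_tac finite_subset[of _ "P \<inter> int_lattice"]) auto
    have WB: "facet_points G \<subseteq> ?B"
      using facet_point_notin[OF F(2,1)] F(3) facet_points_subset[OF F(2)] by (auto simp: facet_points_def)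
    show ?thesis
    proof (cases "\<exists>x\<in>corners G. x \<noteq> v \<and> x \<notin> F")
      case True
      then obtain x where x: "x \<in> corners G" "x \<noteq> v" "x \<notin> F" by blast
      have "insert x (insert v (facet_points G)) \<subseteq> ?B" using WB x v cG by auto
      then have "card (insert x (insert v (facet_points G))) \<le> card ?B" by (rule card_mono[OF finB])
      moreover have "card (insert x (insert v (facet_points G))) = card (facet_points G) + 2"
        using x v corner_notin_facet_points[OF F(2)] finite_facet_points[OF F(2)] by simp
      moreover have "card (facet_points F) + card ?B \<le> card double_points + 1"
      proof (rule card_sumset_ge[OF finite_facet_points[OF F(1)] finB F(4) _ finite_double_points])
        show "?B \<noteq> {}" using v cG by auto
        show "a + b \<in> double_points" if "a \<in> facet_points F" "b \<in> ?B" for a b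
          using facet_plus_point[OF F(1) that(1), of b] that(2) GP by auto
      qed
      ultimately show ?thesis by linarith
    next
      case False
      then show ?thesis using v by blast
    qed
  qed
  from *[OF F ne(1)] show ?thesis
  proof
    assume "\<exists>v\<in>corners F2. v \<notin> F1 \<and> (\<forall>x\<in>corners F2. x \<noteq> v \<longrightarrow> x \<in> F1)"
    then obtain v2 where v2: "v2 \<in> corners F2" "v2 \<notin> F1" "\<And>x. x \<in> corners F2 \<Longrightarrow> x \<noteq> v2 \<Longrightarrow> x \<in> F1" by blast
    from *[OF F(2,1) F(3)[symmetric] ne(2)] show ?thesis
    proof
      assume "\<exists>v\<in>corners F1. v \<notin> F2 \<and> (\<forall>x\<in>corners F1. x \<noteq> v \<longrightarrow> x \<in> F2)"
      then obtain v1 where v1: "v1 \<in> corners F1" "v1 \<notin> F2" "\<And>x. x \<in> corners F1 \<Longrightarrow> x \<noteq> v1 \<Longrightarrow> x \<in> F2" by blast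
      obtain a1 b1 where a1: "\<And>x. x \<in> P \<Longrightarrow> b1 \<le> a1 \<bullet> x" "F1 = {x \<in> P. a1 \<bullet> x = b1}"
        by (rule facet_functional[OF F(1)]) (rule that)
      obtain a2 b2 where a2: "\<And>x. x \<in> P \<Longrightarrow> b2 \<le> a2 \<bullet> x" "F2 = {x \<in> P. a2 \<bullet> x = b2}"
        by (rule facet_functional[OF F(2)]) (rule that)
      have lt2: "a1 \<bullet> w < a1 \<bullet> v2" if "w \<in> facet_points F2" for w
        by (rule facet_functional_corner_max[OF F(2) a1 v2 that])
      have lt1: "a2 \<bullet> w < a2 \<bullet> v1" if "w \<in> facet_points F1" for w
        by (rule facet_functional_corner_max[OF F(1) a2 v1 that])
      have e1: "a1 \<bullet> x = b1" if "x \<in> F1" for x using that a1(2) by blast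
      have e2: "a2 \<bullet> x = b2" if "x \<in> F2" for x using that a2(2) by blast
      obtain w1 w2 where w: "w1 \<in> facet_points F1" "w2 \<in> facet_points F2" using ne by blast
      have sub1: "facet_points F1 \<subseteq> F1" and sub2: "facet_points F2 \<subseteq> F2" using facet_points_subset F by auto
      have vF: "v1 \<in> F1" "v2 \<in> F2" "v1 \<in> P \<inter> int_lattice" "v2 \<in> P \<inter> int_lattice"
        using v1 v2 corners(2,3)[OF facet_properties(1)] F by blast+
      \<comment> \<open>The functional \<open>a1\<close> is constant on \<open>F1\<close> and
        largest on \<open>F2\<close> at \<open>v2\<close>, so it is greater on \<open>?T\<close>
        than on \<open>?S\<close> and than at \<open>w1 + w2\<close>. In the same way
        \<open>a2\<close> separates \<open>?S\<close> from \<open>w1 + w2\<close>.\<close>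
      let ?S = "(+) v1 ` facet_points F2" and ?T = "(\<lambda>x. x + v2) ` facet_points F1"
      have "?S \<subseteq> double_points"
        using facet_plus_point[OF F(2) _ vF(3) v1(2)] by (auto simp: add.commute)
      moreover have "?T \<subseteq> double_points"
        using facet_plus_point[OF F(1) _ vF(4) v2(2)] by auto
      moreover have "w1 + w2 \<in> double_points"
        using facet_plus_point[OF F(1) w(1), of w2] w(2) facet_points_subset(2)[OF F(2)]
          facet_point_notin[OF F(2,1) F(3)[symmetric], of w2] by (auto simp: facet_points_def)
      ultimately have "card (insert (w1 + w2) (?S \<union> ?T)) \<le> card double_points"
        by (intro card_mono finite_double_points) auto
      moreover have "?S \<inter> ?T = {}"
      proof (rule ccontr)
        assume "?S \<inter> ?T \<noteq> {}"
        then obtain x y where xy: "x \<in> facet_points F2" "y \<in> facet_points F1" "v1 + x = y + v2" by auto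
        have "a1 \<bullet> v1 + a1 \<bullet> x = a1 \<bullet> y + a1 \<bullet> v2"
          using arg_cong[OF xy(3), of "\<lambda>t. a1 \<bullet> t"] by (simp add: inner_add_right)
        moreover have "a1 \<bullet> y = b1" "a1 \<bullet> v1 = b1" using e1 xy(2) sub1 vF(1) by blast+
        ultimately show False using lt2[OF xy(1)] by linarith
      qed
      moreover have "w1 + w2 \<notin> ?S"
      proof
        assume "w1 + w2 \<in> ?S"
        then obtain x where x: "x \<in> facet_points F2" "w1 + w2 = v1 + x" by auto
        have "a2 \<bullet> w1 + a2 \<bullet> w2 = a2 \<bullet> v1 + a2 \<bullet> x"
          using arg_cong[OF x(2), of "\<lambda>t. a2 \<bullet> t"] by (simp add: inner_add_right)
        moreover have "a2 \<bullet> x = b2" "a2 \<bullet> w2 = b2" using e2 x(1) sub2 w(2) by blast+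
        ultimately show False using lt1[OF w(1)] by linarith
      qed
      moreover have "w1 + w2 \<notin> ?T"
      proof
        assume "w1 + w2 \<in> ?T"
        then obtain x where x: "x \<in> facet_points F1" "w1 + w2 = x + v2" by auto
        have "a1 \<bullet> w1 + a1 \<bullet> w2 = a1 \<bullet> x + a1 \<bullet> v2"
          using arg_cong[OF x(2), of "\<lambda>t. a1 \<bullet> t"] by (simp add: inner_add_right)
        moreover have "a1 \<bullet> x = b1" "a1 \<bullet> w1 = b1" using e1 x(1) sub1 w(1) by blast+
        ultimately show False using lt2[OF w(2)] by linarith
      qed
      moreover have "card ?S = card (facet_points F2)" "card ?T = card (facet_points F1)"
        by (auto intro!: card_image inj_onI)
      moreover have "finite ?S" "finite ?T" using finite_facet_points F by auto
      ultimately show ?thesis by (simp add: card_Un_disjoint)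
    qed simp
  qed
qed

lemma facet_points_plus:
  assumes "F \<in> facets" "G \<in> facets" "F \<noteq> G" "x \<in> facet_points F" "y \<in> facet_points G"
  shows "x + y \<in> double_points"
  using facet_plus_point[OF assms(1,4), of y] facet_points_subset(2)[OF assms(2)] assms(5)
    facet_point_notin[OF assms(2,1) assms(3)[symmetric], of y]
  by (auto simp: facet_points_def)

lemma facet_points_disjoint:
  assumes "F \<in> facets" "G \<in> facets" "F \<noteq> G"
  shows "facet_points F \<inter> facet_points G = {}"
proof -
  have "x \<notin> facet_points G" if "x \<in> facet_points F" for x
    using facet_point_notin[OF assms] that facet_points_subset(1)[OF assms(2)] by (auto simp: facet_points_def)
  then show ?thesis by blast
qed

lemma nonhollow_facetsD: "F \<in> nonhollow_facets \<Longrightarrow> F \<in> facets" "F \<in> nonhollow_facets \<Longrightarrow> facet_points F \<noteq> {}"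
  by (auto simp: nonhollow_facets_def)

lemma finite_nonhollow_facets: "finite nonhollow_facets"
  unfolding nonhollow_facets_def using fin by simp

lemma card_Union_facet_points:
  assumes "\<Psi> \<subseteq> facets"
  shows "card (\<Union>(facet_points ` \<Psi>)) = (\<Sum>F\<in>\<Psi>. card (facet_points F))"
proof (rule card_UN_disjoint)
  show "finite \<Psi>" by (rule finite_subset[OF assms fin])
  show "\<forall>F\<in>\<Psi>. finite (facet_points F)" using finite_facet_points assms by blast
  show "\<forall>F\<in>\<Psi>. \<forall>G\<in>\<Psi>. F \<noteq> G \<longrightarrow> facet_points F \<inter> facet_points G = {}"
    using facet_points_disjoint assms by blast
qed

lemma sum_interior_count_facets: "(\<Sum>F\<in>facets. interior_count 1 F) = (\<Sum>F\<in>nonhollow_facets. card (facet_points F))"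
  unfolding interior_count_facet_points
  by (rule sum.mono_neutral_right) (auto simp: nonhollow_facets_def fin)

lemma sum_nonhollow_remove:
  assumes "F \<in> nonhollow_facets"
  shows "(\<Sum>F\<in>nonhollow_facets. card (facet_points F))
    = card (facet_points F) + card (\<Union>(facet_points ` (nonhollow_facets - {F})))"
proof -
  have "nonhollow_facets - {F} \<subseteq> facets" by (auto dest: nonhollow_facetsD)
  then show ?thesis
    using sum.remove[OF finite_nonhollow_facets assms] card_Union_facet_points by simp
qed

text \<open>The sums of \<open>Y\<close> and \<open>X\<close> number at least
  \<open>card Y + card X - 1\<close>. At least two more are \<open>M + x'\<close> with
  \<open>x'\<close> in \<open>X'\<close>, where \<open>M\<close> is a point of \<open>X\<close>
  highest above \<open>F\<close>: since \<open>x'\<close> is off \<open>F\<close>, such a sum is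
  higher than all of the former.\<close>

lemma card_double_points_levels:
  assumes F: "F \<in> nonhollow_facets" and other: "nonhollow_facets - {F} \<noteq> {}"
    and big: "\<And>G. G \<in> nonhollow_facets - {F} \<Longrightarrow> 2 \<le> card (\<Union>(facet_points ` (nonhollow_facets - {F, G})))"
  shows "(\<Sum>F\<in>nonhollow_facets. card (facet_points F)) < card double_points"
proof -
  note Ff = nonhollow_facetsD[OF F]
  define X where "X = \<Union>(facet_points ` (nonhollow_facets - {F}))"
  have finX: "finite X" unfolding X_def using finite_nonhollow_facets finite_facet_points nonhollow_facetsD by auto
  have X0: "X \<noteq> {}" using other nonhollow_facetsD unfolding X_def by fastforce
  have XE: "\<exists>G. G \<in> nonhollow_facets \<and> G \<in> facets \<and> G \<noteq> F \<and> x \<in> facet_points G" if "x \<in> X" for x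
    using that nonhollow_facetsD unfolding X_def by blast
  obtain a b where ab: "\<And>x. x \<in> P \<Longrightarrow> b \<le> a \<bullet> x" "F = {x \<in> P. a \<bullet> x = b}"
    by (rule facet_functional[OF Ff(1)]) (rule that)
  have pos: "b < a \<bullet> x" if x: "x \<in> X" for x
  proof -
    obtain G where G: "G \<in> facets" "G \<noteq> F" "x \<in> facet_points G" using XE[OF x] by blast
    then have "x \<in> P" "x \<notin> F"
      using facet_points_subset(2) facet_point_notin[OF G(1) Ff(1) G(2), of x] by (auto simp: facet_points_def)
    then show ?thesis using ab by (auto simp: less_le)
  qed
  have "Max ((\<lambda>x. a \<bullet> x) ` X) \<in> (\<lambda>x. a \<bullet> x) ` X" using finX X0 by (intro Max_in) auto
  then obtain M where "M \<in> X" "Max ((\<lambda>x. a \<bullet> x) ` X) = a \<bullet> M" by blast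
  then have M: "M \<in> X" "\<And>x. x \<in> X \<Longrightarrow> a \<bullet> x \<le> a \<bullet> M" using finX by (metis Max_ge finite_imageI imageI)+
  obtain G where G: "G \<in> nonhollow_facets" "G \<in> facets" "G \<noteq> F" "M \<in> facet_points G" using XE[OF M(1)] by blast
  define X' where "X' = \<Union>(facet_points ` (nonhollow_facets - {F, G}))"
  have X'X: "X' \<subseteq> X" unfolding X'_def X_def by blast
  have finX': "finite X'" using finX X'X finite_subset by blast
  have "2 \<le> card X'" unfolding X'_def using big G by blast
  define Y where "Y = facet_points F"
  define Z where "Z = (\<lambda>(y, x). y + x) ` (Y \<times> X)"
  have Zd: "Z \<subseteq> double_points"
  proof -
    have "y + x \<in> double_points" if "y \<in> Y" "x \<in> X" for x y
      using XE[OF that(2)] facet_points_plus[OF Ff(1)] that(1) unfolding Y_def by blast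
    then show ?thesis by (auto simp: Z_def)
  qed
  have finZ: "finite Z" using Zd finite_double_points finite_subset by blast
  have cZ: "card Y + card X \<le> card Z + 1"
    using card_sumset_ge[of Y X Z] finite_facet_points[OF Ff(1)] Ff(2) finX X0 finZ by (auto simp: Y_def Z_def)
  have Td: "(+) M ` X' \<subseteq> double_points"
  proof
    fix t assume "t \<in> (+) M ` X'"
    then obtain H x where "H \<in> nonhollow_facets" "H \<noteq> G" "x \<in> facet_points H" "t = M + x"
      unfolding X'_def by blast
    then show "t \<in> double_points" using facet_points_plus[OF G(2) _ _ G(4), of H x] nonhollow_facetsD by blast
  qed
  have "Z \<inter> (+) M ` X' = {}"
  proof (rule ccontr)
    assume "Z \<inter> (+) M ` X' \<noteq> {}"
    then obtain y x x' where *: "y \<in> Y" "x \<in> X" "x' \<in> X'" "y + x = M + x'" unfolding Z_def by fastforce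
    have "a \<bullet> y + a \<bullet> x = a \<bullet> M + a \<bullet> x'" using arg_cong[OF *(4), of "\<lambda>t. a \<bullet> t"] by (simp add: inner_add_right)
    moreover have "a \<bullet> y = b" using *(1) facet_points_subset(1)[OF Ff(1)] ab(2) unfolding Y_def by blast
    moreover have "b < a \<bullet> x'" using pos X'X *(3) by blast
    ultimately show False using M(2)[OF *(2)] by linarith
  qed
  then have "card Z + card ((+) M ` X') = card (Z \<union> (+) M ` X')"
    using finZ finX' by (intro card_Un_disjoint[symmetric]) auto
  also have "\<dots> \<le> card double_points" using Zd Td by (intro card_mono finite_double_points) auto
  finally have "card Z + card X' \<le> card double_points" by (simp add: card_image)
  then show ?thesis
    using cZ \<open>2 \<le> card X'\<close> sum_nonhollow_remove[OF F] unfolding X_def Y_def by linarith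
qed

text \<open>Both \<open>p\<close> and \<open>q\<close> can be added to the \<open>n\<close> interior
  points of \<open>F\<close> and to one corner of \<open>F\<close>. Without surplus, the two
  resulting sets of \<open>n + 1\<close> sums coincide, and comparing their element sums puts
  \<open>v - v'\<close> in the direction of \<open>q - p\<close>. Then \<open>v\<close> and
  \<open>v'\<close> are the only corners off \<open>G\<close> and off \<open>H\<close>, and an
  interior point of \<open>F\<close> lies on the line through them, where a nonconstant functional
  has its maximum on \<open>F\<close>.\<close>

lemma card_double_points_two_singletons:
  assumes F: "F \<in> facets" "G \<in> facets" "H \<in> facets" "F \<noteq> G" "F \<noteq> H" "G \<noteq> H"
    and ne: "facet_points F \<noteq> {}" and p: "p \<in> facet_points G" and q: "q \<in> facet_points H"
  shows "card (facet_points F) + 2 < card double_points"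
proof (rule ccontr)
  assume neg: "\<not> ?thesis"
  define Y where "Y = facet_points F"
  define n where "n = card Y"
  have finY: "finite Y" unfolding Y_def by (rule finite_facet_points[OF F(1)])
  have n1: "n \<ge> 1" using ne finY by (simp add: n_def Y_def Suc_le_eq card_gt_0_iff)
  note cF = corners[OF facet_properties(1)[OF F(1)]]
  have pP: "p \<in> P" "p \<in> int_lattice" "q \<in> P" "q \<in> int_lattice" using p q facet_points_subset(2) F by blast+
  have pF: "p \<notin> F" "q \<notin> F" "p \<notin> H"
    using facet_point_notin[OF F(2,1)] facet_point_notin[OF F(3,1)] facet_point_notin[OF F(2,3)] F p q
    by (auto simp: facet_points_def)
  have "p \<noteq> q" using q facet_points_subset(1)[OF F(3)] pF by blast
  obtain a b where ab: "\<And>x. x \<in> P \<Longrightarrow> b \<le> a \<bullet> x" "F = {x \<in> P. a \<bullet> x = b}"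
    by (rule facet_functional[OF F(1)]) (rule that)
  have gt: "b < a \<bullet> p" "b < a \<bullet> q" using ab pP pF by (auto simp: less_le)
  have YF: "Y \<subseteq> F" unfolding Y_def by (rule facet_points_subset(1)[OF F(1)])
  have key: "v + p \<in> (\<lambda>x. x + q) ` insert v' Y \<and> v = v' + real (n + 1) *\<^sub>R (q - p)"
    if v: "v \<in> corners F" "v \<notin> G" and v': "v' \<in> corners F" "v' \<notin> H" for v v'
  proof -
    let ?S = "(\<lambda>x. x + p) ` insert v Y" and ?T = "(\<lambda>x. x + q) ` insert v' Y"
    have vY: "v \<notin> Y" "v' \<notin> Y" using corner_notin_facet_points[OF F(1)] v v' by (auto simp: Y_def)
    have cS: "card ?S = n + 1" "card ?T = n + 1"
      using vY finY by (simp_all add: card_image inj_on_def n_def del: image_insert)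
    have vP: "v \<in> P \<inter> int_lattice" "v' \<in> P \<inter> int_lattice" using cF v v' by blast+
    have "?S \<subseteq> double_points"
    proof -
      have "v + p \<in> double_points" using facet_plus_point[OF F(2) p vP(1) v(2)] by (simp add: add.commute)
      moreover have "y + p \<in> double_points" if "y \<in> Y" for y
        using facet_points_plus[OF F(1,2,4) _ p] that by (simp add: Y_def)
      ultimately show ?thesis by auto
    qed
    moreover have "?T \<subseteq> double_points"
    proof -
      have "v' + q \<in> double_points" using facet_plus_point[OF F(3) q vP(2) v'(2)] by (simp add: add.commute)
      moreover have "y + q \<in> double_points" if "y \<in> Y" for y
        using facet_points_plus[OF F(1,3,5) _ q] that by (simp add: Y_def)
      ultimately show ?thesis by auto
    qed
    moreover have "p + q \<in> double_points" using facet_points_plus[OF F(2,3,6) p q] .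
    ultimately have "card (insert (p + q) (?S \<union> ?T)) \<le> card double_points"
      by (intro card_mono finite_double_points) auto
    moreover have "p + q \<notin> ?S \<union> ?T"
    proof
      assume "p + q \<in> ?S \<union> ?T"
      then have "q \<in> insert v Y \<or> p \<in> insert v' Y" by (auto simp: algebra_simps)
      then show False using pF YF cF v v' by auto
    qed
    ultimately have "card (?S \<union> ?T) \<le> n + 1" using neg finY by (simp add: n_def Y_def)
    then have "?S \<union> ?T = ?S" "?S \<union> ?T = ?T"
      using finY cS by (intro card_seteq[symmetric]; auto)+
    then have ST: "?S = ?T" by simp
    \<comment> \<open>Equal sets have equal element sums; \<open>Y\<close> cancels, and
      \<open>n + 1\<close> copies each of \<open>p\<close> and of \<open>q\<close> remain.\<close>
    have "(\<Sum>x\<in>insert v Y. x + p) = \<Sum>?S" by (subst sum.reindex) (auto simp: inj_on_def)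
    moreover have "(\<Sum>x\<in>insert v' Y. x + q) = \<Sum>?T" by (subst sum.reindex) (auto simp: inj_on_def)
    ultimately have "(\<Sum>x\<in>insert v Y. x + p) = (\<Sum>x\<in>insert v' Y. x + q)" using ST by simp
    then have "v + real (n + 1) *\<^sub>R p = v' + real (n + 1) *\<^sub>R q"
      using vY finY by (simp add: sum.distrib n_def algebra_simps sum_constant_scaleR)
    then have "v = v' + real (n + 1) *\<^sub>R (q - p)" by (simp add: scaleR_right_diff_distrib algebra_simps)
    moreover have "v + p \<in> ?T" using ST by blast
    ultimately show ?thesis by blast
  qed
  obtain v where v: "v \<in> corners F" "v \<notin> G"
    by (rule exists_corner_notin[OF facet_properties(1)[OF F(1)] facet_properties(1)[OF F(2)] facet_not_subset[OF F(1,2,4)]]) (rule that)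
  obtain v' where v': "v' \<in> corners F" "v' \<notin> H"
    by (rule exists_corner_notin[OF facet_properties(1)[OF F(1)] facet_properties(1)[OF F(3)] facet_not_subset[OF F(1,3,5)]]) (rule that)
  \<comment> \<open>The formula determines the corner off \<open>G\<close> from \<open>v'\<close>
    and the corner off \<open>H\<close> from \<open>v\<close>, so each is unique.\<close>
  have inG: "x \<in> G" if "x \<in> corners F" "x \<noteq> v" for x using key[OF that(1) _ v'] key[OF v v'] that(2) by metis
  have inH: "x \<in> H" if "x \<in> corners F" "x \<noteq> v'" for x
    using key[OF v that(1)] key[OF v v'] that(2) by (metis add_right_cancel)
  note k = key[OF v v']
  define y where "y = v + p - q"
  have vy: "v = y + (q - p)" by (simp add: y_def)
  have "y \<in> insert v' Y" using k by (auto simp: y_def)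
  moreover have "y \<noteq> v'"
  proof
    assume "y = v'"
    then have "real (n + 1) *\<^sub>R (q - p) = 1 *\<^sub>R (q - p)" using k vy by simp
    then have "real (n + 1) = 1" using \<open>p \<noteq> q\<close> by (metis right_minus_eq scaleR_cancel_right)
    then show False using n1 by simp
  qed
  ultimately have yY: "y \<in> Y" by blast
  have "v \<noteq> v'" using k \<open>p \<noteq> q\<close> by auto
  obtain a2 b2 where a2: "\<And>x. x \<in> P \<Longrightarrow> b2 \<le> a2 \<bullet> x" "G = {x \<in> P. a2 \<bullet> x = b2}"
    by (rule facet_functional[OF F(2)]) (rule that)
  obtain a3 b3 where a3: "\<And>x. x \<in> P \<Longrightarrow> b3 \<le> a3 \<bullet> x" "H = {x \<in> P. a3 \<bullet> x = b3}"
    by (rule facet_functional[OF F(3)]) (rule that)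
  define s2 where "s2 = a2 \<bullet> v - b2"
  define s3 where "s3 = a3 \<bullet> v' - b3"
  have vP: "v \<in> P" "v' \<in> P" using cF v v' by blast+
  have s: "0 < s2" "0 < s3" using a2 a3 v v' vP by (auto simp: s2_def s3_def less_le)
  \<comment> \<open>Scaled so that \<open>c - m\<close> is \<open>1\<close> at \<open>v\<close> and
    \<open>v'\<close>: as \<open>v\<close> lies in \<open>H\<close> and \<open>v'\<close> in
    \<open>G\<close>, only one summand is nonzero at each. The remaining corners lie in both
    \<open>G\<close> and \<open>H\<close> and get the value \<open>0\<close>.\<close>
  define c where "c = (1 / s2) *\<^sub>R a2 + (1 / s3) *\<^sub>R a3"
  define m where "m = b2 / s2 + b3 / s3"
  have cx: "c \<bullet> x - m = (a2 \<bullet> x - b2) / s2 + (a3 \<bullet> x - b3) / s3" for x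
    by (simp add: c_def m_def inner_add_left diff_divide_distrib)
  have cv: "c \<bullet> v - m = 1" "c \<bullet> v' - m = 1"
    using inH[OF v(1) \<open>v \<noteq> v'\<close>] inG[OF v'(1) \<open>v \<noteq> v'\<close>[symmetric]] a2(2) a3(2) s
    unfolding cx by (auto simp: s2_def s3_def)
  have c0: "c \<bullet> x - m = 0" if "x \<in> corners F" "x \<noteq> v" "x \<noteq> v'" for x
    using inH[OF that(1,3)] inG[OF that(1,2)] a2(2) a3(2) unfolding cx by auto
  have le: "c \<bullet> x \<le> m + 1" if "x \<in> F" for x
  proof -
    have "corners F \<subseteq> {x. c \<bullet> x \<le> m + 1}"
    proof
      fix x assume x: "x \<in> corners F"
      then show "x \<in> {x. c \<bullet> x \<le> m + 1}"
        using cv c0[OF x] by (cases "x = v \<or> x = v'") auto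
    qed
    then have "F \<subseteq> {x. c \<bullet> x \<le> m + 1}"
      using hull_minimal[of "corners F" "{x. c \<bullet> x \<le> m + 1}" convex] cF(1) convex_halfspace_le by auto
    then show ?thesis using that by blast
  qed
  have "c \<bullet> y = m + 1"
  proof -
    have "c \<bullet> v = c \<bullet> v' + real (n + 1) * (c \<bullet> (q - p))" using k by (metis inner_add_right inner_scaleR_right)
    then have "real (n + 1) * (c \<bullet> (q - p)) = 0" using cv by linarith
    moreover have "real (n + 1) \<noteq> 0" by linarith
    ultimately have "c \<bullet> (q - p) = 0" by (metis mult_eq_0_iff)
    then show ?thesis using cv(1) vy by (metis add.right_neutral add.commute diff_eq_eq inner_add_right)
  qed
  moreover obtain x where x: "x \<in> corners F" "x \<noteq> v" "x \<noteq> v'"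
    using corners_facet_not_pair[OF F(1), of v v'] by blast
  ultimately have "c \<bullet> x = m + 1"
    using functional_max_rel_interior[OF facet_properties(7)[OF F(1)] le, of y x] yY cF(2)
    by (auto simp: Y_def facet_points_def)
  then show False using c0[OF x] by simp
qed

text \<open>With three or more facets, failure of the level argument for a given facet forces
  exactly three of them, one of the others carrying a single point. Used for an arbitrary facet and
  then for the one found, this yields two facets with single points, and the remaining facet takes
  the place of \<open>F\<close> in \<open>card_double_points_two_singletons\<close>.\<close>

theorem card_double_points_gt:
  assumes "2 \<le> card nonhollow_facets"
  shows "(\<Sum>F\<in>nonhollow_facets. card (facet_points F)) < card double_points"
proof (cases "card nonhollow_facets = 2")
  case True
  then obtain F G where FG: "nonhollow_facets = {F, G}" "F \<noteq> G" by (auto simp: card_2_iff)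
  then show ?thesis
    using card_double_points_two_facets[of F G] nonhollow_facetsD[of F] nonhollow_facetsD[of G] by simp
next
  case False
  then have c3: "3 \<le> card nonhollow_facets" using assms by simp
  show ?thesis
  proof (rule ccontr)
    assume neg: "\<not> ?thesis"
    have *: "\<exists>G H p. nonhollow_facets = {F, G, H} \<and> F \<noteq> G \<and> F \<noteq> H \<and> G \<noteq> H \<and> facet_points H = {p}"
      if F: "F \<in> nonhollow_facets" for F
    proof -
      have "card (nonhollow_facets - {F}) = card nonhollow_facets - 1" using F by simp
      then have "nonhollow_facets - {F} \<noteq> {}" using c3 by force
      then obtain G where G: "G \<in> nonhollow_facets - {F}" "card (\<Union>(facet_points ` (nonhollow_facets - {F, G}))) < 2"
        using card_double_points_levels[OF F] neg by (meson not_less)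
      let ?R = "nonhollow_facets - {F, G}"
      have R: "?R \<subseteq> facets" "finite ?R" using nonhollow_facetsD finite_nonhollow_facets by auto
      have cR: "card ?R = card nonhollow_facets - 2"
      proof -
        have "F \<noteq> G" using G(1) by blast
        then have "card {F, G} = 2" "{F, G} \<subseteq> nonhollow_facets" using F G(1) by simp_all
        then show ?thesis by (simp add: card_Diff_subset)
      qed
      have ge: "1 \<le> card (facet_points H)" if "H \<in> ?R" for H
      proof -
        have "H \<in> nonhollow_facets" using that by blast
        then show ?thesis
          using nonhollow_facetsD[of H] finite_facet_points[of H] by (simp add: Suc_le_eq card_gt_0_iff)
      qed
      have "card ?R \<le> (\<Sum>H\<in>?R. card (facet_points H))"
        using sum_mono[of ?R "\<lambda>_. 1" "\<lambda>H. card (facet_points H)"] ge by simp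
      moreover have sum2: "(\<Sum>H\<in>?R. card (facet_points H)) < 2" using G(2) card_Union_facet_points[OF R(1)] by simp
      ultimately have "card ?R = 1" using cR c3 by linarith
      then obtain H where H: "?R = {H}" by (rule card_1_singletonE)
      then have "card (facet_points H) = 1" using sum2 ge[of H] by simp
      then obtain p where "facet_points H = {p}" by (rule card_1_singletonE)
      moreover have "nonhollow_facets = {F, G, H}" "F \<noteq> G" "F \<noteq> H" "G \<noteq> H" using H F G(1) by blast+
      ultimately show ?thesis by blast
    qed
    have "nonhollow_facets \<noteq> {}" using c3 by auto
    then obtain F where "F \<in> nonhollow_facets" by blast
    from *[OF this] obtain G H q where 1: "nonhollow_facets = {F, G, H}" "facet_points H = {q}" by blast
    then have "H \<in> nonhollow_facets" by simp
    from *[OF this] obtain F' G' p where 2: "nonhollow_facets = {H, F', G'}" "H \<noteq> F'" "H \<noteq> G'" "F' \<noteq> G'"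
      "facet_points G' = {p}" by blast
    have f: "F' \<in> facets" "G' \<in> facets" "H \<in> facets" "facet_points F' \<noteq> {}"
      using nonhollow_facetsD 2(1) by blast+
    have "card (facet_points F') + 2 < card double_points"
      using card_double_points_two_singletons[OF f(1,2,3) 2(4) 2(2)[symmetric] 2(3)[symmetric] f(4), of p q] 1(2) 2(5)
      by simp
    moreover have "(\<Sum>F\<in>nonhollow_facets. card (facet_points F)) = card (facet_points F') + 2"
      unfolding 2(1) using 2(2-5) 1(2) by simp
    ultimately show False using neg by linarith
  qed
qed

section \<open>Consequences of thinness for the facets\<close>

lemma thin_iff_double_points:
  "thin P \<longleftrightarrow> interior_count 1 P = 0 \<and> card double_points = (\<Sum>F\<in>nonhollow_facets. card (facet_points F))"
  unfolding thin_iff sum_interior_count_facets interior_count_double_points ..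

text \<open>An interior lattice point of a facet, added to a corner of \<open>P\<close> off that
  facet, would be interior to the double; so no facet has one and both counts are zero.\<close>

lemma thin_if_degree_le_1:
  assumes "interior_count 2 P = 0"
  shows "thin P"
proof -
  have i1: "interior_count 1 P = 0"
    by (rule interior_count_1_eq_0_if_2[OF polytope_imp_bounded[OF polytope] assms])
  have D: "double_points = {}"
    using assms finite_double_points unfolding interior_count_double_points by simp
  have "facet_points F = {}" if F: "F \<in> facets" for F
  proof (rule ccontr)
    assume "facet_points F \<noteq> {}"
    then obtain w where w: "w \<in> facet_points F" by blast
    have "P face_of P" by (rule face_of_refl[OF convex])
    moreover have "\<not> P \<subseteq> F" using facet_properties(5,8)[OF F] by auto
    ultimately obtain v where "v \<in> corners P" "v \<notin> F"
      using exists_corner_notin[OF _ facet_properties(1)[OF F]] by blast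
    then have "w + v \<in> double_points"
      using facet_plus_point[OF F w] corners(3)[OF \<open>P face_of P\<close>] by blast
    then show False using D by blast
  qed
  then have "nonhollow_facets = {}" by (auto simp: nonhollow_facets_def)
  then show ?thesis unfolding thin_iff_double_points using i1 D by simp
qed

text \<open>By equality of the counts, the interior points of the double are the translate of those
  of \<open>F\<close> by any lattice point \<open>v\<close> of \<open>P\<close> off
  \<open>F\<close>. Comparing element sums shows that only one such \<open>v\<close> exists.\<close>

lemma thin_imp_unique_nonhollow_facet:
  assumes "thin P" "interior_count 2 P \<noteq> 0"
  obtains F v where "F \<in> facets" "v \<in> int_lattice" "v \<notin> F" "P = convex hull (insert v F)"
    "P \<inter> int_lattice \<subseteq> insert v F" "double_points = (\<lambda>w. w + v) ` facet_points F"
    "interior_count 1 P = 0"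
proof -
  have i1: "interior_count 1 P = 0" and D: "card double_points = (\<Sum>F\<in>nonhollow_facets. card (facet_points F))"
    using assms(1) thin_iff_double_points by blast+
  have "nonhollow_facets \<noteq> {}" using D assms(2) interior_count_double_points by auto
  moreover have "\<not> 2 \<le> card nonhollow_facets" using card_double_points_gt D by auto
  ultimately have "card nonhollow_facets = 1"
    using finite_nonhollow_facets by (metis One_nat_def Suc_1 card_0_eq le_neq_implies_less less_one not_less_eq_eq)
  then obtain F where F: "nonhollow_facets = {F}" by (rule card_1_singletonE)
  have Ff: "F \<in> facets" "facet_points F \<noteq> {}" using nonhollow_facetsD[of F] F by simp_all
  have cD: "card double_points = card (facet_points F)" using D F by simp
  have D_eq: "(\<lambda>w. w + v) ` facet_points F = double_points" if "v \<in> P \<inter> int_lattice" "v \<notin> F" for v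
  proof (rule card_subset_eq[OF finite_double_points])
    show "(\<lambda>w. w + v) ` facet_points F \<subseteq> double_points"
      using facet_plus_point[OF Ff(1) _ that] by blast
    show "card ((\<lambda>w. w + v) ` facet_points F) = card double_points"
      unfolding cD by (simp add: card_image inj_on_def)
  qed
  have sumD: "\<Sum>double_points = (\<Sum>w\<in>facet_points F. w) + real (card (facet_points F)) *\<^sub>R v"
    if "v \<in> P \<inter> int_lattice" "v \<notin> F" for v
    unfolding D_eq[OF that, symmetric]
    by (subst sum.reindex) (auto simp: inj_on_def sum.distrib sum_constant_scaleR)
  have uniq: "v = v'" if "v \<in> P \<inter> int_lattice" "v \<notin> F" "v' \<in> P \<inter> int_lattice" "v' \<notin> F" for v v'
  proof -
    have "real (card (facet_points F)) *\<^sub>R v = real (card (facet_points F)) *\<^sub>R v'"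
      using sumD[OF that(1,2)] sumD[OF that(3,4)] by (metis add_left_cancel)
    moreover have "card (facet_points F) \<noteq> 0" using Ff finite_facet_points by auto
    ultimately show ?thesis by (metis of_nat_eq_0_iff scaleR_cancel_left)
  qed
  have Pf: "P face_of P" by (rule face_of_refl[OF convex])
  have "\<not> P \<subseteq> F" using facet_properties(5,8)[OF Ff(1)] by auto
  then obtain v where v: "v \<in> corners P" "v \<notin> F"
    using exists_corner_notin[OF Pf facet_properties(1)[OF Ff(1)]] by blast
  have vP: "v \<in> P \<inter> int_lattice" using corners(3)[OF Pf] v by blast
  have sub: "P \<inter> int_lattice \<subseteq> insert v F" using uniq vP v(2) by blast
  have "P = convex hull (insert v F)"
  proof
    have "corners P \<subseteq> insert v F" using corners(3)[OF Pf] sub by blast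
    then show "P \<subseteq> convex hull (insert v F)" using corners(1)[OF Pf] hull_mono[of "corners P" "insert v F" convex] by simp
    show "convex hull (insert v F) \<subseteq> P" using vP facet_properties(5)[OF Ff(1)] convex by (intro hull_minimal) auto
  qed
  then show thesis using that[OF Ff(1) _ v(2)] vP sub D_eq[OF vP v(2)] i1 by blast
qed

end

section \<open>Empty simplices and lattice frames\<close>

definition empty_simplex :: "'a::euclidean_space set \<Rightarrow> bool" where
  "empty_simplex A \<longleftrightarrow> \<not> affine_dependent A \<and> A \<subseteq> int_lattice \<and> convex hull A \<inter> int_lattice \<subseteq> A"

text \<open>Among the lattice points outside the affine hull take one whose simplex contains fewest
  lattice points. A further lattice point \<open>q\<close> of that simplex would span with
  \<open>A\<close> a smaller one, which loses the extreme point \<open>s\<close>.\<close>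

lemma empty_simplex_insert_exists:
  fixes Q :: "'a::euclidean_space set"
  assumes Q: "polytope Q" and A: "empty_simplex A" "A \<subseteq> Q" "A \<noteq> {}" and s: "s \<in> Q \<inter> int_lattice" "s \<notin> affine hull A"
  shows "\<exists>s. s \<in> Q \<and> s \<notin> affine hull A \<and> empty_simplex (insert s A)"
proof -
  have ind: "\<not> affine_dependent A" and lat: "A \<subseteq> int_lattice" and emp: "convex hull A \<inter> int_lattice \<subseteq> A"
    using A(1) by (auto simp: empty_simplex_def)
  have finQ: "finite (Q \<inter> int_lattice)" by (rule finite_bounded_int_lattice[OF polytope_imp_bounded[OF Q]])
  define m where "m = (\<lambda>s. card (convex hull (insert s A) \<inter> int_lattice))"
  obtain s where s: "s \<in> Q \<inter> int_lattice" "s \<notin> affine hull A"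
    and min: "\<And>t. t \<in> Q \<inter> int_lattice \<Longrightarrow> t \<notin> affine hull A \<Longrightarrow> m s \<le> m t"
    using ex_has_least_nat[of "\<lambda>s. s \<in> Q \<inter> int_lattice \<and> s \<notin> affine hull A" s m] s by blast
  have ind': "\<not> affine_dependent (insert s A)" by (rule affine_independent_insert[OF ind s(2)])
  have subQ: "convex hull (insert s A) \<subseteq> Q"
    using s A(2) polytope_imp_convex[OF Q] by (intro hull_minimal) auto
  have "convex hull (insert s A) \<inter> int_lattice \<subseteq> insert s A"
  proof (rule ccontr)
    assume "\<not> ?thesis"
    then obtain q where q: "q \<in> convex hull (insert s A)" "q \<in> int_lattice" "q \<noteq> s" "q \<notin> A" by blast
    obtain u v b where uv: "0 \<le> u" "0 \<le> v" "u + v = 1" "b \<in> convex hull A" "q = u *\<^sub>R s + v *\<^sub>R b"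
      using q(1) unfolding convex_hull_insert[OF A(3)] by blast
    have bA: "b \<in> affine hull A" using uv(4) convex_hull_subset_affine_hull[of A] by blast
    have qA: "q \<notin> affine hull A"
    proof
      assume *: "q \<in> affine hull A"
      show False
      proof (cases "u = 0")
        case True
        then have "q = b" using uv by simp
        then show False using emp uv(4) q by blast
      next
        case False
        have "s = (1 / u) *\<^sub>R q + (1 - 1 / u) *\<^sub>R b"
        proof -
          define r where "r = 1 / u"
          have "r * u = 1" using False by (simp add: r_def)
          have "v = 1 - u" using uv(3) by simp
          have "r *\<^sub>R q = (r * u) *\<^sub>R s + (r * v) *\<^sub>R b" using uv(5) by (simp add: scaleR_right_distrib)
          also have "r * v = r - r * u" by (simp add: \<open>v = 1 - u\<close> right_diff_distrib)
          finally have "r *\<^sub>R q = s + (r - 1) *\<^sub>R b" using \<open>r * u = 1\<close> by simp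
          then show ?thesis unfolding r_def[symmetric] by (simp add: algebra_simps)
        qed
        then have "s \<in> affine hull A"
          using mem_affine[OF affine_affine_hull * bA, of "1 / u" "1 - 1 / u"] by simp
        then show False using s by blast
      qed
    qed
    have sub: "convex hull (insert q A) \<subseteq> convex hull (insert s A)"
      using q(1) hull_mono[of A "insert s A" convex] hull_subset[of A convex] by (intro hull_minimal) auto
    have "s extreme_point_of (convex hull (insert s A))"
      using extreme_point_of_convex_hull_affine_independent[OF ind'] by simp
    have "s \<notin> convex hull (insert q A)"
    proof
      assume "s \<in> convex hull (insert q A)"
      then have "s extreme_point_of (convex hull (insert q A))"
        using \<open>s extreme_point_of (convex hull (insert s A))\<close> sub unfolding extreme_point_of_def by blast
      then have "s \<in> insert q A" by (rule extreme_point_of_convex_hull)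
      then show False using q(3) s(2) hull_inc[of s A affine] by auto
    qed
    then have "convex hull (insert q A) \<inter> int_lattice \<subset> convex hull (insert s A) \<inter> int_lattice"
      using sub s(1) hull_inc[of s "insert s A" convex] by blast
    moreover have "finite (convex hull (insert s A) \<inter> int_lattice)"
      using finQ subQ by (rule_tac finite_subset[of _ "Q \<inter> int_lattice"]) auto
    ultimately have "m q < m s" unfolding m_def by (intro psubset_card_mono)
    moreover have "m s \<le> m q" using min[of q] q subQ qA by blast
    ultimately show False by simp
  qed
  then show ?thesis using s ind' lat by (auto simp: empty_simplex_def)
qed

lemma empty_simplex_extends:
  fixes Q :: "'a::euclidean_space set"
  assumes Q: "lattice_polytope Q" and A: "empty_simplex A" "A \<subseteq> Q" "A \<noteq> {}"
  shows "\<exists>B. A \<subseteq> B \<and> B \<subseteq> Q \<and> empty_simplex B \<and> affine hull B = affine hull Q"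
  using A
proof (induction "nat (aff_dim Q - aff_dim A)" arbitrary: A rule: less_induct)
  case less
  have pQ: "polytope Q" by (rule lattice_polytope_imp_polytope[OF Q])
  show ?case
  proof (cases "Q \<inter> int_lattice \<subseteq> affine hull A")
    case True
    obtain V where V: "finite V" "V \<subseteq> int_lattice" "Q = convex hull V" using Q by (auto simp: lattice_polytope_def)
    then have "V \<subseteq> affine hull A" using True hull_subset[of V convex] by blast
    then have "affine hull V \<subseteq> affine hull A" by (intro hull_minimal) auto
    moreover have "affine hull A \<subseteq> affine hull Q" using less.prems by (intro hull_mono)
    ultimately have "affine hull A = affine hull Q" using V by auto
    then show ?thesis using less.prems by blast
  next
    case False
    then obtain s where s: "s \<in> Q" "s \<notin> affine hull A" "empty_simplex (insert s A)"
      using empty_simplex_insert_exists[OF pQ less.prems] by blast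
    have "aff_dim (insert s A) = aff_dim A + 1" using s by (simp add: aff_dim_insert)
    moreover have "aff_dim (insert s A) \<le> aff_dim Q" using s less.prems by (intro aff_dim_subset) auto
    ultimately show ?thesis using less.hyps[of "insert s A"] s less.prems by auto
  qed
qed

lemma empty_simplex_vertex_weight:
  assumes A: "empty_simplex A" and \<gamma>: "\<And>a. a \<in> A \<Longrightarrow> 0 \<le> \<gamma> a" "sum \<gamma> A = 1" "(\<Sum>a\<in>A. \<gamma> a *\<^sub>R a) \<in> int_lattice"
  obtains a where "a \<in> (A :: 'a::euclidean_space set)" "\<gamma> a = 1"
proof -
  have ind: "\<not> affine_dependent A" and emp: "convex hull A \<inter> int_lattice \<subseteq> A" using A by (auto simp: empty_simplex_def)
  have fin: "finite A" by (rule aff_independent_finite[OF ind])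
  have "(\<Sum>a\<in>A. \<gamma> a *\<^sub>R a) \<in> convex hull A"
    unfolding convex_hull_finite[OF fin] using \<gamma> by blast
  then have x: "(\<Sum>a\<in>A. \<gamma> a *\<^sub>R a) \<in> A" using emp \<gamma>(3) by blast
  define x where "x = (\<Sum>a\<in>A. \<gamma> a *\<^sub>R a)"
  have "\<gamma> x = (if x = x then 1 else 0)"
  proof (rule affine_independent_weights_unique[OF ind, of \<gamma> "\<lambda>a. if a = x then 1 else 0"])
    show "x \<in> A" using x by (simp add: x_def)
    then show "sum \<gamma> A = (\<Sum>a\<in>A. if a = x then 1 else 0)" using fin \<gamma> by simp
    have "(\<Sum>a\<in>A. (if a = x then 1 else 0) *\<^sub>R a) = (\<Sum>a\<in>A. if a = x then x else 0)"
      by (rule sum.cong) auto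
    then show "(\<Sum>a\<in>A. \<gamma> a *\<^sub>R a) = (\<Sum>a\<in>A. (if a = x then 1 else 0) *\<^sub>R a)"
      using fin \<open>x \<in> A\<close> by (simp add: x_def)
  qed
  then show thesis using that[of x] x by (simp add: x_def)
qed

text \<open>
  A nontrivial box point of height one, or one whose reflection has height one, would be a lattice
  point of the simplex that is not a vertex. In a tetrahedron this only leaves box points of height
  two with all coefficients positive.
\<close>
lemma empty_simplex_unimodular:
  fixes A :: "'a::euclidean_space set"
  assumes A: "empty_simplex A" and card: "card A \<le> 4"
    and two: "\<And>\<beta>. card A = 4 \<Longrightarrow> (\<And>a. a \<in> A \<Longrightarrow> 0 < \<beta> a \<and> \<beta> a < 1) \<Longrightarrow> sum \<beta> A = 2 \<Longrightarrow>
      (\<Sum>a\<in>A. \<beta> a *\<^sub>R a) \<in> int_lattice \<Longrightarrow> False"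
    and x: "x \<in> int_lattice" "sum l A = 1" "x = (\<Sum>a\<in>A. l a *\<^sub>R a)" and a: "a \<in> A"
  shows "l a \<in> \<int>"
proof -
  have ind: "\<not> affine_dependent A" and lat: "A \<subseteq> int_lattice" using A by (auto simp: empty_simplex_def)
  have fin: "finite A" by (rule aff_independent_finite[OF ind])
  \<comment> \<open>Fractional parts give the representative of \<open>x\<close> in the half-open
    fundamental parallelepiped; its height \<open>h\<close> is an integer.\<close>
  define \<beta> where "\<beta> = (\<lambda>a. frac (l a))"
  have \<beta>: "0 \<le> \<beta> a" "\<beta> a < 1" for a by (simp_all add: \<beta>_def frac_lt_1)
  have l: "l a = of_int \<lfloor>l a\<rfloor> + \<beta> a" for a by (simp add: \<beta>_def frac_def)
  define y where "y = (\<Sum>a\<in>A. \<beta> a *\<^sub>R a)"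
  have "x = (\<Sum>a\<in>A. of_int \<lfloor>l a\<rfloor> *\<^sub>R a) + y"
    unfolding x(3) y_def sum.distrib[symmetric] by (rule sum.cong[OF refl], subst l) (simp add: scaleR_left_distrib)
  moreover have "(\<Sum>a\<in>A. of_int \<lfloor>l a\<rfloor> *\<^sub>R a) \<in> int_lattice"
    using lat by (intro int_lattice_sum int_lattice_scaleR) auto
  ultimately have y: "y \<in> int_lattice" using x(1) int_lattice_diff by (metis add_diff_cancel_left')
  define h where "h = sum \<beta> A"
  have "1 = (\<Sum>a\<in>A. of_int \<lfloor>l a\<rfloor>) + h"
    unfolding x(2)[symmetric] h_def sum.distrib[symmetric] using l by (intro sum.cong) auto
  then have "h = of_int (1 - (\<Sum>a\<in>A. \<lfloor>l a\<rfloor>))" by simp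
  then obtain k where k: "h = of_int k" by blast
  have "0 \<le> h" unfolding h_def using \<beta> by (intro sum_nonneg)
  then have k0: "0 \<le> k" using k by simp
  define B where "B = {a \<in> A. 0 < \<beta> a}"
  have BA: "B \<subseteq> A" "finite B" using fin by (auto simp: B_def)
  have out: "\<beta> a = 0" if "a \<in> A - B" for a using that \<beta>(1)[of a] by (auto simp: B_def)
  have hB: "h = sum \<beta> B" unfolding h_def using out by (intro sum.mono_neutral_right fin BA) auto
  have "B = {}"
  proof (rule ccontr)
    assume "B \<noteq> {}"
    have "sum \<beta> B < (\<Sum>a\<in>B. 1)" using \<open>B \<noteq> {}\<close> BA \<beta> by (intro sum_strict_mono) auto
    then have kB: "k < int (card B)" using hB k by simp
    have "0 < sum \<beta> B" using \<open>B \<noteq> {}\<close> BA by (intro sum_pos) (auto simp: B_def)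
    then have "1 \<le> k" using hB k by simp
    have k1: "k \<noteq> 1"
    proof
      assume "k = 1"
      then obtain a where "a \<in> A" "\<beta> a = 1"
        using empty_simplex_vertex_weight[OF A, of \<beta>] \<beta> y k by (auto simp: h_def y_def)
      then show False using \<beta>(2)[of a] by simp
    qed
    have k2: "k \<noteq> int (card B) - 1"
    proof
      assume kc: "k = int (card B) - 1"
      \<comment> \<open>Reflection within the support \<open>B\<close> turns height
        \<open>card B - 1\<close> into height one.\<close>
      define \<gamma> where "\<gamma> = (\<lambda>a. if a \<in> B then 1 - \<beta> a else 0)"
      have "sum \<gamma> A = (\<Sum>a\<in>B. 1 - \<beta> a)"
        unfolding \<gamma>_def using BA by (intro sum.mono_neutral_cong_right fin) auto
      then have s1: "sum \<gamma> A = 1" using hB k kc by (simp add: sum_subtractf)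
      have "(\<Sum>a\<in>A. \<gamma> a *\<^sub>R a) = (\<Sum>a\<in>B. (1 - \<beta> a) *\<^sub>R a)"
        unfolding \<gamma>_def using BA by (intro sum.mono_neutral_cong_right fin) auto
      also have "\<dots> = (\<Sum>a\<in>B. a) - (\<Sum>a\<in>B. \<beta> a *\<^sub>R a)" by (simp add: scaleR_left_diff_distrib sum_subtractf)
      also have "(\<Sum>a\<in>B. \<beta> a *\<^sub>R a) = y"
        unfolding y_def using out by (intro sum.mono_neutral_left fin BA) auto
      also have "(\<Sum>a\<in>B. a) - y \<in> int_lattice" using lat BA y by (intro int_lattice_diff int_lattice_sum) auto
      finally have "(\<Sum>a\<in>A. \<gamma> a *\<^sub>R a) \<in> int_lattice" .
      moreover have "0 \<le> \<gamma> a" for a using \<beta>(2)[of a] by (simp add: \<gamma>_def)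
      ultimately obtain a where a: "a \<in> A" "\<gamma> a = 1"
        using empty_simplex_vertex_weight[OF A, of \<gamma>] s1 by blast
      then show False by (auto simp: \<gamma>_def B_def split: if_splits)
    qed
    have "card B \<le> card A" by (rule card_mono[OF fin BA(1)])
    \<comment> \<open>Since \<open>1 \<le> k < card B\<close> and \<open>k\<close> is neither
      \<open>1\<close> nor \<open>card B - 1\<close>, a support of at most four points leaves only
      \<open>k = 2\<close>.\<close>
    then have "card B = 4" "card A = 4" "k = 2" using kB \<open>1 \<le> k\<close> k1 k2 card by linarith+
    then have "B = A" using card_subset_eq[OF fin BA(1)] by simp
    show False
    proof (rule two[OF \<open>card A = 4\<close>, of \<beta>])
      show "0 < \<beta> a \<and> \<beta> a < 1" if "a \<in> A" for a using that \<open>B = A\<close> \<beta> by (auto simp: B_def)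
      show "sum \<beta> A = 2" using k \<open>k = 2\<close> by (simp add: h_def)
      show "(\<Sum>a\<in>A. \<beta> a *\<^sub>R a) \<in> int_lattice" using y by (simp add: y_def)
    qed
  qed
  then have "\<beta> a = 0" using out a by simp
  then show ?thesis by (simp add: \<beta>_def frac_eq_0_iff)
qed

section \<open>Lattice frames: affine coordinates adapted to the lattice\<close>

definition lattice_frame :: "'a::euclidean_space set \<Rightarrow> 'a \<Rightarrow> 'a \<Rightarrow> 'a \<Rightarrow> 'a \<Rightarrow> bool" where
  "lattice_frame S x\<^sub>0 u v w \<longleftrightarrow>
     (\<forall>y\<in>S. \<exists>a b c. y = x\<^sub>0 + a *\<^sub>R u + b *\<^sub>R v + c *\<^sub>R w) \<and>
     (\<forall>a b c. x\<^sub>0 + a *\<^sub>R u + b *\<^sub>R v + c *\<^sub>R w \<in> S) \<and>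
     (\<forall>a b c. a *\<^sub>R u + b *\<^sub>R v + c *\<^sub>R w = 0 \<longrightarrow> a = 0 \<and> b = 0 \<and> c = 0) \<and>
     (\<forall>a b c. x\<^sub>0 + a *\<^sub>R u + b *\<^sub>R v + c *\<^sub>R w \<in> int_lattice \<longleftrightarrow> a \<in> \<int> \<and> b \<in> \<int> \<and> c \<in> \<int>)"

text \<open>The frame coordinates of a point are its barycentric coordinates at \<open>b\<close>,
  \<open>c\<close> and \<open>d\<close>, which the assumption makes integral at lattice
  points.\<close>

lemma lattice_frame_unimodular:
  fixes a b c d :: "'a::euclidean_space"
  assumes ind: "\<not> affine_dependent {a, b, c, d}" and dist: "card {a, b, c, d} = 4" and lat: "{a, b, c, d} \<subseteq> int_lattice"
    and uni: "\<And>x l t. x \<in> int_lattice \<Longrightarrow> sum l {a, b, c, d} = 1 \<Longrightarrow> x = (\<Sum>t\<in>{a, b, c, d}. l t *\<^sub>R t) \<Longrightarrow>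
      t \<in> {a, b, c, d} \<Longrightarrow> l t \<in> \<int>"
  shows "lattice_frame (affine hull {a, b, c, d}) a (b - a) (c - a) (d - a)"
proof -
  have ne: "a \<noteq> b" "a \<noteq> c" "a \<noteq> d" "b \<noteq> c" "b \<noteq> d" "c \<noteq> d"
    using dist by (auto simp: card_insert_if split: if_splits)
  let ?A = "{a, b, c, d}"
  have S: "(\<Sum>t\<in>?A. l t *\<^sub>R t) = l a *\<^sub>R a + (l b *\<^sub>R b + (l c *\<^sub>R c + l d *\<^sub>R d))"
    "sum l ?A = l a + (l b + (l c + l d))" for l :: "'a \<Rightarrow> real" using ne by simp_all
  define L where "L = (\<lambda>p q r t. if t = b then p else if t = c then q else if t = d then r else (1 - p - q - r :: real))"
  have L: "sum (L p q r) ?A = 1" "(\<Sum>t\<in>?A. L p q r t *\<^sub>R t) = a + p *\<^sub>R (b - a) + q *\<^sub>R (c - a) + r *\<^sub>R (d - a)" for p q r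
    unfolding S using ne by (simp_all add: L_def algebra_simps)
  have hull: "affine hull ?A = {y. \<exists>u. sum u ?A = 1 \<and> (\<Sum>t\<in>?A. u t *\<^sub>R t) = y}"
    by (rule affine_hull_finite) simp
  show ?thesis
    unfolding lattice_frame_def
  proof (intro conjI ballI allI impI)
    fix y assume "y \<in> affine hull ?A"
    then obtain u where u: "sum u ?A = 1" "(\<Sum>t\<in>?A. u t *\<^sub>R t) = y" unfolding hull by blast
    then have ua: "u a = 1 - u b - u c - u d" unfolding S by simp
    have "y = (1 - u b - u c - u d) *\<^sub>R a + (u b *\<^sub>R b + (u c *\<^sub>R c + u d *\<^sub>R d))"
      using u(2) unfolding S(1) ua by simp
    then have "y = a + u b *\<^sub>R (b - a) + u c *\<^sub>R (c - a) + u d *\<^sub>R (d - a)"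
      by (simp add: algebra_simps)
    then show "\<exists>p q r. y = a + p *\<^sub>R (b - a) + q *\<^sub>R (c - a) + r *\<^sub>R (d - a)" by blast
  next
    fix p q r :: real
    show "a + p *\<^sub>R (b - a) + q *\<^sub>R (c - a) + r *\<^sub>R (d - a) \<in> affine hull ?A"
      unfolding hull using L[of p q r] by blast
    show "a + p *\<^sub>R (b - a) + q *\<^sub>R (c - a) + r *\<^sub>R (d - a) \<in> int_lattice \<longleftrightarrow> p \<in> \<int> \<and> q \<in> \<int> \<and> r \<in> \<int>"
    proof
      assume "a + p *\<^sub>R (b - a) + q *\<^sub>R (c - a) + r *\<^sub>R (d - a) \<in> int_lattice"
      then have "L p q r t \<in> \<int>" if "t \<in> ?A" for t using uni[OF _ L(1) L(2)[symmetric] that] by simp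
      then have "L p q r b \<in> \<int>" "L p q r c \<in> \<int>" "L p q r d \<in> \<int>" by simp_all
      then show "p \<in> \<int> \<and> q \<in> \<int> \<and> r \<in> \<int>" using ne by (simp add: L_def)
    qed (use lat in \<open>auto intro!: int_lattice_add int_lattice_scaleR int_lattice_diff\<close>)
  next
    fix p q r :: real
    assume *: "p *\<^sub>R (b - a) + q *\<^sub>R (c - a) + r *\<^sub>R (d - a) = 0"
    have "L p q r t = L 0 0 0 t" if "t \<in> ?A" for t
      by (rule affine_independent_weights_unique[OF ind _ _ that]) (use L * in \<open>simp_all add: add.assoc\<close>)
    then have "L p q r b = L 0 0 0 b" "L p q r c = L 0 0 0 c" "L p q r d = L 0 0 0 d" by blast+
    then show "p = 0" "q = 0" "r = 0" using ne by (simp_all add: L_def)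
  qed
qed

lemma lattice_frame_swap:
  assumes "lattice_frame S x\<^sub>0 u v w"
  shows "lattice_frame S x\<^sub>0 v u w" "lattice_frame S x\<^sub>0 u w v"
proof -
  note f = assms[unfolded lattice_frame_def]
  have e: "x\<^sub>0 + a *\<^sub>R v + b *\<^sub>R u + c *\<^sub>R w = x\<^sub>0 + b *\<^sub>R u + a *\<^sub>R v + c *\<^sub>R w"
    "a *\<^sub>R v + b *\<^sub>R u + c *\<^sub>R w = b *\<^sub>R u + a *\<^sub>R v + c *\<^sub>R w"
    "x\<^sub>0 + a *\<^sub>R u + b *\<^sub>R w + c *\<^sub>R v = x\<^sub>0 + a *\<^sub>R u + c *\<^sub>R v + b *\<^sub>R w"
    "a *\<^sub>R u + b *\<^sub>R w + c *\<^sub>R v = a *\<^sub>R u + c *\<^sub>R v + b *\<^sub>R w" for a b c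
    by (simp_all add: add_ac)
  show "lattice_frame S x\<^sub>0 v u w" unfolding lattice_frame_def e using f by metis
  show "lattice_frame S x\<^sub>0 u w v" unfolding lattice_frame_def e using f by metis
qed

text \<open>Only the first vector is sheared along the third; swaps reduce the other elementary
  changes of basis to this one.\<close>

lemma lattice_frame_shear:
  assumes "lattice_frame S x\<^sub>0 u v w" "k \<in> \<int>"
  shows "lattice_frame S x\<^sub>0 (u + k *\<^sub>R w) v w"
proof -
  note f = assms(1)[unfolded lattice_frame_def]
  have e: "x\<^sub>0 + a *\<^sub>R (u + k *\<^sub>R w) + b *\<^sub>R v + c *\<^sub>R w = x\<^sub>0 + a *\<^sub>R u + b *\<^sub>R v + (c + a * k) *\<^sub>R w"
    "a *\<^sub>R (u + k *\<^sub>R w) + b *\<^sub>R v + c *\<^sub>R w = a *\<^sub>R u + b *\<^sub>R v + (c + a * k) *\<^sub>R w" for a b c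
    by (simp_all add: algebra_simps)
  show ?thesis
    unfolding lattice_frame_def
  proof (intro conjI ballI allI impI)
    fix y assume "y \<in> S"
    then obtain a b c where y: "y = x\<^sub>0 + a *\<^sub>R u + b *\<^sub>R v + c *\<^sub>R w" using f by blast
    then have "y = x\<^sub>0 + a *\<^sub>R (u + k *\<^sub>R w) + b *\<^sub>R v + (c - a * k) *\<^sub>R w" unfolding e by simp
    then show "\<exists>a b c. y = x\<^sub>0 + a *\<^sub>R (u + k *\<^sub>R w) + b *\<^sub>R v + c *\<^sub>R w" by blast
  next
    fix a b c :: real
    show "x\<^sub>0 + a *\<^sub>R (u + k *\<^sub>R w) + b *\<^sub>R v + c *\<^sub>R w \<in> S" unfolding e using f by blast
    have "x\<^sub>0 + a *\<^sub>R (u + k *\<^sub>R w) + b *\<^sub>R v + c *\<^sub>R w \<in> int_lattice \<longleftrightarrow> a \<in> \<int> \<and> b \<in> \<int> \<and> c + a * k \<in> \<int>"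
      unfolding e using f by blast
    moreover have "c + a * k \<in> \<int> \<longleftrightarrow> c \<in> \<int>" if "a \<in> \<int>"
      using that assms(2) by (metis Ints_add Ints_diff Ints_mult add_diff_cancel_right')
    ultimately show "x\<^sub>0 + a *\<^sub>R (u + k *\<^sub>R w) + b *\<^sub>R v + c *\<^sub>R w \<in> int_lattice \<longleftrightarrow> a \<in> \<int> \<and> b \<in> \<int> \<and> c \<in> \<int>"
      by blast
  next
    fix a b c :: real
    assume "a *\<^sub>R (u + k *\<^sub>R w) + b *\<^sub>R v + c *\<^sub>R w = 0"
    then have "a = 0 \<and> b = 0 \<and> c + a * k = 0" unfolding e using f by blast
    then show "a = 0" "b = 0" "c = 0" by auto
  qed
qed

lemma lattice_frame_shift:
  assumes "lattice_frame S x\<^sub>0 u v w" "k \<in> \<int>"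
  shows "lattice_frame S (x\<^sub>0 + k *\<^sub>R w) u v w"
proof -
  note f = assms(1)[unfolded lattice_frame_def]
  have e: "(x\<^sub>0 + k *\<^sub>R w) + a *\<^sub>R u + b *\<^sub>R v + c *\<^sub>R w = x\<^sub>0 + a *\<^sub>R u + b *\<^sub>R v + (c + k) *\<^sub>R w" for a b c
    by (simp_all add: algebra_simps)
  show ?thesis
    unfolding lattice_frame_def
  proof (intro conjI ballI allI impI)
    fix y assume "y \<in> S"
    then obtain a b c where y: "y = x\<^sub>0 + a *\<^sub>R u + b *\<^sub>R v + c *\<^sub>R w" using f by blast
    then have "y = (x\<^sub>0 + k *\<^sub>R w) + a *\<^sub>R u + b *\<^sub>R v + (c - k) *\<^sub>R w" unfolding e by simp
    then show "\<exists>a b c. y = (x\<^sub>0 + k *\<^sub>R w) + a *\<^sub>R u + b *\<^sub>R v + c *\<^sub>R w" by blast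
  next
    fix a b c :: real
    show "(x\<^sub>0 + k *\<^sub>R w) + a *\<^sub>R u + b *\<^sub>R v + c *\<^sub>R w \<in> S" unfolding e using f by blast
    have "(x\<^sub>0 + k *\<^sub>R w) + a *\<^sub>R u + b *\<^sub>R v + c *\<^sub>R w \<in> int_lattice \<longleftrightarrow> a \<in> \<int> \<and> b \<in> \<int> \<and> c + k \<in> \<int>"
      unfolding e using f by blast
    moreover have "c + k \<in> \<int> \<longleftrightarrow> c \<in> \<int>"
      using assms(2) by (metis Ints_add Ints_diff add_diff_cancel_right')
    ultimately show "(x\<^sub>0 + k *\<^sub>R w) + a *\<^sub>R u + b *\<^sub>R v + c *\<^sub>R w \<in> int_lattice \<longleftrightarrow> a \<in> \<int> \<and> b \<in> \<int> \<and> c \<in> \<int>"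
      by blast
  next
    fix a b c :: real
    assume "a *\<^sub>R u + b *\<^sub>R v + c *\<^sub>R w = 0"
    then have "a = 0 \<and> b = 0 \<and> c = 0" using f by blast
    then show "a = 0" "b = 0" "c = 0" by auto
  qed
qed

lemma lattice_frame_uminus:
  assumes "lattice_frame S x\<^sub>0 u v w"
  shows "lattice_frame S x\<^sub>0 u v (- w)"
proof -
  note f = assms(1)[unfolded lattice_frame_def]
  have e: "x\<^sub>0 + a *\<^sub>R u + b *\<^sub>R v + c *\<^sub>R (- w) = x\<^sub>0 + a *\<^sub>R u + b *\<^sub>R v + (- c) *\<^sub>R w"
    "a *\<^sub>R u + b *\<^sub>R v + c *\<^sub>R (- w) = a *\<^sub>R u + b *\<^sub>R v + (- c) *\<^sub>R w" for a b c
    by simp_all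
  show ?thesis
    unfolding lattice_frame_def
  proof (intro conjI ballI allI impI)
    fix y assume "y \<in> S"
    then obtain a b c where y: "y = x\<^sub>0 + a *\<^sub>R u + b *\<^sub>R v + c *\<^sub>R w" using f by blast
    then have "y = x\<^sub>0 + a *\<^sub>R u + b *\<^sub>R v + (- c) *\<^sub>R (- w)" by simp
    then show "\<exists>a b c. y = x\<^sub>0 + a *\<^sub>R u + b *\<^sub>R v + c *\<^sub>R (- w)" by blast
  next
    fix a b c :: real
    show "x\<^sub>0 + a *\<^sub>R u + b *\<^sub>R v + c *\<^sub>R (- w) \<in> S" unfolding e using f by blast
    have "x\<^sub>0 + a *\<^sub>R u + b *\<^sub>R v + c *\<^sub>R (- w) \<in> int_lattice \<longleftrightarrow> a \<in> \<int> \<and> b \<in> \<int> \<and> - c \<in> \<int>"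
      unfolding e using f by blast
    then show "x\<^sub>0 + a *\<^sub>R u + b *\<^sub>R v + c *\<^sub>R (- w) \<in> int_lattice \<longleftrightarrow> a \<in> \<int> \<and> b \<in> \<int> \<and> c \<in> \<int>"
      by (simp add: minus_in_Ints_iff)
  next
    fix a b c :: real
    assume "a *\<^sub>R u + b *\<^sub>R v + c *\<^sub>R (- w) = 0"
    then have "a = 0 \<and> b = 0 \<and> - c = 0" unfolding e using f by blast
    then show "a = 0" "b = 0" "c = 0" by auto
  qed
qed

lemma int_lattice_real2_real:
  "(p :: (real ^ 2) \<times> real) \<in> int_lattice \<longleftrightarrow> vec_nth (fst p) 1 \<in> \<int> \<and> vec_nth (fst p) 2 \<in> \<int> \<and> snd p \<in> \<int>"
proof -
  have B: "Basis = {(axis 1 1 :: real ^ 2, 0 :: real), (axis 2 1, 0), (0, 1)}"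
    by (auto simp: Basis_prod_def Basis_vec_def UNIV_2)
  show ?thesis
    unfolding int_lattice_def B by (simp add: inner_prod_def inner_axis)
qed

lemma vec2_eq: "(x :: real ^ 2) = (vec_nth x 1) *\<^sub>R axis 1 1 + (vec_nth x 2) *\<^sub>R axis 2 1"
  by (simp add: vec_eq_iff forall_2 axis_def)

text \<open>The linear map is prescribed on \<open>u\<close>, \<open>v\<close>, \<open>w\<close> and
  extended arbitrarily to the ambient space, which may be larger; injectivity matters only on the
  affine hull.\<close>

lemma lattice_frame_coordinates:
  fixes P :: "'a::euclidean_space set"
  assumes "lattice_frame (affine hull P) x\<^sub>0 u v w"
  obtains f :: "'a \<Rightarrow> (real ^ 2) \<times> real" and e where "linear f"
    "\<And>a b c. f (x\<^sub>0 + a *\<^sub>R u + b *\<^sub>R v + c *\<^sub>R w) + e = (a *\<^sub>R axis 1 1 + b *\<^sub>R axis 2 1, c)"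
    "affine hull ((\<lambda>x. f x + e) ` P) = UNIV"
    "lattice_isomorphic P ((\<lambda>x. f x + e) ` P)"
    "(\<lambda>x. f x + e) ` (affine hull P \<inter> int_lattice) = int_lattice"
proof -
  note fr = assms[unfolded lattice_frame_def]
  have z: "a = 0 \<and> b = 0 \<and> c = 0" if "a *\<^sub>R u + b *\<^sub>R v + c *\<^sub>R w = 0" for a b c using fr that by blast
  have ne: "u \<noteq> v" "u \<noteq> w" "v \<noteq> w" using z[of 1 "-1" 0] z[of 1 0 "-1"] z[of 0 1 "-1"] by auto
  have ind: "independent {u, v, w}"
  proof
    assume "dependent {u, v, w}"
    then obtain l where l: "(\<Sum>t\<in>{u, v, w}. l t *\<^sub>R t) = 0" "\<exists>t\<in>{u, v, w}. l t \<noteq> 0"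
      by (subst (asm) dependent_finite) auto
    then have "l u *\<^sub>R u + l v *\<^sub>R v + l w *\<^sub>R w = 0" using ne by (simp add: add.assoc)
    then show False using z l(2) by blast
  qed
  define t where "t = (\<lambda>x. if x = u then (axis 1 1, 0) else if x = v then (axis 2 1, 0) else ((0, 1) :: (real ^ 2) \<times> real))"
  obtain f where f: "linear f" "\<And>x. x \<in> {u, v, w} \<Longrightarrow> f x = t x"
    using linear_independent_extend[OF ind, of t] by blast
  have fu: "f u = (axis 1 1, 0)" "f v = (axis 2 1, 0)" "f w = (0, 1)" using f(2) ne by (auto simp: t_def)
  define e where "e = - f x\<^sub>0"
  define L where "L = (\<lambda>x. f x + e)"
  have G: "L (x\<^sub>0 + a *\<^sub>R u + b *\<^sub>R v + c *\<^sub>R w) = (a *\<^sub>R axis 1 1 + b *\<^sub>R axis 2 1, c)" for a b c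
    by (simp add: L_def e_def linear_add[OF f(1)] linear_scale[OF f(1)] fu)
  have bij: "bij_betw L (affine hull P) UNIV"
  proof (rule bij_betw_byWitness[where f' = "\<lambda>p. x\<^sub>0 + (vec_nth (fst p) 1) *\<^sub>R u + (vec_nth (fst p) 2) *\<^sub>R v + snd p *\<^sub>R w"])
    show "\<forall>x\<in>affine hull P. x\<^sub>0 + (vec_nth (fst (L x)) 1) *\<^sub>R u + (vec_nth (fst (L x)) 2) *\<^sub>R v + snd (L x) *\<^sub>R w = x"
    proof
      fix x assume "x \<in> affine hull P"
      then obtain a b c where "x = x\<^sub>0 + a *\<^sub>R u + b *\<^sub>R v + c *\<^sub>R w" using fr by blast
      then show "x\<^sub>0 + (vec_nth (fst (L x)) 1) *\<^sub>R u + (vec_nth (fst (L x)) 2) *\<^sub>R v + snd (L x) *\<^sub>R w = x"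
        by (simp add: G axis_def)
    qed
    show "\<forall>p\<in>UNIV. L (x\<^sub>0 + (vec_nth (fst p) 1) *\<^sub>R u + (vec_nth (fst p) 2) *\<^sub>R v + snd p *\<^sub>R w) = p"
      unfolding G vec2_eq[symmetric] by simp
    show "(\<lambda>p. x\<^sub>0 + (vec_nth (fst p) 1) *\<^sub>R u + (vec_nth (fst p) 2) *\<^sub>R v + snd p *\<^sub>R w) ` UNIV \<subseteq> affine hull P" using fr by blast
  qed simp
  have lat: "L x \<in> int_lattice \<longleftrightarrow> x \<in> int_lattice" if x: "x \<in> affine hull P" for x
  proof -
    obtain a b c where "x = x\<^sub>0 + a *\<^sub>R u + b *\<^sub>R v + c *\<^sub>R w" using fr x by blast
    then show ?thesis using fr by (simp add: G int_lattice_real2_real axis_def)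
  qed
  have img: "L ` (affine hull P \<inter> int_lattice) = int_lattice"
  proof
    show "L ` (affine hull P \<inter> int_lattice) \<subseteq> int_lattice" using lat by auto
    show "int_lattice \<subseteq> L ` (affine hull P \<inter> int_lattice)"
    proof
      fix p assume p: "p \<in> (int_lattice :: ((real ^ 2) \<times> real) set)"
      obtain x where "x \<in> affine hull P" "p = L x" using bij_betw_imp_surj_on[OF bij] by blast
      then show "p \<in> L ` (affine hull P \<inter> int_lattice)" using lat p by blast
    qed
  qed
  have L2: "L = (\<lambda>x. e + x) \<circ> f" by (auto simp: L_def)
  have aff: "affine hull (L ` P) = UNIV"
  proof -
    have "affine hull (L ` P) = L ` (affine hull P)"
      unfolding L2 image_comp[symmetric]
      using affine_hull_translation[of e "f ` P"] affine_hull_linear_image[OF linear_conv_bounded_linear[THEN iffD1, OF f(1)], of P] by simp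
    then show ?thesis using bij_betw_imp_surj_on[OF bij] by simp
  qed
  have "lattice_isomorphic P (L ` P)"
    unfolding lattice_isomorphic_def
  proof (intro exI[of _ f] exI[of _ e] conjI)
    show "linear f" by (rule f(1))
    show "bij_betw (\<lambda>x. f x + e) (affine hull P) (affine hull (L ` P))" using bij aff by (simp add: L_def)
    have "bij_betw L (affine hull P \<inter> int_lattice) int_lattice"
      unfolding bij_betw_def using img bij_betw_imp_inj_on[OF bij] by (auto intro: inj_on_subset)
    then show "bij_betw (\<lambda>x. f x + e) (affine hull P \<inter> int_lattice) (affine hull (L ` P) \<inter> int_lattice)"
      unfolding aff by (simp add: L_def)
    show "(\<lambda>x. f x + e) ` P = L ` P" by (simp add: L_def)
  qed
  then show thesis using that[OF f(1), of e] G aff img unfolding L_def by blast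
qed

lemma int_lattice_real2: "(x :: real ^ 2) \<in> int_lattice \<longleftrightarrow> vec_nth x 1 \<in> \<int> \<and> vec_nth x 2 \<in> \<int>"
proof -
  have B: "Basis = {axis 1 1 :: real ^ 2, axis 2 1}" by (auto simp: Basis_vec_def UNIV_2)
  show ?thesis unfolding int_lattice_def B by (simp add: inner_axis)
qed

lemma convex_hull_affine_image:
  fixes f :: "'a::euclidean_space \<Rightarrow> 'b::euclidean_space"
  assumes "linear f"
  shows "(\<lambda>x. f x + e) ` (convex hull S) = convex hull ((\<lambda>x. f x + e) ` S)"
proof -
  have e: "(\<lambda>x. f x + e) ` T = (+) e ` f ` T" for T by (simp add: image_image add.commute)
  show ?thesis
    unfolding e convex_hull_translation convex_hull_linear_image[OF assms] ..
qed

text \<open>The plane of \<open>u\<close> and \<open>v\<close> carries the base and \<open>w\<close>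
  is the step from \<open>x\<^sub>0\<close> to the apex, so in coordinates the apex has height
  one.\<close>

lemma lattice_pyramid_of_frame:
  fixes P :: "'a::euclidean_space set"
  assumes fr: "lattice_frame (affine hull P) x\<^sub>0 u v w"
    and V: "finite V" "V \<subseteq> int_lattice" "\<And>x. x \<in> V \<Longrightarrow> \<exists>a b. x = x\<^sub>0 + a *\<^sub>R u + b *\<^sub>R v"
    and P: "P = convex hull (insert (x\<^sub>0 + w) V)"
  shows "\<exists>Q :: (real ^ 2) set. lattice_polygon Q \<and> lattice_pyramid_over P Q"
proof -
  obtain f :: "'a \<Rightarrow> (real ^ 2) \<times> real" and e where f: "linear f"
    and G: "\<And>a b c. f (x\<^sub>0 + a *\<^sub>R u + b *\<^sub>R v + c *\<^sub>R w) + e = (a *\<^sub>R axis 1 1 + b *\<^sub>R axis 2 1, c)"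
    and aff: "affine hull ((\<lambda>x. f x + e) ` P) = UNIV"
    and iso: "lattice_isomorphic P ((\<lambda>x. f x + e) ` P)"
    and img: "(\<lambda>x. f x + e) ` (affine hull P \<inter> int_lattice) = int_lattice"
    by (rule lattice_frame_coordinates[OF fr]) (rule that)
  define L where "L = (\<lambda>x. f x + e)"
  define V' where "V' = (\<lambda>x. fst (L x)) ` V"
  define Q where "Q = convex hull V'"
  have LV: "L ` V = V' \<times> {0}"
  proof -
    have "snd (L x) = 0" if x: "x \<in> V" for x
    proof -
      obtain a b where "x = x\<^sub>0 + a *\<^sub>R u + b *\<^sub>R v" using V(3)[OF x] by blast
      then show ?thesis using G[of a b 0] by (simp add: L_def)
    qed
    then have "L ` V = (\<lambda>x. (fst (L x), 0)) ` V" by (intro image_cong) (simp_all add: prod_eq_iff)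
    then show ?thesis unfolding V'_def by auto
  qed
  have apex: "L (x\<^sub>0 + w) = (0, 1)" using G[of 0 0 1] by (simp add: L_def)
  have LP: "L ` P = convex hull (V' \<times> {0} \<union> {(0, 1)})"
    unfolding L_def P convex_hull_affine_image[OF f] using LV apex by (simp add: L_def insert_commute)
  also have "\<dots> = convex hull (convex hull (V' \<times> {0}) \<union> {(0, 1)})" by (rule hull_Un_left)
  also have "convex hull (V' \<times> {0}) = Q \<times> {0::real}" unfolding Q_def by (simp add: convex_hull_Times)
  finally have LP': "L ` P = convex hull (Q \<times> {0} \<union> {0} \<times> {1})" by simp
  have "lattice_polygon Q"
    unfolding lattice_polygon_def
  proof
    have "V' \<subseteq> int_lattice"
    proof
      fix y assume "y \<in> V'"
      then obtain x where x: "x \<in> V" "y = fst (L x)" by (auto simp: V'_def)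
      have "x \<in> affine hull P" using x P hull_inc[of x "insert (x\<^sub>0 + w) V" convex] hull_subset[of P affine] by auto
      then have "L x \<in> int_lattice" using img V(2) x(1) unfolding L_def by blast
      then show "y \<in> int_lattice" using x by (simp add: int_lattice_real2 int_lattice_real2_real)
    qed
    then show "lattice_polytope Q" unfolding lattice_polytope_def Q_def V'_def using V(1) by blast
    \<comment> \<open>The image spans the three-dimensional space and the apex adds at most one
      dimension, so the base must have dimension two.\<close>
    have "aff_dim (UNIV :: ((real ^ 2) \<times> real) set) = aff_dim (L ` P)" using aff unfolding L_def by (metis aff_dim_affine_hull)
    also have "\<dots> = aff_dim (insert (0, 1) (V' \<times> {0 :: real}))" unfolding LP aff_dim_convex_hull by simp
    also have "\<dots> \<le> aff_dim (V' \<times> {0 :: real}) + 1" by (simp add: aff_dim_insert)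
    also have "V' \<times> {0} = (\<lambda>x. (x, 0 :: real)) ` V'" by auto
    also have "aff_dim \<dots> = aff_dim V'"
      by (rule aff_dim_injective_linear_image) (auto simp: linear_iff inj_on_def)
    finally have "2 \<le> aff_dim V'" by simp
    moreover have "aff_dim V' \<le> 2" using aff_dim_le_DIM[of V'] by simp
    ultimately show "aff_dim Q = 2" unfolding Q_def aff_dim_convex_hull by simp
  qed
  moreover have "lattice_pyramid_over P Q" unfolding lattice_pyramid_over_def LP'[symmetric] using iso unfolding L_def .
  ultimately show ?thesis by blast
qed

lemma lawrence_prism_of_frame:
  fixes P :: "'a::euclidean_space set"
  assumes fr: "lattice_frame (affine hull P) x\<^sub>0 u v w" and k: "k\<^sub>0 \<ge> 1" "k\<^sub>1 \<ge> 1" "k\<^sub>2 \<ge> 1"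
    and P: "P = convex hull {x\<^sub>0, x\<^sub>0 + real k\<^sub>0 *\<^sub>R w, x\<^sub>0 + u, x\<^sub>0 + u + real k\<^sub>1 *\<^sub>R w, x\<^sub>0 + v, x\<^sub>0 + v + real k\<^sub>2 *\<^sub>R w}"
  shows "lawrence_prism_3 P"
proof -
  obtain f :: "'a \<Rightarrow> (real ^ 2) \<times> real" and e where f: "linear f"
    and G: "\<And>a b c. f (x\<^sub>0 + a *\<^sub>R u + b *\<^sub>R v + c *\<^sub>R w) + e = (a *\<^sub>R axis 1 1 + b *\<^sub>R axis 2 1, c)"
    and iso: "lattice_isomorphic P ((\<lambda>x. f x + e) ` P)"
    by (rule lattice_frame_coordinates[OF fr]) (rule that)
  define k :: "2 \<Rightarrow> nat" where "k = (\<lambda>i. if i = 1 then k\<^sub>1 else k\<^sub>2)"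
  have "(\<lambda>x. f x + e) ` P = std_lawrence_prism k\<^sub>0 k"
    unfolding P std_lawrence_prism_def convex_hull_affine_image[OF f]
    using G[of 0 0 0] G[of 0 0 "real k\<^sub>0"] G[of 1 0 0] G[of 1 0 "real k\<^sub>1"] G[of 0 1 0] G[of 0 1 "real k\<^sub>2"]
    by (simp add: UNIV_2 k_def insert_commute)
  then have "lattice_isomorphic P (std_lawrence_prism k\<^sub>0 k)" using iso by simp
  moreover have "\<forall>i. k i \<ge> 1" using assms by (simp add: k_def)
  ultimately show ?thesis unfolding lawrence_prism_3_def using assms by blast
qed

lemma linear_functional_inner:
  fixes \<psi> :: "'a::euclidean_space \<Rightarrow> real"
  assumes "linear \<psi>"
  obtains c where "\<And>x. \<psi> x = c \<bullet> x"
  using adjoint_works[OF assms, of _ 1] that[of "adjoint \<psi> 1"] by (simp add: inner_commute)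

section \<open>Pyramids are thin, and doubles of Lawrence prisms have no interior lattice
  points\<close>

context lattice_polytope_3
begin

lemma rel_interior_functional_less:
  assumes "\<And>x. x \<in> P \<Longrightarrow> c \<bullet> x \<le> m" "z \<in> P" "c \<bullet> z < m" "q \<in> rel_interior P"
  shows "c \<bullet> q < m"
proof -
  have "c \<bullet> q \<noteq> m" using functional_max_rel_interior[OF convex assms(1,4) _ assms(2)] assms(3) by auto
  moreover have "q \<in> P" using assms(4) rel_interior_subset[of P] by blast
  ultimately show ?thesis using assms(1)[of q] by simp
qed

text \<open>The height \<open>c \<bullet> x - b\<close> is integral at lattice points and runs from
  \<open>0\<close> on \<open>F\<close> to \<open>1\<close> at \<open>v\<close>. So the interior of
  \<open>P\<close> has no lattice point, a lattice point interior to the double is \<open>v\<close>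
  plus an interior point of \<open>F\<close>, and any other facet with an interior lattice point
  would lie at height one, where there is only \<open>v\<close>.\<close>

lemma thin_if_pyramid_functional:
  assumes F: "F = {x \<in> P. c \<bullet> x = b}" and ge: "\<And>x. x \<in> P \<Longrightarrow> b \<le> c \<bullet> x"
    and v: "v \<in> P \<inter> int_lattice" "c \<bullet> v = b + 1"
    and int: "\<And>x. x \<in> affine hull P \<Longrightarrow> x \<in> int_lattice \<Longrightarrow> c \<bullet> x - b \<in> \<int>"
    and PF: "P = convex hull (insert v F)"
  shows "thin P"
proof -
  have "F = P \<inter> {x. c \<bullet> x = b}" using F by blast
  then have face: "F face_of P" using face_of_Int_supporting_hyperplane_ge[OF convex ge] by simp
  have "c \<bullet> x = b" if "x \<in> affine hull F" for x
    using affine_hull_functional_eq[of F c b x] that F by blast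
  then have "v \<notin> affine hull F" using v(2) by force
  then have "aff_dim F + 1 = aff_dim P" by (metis PF aff_dim_convex_hull aff_dim_insert)
  then have facet: "F \<in> facets" using dim face by (simp add: faces_dim_def)
  note Fp = facet_properties[OF facet]
  have FP: "F \<subseteq> P" by (rule Fp(5))
  have coord: "\<exists>y t. 0 \<le> t \<and> t \<le> 1 \<and> y \<in> F \<and> x = (1 - t) *\<^sub>R y + t *\<^sub>R v \<and> c \<bullet> x - b = t" if x: "x \<in> P" for x
  proof -
    obtain s t y where *: "0 \<le> s" "0 \<le> t" "s + t = 1" "y \<in> convex hull F" "x = s *\<^sub>R v + t *\<^sub>R y"
      using x unfolding PF convex_hull_insert[OF Fp(3)] by blast
    have y: "y \<in> F" using *(4) Fp(7) by (simp add: hull_same)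
    then have cy: "c \<bullet> y = b" using F by blast
    have t: "t = 1 - s" using * by simp
    have "c \<bullet> x - b = s" unfolding *(5) t by (simp add: inner_add_right v(2) cy algebra_simps)
    then show ?thesis using * y t by (intro exI[of _ y] exI[of _ s]) (simp add: add.commute)
  qed
  have le: "c \<bullet> x \<le> b + 1" if "x \<in> P" for x using coord[OF that] by auto
  have ne: "c \<noteq> 0" using v F Fp(3) by auto
  obtain y0 where y0: "y0 \<in> F" using Fp(3) by blast
  then have y0': "y0 \<in> P" "c \<bullet> y0 = b" using F by auto
  have ri: "b < c \<bullet> q" "c \<bullet> q < b + 1" if "q \<in> rel_interior P" for q
  proof -
    show "c \<bullet> q < b + 1" using rel_interior_functional_less[OF le y0'(1) _ that] y0'(2) by simp
    have "(- c) \<bullet> q < - b"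
      by (rule rel_interior_functional_less[of "- c" "- b" v]) (use ge v that in auto)
    then show "b < c \<bullet> q" by simp
  qed
  have affP: "x \<in> affine hull P" if "x \<in> P" for x using that by (rule hull_inc)
  have i1: "interior_count 1 P = 0"
  proof -
    have "q \<notin> int_lattice" if q: "q \<in> rel_interior P" for q
    proof
      assume "q \<in> int_lattice"
      moreover have "q \<in> affine hull P" using q rel_interior_subset[of P] affP by blast
      ultimately have "c \<bullet> q - b \<in> \<int>" by (intro int)
      then obtain k where "c \<bullet> q - b = of_int k" by (auto elim: Ints_cases)
      moreover have "0 < c \<bullet> q - b" "c \<bullet> q - b < 1" using ri[OF q] by auto
      ultimately show False by simp
    qed
    then show ?thesis unfolding interior_count_eq_0_iff[OF polytope_imp_bounded[OF polytope]] by auto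
  qed
  have "double_points = (\<lambda>w. w + v) ` facet_points F"
  proof
    have "v \<notin> F" using v F by auto
    then show "(\<lambda>w. w + v) ` facet_points F \<subseteq> double_points"
      using facet_plus_point[OF facet _ v(1)] by blast
    show "double_points \<subseteq> (\<lambda>w. w + v) ` facet_points F"
    proof
      fix d assume "d \<in> double_points"
      then obtain q where q: "q \<in> rel_interior P" "d = 2 *\<^sub>R q" "d \<in> int_lattice" by (auto simp: double_points_def)
      have qP: "q \<in> P" using q rel_interior_subset[of P] by blast
      \<comment> \<open>Subtracting \<open>v\<close> brings the doubled point back to the affine
        hull of \<open>P\<close>, at an integral height strictly between \<open>-1\<close> and
        \<open>1\<close>, hence \<open>0\<close>.\<close>
      define y where "y = d - v"
      have yM: "y \<in> int_lattice" using q v by (auto simp: y_def intro: int_lattice_diff)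
      have "y = 2 *\<^sub>R q + (- 1) *\<^sub>R v" by (simp add: y_def q)
      then have "y \<in> affine hull P"
        using mem_affine[OF affine_affine_hull affP[OF qP] affP, of v 2 "-1"] v by simp
      then have "c \<bullet> y - b \<in> \<int>" using yM by (rule int)
      then obtain k where k: "c \<bullet> y - b = of_int k" by (auto elim: Ints_cases)
      have cy: "c \<bullet> y - b = 2 * (c \<bullet> q - b) - 1" using v(2) by (simp add: y_def q(2) inner_diff_right)
      then have "-1 < c \<bullet> y - b" "c \<bullet> y - b < 1" using ri[OF q(1)] by auto
      then have "k = 0" using k by linarith
      \<comment> \<open>The slice of \<open>P\<close> at half height is \<open>F\<close> shrunk by
        one half towards \<open>v\<close>.\<close>
      have half: "2 *\<^sub>R x - v \<in> F" if x: "x \<in> P" "c \<bullet> x - b = 1/2" for x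
      proof -
        obtain z t where z: "z \<in> F" "x = (1 - t) *\<^sub>R z + t *\<^sub>R v" "c \<bullet> x - b = t" using coord[OF x(1)] by blast
        have t: "t = 1/2" using z(3) x(2) by simp
        have "2 *\<^sub>R x - v = z" unfolding z(2) t by (simp add: scaleR_right_distrib)
        then show ?thesis using z(1) by simp
      qed
      have cq: "c \<bullet> q - b = 1/2" using cy k \<open>k = 0\<close> by simp
      have "y \<in> rel_interior F"
        unfolding convex_rel_interior_iff[OF Fp(7,3)]
      proof
        fix x assume x: "x \<in> F"
        \<comment> \<open>Prolonging the segment from \<open>x'\<close> through \<open>q\<close>
          stays in the half-height slice, and projecting from \<open>v\<close> gives a prolongation
          of the segment from \<open>x\<close> through \<open>y\<close> inside
          \<open>F\<close>.\<close>
        define x' where "x' = (1 - 1/2) *\<^sub>R x + (1/2) *\<^sub>R v"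
        have "x' \<in> P" unfolding x'_def using x FP v by (intro convexD_alt[OF convex]) auto
        then obtain s where s: "s > 1" "(1 - s) *\<^sub>R x' + s *\<^sub>R q \<in> P"
          using q(1) convex_rel_interior_iff[OF convex nonempty] by blast
        have "c \<bullet> x = b" using x F by blast
        then have cx': "c \<bullet> x' - b = 1/2" using v(2) by (simp add: x'_def inner_add_right field_simps)
        have "c \<bullet> ((1 - s) *\<^sub>R x' + s *\<^sub>R q) - b = (1 - s) * (c \<bullet> x' - b) + s * (c \<bullet> q - b)"
          by (simp add: inner_add_right algebra_simps)
        then have "c \<bullet> ((1 - s) *\<^sub>R x' + s *\<^sub>R q) - b = 1/2" unfolding cx' cq by (simp add: field_simps)
        from half[OF s(2) this] have "2 *\<^sub>R ((1 - s) *\<^sub>R x' + s *\<^sub>R q) - v \<in> F" .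
        moreover have "2 *\<^sub>R ((1 - s) *\<^sub>R x' + s *\<^sub>R q) - v = (1 - s) *\<^sub>R x + s *\<^sub>R y"
        proof -
          have h: "2 *\<^sub>R x' = x + v" "2 *\<^sub>R q = y + v"
            by (simp_all add: x'_def y_def q(2) scaleR_right_distrib)
          have "2 *\<^sub>R ((1 - s) *\<^sub>R x' + s *\<^sub>R q) = (1 - s) *\<^sub>R (2 *\<^sub>R x') + s *\<^sub>R (2 *\<^sub>R q)"
            by (simp add: scaleR_right_distrib mult.commute)
          then show ?thesis unfolding h by (simp add: algebra_simps)
        qed
        ultimately show "\<exists>s>1. (1 - s) *\<^sub>R x + s *\<^sub>R y \<in> F" using s(1) by auto
      qed
      then have "y \<in> facet_points F" using yM by (simp add: facet_points_def)
      moreover have "d = y + v" by (simp add: y_def)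
      ultimately show "d \<in> (\<lambda>w. w + v) ` facet_points F" by blast
    qed
  qed
  then have cD: "card double_points = card (facet_points F)" by (simp add: card_image inj_on_def)
  have "facet_points F' = {}" if F': "F' \<in> facets" "F' \<noteq> F" for F'
  proof (rule ccontr)
    assume "facet_points F' \<noteq> {}"
    then obtain w where w: "w \<in> facet_points F'" by blast
    then have wP: "w \<in> P" "w \<in> int_lattice" "w \<in> rel_interior F'"
      using facet_points_subset(2)[OF F'(1)] by (auto simp: facet_points_def)
    have "w \<notin> F" by (rule facet_point_notin[OF F'(1) facet F'(2) wP(3)])
    then have "c \<bullet> w \<noteq> b" using wP F by blast
    have "c \<bullet> w - b \<in> \<int>" using wP affP by (intro int) auto
    then obtain k where k: "c \<bullet> w - b = of_int k" by (auto elim: Ints_cases)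
    have "0 < c \<bullet> w - b" "c \<bullet> w - b \<le> 1" using ge[OF wP(1)] le[OF wP(1)] \<open>c \<bullet> w \<noteq> b\<close> by auto
    then have "c \<bullet> w = b + 1" using k by auto
    have F'P: "F' \<subseteq> P" by (rule facet_properties(5)[OF F'(1)])
    have "x = v" if x: "x \<in> F'" for x
    proof -
      have "c \<bullet> x = b + 1"
        by (rule functional_max_rel_interior[OF facet_properties(7)[OF F'(1)] _ wP(3) \<open>c \<bullet> w = b + 1\<close> x])
          (use le F'P in blast)
      then show ?thesis using coord[of x] x F'P by auto
    qed
    then have "F' \<subseteq> {v}" by blast
    then have "aff_dim F' \<le> 0" using aff_dim_subset[of F' "{v}"] by simp
    then show False using facet_properties(4)[OF F'(1)] by simp
  qed
  then have "(\<Sum>F'\<in>facets. interior_count 1 F') = interior_count 1 F"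
    unfolding interior_count_facet_points using facet fin by (simp add: sum.remove[of _ F])
  then show ?thesis
    unfolding thin_iff using i1 cD by (simp add: interior_count_double_points interior_count_facet_points[simplified])
qed

lemma lattice_isomorphicE:
  assumes "lattice_isomorphic P P'"
  obtains f e where "linear f" "inj_on (\<lambda>x. f x + e) (affine hull P)"
    "\<And>x. x \<in> affine hull P \<Longrightarrow> f x + e \<in> int_lattice \<longleftrightarrow> x \<in> int_lattice" "(\<lambda>x. f x + e) ` P = P'"
proof -
  obtain f e where f: "linear f" "bij_betw (\<lambda>x. f x + e) (affine hull P) (affine hull P')"
    "bij_betw (\<lambda>x. f x + e) (affine hull P \<inter> int_lattice) (affine hull P' \<inter> int_lattice)" "(\<lambda>x. f x + e) ` P = P'"
    using assms unfolding lattice_isomorphic_def by blast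
  have inj: "inj_on (\<lambda>x. f x + e) (affine hull P)" by (rule bij_betw_imp_inj_on[OF f(2)])
  have "f x + e \<in> int_lattice \<longleftrightarrow> x \<in> int_lattice" if x: "x \<in> affine hull P" for x
  proof
    assume "x \<in> int_lattice"
    then show "f x + e \<in> int_lattice" using bij_betw_apply[OF f(3), of x] x by blast
  next
    assume *: "f x + e \<in> int_lattice"
    moreover have "f x + e \<in> affine hull P'" using bij_betw_apply[OF f(2) x] .
    ultimately obtain z where z: "z \<in> affine hull P \<inter> int_lattice" "f z + e = f x + e"
      using bij_betw_imp_surj_on[OF f(3)] by (metis (no_types, lifting) IntI imageE)
    then have "z = x" using inj_onD[OF inj z(2)] x by blast
    then show "x \<in> int_lattice" using z by blast
  qed
  then show thesis using that f inj by blast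
qed

text \<open>The height of the standard pyramid, pulled back along the isomorphism, is the functional
  that \<open>thin_if_pyramid_functional\<close> asks for.\<close>

lemma thin_if_lattice_pyramid:
  fixes Q :: "(real ^ 2) set"
  assumes Q: "lattice_polygon Q" and pyr: "lattice_pyramid_over P Q"
  shows "thin P"
proof -
  define P' where "P' = convex hull (Q \<times> {0::real} \<union> {0} \<times> {1})"
  obtain f e where f: "linear f" and inj: "inj_on (\<lambda>x. f x + e) (affine hull P)"
    and lat: "\<And>x. x \<in> affine hull P \<Longrightarrow> f x + e \<in> int_lattice \<longleftrightarrow> x \<in> int_lattice" and img: "(\<lambda>x. f x + e) ` P = P'"
    by (rule lattice_isomorphicE[OF pyr[unfolded lattice_pyramid_over_def, folded P'_def]]) (rule that)
  have Qc: "convex Q" "Q \<noteq> {}"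
    using Q lattice_polytope_imp_polytope polytope_imp_convex by (auto simp: lattice_polygon_def)
  have P'eq: "P' = convex hull (insert (0, 1) (Q \<times> {0}))" by (simp add: P'_def insert_commute Un_commute)
  have conv0: "convex hull (Q \<times> {0::real}) = Q \<times> {0}" using Qc by (intro hull_same convex_Times) auto
  have P'D: "\<exists>t y. 0 \<le> t \<and> t \<le> 1 \<and> y \<in> Q \<and> p = t *\<^sub>R (0, 1) + (1 - t) *\<^sub>R (y, 0)" if p: "p \<in> P'" for p
  proof -
    have "Q \<times> {0::real} \<noteq> {}" using Qc by simp
    then obtain s t q where "0 \<le> s" "0 \<le> t" "s + t = 1" "q \<in> Q \<times> {0}" "p = s *\<^sub>R (0, 1) + t *\<^sub>R q"
      using p unfolding P'eq convex_hull_insert[OF \<open>Q \<times> {0::real} \<noteq> {}\<close>] conv0 by blast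
    moreover from this have "t = 1 - s" "s \<le> 1" by auto
    moreover obtain y where "q = (y, 0)" "y \<in> Q" using \<open>q \<in> Q \<times> {0}\<close> by blast
    ultimately show ?thesis by (intro exI[of _ s] exI[of _ y]) simp
  qed
  have linpsi: "linear (\<lambda>x. snd (f x))" using linear_compose[OF f linear_snd] by (simp add: comp_def)
  obtain c where c: "\<And>x. snd (f x) = c \<bullet> x" by (rule linear_functional_inner[OF linpsi]) (rule that)
  define b where "b = - snd e"
  have z: "c \<bullet> x - b = snd (f x + e)" for x by (simp add: b_def c[symmetric])
  define F where "F = {x \<in> P. c \<bullet> x = b}"
  have affP: "x \<in> affine hull P" if "x \<in> P" for x using that by (rule hull_inc)
  have "(0, 1) \<in> P'" unfolding P'eq by (rule hull_inc) simp
  then obtain v where v: "v \<in> P" "f v + e = (0, 1)" using img by (metis (no_types, lifting) imageE)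
  have vM: "v \<in> int_lattice" using lat[OF affP[OF v(1)]] v(2) by (simp add: int_lattice_real2_real)
  have FP: "x \<in> F \<longleftrightarrow> x \<in> P \<and> snd (f x + e) = 0" for x
    using z[of x] by (auto simp: F_def)
  have range: "0 \<le> snd (f x + e)" if "x \<in> P" for x
  proof -
    have "f x + e \<in> P'" using img that by blast
    then obtain t y where "0 \<le> t" "f x + e = t *\<^sub>R (0, 1) + (1 - t) *\<^sub>R (y, 0)" using P'D by blast
    then show ?thesis by simp
  qed
  have "P = convex hull (insert v F)"
  proof
    show "convex hull (insert v F) \<subseteq> P" using v(1) convex by (intro hull_minimal) (auto simp: F_def)
    show "P \<subseteq> convex hull (insert v F)"
    proof
      fix x assume x: "x \<in> P"
      then obtain t y where t: "0 \<le> t" "t \<le> 1" "y \<in> Q" "f x + e = t *\<^sub>R (0, 1) + (1 - t) *\<^sub>R (y, 0)"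
        using P'D[of "f x + e"] img by blast
      have "(y, 0) \<in> P'" unfolding P'eq using t(3) by (intro hull_inc) simp
      then obtain x' where x': "x' \<in> P" "f x' + e = (y, 0)" using img by (metis (no_types, lifting) imageE)
      define r where "r = t *\<^sub>R v + (1 - t) *\<^sub>R x'"
      have x'F: "x' \<in> F" using x' by (simp add: FP)
      have "f r + e = t *\<^sub>R (f v + e) + (1 - t) *\<^sub>R (f x' + e)"
        unfolding r_def linear_add[OF f] linear_scale[OF f] by (simp add: algebra_simps)
      then have "f r + e = f x + e" using v(2) x'(2) t(4) by simp
      moreover have "r \<in> affine hull P"
        unfolding r_def using mem_affine[OF affine_affine_hull affP[OF v(1)] affP[OF x'(1)], of t "1 - t"] by simp
      ultimately have "r = x" using inj_onD[OF inj, of r x] affP[OF x] by blast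
      moreover have "r \<in> convex hull (insert v F)"
        unfolding r_def using x'F t hull_inc[of v "insert v F" convex] hull_inc[of x' "insert v F" convex]
        by (intro convexD[OF convex_convex_hull]) auto
      ultimately show "x \<in> convex hull (insert v F)" by simp
    qed
  qed
  moreover have "c \<bullet> x - b \<in> \<int>" if "x \<in> affine hull P" "x \<in> int_lattice" for x
    unfolding z using lat[OF that(1)] that(2) int_lattice_real2_real by blast
  ultimately show ?thesis
  proof (intro thin_if_pyramid_functional[of F c b v])
    show "b \<le> c \<bullet> x" if "x \<in> P" for x using range[OF that] z[of x] by simp
    show "c \<bullet> v = b + 1" using z[of v] v(2) by simp
  qed (use v vM in \<open>auto simp: F_def\<close>)
qed

text \<open>Forgetting the last coordinate maps the prism to the unimodular triangle. Its double has
  no interior lattice point, as two positive integers cannot have a sum below two.\<close>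

lemma interior_count_2_lawrence_prism:
  assumes "lawrence_prism_3 P"
  shows "interior_count 2 P = 0"
proof -
  obtain k0 and k :: "2 \<Rightarrow> nat" where iso: "lattice_isomorphic P (std_lawrence_prism k0 k)"
    using assms by (auto simp: lawrence_prism_3_def)
  define P' where "P' = std_lawrence_prism k0 k"
  obtain f e where f: "linear f"
    and lat: "\<And>x. x \<in> affine hull P \<Longrightarrow> f x + e \<in> int_lattice \<longleftrightarrow> x \<in> int_lattice" and img: "(\<lambda>x. f x + e) ` P = P'"
    by (rule lattice_isomorphicE[OF iso[folded P'_def]]) (rule that)
  define \<alpha> where "\<alpha> = (\<lambda>i x. vec_nth (fst (f x)) i)"
  define \<epsilon> where "\<epsilon> = vec_nth (fst e)"
  have lin: "linear (\<alpha> i)" for i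
    unfolding \<alpha>_def linear_iff by (simp add: linear_add[OF f] linear_scale[OF f])
  have sub: "P' \<subseteq> {p. 0 \<le> vec_nth (fst p) 1 \<and> 0 \<le> vec_nth (fst p) 2 \<and> vec_nth (fst p) 1 + vec_nth (fst p) 2 \<le> 1}"
    unfolding P'_def std_lawrence_prism_def
  proof (rule hull_minimal)
    show "convex {p :: (real ^ 2) \<times> real. 0 \<le> vec_nth (fst p) 1 \<and> 0 \<le> vec_nth (fst p) 2 \<and> vec_nth (fst p) 1 + vec_nth (fst p) 2 \<le> 1}"
      unfolding convex_def
    proof (intro ballI allI impI, unfold mem_Collect_eq)
      fix x y :: "(real ^ 2) \<times> real" and u v :: real
      assume *: "0 \<le> vec_nth (fst x) 1 \<and> 0 \<le> vec_nth (fst x) 2 \<and> vec_nth (fst x) 1 + vec_nth (fst x) 2 \<le> 1"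
        "0 \<le> vec_nth (fst y) 1 \<and> 0 \<le> vec_nth (fst y) 2 \<and> vec_nth (fst y) 1 + vec_nth (fst y) 2 \<le> 1"
        "0 \<le> u" "0 \<le> v" "u + v = 1"
      have "u * (vec_nth (fst x) 1 + vec_nth (fst x) 2) + v * (vec_nth (fst y) 1 + vec_nth (fst y) 2) \<le> 1"
        using * by (intro convex_bound_le) auto
      then show "0 \<le> vec_nth (fst (u *\<^sub>R x + v *\<^sub>R y)) 1 \<and> 0 \<le> vec_nth (fst (u *\<^sub>R x + v *\<^sub>R y)) 2 \<and>
          vec_nth (fst (u *\<^sub>R x + v *\<^sub>R y)) 1 + vec_nth (fst (u *\<^sub>R x + v *\<^sub>R y)) 2 \<le> 1"
        using * by (simp add: algebra_simps)
    qed
  qed (auto simp: UNIV_2 axis_def)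
  have mem: "(0, 0) \<in> P'" "(axis 1 1, 0) \<in> P'" "(axis 2 1, 0) \<in> P'"
    unfolding P'_def std_lawrence_prism_def by (rule hull_inc, auto)+
  obtain z0 z1 z2 where zs: "z0 \<in> P" "f z0 + e = (0, 0)" "z1 \<in> P" "f z1 + e = (axis 1 1, 0)" "z2 \<in> P" "f z2 + e = (axis 2 1, 0)"
  proof -
    have "\<exists>z. z \<in> P \<and> f z + e = p" if "p \<in> P'" for p
    proof -
      have "p \<in> (\<lambda>x. f x + e) ` P" using that img by simp
      then show ?thesis by auto
    qed
    then show thesis using mem that by meson
  qed
  have fe: "vec_nth (fst (f x + e)) i = \<alpha> i x + \<epsilon> i" for x i by (simp add: \<alpha>_def \<epsilon>_def)
  have bounds: "0 \<le> \<alpha> 1 x + \<epsilon> 1" "0 \<le> \<alpha> 2 x + \<epsilon> 2" "\<alpha> 1 x + \<epsilon> 1 + (\<alpha> 2 x + \<epsilon> 2) \<le> 1" if "x \<in> P" for x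
  proof -
    have "f x + e \<in> P'" using img that by blast
    then have "f x + e \<in> {p. 0 \<le> vec_nth (fst p) 1 \<and> 0 \<le> vec_nth (fst p) 2 \<and> vec_nth (fst p) 1 + vec_nth (fst p) 2 \<le> 1}"
      by (rule subsetD[OF sub])
    then show "0 \<le> \<alpha> 1 x + \<epsilon> 1" "0 \<le> \<alpha> 2 x + \<epsilon> 2" "\<alpha> 1 x + \<epsilon> 1 + (\<alpha> 2 x + \<epsilon> 2) \<le> 1"
      unfolding mem_Collect_eq fe by simp_all
  qed
  obtain c1 where c1: "\<And>x. \<alpha> 1 x = c1 \<bullet> x" by (rule linear_functional_inner[OF lin]) (rule that)
  obtain c2 where c2: "\<And>x. \<alpha> 2 x = c2 \<bullet> x" by (rule linear_functional_inner[OF lin]) (rule that)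
  have "2 *\<^sub>R q \<notin> int_lattice" if q: "q \<in> rel_interior P" for q
  proof
    assume 2: "2 *\<^sub>R q \<in> int_lattice"
    have "(- c1) \<bullet> q < \<epsilon> 1"
    proof (rule rel_interior_functional_less[of _ _ z1])
      show "(- c1) \<bullet> x \<le> \<epsilon> 1" if "x \<in> P" for x using bounds(1)[OF that] c1 by simp
      show "(- c1) \<bullet> z1 < \<epsilon> 1" using fe[of z1 1] c1[of z1] zs(4) by (simp add: axis_def)
    qed (use zs q in auto)
    then have p1: "0 < \<alpha> 1 q + \<epsilon> 1" using c1 by simp
    have "(- c2) \<bullet> q < \<epsilon> 2"
    proof (rule rel_interior_functional_less[of _ _ z2])
      show "(- c2) \<bullet> x \<le> \<epsilon> 2" if "x \<in> P" for x using bounds(2)[OF that] c2 by simp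
      show "(- c2) \<bullet> z2 < \<epsilon> 2" using fe[of z2 2] c2[of z2] zs(6) by (simp add: axis_def)
    qed (use zs q in auto)
    then have p2: "0 < \<alpha> 2 q + \<epsilon> 2" using c2 by simp
    have "(c1 + c2) \<bullet> q < 1 - \<epsilon> 1 - \<epsilon> 2"
    proof (rule rel_interior_functional_less[of _ _ z0])
      show "(c1 + c2) \<bullet> x \<le> 1 - \<epsilon> 1 - \<epsilon> 2" if "x \<in> P" for x
        using bounds(3)[OF that] c1[of x] c2[of x] by (simp add: inner_add_left)
      show "(c1 + c2) \<bullet> z0 < 1 - \<epsilon> 1 - \<epsilon> 2"
        using fe[of z0 1] fe[of z0 2] c1[of z0] c2[of z0] zs(2) by (simp add: inner_add_left)
    qed (use zs q in auto)
    then have p3: "(\<alpha> 1 q + \<epsilon> 1) + (\<alpha> 2 q + \<epsilon> 2) < 1" using c1[of q] c2[of q] by (simp add: inner_add_left)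
    have z0M: "z0 \<in> int_lattice" using lat[of z0] zs(1,2) hull_inc[of z0 P affine] by (simp add: int_lattice_real2_real)
    \<comment> \<open>In a larger ambient space \<open>2 *\<^sub>R q\<close> may lie outside the
      affine hull of \<open>P\<close>, where the map need not respect the lattice; subtracting the
      lattice point \<open>z0\<close> leads back.\<close>
    define y where "y = 2 *\<^sub>R q - z0"
    have yM: "y \<in> int_lattice" unfolding y_def by (rule int_lattice_diff[OF 2 z0M])
    have qP: "q \<in> P" using q rel_interior_subset[of P] by blast
    have "y = 2 *\<^sub>R q + (- 1) *\<^sub>R z0" by (simp add: y_def)
    then have yA: "y \<in> affine hull P"
      using mem_affine[OF affine_affine_hull hull_inc[OF qP] hull_inc[OF zs(1)], of 2 "-1"] by simp
    then have "f y + e \<in> int_lattice" using lat yM by blast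
    then have ints: "\<alpha> 1 y + \<epsilon> 1 \<in> \<int>" "\<alpha> 2 y + \<epsilon> 2 \<in> \<int>" unfolding int_lattice_real2_real fe by simp_all
    have "\<alpha> i z0 + \<epsilon> i = 0" for i using fe[of z0 i] zs(2) by simp
    then have dbl: "\<alpha> i y + \<epsilon> i = 2 * (\<alpha> i q + \<epsilon> i)" for i
      unfolding y_def linear_diff[OF lin] linear_scale[OF lin] by (simp add: algebra_simps add_eq_0_iff)
    have no: False if st: "0 < s" "0 < t" "s + t < 1" "2 * s \<in> \<int>" "2 * t \<in> \<int>" for s t :: real
    proof -
      obtain m n where mn: "2 * s = of_int m" "2 * t = of_int n" using st(4,5) by (auto elim!: Ints_cases)
      then have "0 < real_of_int m" "0 < real_of_int n" using st(1,2) by auto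
      moreover have "real_of_int m + real_of_int n < 2" using st(3) mn by linarith
      then have "real_of_int (m + n) < real_of_int 2" by simp
      then have "m + n < 2" by (simp only: of_int_less_iff)
      moreover have "0 < m" "0 < n" using \<open>0 < real_of_int m\<close> \<open>0 < real_of_int n\<close> by simp_all
      ultimately show False by linarith
    qed
    show False by (rule no[OF p1 p2 p3 ints[unfolded dbl]])
  qed
  then show ?thesis
    unfolding interior_count_eq_0_iff[OF polytope_imp_bounded[OF polytope]] by auto
qed

section \<open>Thin polytopes with interior lattice points in the double are pyramids\<close>

lemma double_points_contains:
  assumes B: "finite B" "B \<subseteq> P" "affine hull B = affine hull P" and \<beta>: "\<And>x. x \<in> B \<Longrightarrow> 0 < \<beta> x" "sum \<beta> B = 2"
    and lat: "(\<Sum>x\<in>B. \<beta> x *\<^sub>R x) \<in> int_lattice"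
  shows "(\<Sum>x\<in>B. \<beta> x *\<^sub>R x) \<in> double_points"
proof -
  define q where "q = (\<Sum>x\<in>B. (\<beta> x / 2) *\<^sub>R x)"
  have "q \<in> rel_interior (convex hull B)"
  proof (rule subsetD[OF explicit_subset_rel_interior_convex_hull_minimal[OF B(1)]], intro CollectI exI conjI)
    show "\<forall>x\<in>B. 0 < \<beta> x / 2" using \<beta>(1) by simp
    show "(\<Sum>x\<in>B. \<beta> x / 2) = 1" using \<beta>(2) by (simp flip: sum_divide_distrib)
  qed (simp add: q_def)
  moreover have "convex hull B \<subseteq> P" using B(2) convex by (rule hull_minimal)
  then have "rel_interior (convex hull B) \<subseteq> rel_interior P"
    using B(3) by (intro subset_rel_interior) auto
  ultimately have "q \<in> rel_interior P" by blast
  moreover have "(\<Sum>x\<in>B. \<beta> x *\<^sub>R x) = 2 *\<^sub>R q" by (simp add: q_def scaleR_sum_right)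
  ultimately show ?thesis using lat by (auto simp: double_points_def)
qed

lemma card_full_simplex:
  assumes "\<not> affine_dependent A" "affine hull A = affine hull P"
  shows "card A = 4"
  using aff_dim_unique[of A P] assms dim by simp

text \<open>Unimodularity can fail only through box points of height two with all weights positive,
  and these are interior lattice points of the double. Their exclusion is left as a hypothesis, so
  that the lemma serves for an empty double as well as for a double whose points are known.\<close>

lemma lattice_frame_of_empty_simplex:
  assumes B: "empty_simplex {a, b, c, d}" "{a, b, c, d} \<subseteq> P" "affine hull {a, b, c, d} = affine hull P"
    and two: "\<And>\<beta>. (\<And>x. x \<in> {a, b, c, d} \<Longrightarrow> 0 < \<beta> x \<and> \<beta> x < 1) \<Longrightarrow> sum \<beta> {a, b, c, d} = 2 \<Longrightarrow>
      (\<Sum>x\<in>{a, b, c, d}. \<beta> x *\<^sub>R x) \<notin> double_points"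
  shows "lattice_frame (affine hull P) a (b - a) (c - a) (d - a)"
proof -
  have ind: "\<not> affine_dependent {a, b, c, d}" and lat: "{a, b, c, d} \<subseteq> int_lattice" using B(1) by (auto simp: empty_simplex_def)
  have card: "card {a, b, c, d} = 4" by (rule card_full_simplex[OF ind B(3)])
  have "lattice_frame (affine hull {a, b, c, d}) a (b - a) (c - a) (d - a)"
  proof (rule lattice_frame_unimodular[OF ind card lat])
    fix x l t assume x: "x \<in> int_lattice" "sum l {a, b, c, d} = 1" "x = (\<Sum>t\<in>{a, b, c, d}. l t *\<^sub>R t)" "t \<in> {a, b, c, d}"
    show "l t \<in> \<int>"
    proof (rule empty_simplex_unimodular[OF B(1) _ _ x])
      show "card {a, b, c, d} \<le> 4" using card by simp
      fix \<beta> :: "'a \<Rightarrow> real"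
    assume \<beta>: "\<And>x. x \<in> {a, b, c, d} \<Longrightarrow> 0 < \<beta> x \<and> \<beta> x < 1" "sum \<beta> {a, b, c, d} = 2"
        "(\<Sum>x\<in>{a, b, c, d}. \<beta> x *\<^sub>R x) \<in> int_lattice"
      have "(\<Sum>x\<in>{a, b, c, d}. \<beta> x *\<^sub>R x) \<in> double_points"
        by (rule double_points_contains[OF _ B(2,3)]) (use \<beta> in auto)
      then show False using two[OF \<beta>(1,2)] by blast
    qed
  qed
  then show ?thesis using B(3) by simp
qed

text \<open>An empty lattice triangle spanning \<open>F\<close> forms with \<open>v\<close> an empty
  tetrahedron, since \<open>v\<close> is the only lattice point of \<open>P\<close> off
  \<open>F\<close>. An exceptional box point would be \<open>w + v\<close> with \<open>w\<close> in
  \<open>F\<close> and so have weight exactly \<open>1\<close> at \<open>v\<close>, not less. The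
  resulting frame puts \<open>v\<close> at height one above \<open>F\<close>.\<close>

lemma lattice_pyramid_if_thin:
  assumes "thin P" "interior_count 2 P \<noteq> 0"
  shows "\<exists>Q :: (real ^ 2) set. lattice_polygon Q \<and> lattice_pyramid_over P Q"
proof -
  obtain F v where F: "F \<in> facets" and v: "v \<in> int_lattice" "v \<notin> F" and P: "P = convex hull (insert v F)"
    and sub: "P \<inter> int_lattice \<subseteq> insert v F" and D: "double_points = (\<lambda>w. w + v) ` facet_points F"
    by (rule thin_imp_unique_nonhollow_facet[OF assms]) (rule that)
  note Fp = facet_properties[OF F]
  obtain c0 b0 where cb: "\<And>x. x \<in> P \<Longrightarrow> b0 \<le> c0 \<bullet> x" "F = {x \<in> P. c0 \<bullet> x = b0}"
    by (rule facet_functional[OF F]) (rule that)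
  have vP: "v \<in> P" unfolding P by (rule hull_inc) simp
  have vgt: "b0 < c0 \<bullet> v" using cb vP v(2) by (auto simp: less_le)
  note cF = corners[OF Fp(1)]
  obtain a where a: "a \<in> corners F" using corners_facet_not_pair[OF F] by blast
  have "empty_simplex {a}" "{a} \<subseteq> F" using a cF by (auto simp: empty_simplex_def)
  then obtain A where A: "a \<in> A" "A \<subseteq> F" "empty_simplex A" "affine hull A = affine hull F"
    using empty_simplex_extends[OF Fp(2), of "{a}"] by blast
  have indA: "\<not> affine_dependent A" "A \<subseteq> int_lattice" using A(3) by (auto simp: empty_simplex_def)
  have "card A = 3" using aff_dim_unique[of A F] indA A(4) Fp(4) by simp
  then obtain a b c where abc: "A = {a, b, c}" by (auto simp: card_3_iff)
  have on0: "c0 \<bullet> x = b0" if "x \<in> affine hull F" for x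
    using affine_hull_functional_eq[of F c0 b0 x] that cb(2) by blast
  have vA: "v \<notin> affine hull A" using on0 A(4) vgt by auto
  have ind: "\<not> affine_dependent (insert v A)" by (rule affine_independent_insert[OF indA(1) vA])
  have vAP: "insert v A \<subseteq> P" using vP A(2) Fp(5) by blast
  have aff: "affine hull (insert v A) = affine hull P"
  proof (rule affine_dim_equal)
    have "aff_dim (insert v A) = aff_dim F + 1" using vA A(4) aff_dim_insert[of v A] by (metis aff_dim_affine_hull)
    then show "aff_dim (affine hull insert v A) = aff_dim (affine hull P)" using Fp(4) dim by simp
    show "affine hull insert v A \<subseteq> affine hull P" by (rule hull_mono[OF vAP])
  qed auto
  have empty: "empty_simplex (insert v A)"
    unfolding empty_simplex_def
  proof (intro conjI)
    show "insert v A \<subseteq> int_lattice" using v indA by simp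
    show "convex hull insert v A \<inter> int_lattice \<subseteq> insert v A"
    proof
      fix x assume x: "x \<in> convex hull insert v A \<inter> int_lattice"
      have "x \<in> P" using x hull_minimal[of "insert v A" P convex] vAP convex by blast
      then consider "x = v" | "x \<in> F" using sub x by blast
      then show "x \<in> insert v A"
      proof cases
        case 2
        have "A \<noteq> {}" using A(1) by blast
        then obtain s t y where st: "0 \<le> s" "0 \<le> t" "s + t = 1" "y \<in> convex hull A" "x = s *\<^sub>R v + t *\<^sub>R y"
          using x unfolding convex_hull_insert[OF \<open>A \<noteq> {}\<close>] by blast
        have "y \<in> affine hull F" using st(4) A(4) convex_hull_subset_affine_hull[of A] by blast
        then have "c0 \<bullet> y = b0" by (rule on0)
        moreover have "c0 \<bullet> x = b0" using 2 cb(2) by blast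
        ultimately have "s * (c0 \<bullet> v) + t * b0 = b0" using st(5) by (simp add: inner_add_right)
        moreover have "t = 1 - s" using st(3) by simp
        ultimately have "s * (c0 \<bullet> v - b0) = 0" by (simp add: algebra_simps)
        then have "s = 0" using vgt by simp
        then have "x = y" using st by simp
        then show ?thesis using st(4) A(3) x by (auto simp: empty_simplex_def)
      qed simp
    qed
  qed (rule ind)
  have set: "insert v A = {a, b, c, v}" using abc by blast
  have fr: "lattice_frame (affine hull P) a (b - a) (c - a) (v - a)"
  proof (rule lattice_frame_of_empty_simplex[OF empty[unfolded set] vAP[unfolded set] aff[unfolded set]])
    fix \<beta> :: "'a \<Rightarrow> real"
    assume \<beta>: "\<And>x. x \<in> {a, b, c, v} \<Longrightarrow> 0 < \<beta> x \<and> \<beta> x < 1" "sum \<beta> {a, b, c, v} = 2"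
    show "(\<Sum>x\<in>{a, b, c, v}. \<beta> x *\<^sub>R x) \<notin> double_points"
    proof
      assume "(\<Sum>x\<in>{a, b, c, v}. \<beta> x *\<^sub>R x) \<in> double_points"
      then obtain y where y: "y \<in> F" "(\<Sum>x\<in>insert v A. \<beta> x *\<^sub>R x) = y + v"
        using D facet_points_subset(1)[OF F] unfolding set by blast
      have finA: "finite A" by (rule aff_independent_finite[OF indA(1)])
      have vnA: "v \<notin> A" using vA hull_inc[of v A affine] by blast
      have "c0 \<bullet> (\<Sum>x\<in>insert v A. \<beta> x *\<^sub>R x) = \<beta> v * (c0 \<bullet> v) + (\<Sum>x\<in>A. \<beta> x * (c0 \<bullet> x))"
        using finA vnA by (simp add: inner_add_right inner_sum_right)
      also have "(\<Sum>x\<in>A. \<beta> x * (c0 \<bullet> x)) = (\<Sum>x\<in>A. \<beta> x * b0)"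
        by (rule sum.cong) (use A(2) cb(2) in auto)
      also have "\<dots> = (2 - \<beta> v) * b0" using \<beta>(2) finA vnA by (simp flip: set sum_distrib_right)
      finally have "b0 + c0 \<bullet> v = \<beta> v * (c0 \<bullet> v) + (2 - \<beta> v) * b0"
        using y cb(2) by (auto simp: inner_add_right)
      then have "(1 - \<beta> v) * (c0 \<bullet> v - b0) = 0" by (simp add: algebra_simps)
      then show False using vgt \<beta>(1)[of v] by simp
    qed
  qed
  have Fpts: "\<exists>s t. x = a + s *\<^sub>R (b - a) + t *\<^sub>R (c - a)" if x: "x \<in> corners F" for x
  proof -
    have "x \<in> affine hull P" using x cF by (intro hull_inc) blast
    then obtain s t r where *: "x = a + s *\<^sub>R (b - a) + t *\<^sub>R (c - a) + r *\<^sub>R (v - a)"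
      using fr unfolding lattice_frame_def by blast
    have abc0: "c0 \<bullet> a = b0" "c0 \<bullet> b = b0" "c0 \<bullet> c = b0" using A(2) abc cb(2) by auto
    have "c0 \<bullet> x = b0" using x cF(2) cb(2) by blast
    then have "r * (c0 \<bullet> v - b0) = 0" unfolding * by (simp add: inner_add_right inner_diff_right abc0)
    then have "r = 0" using vgt by simp
    then show ?thesis using * by auto
  qed
  show ?thesis
  proof (rule lattice_pyramid_of_frame[OF fr, of "corners F"])
    show "finite (corners F)" using cF(3) finite_points finite_subset by blast
    show "corners F \<subseteq> int_lattice" using cF(3) by blast
    show "P = convex hull insert (a + (v - a)) (corners F)"
      using hull_insert[of convex v "corners F"] cF(1) P by simp
  qed (use Fpts in blast)
qed

end

section \<open>Polytopes of degree at most one\<close>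

definition frame_point :: "'a::euclidean_space \<Rightarrow> 'a \<Rightarrow> 'a \<Rightarrow> 'a \<Rightarrow> real \<Rightarrow> real \<Rightarrow> real \<Rightarrow> 'a" where
  "frame_point x\<^sub>0 u v w a b c = x\<^sub>0 + a *\<^sub>R u + b *\<^sub>R v + c *\<^sub>R w"

lemma frame_point_swap:
  "frame_point x\<^sub>0 v u w a b c = frame_point x\<^sub>0 u v w b a c"
  "frame_point x\<^sub>0 u w v a b c = frame_point x\<^sub>0 u v w a c b"
  by (simp_all add: frame_point_def add_ac)

text \<open>A symmetry of the frame tetrahedron that exchanges the origin with
  \<open>x\<^sub>0 + w\<close>; \<open>1 - a - b - c\<close> is the barycentric coordinate belonging
  to the old origin.\<close>

lemma frame_point_rebase:
  "frame_point (x\<^sub>0 + w) (u - w) (v - w) (- w) a b c = frame_point x\<^sub>0 u v w a b (1 - a - b - c)"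
  by (simp add: frame_point_def algebra_simps)

lemma lattice_frame_rebase:
  assumes "lattice_frame S x\<^sub>0 u v w"
  shows "lattice_frame S (x\<^sub>0 + w) (u - w) (v - w) (- w)"
proof -
  have "lattice_frame S (x\<^sub>0 + 1 *\<^sub>R w) u v w" by (rule lattice_frame_shift[OF assms]) simp
  then have "lattice_frame S (x\<^sub>0 + w) u v w" by simp
  then have "lattice_frame S (x\<^sub>0 + w) (u + (- 1) *\<^sub>R w) v w" by (rule lattice_frame_shear) simp
  then have "lattice_frame S (x\<^sub>0 + w) (u - w) v w" by simp
  then have "lattice_frame S (x\<^sub>0 + w) v (u - w) w" by (rule lattice_frame_swap)
  then have "lattice_frame S (x\<^sub>0 + w) (v + (- 1) *\<^sub>R w) (u - w) w" by (rule lattice_frame_shear) simp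
  then have "lattice_frame S (x\<^sub>0 + w) (v - w) (u - w) w" by simp
  then show ?thesis by (rule lattice_frame_uminus[OF lattice_frame_swap(1)])
qed

context lattice_polytope_3
begin

lemma frame_point_lattice:
  assumes "lattice_frame (affine hull P) x\<^sub>0 u v w"
  shows "frame_point x\<^sub>0 u v w a b c \<in> int_lattice \<longleftrightarrow> a \<in> \<int> \<and> b \<in> \<int> \<and> c \<in> \<int>"
  using assms unfolding lattice_frame_def frame_point_def by blast

lemma frame_point_inject:
  assumes "lattice_frame (affine hull P) x\<^sub>0 u v w"
  shows "frame_point x\<^sub>0 u v w a b c = frame_point x\<^sub>0 u v w a' b' c' \<longleftrightarrow> a = a' \<and> b = b' \<and> c = c'"
proof
  assume "frame_point x\<^sub>0 u v w a b c = frame_point x\<^sub>0 u v w a' b' c'"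
  then have "(a - a') *\<^sub>R u + (b - b') *\<^sub>R v + (c - c') *\<^sub>R w = 0"
    by (simp add: frame_point_def algebra_simps)
  then have "a - a' = 0 \<and> b - b' = 0 \<and> c - c' = 0" using assms unfolding lattice_frame_def by blast
  then show "a = a' \<and> b = b' \<and> c = c'" by simp
qed simp

lemma frame_point_convex:
  assumes "frame_point x\<^sub>0 u v w a b c \<in> P" "frame_point x\<^sub>0 u v w a' b' c' \<in> P" "0 \<le> t" "t \<le> 1"
  shows "frame_point x\<^sub>0 u v w ((1 - t) * a + t * a') ((1 - t) * b + t * b') ((1 - t) * c + t * c') \<in> P"
proof -
  have "frame_point x\<^sub>0 u v w ((1 - t) * a + t * a') ((1 - t) * b + t * b') ((1 - t) * c + t * c')
     = (1 - t) *\<^sub>R frame_point x\<^sub>0 u v w a b c + t *\<^sub>R frame_point x\<^sub>0 u v w a' b' c'"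
    by (simp add: frame_point_def algebra_simps)
  then show ?thesis using convexD_alt[OF convex assms] by simp
qed

text \<open>
  A combination of total weight two, with positive weights on four affinely independent points of
  the polytope, is an interior point of its double, so it cannot be a lattice point. All later
  exclusions of points are instances of this with suitable weights.
\<close>
lemma no_half_point:
  fixes a b c d f h x y z w0 w1 w2 w3 w4 :: real
  assumes fr: "lattice_frame (affine hull P) x\<^sub>0 u v w" and D: "double_points = {}"
    and p: "frame_point x\<^sub>0 u v w 0 0 0 \<in> P" "frame_point x\<^sub>0 u v w 0 0 h \<in> P" "frame_point x\<^sub>0 u v w 0 b c \<in> P"
      "frame_point x\<^sub>0 u v w a d f \<in> P" "frame_point x\<^sub>0 u v w x y z \<in> P"
    and ne: "h \<noteq> 0" "b \<noteq> 0" "a \<noteq> 0"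
    and ws: "0 < w0" "0 < w1" "0 < w2" "0 < w3" "0 \<le> w4" "w0 + w1 + w2 + w3 + w4 = 2"
    and int: "w3 * a + w4 * x \<in> \<int>" "w2 * b + w3 * d + w4 * y \<in> \<int>" "w1 * h + w2 * c + w3 * f + w4 * z \<in> \<int>"
  shows False
proof -
  let ?p = "frame_point x\<^sub>0 u v w"
  note frd = fr[unfolded lattice_frame_def]
  note inj = frame_point_inject[OF fr, THEN iffD1]
  let ?B = "{?p 0 0 0, ?p 0 0 h, ?p 0 b c, ?p a d f}"
  have dist: "?p 0 0 0 \<noteq> ?p 0 0 h" "?p 0 0 0 \<noteq> ?p 0 b c" "?p 0 0 0 \<noteq> ?p a d f" "?p 0 0 h \<noteq> ?p 0 b c"
    "?p 0 0 h \<noteq> ?p a d f" "?p 0 b c \<noteq> ?p a d f"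
    using inj ne by metis+
  have BP: "?B \<subseteq> P" using p by blast
  have comb: "k0 *\<^sub>R ?p 0 0 0 + k1 *\<^sub>R ?p 0 0 h + k2 *\<^sub>R ?p 0 b c + k3 *\<^sub>R ?p a d f
      = (k0 + k1 + k2 + k3) *\<^sub>R x\<^sub>0 + (k3 * a) *\<^sub>R u + (k2 * b + k3 * d) *\<^sub>R v + (k1 * h + k2 * c + k3 * f) *\<^sub>R w" for k0 k1 k2 k3
    by (simp add: frame_point_def algebra_simps)
  have "affine hull P \<subseteq> affine hull ?B"
  proof
    fix q assume "q \<in> affine hull P"
    then obtain \<alpha> \<beta> \<gamma> where q: "q = x\<^sub>0 + \<alpha> *\<^sub>R u + \<beta> *\<^sub>R v + \<gamma> *\<^sub>R w" using frd by blast
    \<comment> \<open>The four points are in triangular form, so the coefficients come from back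
      substitution, dividing by \<open>a\<close>, \<open>b\<close> and \<open>h\<close>.\<close>
    define k3 where "k3 = \<alpha> / a"
    define k2 where "k2 = (\<beta> - k3 * d) / b"
    define k1 where "k1 = (\<gamma> - k2 * c - k3 * f) / h"
    define k0 where "k0 = 1 - k1 - k2 - k3"
    have k: "k3 * a = \<alpha>" "k2 * b + k3 * d = \<beta>" "k1 * h + k2 * c + k3 * f = \<gamma>" "k0 + k1 + k2 + k3 = 1"
      using ne by (simp_all add: k3_def k2_def k1_def k0_def)
    have "q = k0 *\<^sub>R ?p 0 0 0 + k1 *\<^sub>R ?p 0 0 h + k2 *\<^sub>R ?p 0 b c + k3 *\<^sub>R ?p a d f"
      unfolding comb k q by simp
    moreover define \<mu> where "\<mu> = (\<lambda>t. if t = ?p 0 0 0 then k0 else if t = ?p 0 0 h then k1 else if t = ?p 0 b c then k2 else k3)"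
    ultimately have "sum \<mu> ?B = 1" "(\<Sum>t\<in>?B. \<mu> t *\<^sub>R t) = q"
      using dist k(4) by (simp_all add: \<mu>_def add.assoc)
    then show "q \<in> affine hull ?B" using affine_hull_finite[of ?B] by blast
  qed
  then have aff: "affine hull ?B = affine hull P" using hull_mono[OF BP, of affine] by blast
  define W where "W = w0 + w1 + w2 + w3"
  have W: "0 < W" "W \<le> 2" "w4 = 2 - W" using ws by (auto simp: W_def)
  define m where "m = (w0/W) *\<^sub>R ?p 0 0 0 + (w1/W) *\<^sub>R ?p 0 0 h + (w2/W) *\<^sub>R ?p 0 b c + (w3/W) *\<^sub>R ?p a d f"
  have "m \<in> rel_interior (convex hull ?B)"
  proof -
    define \<mu> where "\<mu> = (\<lambda>t. if t = ?p 0 0 0 then w0/W else if t = ?p 0 0 h then w1/W else if t = ?p 0 b c then w2/W else w3/W)"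
    have "sum \<mu> ?B = w0/W + (w1/W + (w2/W + w3/W))" "(\<Sum>t\<in>?B. \<mu> t *\<^sub>R t) = m"
      using dist by (simp_all add: \<mu>_def m_def add.assoc)
    moreover have "w0/W + (w1/W + (w2/W + w3/W)) = 1" using W by (simp add: W_def add_divide_distrib[symmetric] add.assoc)
    moreover have "\<forall>t\<in>?B. 0 < \<mu> t" using ws W by (simp add: \<mu>_def)
    ultimately show ?thesis
      using explicit_subset_rel_interior_convex_hull_minimal[of ?B] by force
  qed
  moreover have "convex hull ?B \<subseteq> P" using BP convex by (rule hull_minimal)
  then have "rel_interior (convex hull ?B) \<subseteq> rel_interior P"
    using aff by (intro subset_rel_interior) auto
  ultimately have mP: "m \<in> rel_interior P" by blast
  \<comment> \<open>The fifth point may lie anywhere in \<open>P\<close>: moving from it towards the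
    interior point \<open>m\<close> stays in the interior.\<close>
  define s where "s = ?p x y z"
  have "s - (W/2) *\<^sub>R (s - m) \<in> rel_interior P"
    by (rule rel_interior_convex_shrink[OF convex mP]) (use p W in \<open>auto simp: s_def\<close>)
  moreover have "2 *\<^sub>R (s - (W/2) *\<^sub>R (s - m)) = w4 *\<^sub>R s + W *\<^sub>R m" by (simp add: W(3) algebra_simps)
  moreover have "W *\<^sub>R m = w0 *\<^sub>R ?p 0 0 0 + w1 *\<^sub>R ?p 0 0 h + w2 *\<^sub>R ?p 0 b c + w3 *\<^sub>R ?p a d f"
    unfolding m_def using W by (simp add: scaleR_right_distrib)
  ultimately have half: "2 *\<^sub>R (s - (W/2) *\<^sub>R (s - m)) = 2 *\<^sub>R x\<^sub>0 + (w3 * a + w4 * x) *\<^sub>R u + (w2 * b + w3 * d + w4 * y) *\<^sub>R v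
      + (w1 * h + w2 * c + w3 * f + w4 * z) *\<^sub>R w"
  proof -
    have "W + w4 = 2" using W by simp
    have "w4 *\<^sub>R s = w4 *\<^sub>R x\<^sub>0 + (w4 * x) *\<^sub>R u + (w4 * y) *\<^sub>R v + (w4 * z) *\<^sub>R w"
      by (simp add: s_def frame_point_def algebra_simps)
    then have "w4 *\<^sub>R s + W *\<^sub>R m = (W + w4) *\<^sub>R x\<^sub>0 + (w3 * a + w4 * x) *\<^sub>R u + (w2 * b + w3 * d + w4 * y) *\<^sub>R v
      + (w1 * h + w2 * c + w3 * f + w4 * z) *\<^sub>R w"
      unfolding \<open>W *\<^sub>R m = _\<close> comb W_def[symmetric] by (simp add: algebra_simps)
    then show ?thesis unfolding \<open>W + w4 = 2\<close> \<open>2 *\<^sub>R (s - (W/2) *\<^sub>R (s - m)) = _\<close> .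
  qed
  have "x\<^sub>0 + 0 *\<^sub>R u + 0 *\<^sub>R v + 0 *\<^sub>R w \<in> int_lattice" using frd Ints_0 by blast
  \<comment> \<open>The doubled point is \<open>x\<^sub>0\<close> plus a frame point with integral
    coordinates, hence a lattice point even where it leaves the affine hull of
    \<open>P\<close>.\<close>
  then have x0: "x\<^sub>0 \<in> int_lattice" by simp
  have "x\<^sub>0 + (w3 * a + w4 * x) *\<^sub>R u + (w2 * b + w3 * d + w4 * y) *\<^sub>R v
      + (w1 * h + w2 * c + w3 * f + w4 * z) *\<^sub>R w \<in> int_lattice" using frd int by blast
  then have "x\<^sub>0 + (x\<^sub>0 + (w3 * a + w4 * x) *\<^sub>R u + (w2 * b + w3 * d + w4 * y) *\<^sub>R v
      + (w1 * h + w2 * c + w3 * f + w4 * z) *\<^sub>R w) \<in> int_lattice" by (rule int_lattice_add[OF x0])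
  then have "2 *\<^sub>R (s - (W/2) *\<^sub>R (s - m)) \<in> int_lattice" unfolding half by (simp add: scaleR_2 add.assoc)
  then have "2 *\<^sub>R (s - (W/2) *\<^sub>R (s - m)) \<in> double_points"
    using \<open>s - (W/2) *\<^sub>R (s - m) \<in> rel_interior P\<close> by (auto simp: double_points_def)
  then show False using D by blast
qed

abbreviation "pyramid_over_polygon \<equiv> (\<exists>Q :: (real ^ 2) set. lattice_polygon Q \<and> lattice_pyramid_over P Q)"

lemma frame_point_exists:
  assumes "lattice_frame (affine hull P) x\<^sub>0 u v w" "x \<in> P \<inter> int_lattice"
  obtains a b c :: int where "x = frame_point x\<^sub>0 u v w a b c"
proof -
  have "x \<in> affine hull P" using assms(2) by (simp add: hull_inc)
  then obtain a b c where x: "x = frame_point x\<^sub>0 u v w a b c"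
    using assms(1) unfolding lattice_frame_def frame_point_def by blast
  then have "a \<in> \<int>" "b \<in> \<int>" "c \<in> \<int>" using frame_point_lattice[OF assms(1)] assms(2) by auto
  then show thesis using that x by (auto elim!: Ints_cases)
qed

lemma corners_P: "P = convex hull (corners P)" "corners P \<subseteq> P \<inter> int_lattice" "finite (corners P)"
  using corners[OF face_of_refl[OF convex]] finite_subset[OF _ finite_points] by auto

lemma frame_fiber:
  assumes fr: "lattice_frame (affine hull P) x\<^sub>0 u v w" and p: "frame_point x\<^sub>0 u v w a b 0 \<in> P" and ab: "a \<in> \<int>" "b \<in> \<int>"
  obtains l m :: int where "l \<le> 0" "0 \<le> m" "frame_point x\<^sub>0 u v w a b l \<in> P" "frame_point x\<^sub>0 u v w a b m \<in> P"
    "\<And>k :: int. frame_point x\<^sub>0 u v w a b k \<in> P \<Longrightarrow> l \<le> k \<and> k \<le> m"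
proof -
  define Z where "Z = {k :: int. frame_point x\<^sub>0 u v w a b k \<in> P}"
  have "finite Z"
  proof (rule finite_imageD)
    show "finite ((\<lambda>k :: int. frame_point x\<^sub>0 u v w a b k) ` Z)"
      by (rule finite_subset[OF _ finite_points]) (auto simp: Z_def frame_point_lattice[OF fr] ab)
    show "inj_on (\<lambda>k :: int. frame_point x\<^sub>0 u v w a b k) Z"
      by (rule inj_onI) (simp add: frame_point_inject[OF fr])
  qed
  moreover have "0 \<in> Z" using p by (simp add: Z_def)
  ultimately have "Min Z \<in> Z" "Max Z \<in> Z" "\<And>k. k \<in> Z \<Longrightarrow> Min Z \<le> k \<and> k \<le> Max Z"
    using Min_in Max_in by auto
  then show thesis using that[of "Min Z" "Max Z"] \<open>0 \<in> Z\<close> unfolding Z_def by blast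
qed

lemma frame_point_fiber_segment:
  assumes "l \<le> k" "k \<le> m" "frame_point x\<^sub>0 u v w a b l \<in> convex hull V" "frame_point x\<^sub>0 u v w a b m \<in> convex hull V"
  shows "frame_point x\<^sub>0 u v w a b k \<in> convex hull V"
proof (cases "l = m")
  case False
  define t where "t = (k - l) / (m - l)"
  have "t * (m - l) = k - l" using False by (simp add: t_def)
  then have k: "k = (1 - t) * l + t * m" by (simp add: algebra_simps)
  have "frame_point x\<^sub>0 u v w a b k = (1 - t) *\<^sub>R frame_point x\<^sub>0 u v w a b l + t *\<^sub>R frame_point x\<^sub>0 u v w a b m"
    unfolding k by (simp add: frame_point_def algebra_simps)
  moreover have "0 \<le> t" "t \<le> 1" using assms(1,2) False by (auto simp: t_def divide_le_eq_1)
  ultimately show ?thesis using convexD_alt[OF convex_convex_hull assms(3,4)] by simp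
qed (use assms in auto)

text \<open>All lattice points lie over the corners of a unimodular triangle, so \<open>P\<close> is
  the hull of three parallel segments. If one of them is a point, it is the apex of a pyramid over
  the hull of the other two; otherwise shearing the lower ends to height zero gives a Lawrence
  prism.\<close>

lemma pyramid_or_lawrence_if_three_lines:
  assumes fr: "lattice_frame (affine hull P) x\<^sub>0 u v w"
    and p: "frame_point x\<^sub>0 u v w 0 0 0 \<in> P" "frame_point x\<^sub>0 u v w 1 0 0 \<in> P" "frame_point x\<^sub>0 u v w 0 1 0 \<in> P"
    and lines: "\<And>(a :: int) (b :: int) (c :: int). frame_point x\<^sub>0 u v w a b c \<in> P \<Longrightarrow> a = 0 \<and> b = 0 \<or> a = 1 \<and> b = 0 \<or> a = 0 \<and> b = 1"
  shows "pyramid_over_polygon \<or> lawrence_prism_3 P"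
proof -
  let ?p = "frame_point x\<^sub>0 u v w"
  obtain l0 m0 :: int where h0: "l0 \<le> 0" "0 \<le> m0" "?p 0 0 l0 \<in> P" "?p 0 0 m0 \<in> P" "\<And>k :: int. ?p 0 0 k \<in> P \<Longrightarrow> l0 \<le> k \<and> k \<le> m0"
    by (rule frame_fiber[OF fr p(1)]) (simp, simp, rule that)
  obtain l1 m1 :: int where h1: "l1 \<le> 0" "0 \<le> m1" "?p 1 0 l1 \<in> P" "?p 1 0 m1 \<in> P" "\<And>k :: int. ?p 1 0 k \<in> P \<Longrightarrow> l1 \<le> k \<and> k \<le> m1"
    by (rule frame_fiber[OF fr p(2)]) (simp, simp, rule that)
  obtain l2 m2 :: int where h2: "l2 \<le> 0" "0 \<le> m2" "?p 0 1 l2 \<in> P" "?p 0 1 m2 \<in> P" "\<And>k :: int. ?p 0 1 k \<in> P \<Longrightarrow> l2 \<le> k \<and> k \<le> m2"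
    by (rule frame_fiber[OF fr p(3)]) (simp, simp, rule that)
  define V where "V = {?p 0 0 l0, ?p 0 0 m0, ?p 1 0 l1, ?p 1 0 m1, ?p 0 1 l2, ?p 0 1 m2}"
  have VP: "V \<subseteq> P" using h0 h1 h2 by (simp add: V_def)
  have inV: "x \<in> convex hull V" if "x \<in> V" for x using that by (rule hull_inc)
  have PV: "P = convex hull V"
  proof
    show "convex hull V \<subseteq> P" using VP convex by (rule hull_minimal)
    have "corners P \<subseteq> convex hull V"
    proof
      fix x assume "x \<in> corners P"
      then have xP: "x \<in> P \<inter> int_lattice" using corners_P(2) by blast
      then obtain a b c :: int where x: "x = ?p a b c" by (rule frame_point_exists[OF fr])
      have "?p a b c \<in> P" using x xP by simp
      then have "a = 0 \<and> b = 0 \<or> a = 1 \<and> b = 0 \<or> a = 0 \<and> b = 1" using lines[of a b c] by simp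
      then consider "a = 0" "b = 0" | "a = 1" "b = 0" | "a = 0" "b = 1" by auto
      then show "x \<in> convex hull V"
      proof cases
        case 1
        then have "?p 0 0 c \<in> P" using x xP by simp
        then have le: "l0 \<le> c" "c \<le> m0" using h0(5)[of c] by simp_all
        show ?thesis unfolding x 1 of_int_0
          by (rule frame_point_fiber_segment[of "of_int l0" _ "of_int m0", OF _ _ inV inV]) (use le in \<open>auto simp: V_def\<close>)
      next
        case 2
        then have "?p 1 0 c \<in> P" using x xP by simp
        then have le: "l1 \<le> c" "c \<le> m1" using h1(5)[of c] by simp_all
        show ?thesis unfolding x 2 of_int_0 of_int_1
          by (rule frame_point_fiber_segment[of "of_int l1" _ "of_int m1", OF _ _ inV inV]) (use le in \<open>auto simp: V_def\<close>)
      next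
        case 3
        then have "?p 0 1 c \<in> P" using x xP by simp
        then have le: "l2 \<le> c" "c \<le> m2" using h2(5)[of c] by simp_all
        show ?thesis unfolding x 3 of_int_0 of_int_1
          by (rule frame_point_fiber_segment[of "of_int l2" _ "of_int m2", OF _ _ inV inV]) (use le in \<open>auto simp: V_def\<close>)
      qed
    qed
    then have "convex hull (corners P) \<subseteq> convex hull V" by (rule hull_minimal) (rule convex_convex_hull)
    then show "P \<subseteq> convex hull V" using corners_P(1) by simp
  qed
  have Vlat: "V \<subseteq> int_lattice" by (auto simp: V_def frame_point_lattice[OF fr])
  consider "l1 = m1" | "l2 = m2" | "l0 = m0" | "l0 < m0" "l1 < m1" "l2 < m2" using h0 h1 h2 by linarith
  then show ?thesis
  proof cases
    case 1
    then have z: "l1 = 0" "m1 = 0" using h1(1,2) by auto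
    let ?V = "{?p 0 0 l0, ?p 0 0 m0, ?p 0 1 l2, ?p 0 1 m2}"
    have "pyramid_over_polygon"
    proof (rule lattice_pyramid_of_frame[of P x\<^sub>0 v w u ?V])
      show "lattice_frame (affine hull P) x\<^sub>0 v w u" using fr lattice_frame_swap by blast
      show "?V \<subseteq> int_lattice" using Vlat by (simp add: V_def)
      show "P = convex hull insert (x\<^sub>0 + u) ?V"
        unfolding PV V_def z by (simp add: frame_point_def insert_commute)
      have "?p 0 b c = x\<^sub>0 + b *\<^sub>R v + c *\<^sub>R w" for b c by (simp add: frame_point_def)
      then show "\<exists>a b. x = x\<^sub>0 + a *\<^sub>R v + b *\<^sub>R w" if "x \<in> ?V" for x using that by blast
    qed simp
    then show ?thesis by blast
  next
    case 2
    then have z: "l2 = 0" "m2 = 0" using h2(1,2) by auto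
    let ?V = "{?p 0 0 l0, ?p 0 0 m0, ?p 1 0 l1, ?p 1 0 m1}"
    have "pyramid_over_polygon"
    proof (rule lattice_pyramid_of_frame[of P x\<^sub>0 u w v ?V])
      show "lattice_frame (affine hull P) x\<^sub>0 u w v" using fr lattice_frame_swap by blast
      show "?V \<subseteq> int_lattice" using Vlat by (simp add: V_def)
      show "P = convex hull insert (x\<^sub>0 + v) ?V"
        unfolding PV V_def z by (simp add: frame_point_def insert_commute)
      have "?p a 0 c = x\<^sub>0 + a *\<^sub>R u + c *\<^sub>R w" for a c by (simp add: frame_point_def)
      then show "\<exists>a b. x = x\<^sub>0 + a *\<^sub>R u + b *\<^sub>R w" if "x \<in> ?V" for x using that by blast
    qed simp
    then show ?thesis by blast
  next
    case 3
    then have z: "l0 = 0" "m0 = 0" using h0(1,2) by auto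
    let ?V = "{?p 1 0 l1, ?p 1 0 m1, ?p 0 1 l2, ?p 0 1 m2}"
    have "pyramid_over_polygon"
    \<comment> \<open>Here the apex is \<open>x\<^sub>0\<close>, so the frame is moved to
      \<open>x\<^sub>0 + u\<close>, from where \<open>v - u\<close> and \<open>w\<close> span the
      base and \<open>- u\<close> leads to the apex.\<close>
    proof (rule lattice_pyramid_of_frame[of P "x\<^sub>0 + u" "v - u" w "- u" ?V])
      have "lattice_frame (affine hull P) x\<^sub>0 v w u" using fr lattice_frame_swap by blast
      then have "lattice_frame (affine hull P) (x\<^sub>0 + 1 *\<^sub>R u) v w u" by (rule lattice_frame_shift) simp
      then have "lattice_frame (affine hull P) (x\<^sub>0 + 1 *\<^sub>R u) (v + (- 1) *\<^sub>R u) w u" by (rule lattice_frame_shear) simp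
      then show "lattice_frame (affine hull P) (x\<^sub>0 + u) (v - u) w (- u)" using lattice_frame_uminus by simp
      show "?V \<subseteq> int_lattice" using Vlat by (simp add: V_def)
      show "P = convex hull insert (x\<^sub>0 + u + - u) ?V"
        unfolding PV V_def z by (simp add: frame_point_def insert_commute)
      have "?p 1 0 c = (x\<^sub>0 + u) + 0 *\<^sub>R (v - u) + c *\<^sub>R w" "?p 0 1 c = (x\<^sub>0 + u) + 1 *\<^sub>R (v - u) + c *\<^sub>R w" for c
        by (simp_all add: frame_point_def)
      then show "\<exists>a b. x = (x\<^sub>0 + u) + a *\<^sub>R (v - u) + b *\<^sub>R w" if "x \<in> ?V" for x using that by blast
    qed simp
    then show ?thesis by blast
  next
    case 4
    define x\<^sub>1 where "x\<^sub>1 = x\<^sub>0 + of_int l0 *\<^sub>R w"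
    define u' where "u' = u + of_int (l1 - l0) *\<^sub>R w"
    define v' where "v' = v + of_int (l2 - l0) *\<^sub>R w"
    have "lattice_frame (affine hull P) x\<^sub>1 u v w" unfolding x\<^sub>1_def by (rule lattice_frame_shift[OF fr]) simp
    then have "lattice_frame (affine hull P) x\<^sub>1 u' v w" unfolding u'_def by (rule lattice_frame_shear) simp
    then have "lattice_frame (affine hull P) x\<^sub>1 v u' w" by (rule lattice_frame_swap)
    then have "lattice_frame (affine hull P) x\<^sub>1 v' u' w" unfolding v'_def by (rule lattice_frame_shear) simp
    then have fr': "lattice_frame (affine hull P) x\<^sub>1 u' v' w" by (rule lattice_frame_swap)
    have "lawrence_prism_3 P"
    proof (rule lawrence_prism_of_frame[OF fr', of "nat (m0 - l0)" "nat (m1 - l1)" "nat (m2 - l2)"])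
      have "?p 0 0 l0 = x\<^sub>1" "?p 0 0 m0 = x\<^sub>1 + of_int (m0 - l0) *\<^sub>R w" "?p 1 0 l1 = x\<^sub>1 + u'" "?p 1 0 m1 = x\<^sub>1 + u' + of_int (m1 - l1) *\<^sub>R w"
        "?p 0 1 l2 = x\<^sub>1 + v'" "?p 0 1 m2 = x\<^sub>1 + v' + of_int (m2 - l2) *\<^sub>R w"
        by (simp_all add: frame_point_def x\<^sub>1_def u'_def v'_def algebra_simps)
      then show "P = convex hull {x\<^sub>1, x\<^sub>1 + real (nat (m0 - l0)) *\<^sub>R w, x\<^sub>1 + u', x\<^sub>1 + u' + real (nat (m1 - l1)) *\<^sub>R w,
          x\<^sub>1 + v', x\<^sub>1 + v' + real (nat (m2 - l2)) *\<^sub>R w}"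
        unfolding PV V_def using 4 by simp
    qed (use 4 in auto)
    then show ?thesis by blast
  qed
qed

section \<open>Three lattice points on a line\<close>

lemma collinear_nonneg:
  fixes a b c :: real
  assumes fr: "lattice_frame (affine hull P) x\<^sub>0 u v w" and D: "double_points = {}"
    and p: "frame_point x\<^sub>0 u v w 0 0 0 \<in> P" "frame_point x\<^sub>0 u v w 0 0 2 \<in> P" "frame_point x\<^sub>0 u v w 1 0 0 \<in> P"
      "frame_point x\<^sub>0 u v w 0 1 0 \<in> P" and r: "frame_point x\<^sub>0 u v w a b c \<in> P"
  shows "0 \<le> a"
proof (rule ccontr)
  assume "\<not> 0 \<le> a"
  then have a: "a < 0" by simp
  \<comment> \<open>Makes the perturbations add up to \<open>1 / 4\<close>, below the unperturbed
    weights, the least of which is \<open>1 / 2\<close>.\<close>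
  define \<epsilon> where "\<epsilon> = 1 / (4 * (1 + \<bar>a\<bar> + \<bar>b\<bar> + \<bar>c\<bar>))"
  have pos: "0 < 1 + \<bar>a\<bar> + \<bar>b\<bar> + \<bar>c\<bar>" by linarith
  then have "\<epsilon> * (1 + \<bar>a\<bar> + \<bar>b\<bar> + \<bar>c\<bar>) = 1 / 4" by (simp add: \<epsilon>_def)
  then have sum: "\<epsilon> + \<epsilon> * \<bar>a\<bar> + \<epsilon> * \<bar>b\<bar> + \<epsilon> * \<bar>c\<bar> = 1 / 4" by (simp add: algebra_simps)
  have e: "0 < \<epsilon>" using pos by (simp add: \<epsilon>_def)
  then have abs: "\<epsilon> * \<bar>a\<bar> = \<bar>\<epsilon> * a\<bar>" "\<epsilon> * \<bar>b\<bar> = \<bar>\<epsilon> * b\<bar>" "\<epsilon> * \<bar>c\<bar> = \<bar>\<epsilon> * c\<bar>" by (simp_all add: abs_mult)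
  have s: "\<epsilon> + \<bar>\<epsilon> * a\<bar> + \<bar>\<epsilon> * b\<bar> + \<bar>\<epsilon> * c\<bar> = 1 / 4" using sum unfolding abs .
  show False
  \<comment> \<open>The doubled point has coordinates \<open>(0, 1, 1)\<close>: half of the origin,
    half of \<open>(0, 0, 2)\<close> and all of \<open>(0, 1, 0)\<close>. This puts no weight on
    \<open>(1, 0, 0)\<close>; a small weight \<open>\<epsilon>\<close> on a point with
    \<open>a < 0\<close> is balanced by the positive weight \<open>- (\<epsilon> * a)\<close>
    there.\<close>
  proof (rule no_half_point[OF fr D p(1,2,4,3) r, of "1/2 + \<epsilon> * a + \<epsilon> * b + \<epsilon> * c / 2 - \<epsilon>" "(1 - \<epsilon> * c) / 2" "1 - \<epsilon> * b" "- (\<epsilon> * a)" \<epsilon>])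
    show "0 < - (\<epsilon> * a)" using a e by (simp add: mult_pos_neg)
  qed (use s e in \<open>auto simp: abs_if field_simps split: if_splits\<close>)
qed

text \<open>The same perturbation for the doubled point \<open>(a, b, c + 1)\<close>: weight
  \<open>1 - \<epsilon>\<close> goes to the given point, and positive \<open>a\<close> and
  \<open>b\<close> provide small positive weights on \<open>(1, 0, 0)\<close> and
  \<open>(0, 1, 0)\<close>.\<close>

lemma collinear_not_both_pos:
  fixes a b c :: real
  assumes fr: "lattice_frame (affine hull P) x\<^sub>0 u v w" and D: "double_points = {}"
    and p: "frame_point x\<^sub>0 u v w 0 0 0 \<in> P" "frame_point x\<^sub>0 u v w 0 0 2 \<in> P" "frame_point x\<^sub>0 u v w 1 0 0 \<in> P"
      "frame_point x\<^sub>0 u v w 0 1 0 \<in> P" and r: "frame_point x\<^sub>0 u v w a b c \<in> P" "a \<in> \<int>" "b \<in> \<int>" "c \<in> \<int>"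
  shows "\<not> (0 < a \<and> 0 < b)"
proof
  assume ab: "0 < a \<and> 0 < b"
  define \<epsilon> where "\<epsilon> = 1 / (4 * (1 + \<bar>a\<bar> + \<bar>b\<bar> + \<bar>c\<bar>))"
  have pos: "0 < 1 + \<bar>a\<bar> + \<bar>b\<bar> + \<bar>c\<bar>" by linarith
  then have "\<epsilon> * (1 + \<bar>a\<bar> + \<bar>b\<bar> + \<bar>c\<bar>) = 1 / 4" by (simp add: \<epsilon>_def)
  then have sum: "\<epsilon> + \<epsilon> * \<bar>a\<bar> + \<epsilon> * \<bar>b\<bar> + \<epsilon> * \<bar>c\<bar> = 1 / 4" by (simp add: algebra_simps)
  have e: "0 < \<epsilon>" using pos by (simp add: \<epsilon>_def)
  then have abs: "\<epsilon> * \<bar>a\<bar> = \<bar>\<epsilon> * a\<bar>" "\<epsilon> * \<bar>b\<bar> = \<bar>\<epsilon> * b\<bar>" "\<epsilon> * \<bar>c\<bar> = \<bar>\<epsilon> * c\<bar>" by (simp_all add: abs_mult)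
  have s: "\<epsilon> + \<bar>\<epsilon> * a\<bar> + \<bar>\<epsilon> * b\<bar> + \<bar>\<epsilon> * c\<bar> = 1 / 4" using sum unfolding abs .
  have ea: "0 < \<epsilon> * a" "0 < \<epsilon> * b" using ab e by simp_all
  have int3: "(1 + \<epsilon> * c) / 2 * 2 + \<epsilon> * b * 0 + \<epsilon> * a * 0 + (1 - \<epsilon>) * c = 1 + c" by (simp add: algebra_simps)
  show False
  proof (rule no_half_point[OF fr D p(1,2,4,3) r(1), of "1/2 + \<epsilon> - \<epsilon> * a - \<epsilon> * b - \<epsilon> * c / 2" "(1 + \<epsilon> * c) / 2" "\<epsilon> * b" "\<epsilon> * a" "1 - \<epsilon>"])
    show "\<epsilon> * a * 1 + (1 - \<epsilon>) * a \<in> \<int>" "\<epsilon> * b * 1 + \<epsilon> * a * 0 + (1 - \<epsilon>) * b \<in> \<int>"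
      using r(2,3) by (simp_all add: algebra_simps)
    show "(1 + \<epsilon> * c) / 2 * 2 + \<epsilon> * b * 0 + \<epsilon> * a * 0 + (1 - \<epsilon>) * c \<in> \<int>" unfolding int3 using r(4) by simp
  qed (use s e ea in \<open>auto simp: abs_if field_simps split: if_splits\<close>)
qed

text \<open>Weights \<open>1 / a\<close> and \<open>1 / b\<close> give the first two coordinates the
  value \<open>1\<close>. If more than \<open>1 / 2\<close> of the total weight \<open>2\<close>
  remains, shifting it along the segment of lattice length two moves the third coordinate by more
  than one unit, so it can be rounded up to an integer.\<close>

lemma collinear_bound:
  fixes a b c d :: real
  assumes fr: "lattice_frame (affine hull P) x\<^sub>0 u v w" and D: "double_points = {}"
    and p: "frame_point x\<^sub>0 u v w 0 0 0 \<in> P" "frame_point x\<^sub>0 u v w 0 0 2 \<in> P"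
      "frame_point x\<^sub>0 u v w a 0 c \<in> P" "frame_point x\<^sub>0 u v w 0 b d \<in> P" and ab: "0 < a" "0 < b"
  shows "3 / 2 \<le> 1 / a + 1 / b"
proof (rule ccontr)
  assume neg: "\<not> 3 / 2 \<le> 1 / a + 1 / b"
  define \<kappa> where "\<kappa> = c / a + d / b"
  define k where "k = real_of_int \<lfloor>\<kappa>\<rfloor> + 1"
  have k: "\<kappa> < k" "k \<le> \<kappa> + 1" "k \<in> \<int>" unfolding k_def by linarith+ simp
  have "(k - \<kappa>) / 2 * 2 + 1 / b * d + 1 / a * c + 0 * 0 = (k - \<kappa>) + (d / b + c / a)" by simp
  then have int3: "(k - \<kappa>) / 2 * 2 + 1 / b * d + 1 / a * c + 0 * 0 = k" by (simp add: \<kappa>_def)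
  show False
  proof (rule no_half_point[OF fr D p(1,2,4,3) p(1), of "2 - 1 / a - 1 / b - (k - \<kappa>) / 2" "(k - \<kappa>) / 2" "1 / b" "1 / a" 0])
    show "(k - \<kappa>) / 2 * 2 + 1 / b * d + 1 / a * c + 0 * 0 \<in> \<int>" unfolding int3 by (rule k(3))
    have "0 < 2 - s - t - (k - \<kappa>) / 2" if "\<not> 3 / 2 \<le> s + t" for s t using that k(1,2) by simp
    from this[OF neg] show "0 < 2 - 1 / a - 1 / b - (k - \<kappa>) / 2" .
  qed (use ab k in auto)
qed

text \<open>The borderline case of \<open>collinear_bound\<close>: exactly \<open>1 / 2\<close> of
  weight remains, and rounding by a full unit would just fail. Sharing weight between the two points
  over \<open>(0, 1)\<close> shifts the third coordinate by a quarter, which makes it nonintegral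
  and leaves strict room.\<close>

lemma collinear_long_edge:
  fixes c d :: int
  assumes fr: "lattice_frame (affine hull P) x\<^sub>0 u v w" and D: "double_points = {}"
    and p: "frame_point x\<^sub>0 u v w 0 0 0 \<in> P" "frame_point x\<^sub>0 u v w 0 0 2 \<in> P"
      "frame_point x\<^sub>0 u v w 2 0 c \<in> P" "frame_point x\<^sub>0 u v w 0 1 0 \<in> P" "frame_point x\<^sub>0 u v w 0 1 d \<in> P"
  shows "d = 0"
proof (rule ccontr)
  assume d: "d \<noteq> 0"
  define \<theta> where "\<theta> = 1 / (4 * \<bar>real_of_int d\<bar>)"
  have d1: "1 \<le> \<bar>real_of_int d\<bar>" using d by linarith
  then have th: "0 < \<theta>" "\<theta> \<le> 1 / 4" by (auto simp: \<theta>_def field_simps)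
  define \<kappa> where "\<kappa> = c / 2 + \<theta> * d"
  define k where "k = real_of_int \<lfloor>\<kappa>\<rfloor> + 1"
  have td: "4 * (\<theta> * d) = 1 \<or> 4 * (\<theta> * d) = -1" using d by (auto simp: \<theta>_def abs_if)
  have "real_of_int \<lfloor>\<kappa>\<rfloor> \<noteq> \<kappa>"
  proof
    assume "real_of_int \<lfloor>\<kappa>\<rfloor> = \<kappa>"
    then have "4 * real_of_int \<lfloor>\<kappa>\<rfloor> = 4 * \<kappa>" by simp
    also have "4 * \<kappa> = 2 * real_of_int c + 4 * (\<theta> * d)" by (simp add: \<kappa>_def algebra_simps)
    finally have "4 * real_of_int \<lfloor>\<kappa>\<rfloor> = 2 * real_of_int c + 4 * (\<theta> * d)" .
    then have "real_of_int (4 * \<lfloor>\<kappa>\<rfloor>) = real_of_int (2 * c + 1) \<or> real_of_int (4 * \<lfloor>\<kappa>\<rfloor>) = real_of_int (2 * c - 1)" using td by auto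
    then have "4 * \<lfloor>\<kappa>\<rfloor> = 2 * c + 1 \<or> 4 * \<lfloor>\<kappa>\<rfloor> = 2 * c - 1" by (simp only: of_int_eq_iff)
    then show False by presburger
  qed
  then have k: "\<kappa> < k" "k < \<kappa> + 1" "k \<in> \<int>" unfolding k_def by linarith+ simp
  have "(k - \<kappa>) / 2 * 2 + (1 - \<theta>) * 0 + 1 / 2 * c + \<theta> * d = (k - \<kappa>) + (c / 2 + \<theta> * d)" by simp
  then have int3: "(k - \<kappa>) / 2 * 2 + (1 - \<theta>) * 0 + 1 / 2 * c + \<theta> * d = k" by (simp add: \<kappa>_def)
  show False
  proof (rule no_half_point[OF fr D p(1,2,4,3) p(5), of "1 / 2 - (k - \<kappa>) / 2" "(k - \<kappa>) / 2" "1 - \<theta>" "1 / 2" \<theta>])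
    show "(k - \<kappa>) / 2 * 2 + (1 - \<theta>) * 0 + 1 / 2 * c + \<theta> * d \<in> \<int>" unfolding int3 by (rule k(3))
  qed (use th k in auto)
qed

text \<open>By the bound a point with \<open>a \<ge> 2\<close> has \<open>a = 2\<close>, and then
  the other side carries nothing but \<open>(0, 1, 0)\<close>, which becomes the apex.\<close>

lemma pyramid_if_long_edge:
  fixes a b c :: int
  assumes fr: "lattice_frame (affine hull P) x\<^sub>0 u v w" and D: "double_points = {}"
    and p: "frame_point x\<^sub>0 u v w 0 0 0 \<in> P" "frame_point x\<^sub>0 u v w 0 0 2 \<in> P" "frame_point x\<^sub>0 u v w 1 0 0 \<in> P"
      "frame_point x\<^sub>0 u v w 0 1 0 \<in> P" and r: "frame_point x\<^sub>0 u v w a b c \<in> P" "2 \<le> a"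
  shows "pyramid_over_polygon"
proof -
  let ?p = "frame_point x\<^sub>0 u v w"
  have fr': "lattice_frame (affine hull P) x\<^sub>0 v u w" by (rule lattice_frame_swap[OF fr])
  have p': "frame_point x\<^sub>0 v u w 0 0 0 \<in> P" "frame_point x\<^sub>0 v u w 0 0 2 \<in> P" "frame_point x\<^sub>0 v u w 1 0 0 \<in> P"
    "frame_point x\<^sub>0 v u w 0 1 0 \<in> P" using p by (simp_all add: frame_point_swap(1)[of x\<^sub>0 u v w])
  have nn: "0 \<le> a'" "0 \<le> b'" "\<not> (0 < a' \<and> 0 < b')" if q: "?p (of_int a') (of_int b') (of_int c') \<in> P" for a' b' c' :: int
  proof -
    show "0 \<le> a'" using collinear_nonneg[OF fr D p q] by simp
    have "frame_point x\<^sub>0 v u w (of_int b') (of_int a') (of_int c') \<in> P" using q by (simp add: frame_point_swap(1)[of x\<^sub>0 u v w])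
    then show "0 \<le> b'" using collinear_nonneg[OF fr' D p'] by fastforce
    show "\<not> (0 < a' \<and> 0 < b')" using collinear_not_both_pos[OF fr D p q] by simp
  qed
  have b: "b = 0" using nn(2,3)[OF r(1)] r(2) by linarith
  then have r': "?p (of_int a) 0 (of_int c) \<in> P" using r by simp
  have "3 / 2 \<le> 1 / real_of_int a + 1 / 1"
    using collinear_bound[OF fr D p(1,2) r' p(4)] r(2) by simp
  then have "1 / 2 \<le> 1 / real_of_int a" by linarith
  then have "real_of_int a \<le> 2" using r(2) by (simp add: field_simps)
  then have a: "a = 2" using r(2) by linarith
  have r2: "?p 2 0 (of_int c) \<in> P" using r' a by simp
  have apex: "b' = 0 \<or> a' = 0 \<and> b' = 1 \<and> c' = 0" if q: "?p (of_int a') (of_int b') (of_int c') \<in> P" for a' b' c' :: int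
  proof (cases "b' = 0")
    case False
    then have b': "0 < b'" "a' = 0" using nn[OF q] by linarith+
    then have q': "?p 0 (of_int b') (of_int c') \<in> P" using q by simp
    have "3 / 2 \<le> 1 / 2 + 1 / real_of_int b'"
      using collinear_bound[OF fr D p(1,2) r2 q'] b' by simp
    then have "1 \<le> 1 / real_of_int b'" by linarith
    then have "real_of_int b' \<le> 1" using b' by (simp add: field_simps)
    then have "b' = 1" using b' by linarith
    moreover have "c' = 0" using collinear_long_edge[OF fr D p(1,2) r2 p(4)] q' \<open>b' = 1\<close> by simp
    ultimately show ?thesis using b' by simp
  qed simp
  show ?thesis
  proof (rule lattice_pyramid_of_frame[of P x\<^sub>0 u w v "corners P - {x\<^sub>0 + v}"])
    show "lattice_frame (affine hull P) x\<^sub>0 u w v" by (rule lattice_frame_swap[OF fr])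
    show "finite (corners P - {x\<^sub>0 + v})" "corners P - {x\<^sub>0 + v} \<subseteq> int_lattice" using corners_P by auto
    have e: "?p 0 1 0 = x\<^sub>0 + v" by (simp add: frame_point_def)
    show "P = convex hull insert (x\<^sub>0 + v) (corners P - {x\<^sub>0 + v})"
    proof
      have "corners P \<subseteq> insert (x\<^sub>0 + v) (corners P - {x\<^sub>0 + v})" by blast
      then show "P \<subseteq> convex hull insert (x\<^sub>0 + v) (corners P - {x\<^sub>0 + v})" using corners_P(1) hull_mono by metis
      show "convex hull insert (x\<^sub>0 + v) (corners P - {x\<^sub>0 + v}) \<subseteq> P"
        using corners_P(2) p(4) convex unfolding e by (intro hull_minimal) auto
    qed
    fix x assume x: "x \<in> corners P - {x\<^sub>0 + v}"
    then have xP: "x \<in> P \<inter> int_lattice" using corners_P(2) by blast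
    then obtain a' b' c' :: int where x': "x = ?p a' b' c'" by (rule frame_point_exists[OF fr])
    have "?p a' b' c' \<in> P" using x' xP by simp
    then have "b' = 0 \<or> a' = 0 \<and> b' = 1 \<and> c' = 0" by (rule apex)
    moreover have "\<not> (a' = 0 \<and> b' = 1 \<and> c' = 0)" using x x' e by auto
    ultimately have "x = x\<^sub>0 + of_int a' *\<^sub>R u + of_int c' *\<^sub>R w" using x' by (simp add: frame_point_def)
    then show "\<exists>a b. x = x\<^sub>0 + a *\<^sub>R u + b *\<^sub>R w" by blast
  qed
qed

text \<open>Unless a point at distance two already gives a pyramid, the exclusions confine all
  lattice points to three parallel lines.\<close>

lemma pyramid_or_lawrence_if_collinear:
  assumes fr: "lattice_frame (affine hull P) x\<^sub>0 u v w" and D: "double_points = {}"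
    and p: "frame_point x\<^sub>0 u v w 0 0 0 \<in> P" "frame_point x\<^sub>0 u v w 0 0 2 \<in> P" "frame_point x\<^sub>0 u v w 1 0 0 \<in> P"
      "frame_point x\<^sub>0 u v w 0 1 0 \<in> P"
  shows "pyramid_over_polygon \<or> lawrence_prism_3 P"
proof -
  have fr': "lattice_frame (affine hull P) x\<^sub>0 v u w" by (rule lattice_frame_swap[OF fr])
  have p': "frame_point x\<^sub>0 v u w 0 0 0 \<in> P" "frame_point x\<^sub>0 v u w 0 0 2 \<in> P" "frame_point x\<^sub>0 v u w 1 0 0 \<in> P"
    "frame_point x\<^sub>0 v u w 0 1 0 \<in> P" using p by (simp_all add: frame_point_swap(1)[of x\<^sub>0 u v w])
  show ?thesis
  proof (cases "pyramid_over_polygon")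
    case False
    show ?thesis
    proof (rule pyramid_or_lawrence_if_three_lines[OF fr p(1,3,4)])
      fix a b c :: int assume q: "frame_point x\<^sub>0 u v w a b c \<in> P"
      then have q': "frame_point x\<^sub>0 v u w b a c \<in> P" by (simp add: frame_point_swap(1)[of x\<^sub>0 u v w])
      have "\<not> 2 \<le> a" using pyramid_if_long_edge[OF fr D p q] False by blast
      moreover have "\<not> 2 \<le> b" using pyramid_if_long_edge[OF fr' D p' q'] False by blast
      moreover have "0 \<le> a" using collinear_nonneg[OF fr D p q] by simp
      moreover have "0 \<le> b" using collinear_nonneg[OF fr' D p' q'] by simp
      moreover have "\<not> (0 < a \<and> 0 < b)" using collinear_not_both_pos[OF fr D p q] by simp
      ultimately show "real_of_int a = 0 \<and> real_of_int b = 0 \<or> real_of_int a = 1 \<and> real_of_int b = 0 \<or> real_of_int a = 0 \<and> real_of_int b = 1"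
        by auto
    qed
  qed blast
qed

end

section \<open>No three lattice points on a line\<close>

locale primitive_polytope_3 = lattice_polytope_3 +
  assumes no_double_points: "double_points = {}"
    and no_midpoint: "\<And>x y. x \<in> P \<inter> int_lattice \<Longrightarrow> y \<in> P \<inter> int_lattice \<Longrightarrow> x \<noteq> y \<Longrightarrow> (1/2) *\<^sub>R (x + y) \<notin> int_lattice"
begin

definition frame_simplex :: "'a \<Rightarrow> 'a \<Rightarrow> 'a \<Rightarrow> 'a \<Rightarrow> bool" where
  "frame_simplex x\<^sub>0 u v w \<longleftrightarrow> lattice_frame (affine hull P) x\<^sub>0 u v w \<and> frame_point x\<^sub>0 u v w 0 0 0 \<in> P \<and>
     frame_point x\<^sub>0 u v w 1 0 0 \<in> P \<and> frame_point x\<^sub>0 u v w 0 1 0 \<in> P \<and> frame_point x\<^sub>0 u v w 0 0 1 \<in> P"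

lemma frame_simplexD:
  assumes "frame_simplex x\<^sub>0 u v w"
  shows "lattice_frame (affine hull P) x\<^sub>0 u v w" "frame_point x\<^sub>0 u v w 0 0 0 \<in> P"
    "frame_point x\<^sub>0 u v w 1 0 0 \<in> P" "frame_point x\<^sub>0 u v w 0 1 0 \<in> P" "frame_point x\<^sub>0 u v w 0 0 1 \<in> P"
  using assms by (auto simp: frame_simplex_def)

lemma frame_simplex_swap:
  assumes "frame_simplex x\<^sub>0 u v w"
  shows "frame_simplex x\<^sub>0 v u w" "frame_simplex x\<^sub>0 u w v"
  using frame_simplexD[OF assms] lattice_frame_swap[of "affine hull P" x\<^sub>0 u v w]
  by (simp_all add: frame_simplex_def frame_point_swap(1)[of x\<^sub>0 v u w] frame_point_swap(2)[of x\<^sub>0 u w v])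

lemma frame_simplex_rebase:
  assumes "frame_simplex x\<^sub>0 u v w"
  shows "frame_simplex (x\<^sub>0 + w) (u - w) (v - w) (- w)"
  using frame_simplexD[OF assms] lattice_frame_rebase
  by (simp add: frame_simplex_def frame_point_rebase)

text \<open>
  Two lattice points in the same class modulo two have a lattice midpoint.
\<close>
lemma frame_point_eq_if_same_parity:
  fixes a b c a' b' c' :: int
  assumes fr: "lattice_frame (affine hull P) x\<^sub>0 u v w"
    and p: "frame_point x\<^sub>0 u v w a b c \<in> P" "frame_point x\<^sub>0 u v w a' b' c' \<in> P"
    and ev: "even (a + a')" "even (b + b')" "even (c + c')"
  shows "a = a' \<and> b = b' \<and> c = c'"
proof (rule ccontr)
  assume "\<not> ?thesis"
  then have ne: "frame_point x\<^sub>0 u v w a b c \<noteq> frame_point x\<^sub>0 u v w a' b' c'"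
    unfolding frame_point_inject[OF fr] by simp
  obtain i j k where ijk: "a + a' = 2 * i" "b + b' = 2 * j" "c + c' = 2 * k" using ev unfolding dvd_def by blast
  have r: "real_of_int a + real_of_int a' = 2 * real_of_int i" "real_of_int b + real_of_int b' = 2 * real_of_int j"
    "real_of_int c + real_of_int c' = 2 * real_of_int k"
    using ijk by (metis of_int_add of_int_mult of_int_numeral)+
  have "frame_point x\<^sub>0 u v w a b c + frame_point x\<^sub>0 u v w a' b' c' = 2 *\<^sub>R x\<^sub>0 + (real_of_int a + real_of_int a') *\<^sub>R u
      + (real_of_int b + real_of_int b') *\<^sub>R v + (real_of_int c + real_of_int c') *\<^sub>R w"
    by (simp add: frame_point_def algebra_simps scaleR_2)
  also have "\<dots> = 2 *\<^sub>R frame_point x\<^sub>0 u v w i j k"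
    unfolding r by (simp add: frame_point_def scaleR_right_distrib)
  finally have "(1/2) *\<^sub>R (frame_point x\<^sub>0 u v w a b c + frame_point x\<^sub>0 u v w a' b' c') = frame_point x\<^sub>0 u v w i j k"
    by simp
  moreover have "frame_point x\<^sub>0 u v w i j k \<in> int_lattice" by (simp add: frame_point_lattice[OF fr])
  ultimately show False
    using no_midpoint[OF _ _ ne] p by (simp add: frame_point_lattice[OF fr])
qed

text \<open>If \<open>c \<noteq> 0\<close>, half the sum of the origin, \<open>(1, 0, 0)\<close>,
  \<open>(0, 1, 0)\<close> and the given point has total weight two; it is integral by parity and
  interior to the double.\<close>

lemma odd_odd_even_coplanar:
  fixes a b c :: int
  assumes T: "frame_simplex x\<^sub>0 u v w" and r: "frame_point x\<^sub>0 u v w a b c \<in> P" and par: "odd a" "odd b" "even c"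
  shows "c = 0"
proof (rule ccontr)
  assume c: "c \<noteq> 0"
  note t = frame_simplexD[OF T]
  have fr: "lattice_frame (affine hull P) x\<^sub>0 w v u" using t(1) lattice_frame_swap by blast
  have sw: "frame_point x\<^sub>0 w v u i j k = frame_point x\<^sub>0 u v w k j i" for i j k by (simp add: frame_point_def)
  obtain i j k where ijk: "a = 2 * i + 1" "b = 2 * j + 1" "c = 2 * k" using par by (auto elim!: evenE oddE)
  show False
  proof (rule no_half_point[OF fr no_double_points, of 1 1 0 "of_int c" "of_int b" "of_int a" 0 0 0 "1/2" "1/2" "1/2" "1/2" 0])
    show "1 / 2 * real_of_int c + 0 * 0 \<in> \<int>" using ijk by simp
    have "1 / 2 * 1 + 1 / 2 * real_of_int b + 0 * 0 = real_of_int (j + 1)" using ijk by (simp add: field_simps)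
    then show "1 / 2 * 1 + 1 / 2 * real_of_int b + 0 * 0 \<in> \<int>" by (metis Ints_of_int)
    have "1 / 2 * 1 + 1 / 2 * 0 + 1 / 2 * real_of_int a + 0 * 0 = real_of_int (i + 1)" using ijk by (simp add: field_simps)
    then show "1 / 2 * 1 + 1 / 2 * 0 + 1 / 2 * real_of_int a + 0 * 0 \<in> \<int>" by (metis Ints_of_int)
  qed (use t r c in \<open>simp_all add: sw\<close>)
qed

text \<open>The point \<open>(1, 1, 0)\<close> lies in the triangle spanned by
  \<open>(1, 0, 0)\<close>, \<open>(0, 1, 0)\<close> and the given point, so it belongs to
  \<open>P\<close>; having the same parity, it is the given point.\<close>

lemma coplanar_pos:
  fixes a b :: int
  assumes T: "frame_simplex x\<^sub>0 u v w" and r: "frame_point x\<^sub>0 u v w a b 0 \<in> P" and par: "odd a" "odd b" and pos: "0 < a" "0 < b"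
  shows "a = 1 \<and> b = 1"
proof -
  note t = frame_simplexD[OF T]
  define g where "g = 1 / (real_of_int a + real_of_int b - 1)"
  have g: "0 < real_of_int a + real_of_int b - 1" using pos by linarith
  have g1: "g * (real_of_int a + real_of_int b - 1) = 1" using g by (simp add: g_def)
  let ?q = "((b - 1) * g) *\<^sub>R frame_point x\<^sub>0 u v w 1 0 0 + ((a - 1) * g) *\<^sub>R frame_point x\<^sub>0 u v w 0 1 0 + g *\<^sub>R frame_point x\<^sub>0 u v w a b 0"
  have s: "(real_of_int b - 1) * g + (real_of_int a - 1) * g + g = 1" using g1 by (simp add: algebra_simps)
  have "?q \<in> convex hull {frame_point x\<^sub>0 u v w 1 0 0, frame_point x\<^sub>0 u v w 0 1 0, frame_point x\<^sub>0 u v w a b 0}"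
    unfolding convex_hull_3 using s pos g by (intro CollectI exI conjI) (auto simp: g_def)
  also have "\<dots> \<subseteq> P" using t r convex by (intro hull_minimal) auto
  finally have "?q \<in> P" .
  moreover have "?q = frame_point x\<^sub>0 u v w 1 1 0"
  proof -
    have "?q = ((real_of_int b - 1) * g + (real_of_int a - 1) * g + g) *\<^sub>R x\<^sub>0
        + ((real_of_int b - 1) * g + g * a) *\<^sub>R u + ((real_of_int a - 1) * g + g * b) *\<^sub>R v"
      by (simp add: frame_point_def algebra_simps)
    moreover have "(real_of_int b - 1) * g + g * a = 1" "(real_of_int a - 1) * g + g * b = 1"
      using g1 by (simp_all add: algebra_simps)
    ultimately show ?thesis unfolding s by (simp add: frame_point_def)
  qed
  ultimately have q: "frame_point x\<^sub>0 u v w (of_int 1) (of_int 1) (of_int 0) \<in> P" by simp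
  have r': "frame_point x\<^sub>0 u v w a b (of_int 0) \<in> P" using r by simp
  show ?thesis using frame_point_eq_if_same_parity[OF t(1) r' q] par by simp
qed

text \<open>Under these signs \<open>(1, 0, 0)\<close> is a strict convex combination of the origin,
  \<open>(0, 1, 0)\<close> and the given point; adding \<open>(0, 0, 1)\<close> gives a lattice
  point interior to the double.\<close>

lemma coplanar_mixed:
  fixes a b :: int
  assumes T: "frame_simplex x\<^sub>0 u v w" and r: "frame_point x\<^sub>0 u v w a b 0 \<in> P" and sgn: "0 < a" "b < 0" "1 - a - b < 0"
  shows False
proof -
  note t = frame_simplexD[OF T]
  have a: "0 < real_of_int a" using sgn by simp
  show False
  proof (rule no_half_point[OF t(1) no_double_points t(2,5,4) r t(2), of "(real_of_int a + real_of_int b - 1) / real_of_int a" 1 "- real_of_int b / real_of_int a" "1 / real_of_int a" 0])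
    have "0 < real_of_int a + real_of_int b - 1" using sgn by linarith
    then show "0 < (real_of_int a + real_of_int b - 1) / real_of_int a" using a by simp
    show "0 < - real_of_int b / real_of_int a" using a sgn by (simp add: divide_neg_pos)
    show "(real_of_int a + real_of_int b - 1) / real_of_int a + 1 + - real_of_int b / real_of_int a + 1 / real_of_int a + 0 = 2"
      using a by (simp add: field_simps)
  qed (use a in simp_all)
qed

text \<open>Exchanges the origin with \<open>(0, 1, 0)\<close>, so that the second coordinate
  becomes the barycentric coordinate of the origin; the plane \<open>c = 0\<close> is kept.\<close>

lemma coplanar_rebase:
  assumes T: "frame_simplex x\<^sub>0 u v w"
  shows "frame_simplex (x\<^sub>0 + v) (u - v) (- v) (w - v)"
    "frame_point (x\<^sub>0 + v) (u - v) (- v) (w - v) a b c = frame_point x\<^sub>0 u v w a (1 - a - b - c) c"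
  using frame_simplex_swap(2)[OF frame_simplex_rebase[OF frame_simplex_swap(2)[OF T]]]
  by (simp_all add: frame_point_def algebra_simps)

text \<open>In the plane, the barycentric coordinates \<open>1 - a - b\<close>, \<open>a\<close> and
  \<open>b\<close> are all odd, hence nonzero. Two negative ones are excluded, and two positive ones
  both equal \<open>1\<close>, so the third is \<open>-1\<close>: the point completes the triangle
  to a parallelogram.\<close>

lemma odd_odd_even_cases:
  fixes a b c :: int
  assumes T: "frame_simplex x\<^sub>0 u v w" and r: "frame_point x\<^sub>0 u v w a b c \<in> P" and par: "odd a" "odd b" "even c"
  shows "c = 0 \<and> (a = 1 \<and> b = 1 \<or> a = 1 \<and> b = -1 \<or> a = -1 \<and> b = 1)"
proof -
  have c: "c = 0" by (rule odd_odd_even_coplanar[OF T r par])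
  then have r0: "frame_point x\<^sub>0 u v w a b 0 \<in> P" using r by simp
  have mixed: "a = 1 \<and> b = -1"
    if T: "frame_simplex x\<^sub>0 u v w" and r0: "frame_point x\<^sub>0 u v w (of_int a) (of_int b) 0 \<in> P" and par: "odd a" "odd b" and s: "0 < a" "b < 0"
    for a b :: int and x\<^sub>0 u v w
  proof -
    have "1 - a - b \<noteq> 0" using par by presburger
    moreover have "\<not> 1 - a - b < 0" using coplanar_mixed[OF T r0 s] by blast
    ultimately have l: "0 < 1 - a - b" by linarith
    have "frame_point (x\<^sub>0 + v) (u - v) (- v) (w - v) (of_int a) (of_int (1 - a - b)) 0 \<in> P"
      unfolding coplanar_rebase(2)[OF T] using r0 by simp
    then have "a = 1 \<and> 1 - a - b = 1"
      using coplanar_pos[OF coplanar_rebase(1)[OF T], of a "1 - a - b"] par s l by simp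
    then show ?thesis by simp
  qed
  have ne: "a \<noteq> 0" "b \<noteq> 0" using par by auto
  consider "0 < a" "0 < b" | "0 < a" "b < 0" | "a < 0" "0 < b" | "a < 0" "b < 0" using ne by linarith
  then show ?thesis
  proof cases
    case 1 then show ?thesis using coplanar_pos[OF T r0 par(1,2)] c by simp
  next
    case 2 then show ?thesis using mixed[OF T r0 par(1,2)] c by simp
  next
    case 3
    have "frame_point x\<^sub>0 v u w (of_int b) (of_int a) 0 \<in> P" using r0 by (simp add: frame_point_swap(1)[of x\<^sub>0 u v w])
    then show ?thesis using mixed[OF frame_simplex_swap(1)[OF T] _ par(2,1)] 3 c by simp
  next
    case 4
    note T' = frame_simplex_swap(1)[OF T]
    have "frame_point x\<^sub>0 v u w (of_int b) (of_int a) 0 \<in> P" using r0 by (simp add: frame_point_swap(1)[of x\<^sub>0 u v w])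
    then have "frame_point (x\<^sub>0 + u) (v - u) (- u) (w - u) (of_int b) (of_int (1 - a - b)) 0 \<in> P"
      unfolding coplanar_rebase(2)[OF T'] by simp
    then have "frame_point (x\<^sub>0 + u) (- u) (v - u) (w - u) (of_int (1 - a - b)) (of_int b) 0 \<in> P"
      by (simp add: frame_point_swap(1)[of "x\<^sub>0 + u" "v - u" "- u"])
    then show ?thesis
      using coplanar_mixed[OF frame_simplex_swap(1)[OF coplanar_rebase(1)[OF T']], of "1 - a - b" b] 4 by simp
  qed
qed

lemma square_if_odd_odd_even:
  fixes a b c :: int
  assumes T: "frame_simplex x\<^sub>0 u v w" and r: "frame_point x\<^sub>0 u v w a b c \<in> P" and par: "odd a" "odd b" "even c"
  shows "\<exists>x\<^sub>0 u v w. frame_simplex x\<^sub>0 u v w \<and> frame_point x\<^sub>0 u v w 1 1 0 \<in> P"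
proof -
  note * = odd_odd_even_cases[OF assms]
  then consider "a = 1" "b = 1" "c = 0" | "a = 1" "b = -1" "c = 0" | "a = -1" "b = 1" "c = 0" by blast
  then show ?thesis
  proof cases
    case 1 then show ?thesis using T r by auto
  next
    case 2
    then have "frame_point (x\<^sub>0 + v) (u - v) (- v) (w - v) 1 1 0 \<in> P"
      unfolding coplanar_rebase(2)[OF T] using r by simp
    then show ?thesis using coplanar_rebase(1)[OF T] by blast
  next
    case 3
    note T' = frame_simplex_swap(1)[OF T]
    have "frame_point x\<^sub>0 v u w 1 (-1) 0 \<in> P" using r 3 by (simp add: frame_point_swap(1)[of x\<^sub>0 u v w])
    then have "frame_point (x\<^sub>0 + u) (v - u) (- u) (w - u) 1 1 0 \<in> P"
      unfolding coplanar_rebase(2)[OF T'] by simp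
    then show ?thesis using coplanar_rebase(1)[OF T'] by blast
  qed
qed

text \<open>The parity classes of the four tetrahedron vertices are taken. Symmetries of the
  tetrahedron bring the other four classes to odd, odd, even; for three odd coordinates the rebased
  coordinate \<open>1 - a - b - c\<close> is even.\<close>

lemma square_if_extra_point:
  fixes a b c :: int
  assumes T: "frame_simplex x\<^sub>0 u v w" and r: "frame_point x\<^sub>0 u v w a b c \<in> P"
    and extra: "(a, b, c) \<notin> {(0, 0, 0), (1, 0, 0), (0, 1, 0), (0, 0, 1)}"
  shows "\<exists>x\<^sub>0 u v w. frame_simplex x\<^sub>0 u v w \<and> frame_point x\<^sub>0 u v w 1 1 0 \<in> P"
proof -
  note t = frame_simplexD[OF T]
  have t': "frame_point x\<^sub>0 u v w (of_int 0) (of_int 0) (of_int 0) \<in> P" "frame_point x\<^sub>0 u v w (of_int 1) (of_int 0) (of_int 0) \<in> P"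
    "frame_point x\<^sub>0 u v w (of_int 0) (of_int 1) (of_int 0) \<in> P" "frame_point x\<^sub>0 u v w (of_int 0) (of_int 0) (of_int 1) \<in> P"
    using t by simp_all
  note same = frame_point_eq_if_same_parity[OF t(1) r]
  have n: "\<not> (even a \<and> even b \<and> even c)" "\<not> (odd a \<and> even b \<and> even c)" "\<not> (even a \<and> odd b \<and> even c)" "\<not> (even a \<and> even b \<and> odd c)"
    using same[OF t'(1)] same[OF t'(2)] same[OF t'(3)] same[OF t'(4)] extra by auto
  then consider "odd a" "odd b" "even c" | "odd a" "even b" "odd c" | "even a" "odd b" "odd c" | "odd a" "odd b" "odd c" by blast
  then show ?thesis
  proof cases
    case 1 then show ?thesis by (rule square_if_odd_odd_even[OF T r])
  next
    case 2
    have "frame_point x\<^sub>0 u w v a c b \<in> P" using r by (simp add: frame_point_swap(2)[of x\<^sub>0 u v w])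
    then show ?thesis using square_if_odd_odd_even[OF frame_simplex_swap(2)[OF T]] 2 by blast
  next
    case 3
    have "frame_point x\<^sub>0 v w u b c a \<in> P" using r by (simp add: frame_point_def add_ac)
    then show ?thesis using square_if_odd_odd_even[OF frame_simplex_swap(2)[OF frame_simplex_swap(1)[OF T]]] 3 by blast
  next
    case 4
    have "frame_point (x\<^sub>0 + w) (u - w) (v - w) (- w) (of_int a) (of_int b) (of_int (1 - a - b - c)) \<in> P"
      unfolding frame_point_rebase using r by simp
    then show ?thesis using square_if_odd_odd_even[OF frame_simplex_rebase[OF T]] 4 by fastforce
  qed
qed

text \<open>Add half the sum of the two points to a quarter of the sum of the four corners of the
  square: the center contributes \<open>1 / 2\<close> to each of the first two coordinates, which is
  what the parities lack.\<close>

lemma square_no_opposite_parity: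
  fixes a b c a' b' c' :: int
  assumes T: "frame_simplex x\<^sub>0 u v w" and sq: "frame_point x\<^sub>0 u v w 1 1 0 \<in> P"
    and r: "frame_point x\<^sub>0 u v w a b c \<in> P" "frame_point x\<^sub>0 u v w a' b' c' \<in> P"
    and c: "c \<noteq> 0" and par: "odd (a + a')" "odd (b + b')" "even (c + c')"
  shows False
proof -
  note t = frame_simplexD[OF T]
  have fr: "lattice_frame (affine hull P) x\<^sub>0 w v u" using t(1) lattice_frame_swap by blast
  have sw: "frame_point x\<^sub>0 w v u i j k = frame_point x\<^sub>0 u v w k j i" for i j k by (simp add: frame_point_def)
  obtain i j k where ijk: "a + a' = 2 * i + 1" "b + b' = 2 * j + 1" "c + c' = 2 * k"
    using oddE[OF par(1)] oddE[OF par(2)] evenE[OF par(3)] by metis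
  have rr: "real_of_int a + a' = 2 * i + 1" "real_of_int b + b' = 2 * j + 1" "real_of_int c + c' = 2 * k"
    using ijk by (metis of_int_add of_int_mult of_int_numeral of_int_1)+
  \<comment> \<open>\<open>no_half_point\<close> takes a single extra point, so the fourth corner
    with weight \<open>1 / 4\<close> and the second point with weight \<open>1 / 2\<close> are
    merged into one of weight \<open>3 / 4\<close>.\<close>
  have ext: "frame_point x\<^sub>0 u v w ((1 + 2 * a') / 3) ((1 + 2 * b') / 3) (2 * c' / 3) \<in> P"
    using frame_point_convex[OF sq r(2), of "2/3"] by (simp add: field_simps)
  show False
  proof (rule no_half_point[OF fr no_double_points, of 1 1 0 "of_int c" "of_int b" "of_int a" "2 * c' / 3" "(1 + 2 * b') / 3" "(1 + 2 * a') / 3"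
        "1/4" "1/4" "1/4" "1/2" "3/4"])
    have "1 / 2 * real_of_int c + 3 / 4 * (2 * c' / 3) = real_of_int k" using rr by (simp add: field_simps)
    then show "1 / 2 * real_of_int c + 3 / 4 * (2 * c' / 3) \<in> \<int>" by (metis Ints_of_int)
    have "1 / 4 * 1 + 1 / 2 * real_of_int b + 3 / 4 * ((1 + 2 * b') / 3) = real_of_int (j + 1)" using rr by (simp add: field_simps)
    then show "1 / 4 * 1 + 1 / 2 * real_of_int b + 3 / 4 * ((1 + 2 * b') / 3) \<in> \<int>" by (metis Ints_of_int)
    have "1 / 4 * 1 + 1 / 4 * 0 + 1 / 2 * real_of_int a + 3 / 4 * ((1 + 2 * a') / 3) = real_of_int (i + 1)" using rr by (simp add: field_simps)
    then show "1 / 4 * 1 + 1 / 4 * 0 + 1 / 2 * real_of_int a + 3 / 4 * ((1 + 2 * a') / 3) \<in> \<int>" by (metis Ints_of_int)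
  qed (use t r c ext in \<open>simp_all add: sw\<close>)
qed

text \<open>Points above and below the square make its center interior: with weight
  \<open>1 / 4\<close> on each of them and the rest suitably on the corners, the doubled point is
  \<open>(1, 1, 0)\<close>.\<close>

lemma square_no_point_below:
  assumes T: "frame_simplex x\<^sub>0 u v w" and sq: "frame_point x\<^sub>0 u v w 1 1 0 \<in> P" and r: "frame_point x\<^sub>0 u v w 0 1 (-1) \<in> P"
  shows False
proof -
  note t = frame_simplexD[OF T]
  have ext: "frame_point x\<^sub>0 u v w (2/3) 1 (-1/3) \<in> P" using frame_point_convex[OF sq r, of "1/3"] by simp
  show False
    by (rule no_half_point[OF t(1) no_double_points t(2,5,4,3) ext, of "1/4" "1/4" "1/4" "1/2" "3/4"]) simp_all
qed

text \<open>A point in the parity class of a known point equals it. For exactly two odd coordinates,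
  one of them \<open>c\<close>, the point completes a parallelogram, and points below the square are
  excluded; three odd coordinates are opposite in parity to \<open>(0, 0, 1)\<close>.\<close>

lemma square_points:
  fixes a b c :: int
  assumes T: "frame_simplex x\<^sub>0 u v w" and sq: "frame_point x\<^sub>0 u v w 1 1 0 \<in> P" and r: "frame_point x\<^sub>0 u v w a b c \<in> P"
  shows "c = 0 \<and> a \<in> {0, 1} \<and> b \<in> {0, 1} \<or> c = 1 \<and> (a = 0 \<and> b = 0 \<or> a = 0 \<and> b = 1 \<or> a = 0 \<and> b = -1 \<or> a = 1 \<and> b = 0 \<or> a = -1 \<and> b = 0)"
proof -
  note t = frame_simplexD[OF T]
  have t': "frame_point x\<^sub>0 u v w (of_int 0) (of_int 0) (of_int 0) \<in> P" "frame_point x\<^sub>0 u v w (of_int 1) (of_int 0) (of_int 0) \<in> P"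
    "frame_point x\<^sub>0 u v w (of_int 0) (of_int 1) (of_int 0) \<in> P" "frame_point x\<^sub>0 u v w (of_int 0) (of_int 0) (of_int 1) \<in> P"
    "frame_point x\<^sub>0 u v w (of_int 1) (of_int 1) (of_int 0) \<in> P"
    using t sq by simp_all
  note same = frame_point_eq_if_same_parity[OF t(1) r]
  note kill = square_no_opposite_parity[OF T sq r t'(4)]
  consider "even c" | "odd c" "even a" "even b" | "odd a" "even b" "odd c" | "even a" "odd b" "odd c" | "odd a" "odd b" "odd c" by blast
  then show ?thesis
  proof cases
    case 1
    then show ?thesis using same[OF t'(1)] same[OF t'(2)] same[OF t'(3)] same[OF t'(5)] by auto
  next
    case 2
    then show ?thesis using same[OF t'(4)] by auto
  next
    case 3
    have "frame_point x\<^sub>0 u w v a c b \<in> P" using r by (simp add: frame_point_swap(2)[of x\<^sub>0 u v w])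
    then have "b = 0 \<and> (a = 1 \<and> c = 1 \<or> a = 1 \<and> c = -1 \<or> a = -1 \<and> c = 1)"
      using odd_odd_even_cases[OF frame_simplex_swap(2)[OF T]] 3 by blast
    moreover have False if "a = 1" "b = 0" "c = -1"
    proof (rule square_no_point_below[OF frame_simplex_swap(1)[OF T]])
      show "frame_point x\<^sub>0 v u w 1 1 0 \<in> P" "frame_point x\<^sub>0 v u w 0 1 (-1) \<in> P"
        using sq r that by (simp_all add: frame_point_swap(1)[of x\<^sub>0 u v w])
    qed
    ultimately show ?thesis by blast
  next
    case 4
    have "frame_point x\<^sub>0 v w u b c a \<in> P" using r by (simp add: frame_point_def add_ac)
    then have "a = 0 \<and> (b = 1 \<and> c = 1 \<or> b = 1 \<and> c = -1 \<or> b = -1 \<and> c = 1)"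
      using odd_odd_even_cases[OF frame_simplex_swap(2)[OF frame_simplex_swap(1)[OF T]]] 4 by blast
    moreover have False if "a = 0" "b = 1" "c = -1"
      using square_no_point_below[OF T sq] r that by simp
    ultimately show ?thesis by blast
  next
    case 5
    have "frame_point (x\<^sub>0 + w) (u - w) (v - w) (- w) (of_int a) (of_int b) (of_int (1 - a - b - c)) \<in> P"
      unfolding frame_point_rebase using r by simp
    then have "1 - a - b - c = 0 \<and> (a = 1 \<and> b = 1 \<or> a = 1 \<and> b = -1 \<or> a = -1 \<and> b = 1)"
      using odd_odd_even_cases[OF frame_simplex_rebase[OF T]] 5 by fastforce
    then have "c \<noteq> 0" "odd (a + 0)" "odd (b + 0)" "even (c + 1)" by auto
    then show ?thesis using kill by blast
  qed
qed

text \<open>At height one the lattice points cannot spread in both directions, since points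
  displaced from \<open>(0, 0, 1)\<close> in different directions have opposite parities. So all
  lattice points lie on three lines parallel to one side of the square.\<close>

lemma pyramid_or_lawrence_if_square:
  assumes T: "frame_simplex x\<^sub>0 u v w" and sq: "frame_point x\<^sub>0 u v w 1 1 0 \<in> P"
  shows "pyramid_over_polygon \<or> lawrence_prism_3 P"
proof -
  note t = frame_simplexD[OF T]
  show ?thesis
  proof (cases "\<exists>b :: int. b \<noteq> 0 \<and> frame_point x\<^sub>0 u v w 0 b 1 \<in> P")
    case False
    have sw: "frame_point x\<^sub>0 v w u i j k = frame_point x\<^sub>0 u v w k i j" for i j k by (simp add: frame_point_def add_ac)
    show ?thesis
    proof (rule pyramid_or_lawrence_if_three_lines[of x\<^sub>0 v w u])
      show "lattice_frame (affine hull P) x\<^sub>0 v w u" using t(1) lattice_frame_swap by blast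
      fix b c a :: int assume "frame_point x\<^sub>0 v w u b c a \<in> P"
      then have r: "frame_point x\<^sub>0 u v w a b c \<in> P" by (simp add: sw)
      have "b = 0" if "a = 0" "c = 1" using False r that by auto
      then have "b = 0 \<and> c = 0 \<or> b = 1 \<and> c = 0 \<or> b = 0 \<and> c = 1" using square_points[OF T sq r] by auto
      then show "real_of_int b = 0 \<and> real_of_int c = 0 \<or> real_of_int b = 1 \<and> real_of_int c = 0 \<or> real_of_int b = 0 \<and> real_of_int c = 1"
        by auto
    qed (use t in \<open>simp_all add: sw\<close>)
  next
    case True
    then obtain b0 :: int where b0: "b0 \<noteq> 0" "frame_point x\<^sub>0 u v w (of_int 0) b0 (of_int 1) \<in> P" by auto
    have b0': "b0 = 1 \<or> b0 = -1" using square_points[OF T sq b0(2)] b0(1) by auto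
    have sw: "frame_point x\<^sub>0 u w v i j k = frame_point x\<^sub>0 u v w i k j" for i j k by (simp add: frame_point_def add_ac)
    show ?thesis
    proof (rule pyramid_or_lawrence_if_three_lines[of x\<^sub>0 u w v])
      show "lattice_frame (affine hull P) x\<^sub>0 u w v" using t(1) lattice_frame_swap by blast
      fix a c b :: int assume "frame_point x\<^sub>0 u w v a c b \<in> P"
      then have r: "frame_point x\<^sub>0 u v w a b c \<in> P" by (simp add: sw)
      have "a = 0" if c: "c = 1"
      proof (rule ccontr)
        assume "a \<noteq> 0"
        then have "(a = 1 \<or> a = -1) \<and> b = 0" using square_points[OF T sq r] c by auto
        then show False using square_no_opposite_parity[OF T sq r b0(2)] c b0' by auto
      qed
      then have "a = 0 \<and> c = 0 \<or> a = 1 \<and> c = 0 \<or> a = 0 \<and> c = 1" using square_points[OF T sq r] by auto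
      then show "real_of_int a = 0 \<and> real_of_int c = 0 \<or> real_of_int a = 1 \<and> real_of_int c = 0 \<or> real_of_int a = 0 \<and> real_of_int c = 1"
        by auto
    qed (use t in \<open>simp_all add: sw\<close>)
  qed
qed

end

section \<open>Classification in degree at most one\<close>

context lattice_polytope_3
begin

lemma empty_simplex_frame:
  assumes D: "double_points = {}" and A: "empty_simplex A" "A \<subseteq> P" "a \<in> A" "d \<in> A" "a \<noteq> d"
  obtains b c where "lattice_frame (affine hull P) a (b - a) (c - a) (d - a)" "b \<in> P" "c \<in> P"
    "empty_simplex {a, b, c, d}" "affine hull {a, b, c, d} = affine hull P"
proof -
  have "A \<noteq> {}" using A(3) by blast
  then obtain B where B: "A \<subseteq> B" "B \<subseteq> P" "empty_simplex B" "affine hull B = affine hull P"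
    using empty_simplex_extends[OF lattice A(1,2)] by blast
  have ind: "\<not> affine_dependent B" using B(3) by (simp add: empty_simplex_def)
  have "card B = 4" by (rule card_full_simplex[OF ind B(4)])
  then have "card (B - {a, d}) = 2" using A(3-5) B(1) by (subst card_Diff_subset) auto
  then obtain b c where bc: "B - {a, d} = {b, c}" by (auto simp: card_2_iff)
  then have "B = {a, b, c, d}" using A(3,4) B(1) by blast
  then have B': "empty_simplex {a, b, c, d}" "{a, b, c, d} \<subseteq> P" "affine hull {a, b, c, d} = affine hull P" using B by auto
  have "lattice_frame (affine hull P) a (b - a) (c - a) (d - a)"
    by (rule lattice_frame_of_empty_simplex[OF B']) (simp add: D)
  then show thesis using that B' by blast
qed

text \<open>If some segment between lattice points contains a further one, its primitive vector
  serves as \<open>w\<close>, and its length is a multiple \<open>k \<ge> 2\<close> of that vector.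
  Otherwise lattice midpoints are impossible; then either a lattice point besides the vertices of an
  empty tetrahedron in \<open>P\<close> yields a square, or \<open>P\<close> is that
  tetrahedron.\<close>

theorem pyramid_or_lawrence_if_degree_le_1:
  assumes "interior_count 2 P = 0"
  shows "pyramid_over_polygon \<or> lawrence_prism_3 P"
proof -
  have D: "double_points = {}" using assms finite_double_points unfolding interior_count_double_points by simp
  show ?thesis
  proof (cases "\<exists>x y. x \<in> P \<inter> int_lattice \<and> y \<in> P \<inter> int_lattice \<and> x \<noteq> y \<and> \<not> empty_simplex {x, y}")
    case True
    then obtain x y where xy: "x \<in> P \<inter> int_lattice" "y \<in> P \<inter> int_lattice" "x \<noteq> y" "\<not> empty_simplex {x, y}" by blast
    define Q where "Q = convex hull {x, y}"
    have "polytope Q" unfolding Q_def by (rule polytope_convex_hull) simp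
    have QP: "Q \<subseteq> P" unfolding Q_def using xy convex by (intro hull_minimal) auto
    have ex: "empty_simplex {x}" "{x} \<subseteq> Q" using xy by (auto simp: empty_simplex_def Q_def hull_inc)
    have "y \<in> Q \<inter> int_lattice" "y \<notin> affine hull {x}" using xy by (auto simp: Q_def hull_inc)
    then obtain s where s: "s \<in> Q" "s \<notin> affine hull {x}" "empty_simplex {s, x}"
      using empty_simplex_insert_exists[OF \<open>polytope Q\<close> ex] by blast
    have sx: "s \<noteq> x" using s(2) by auto
    have "s \<noteq> y" using s(3) xy(4) by (auto simp: insert_commute)
    obtain t where t: "0 \<le> t" "t \<le> 1" "s = (1 - t) *\<^sub>R x + t *\<^sub>R y"
      using s(1) unfolding Q_def segment_convex_hull[symmetric] in_segment by blast
    have t01: "0 < t" "t < 1" using t sx \<open>s \<noteq> y\<close> by (auto simp: less_le)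
    obtain b c where f: "lattice_frame (affine hull P) x (b - x) (c - x) (s - x)" "b \<in> P" "c \<in> P"
      by (rule empty_simplex_frame[OF D s(3), of x s]) (use s QP xy sx in auto)
    let ?p = "frame_point x (b - x) (c - x) (s - x)"
    have y: "y = ?p 0 0 (1 / t)"
    proof -
      have "s - x = t *\<^sub>R (y - x)" by (simp add: t(3) algebra_simps)
      then show ?thesis using t01 by (simp add: frame_point_def)
    qed
    then have "1 / t \<in> \<int>" using frame_point_lattice[OF f(1), of 0 0 "1 / t"] xy by simp
    then obtain k where k: "1 / t = of_int k" by (auto elim: Ints_cases)
    have "1 < 1 / t" using t01 by simp
    then have k2: "2 \<le> k" using k by linarith
    have p0: "?p 0 0 0 \<in> P" using xy by (simp add: frame_point_def)
    have pk: "?p 0 0 (of_int k) \<in> P" using y k xy by simp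
    have "?p 0 0 2 \<in> P" using frame_point_convex[OF p0 pk, of "2 / of_int k"] k2 by simp
    then show ?thesis
      using pyramid_or_lawrence_if_collinear[OF f(1) D p0] f(2,3) by (simp add: frame_point_def)
  next
    case False
    have prim: "primitive_polytope_3 P"
    proof unfold_locales
      show "double_points = {}" by (rule D)
      fix x y assume xy: "x \<in> P \<inter> int_lattice" "y \<in> P \<inter> int_lattice" "x \<noteq> y"
      then have e: "empty_simplex {x, y}" using False by blast
      have "(1/2) *\<^sub>R (x + y) = (1 - 1/2) *\<^sub>R x + (1/2) *\<^sub>R y" by (simp add: scaleR_right_distrib)
      then have "(1/2) *\<^sub>R (x + y) \<in> convex hull {x, y}"
        using convexD_alt[OF convex_convex_hull hull_inc[of x "{x, y}"] hull_inc[of y "{x, y}"], of "1/2"] by simp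
      moreover have "(1/2) *\<^sub>R (x + y) \<noteq> x" "(1/2) *\<^sub>R (x + y) \<noteq> y"
        using xy(3) by (auto simp: scaleR_right_distrib dest: arg_cong[of _ _ "\<lambda>z. 2 *\<^sub>R z"] simp: scaleR_2)
      ultimately show "(1/2) *\<^sub>R (x + y) \<notin> int_lattice" using e by (auto simp: empty_simplex_def)
    qed
    interpret primitive_polytope_3 P by (rule prim)
    obtain a d where ad: "a \<in> corners P" "d \<in> corners P" "a \<noteq> d"
    proof -
      have "corners P \<noteq> {}" using corners_P(1) nonempty by auto
      then obtain a where a: "a \<in> corners P" by blast
      have "corners P \<noteq> {a}" using corners_P(1) dim by auto
      then show thesis using a that by blast
    qed
    then have adP: "a \<in> P \<inter> int_lattice" "d \<in> P \<inter> int_lattice" using corners_P(2) by blast+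
    then have "empty_simplex {a, d}" using False ad by blast
    then obtain b c where f: "lattice_frame (affine hull P) a (b - a) (c - a) (d - a)" "b \<in> P" "c \<in> P"
      "empty_simplex {a, b, c, d}" "affine hull {a, b, c, d} = affine hull P"
      by (rule empty_simplex_frame[OF D, of "{a, d}" a d]) (use adP ad in auto)
    let ?p = "frame_point a (b - a) (c - a) (d - a)"
    have pts: "?p 0 0 0 = a" "?p 1 0 0 = b" "?p 0 1 0 = c" "?p 0 0 1 = d" by (simp_all add: frame_point_def)
    have T: "frame_simplex a (b - a) (c - a) (d - a)" unfolding frame_simplex_def pts using f adP by simp
    show ?thesis
    proof (cases "\<exists>(i :: int) (j :: int) (k :: int). ?p i j k \<in> P
        \<and> (i, j, k) \<notin> ({(0, 0, 0), (1, 0, 0), (0, 1, 0), (0, 0, 1)} :: (int \<times> int \<times> int) set)")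
      case True
      then obtain i j k :: int where ijk: "?p i j k \<in> P" "(i, j, k) \<notin> {(0, 0, 0), (1, 0, 0), (0, 1, 0), (0, 0, 1)}"
        by (elim exE conjE)
      from square_if_extra_point[OF T ijk] show ?thesis using pyramid_or_lawrence_if_square by blast
    next
      case False
      have "x \<in> {a, b, c, d}" if x: "x \<in> P \<inter> int_lattice" for x
      proof -
        obtain i j k :: int where "x = ?p i j k" by (rule frame_point_exists[OF f(1) x])
        then show ?thesis using False x pts by fastforce
      qed
      then have "corners P \<subseteq> insert (a + (d - a)) {a, b, c}" using corners_P(2) by auto
      then have "P \<subseteq> convex hull insert (a + (d - a)) {a, b, c}" using corners_P(1) hull_mono by metis
      moreover have "convex hull insert (a + (d - a)) {a, b, c} \<subseteq> P"
        using adP f convex by (intro hull_minimal) auto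
      ultimately have "P = convex hull insert (a + (d - a)) {a, b, c}" by blast
      moreover have "\<exists>s t. x = a + s *\<^sub>R (b - a) + t *\<^sub>R (c - a)" if "x \<in> {a, b, c}" for x
      proof -
        have "a = a + 0 *\<^sub>R (b - a) + 0 *\<^sub>R (c - a)" "b = a + 1 *\<^sub>R (b - a) + 0 *\<^sub>R (c - a)" "c = a + 0 *\<^sub>R (b - a) + 1 *\<^sub>R (c - a)"
          by simp_all
        then show ?thesis using that by blast
      qed
      moreover have "{a, b, c} \<subseteq> int_lattice" using f(4) by (simp add: empty_simplex_def)
      ultimately have "pyramid_over_polygon" by (intro lattice_pyramid_of_frame[OF f(1), of "{a, b, c}"]) auto
      then show ?thesis by blast
    qed
  qed
qed

end

theorem theorem4p3:
  fixes P :: "'a::euclidean_space set"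
  assumes "lattice_polytope P" and "aff_dim P = 3"
  shows "(thin P \<longleftrightarrow>
            (\<exists>Q :: (real ^ 2) set. lattice_polygon Q \<and> lattice_pyramid_over P Q) \<or>
            lattice_degree P \<le> 1) \<and>
         (thin P \<longleftrightarrow>
            (\<exists>Q :: (real ^ 2) set. lattice_polygon Q \<and> lattice_pyramid_over P Q) \<or>
            lawrence_prism_3 P)"
proof -
  interpret lattice_polytope_3 P by unfold_locales (rule assms)+
  note degree = lattice_degree_le_1_iff
  have "thin P" if "pyramid_over_polygon" using that thin_if_lattice_pyramid by blast
  moreover have "thin P" if "lattice_degree P \<le> 1"
    using that thin_if_degree_le_1 unfolding degree by blast
  moreover have "pyramid_over_polygon \<or> lattice_degree P \<le> 1" if "thin P"
    using that lattice_pyramid_if_thin unfolding degree by blast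
  moreover have "lattice_degree P \<le> 1" if "lawrence_prism_3 P"
    using that interior_count_2_lawrence_prism unfolding degree by blast
  moreover have "pyramid_over_polygon \<or> lawrence_prism_3 P" if "lattice_degree P \<le> 1"
    using that pyramid_or_lawrence_if_degree_le_1 unfolding degree by blast
  ultimately show ?thesis by blast
qed

end
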